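(* Let $k\ge 2$ be an integer and let $s\ge 1$ be a real number. For every sufficiently small $\epsilon>0$ there exists a continuous function $C=C(s,k,E,M)>0$ of the energy and mass (also allowed to depend on $\epsilon$) such that the following holds. For every $\Phi\in H^s(S^1)$, if $u$ is the global solution of $$iu_t+\Delta u=|u|^{2k}u,\quad x\in S^1,\ t\in\mathbb{R},\qquad u(x,0)=\Phi(x),$$ then for all $t\in\mathbb{R}$, $$\|u(t)\|_{H^s}\le C\big(s,k,E(\Phi),M(\Phi)\big)\,(1+|t|)^{2s+\epsilon}\,\|\Phi\|_{H^s}.$$
   Context: $S^1=\mathbb{R}/2\pi\mathbb{Z}$; $\widehat f(n)=\int_{S^1}f(x)e^{-inx}dx$; $\langle n\rangle=\sqrt{1+|n|^2}$; $\|f\|_{H^s}=\big(\sum_{n\in\mathbb{Z}}|\widehat f(n)|^2\langle n\rangle^{2s}\big)^{1/2}$. For $\Phi\in H^s(S^1)$, $s\ge1$, the equation has a unique global solution $u\in C(\mathbb{R};H^s(S^1))$ (in the sense of Duhamel's formula). The mass and energy are $$M(f)=\int_{S^1}|f|^2dx,\qquad E(f)=\frac12\int_{S^1}|\nabla f|^2dx+\frac1{2k+2}\int_{S^1}|f|^{2k+2}dx,$$ and are conserved by the flow. *)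

theory Defs
  imports "HOL-Analysis.Analysis"
begin

text \<open>
  Functions on the circle \<open>\<real>/2\<pi>\<int>\<close> are represented by \<open>2\<pi>\<close>-periodic Borel functions on the real
  line, with integration over \<open>S\<^sup>1\<close> being Lebesgue integration over one period.  Elements of
  \<open>L\<^sup>2\<close> and \<open>H\<^sup>s\<close> are such functions up to almost-everywhere equality: everything below depends
  only on the a.e. class, and equations between functions are asserted almost everywhere.
\<close>

definition circle_periodic :: "(real \<Rightarrow> 'a) \<Rightarrow> bool" where
  "circle_periodic f \<longleftrightarrow> (\<forall>x. f (x + 2 * pi) = f x)"

definition circle_L2 :: "(real \<Rightarrow> complex) set" where
  "circle_L2 = {f. circle_periodic f \<and> f \<in> borel_measurable borel \<and>
     set_integrable lborel {0..2*pi} (\<lambda>x. (cmod (f x))\<^sup>2)}"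

text \<open>No factor \<open>1/(2\<pi>)\<close> here; it appears in the inversion formula instead.\<close>

definition fourier_coeff :: "(real \<Rightarrow> complex) \<Rightarrow> int \<Rightarrow> complex" where
  "fourier_coeff f n = (LBINT x:{0..2*pi}. f x * cis (- (of_int n * x)))"

definition japanese_bracket :: "int \<Rightarrow> real" where
  "japanese_bracket n = sqrt (1 + (of_int n)\<^sup>2)"

definition sobolev :: "real \<Rightarrow> (real \<Rightarrow> complex) set" where
  "sobolev s = {f \<in> circle_L2.
     (\<lambda>n. (cmod (fourier_coeff f n))\<^sup>2 * japanese_bracket n powr (2 * s)) summable_on UNIV}"

definition sobolev_norm :: "real \<Rightarrow> (real \<Rightarrow> complex) \<Rightarrow> real" where
  "sobolev_norm s f =
     sqrt (\<Sum>\<^sub>\<infinity>n. (cmod (fourier_coeff f n))\<^sup>2 * japanese_bracket n powr (2 * s))"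

definition circle_test_function :: "(real \<Rightarrow> real) \<Rightarrow> bool" where
  "circle_test_function \<phi> \<longleftrightarrow>
     circle_periodic \<phi> \<and> (\<forall>m x. (deriv ^^ m) \<phi> field_differentiable at x)"

definition has_weak_deriv :: "(real \<Rightarrow> complex) \<Rightarrow> (real \<Rightarrow> complex) \<Rightarrow> bool" where
  "has_weak_deriv f g \<longleftrightarrow> g \<in> circle_L2 \<and>
     (\<forall>\<phi>. circle_test_function \<phi> \<longrightarrow>
        (LBINT x:{0..2*pi}. f x * of_real (deriv \<phi> x)) =
        - (LBINT x:{0..2*pi}. g x * of_real (\<phi> x)))"

text \<open>
  The gradient of an \<open>H\<^sup>1\<close> function: its weak derivative in \<open>L\<^sup>2\<close>, unique up to a.e. equality.
\<close>

definition weak_deriv :: "(real \<Rightarrow> complex) \<Rightarrow> real \<Rightarrow> complex" where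
  "weak_deriv f = (SOME g. has_weak_deriv f g)"

definition mass :: "(real \<Rightarrow> complex) \<Rightarrow> real" where
  "mass f = (LBINT x:{0..2*pi}. (cmod (f x))\<^sup>2)"

definition energy :: "nat \<Rightarrow> (real \<Rightarrow> complex) \<Rightarrow> real" where
  "energy k f =
     1 / 2 * (LBINT x:{0..2*pi}. (cmod (weak_deriv f x))\<^sup>2) +
     1 / (2 * real k + 2) * (LBINT x:{0..2*pi}. cmod (f x) ^ (2 * k + 2))"

text \<open>
  The free evolution \<open>exp (\<i>t\<Delta>)\<close>, i.e. the Fourier multiplier \<open>exp (- \<i> n\<^sup>2 t)\<close>.  The series
  converges absolutely for \<open>f\<close> in \<open>H\<^sup>s\<close> with \<open>s > 1/2\<close>, so pointwise evaluation is legitimate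
  in the range \<open>s \<ge> 1\<close>.
\<close>

definition free_schroedinger :: "real \<Rightarrow> (real \<Rightarrow> complex) \<Rightarrow> real \<Rightarrow> complex" where
  "free_schroedinger t f x =
     1 / (2 * of_real pi) *
       (\<Sum>\<^sub>\<infinity>n. fourier_coeff f n * cis (of_int n * x - (of_int n)\<^sup>2 * t))"

definition nls_nonlinearity :: "nat \<Rightarrow> (real \<Rightarrow> complex) \<Rightarrow> real \<Rightarrow> complex" where
  "nls_nonlinearity k f x = of_real (cmod (f x) ^ (2 * k)) * f x"

text \<open>
  A global solution in \<open>C(\<real>; H\<^sup>s)\<close> of \<open>\<i>u\<^sub>t + \<Delta>u = |u|^(2k) u\<close>, \<open>u(0) = \<Phi>\<close>, in the sense of Duhamel's
  formula; here \<open>u t x\<close> is the value at time \<open>t\<close> and position \<open>x\<close>.  The time integral is oriented,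
  so negative times are covered.  For \<open>s \<ge> 1\<close> its integrand is continuous in time for every
  \<open>x\<close>, and point evaluation is continuous on \<open>H\<^sup>s\<close>, so it agrees with the \<open>H\<^sup>s\<close>-valued integral.
\<close>

definition nls_global_solution ::
    "real \<Rightarrow> nat \<Rightarrow> (real \<Rightarrow> complex) \<Rightarrow> (real \<Rightarrow> real \<Rightarrow> complex) \<Rightarrow> bool" where
  "nls_global_solution s k \<Phi> u \<longleftrightarrow>
     (\<forall>t. u t \<in> sobolev s) \<and>
     (\<forall>t\<^sub>0. ((\<lambda>t. sobolev_norm s (\<lambda>x. u t x - u t\<^sub>0 x)) \<longlongrightarrow> 0) (at t\<^sub>0)) \<and>
     (AE x in lborel. u 0 x = \<Phi> x) \<and>
     (\<forall>t. AE x in lborel.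
        u t x = free_schroedinger t \<Phi> x -
          \<i> * (LBINT \<tau>=0..t. free_schroedinger (t - \<tau>) (nls_nonlinearity k (u \<tau>)) x))"

end

theory Submission
  imports Defs
begin

text \<open>
  Everything happens on the Fourier side.  For the truncation \<open>v\<close> of \<open>u\<close> to the frequencies
  \<open>\<bar>n\<bar> \<le> N\<close>, the derivative of \<open>\<Sum> \<langle>n\<rangle>\<^bsup>2s\<^esup> \<bar>v\<^sub>n\<bar>\<^sup>2\<close> is, apart from terms controlled by commutators, a quadratic form in
  \<open>cnj w\<close>, \<open>w = v\<^sub>x\<close>, with coefficient \<open>v ^ (k + 1) * cnj v ^ (k - 1)\<close>.  It pairs \<open>n\<close> with \<open>m \<approx> - n\<close>, where the phase
  \<open>n\<^sup>2 + m\<^sup>2\<close> is large, so adding to the norm a correction with the weight \<open>1 / (n\<^sup>2 + m\<^sup>2)\<close> (a normal form)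
  removes it.  With \<open>X\<close> the \<open>H\<^sup>s\<close> norm, the resulting modified energy obeys \<open>\<bar>H'\<bar> \<le> C X\<^bsup>2 - 1/(2s)\<^esup>\<close>, with \<open>C\<close>
  depending on the \<open>H\<^sup>1\<close> norm, which mass and energy control; integration gives \<open>X \<le> C (1 + \<bar>t\<bar>)\<^bsup>2s\<^esup> X\<^sub>0\<close>.  Because
  truncation does not commute with the nonlinearity, the equation, the conservation laws and this
  inequality all hold up to errors that vanish as \<open>N \<rightarrow> \<infinity>\<close>, locally uniformly in \<open>t\<close>.

  The constants so obtained depend only on an upper bound for \<open>E + M\<close>; averaging a monotone
  majorant over unit intervals makes the dependence continuous.
\<close>

section \<open>Japanese brackets\<close>

text \<open>The exponent is decided by a gain of \<open>\<theta>\<close> derivatives: each term of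
  \<open>H'\<close> is at most the \<open>H^s\<close> norm times the \<open>H^(s - \<theta>)\<close>
  norm, with constants that see only \<open>H^1\<close>. Coefficients such as
  \<open>|v|^(2k)\<close> are measured in weighted \<open>l^1\<close>, and \<open>H^1\<close>
  controls the weight \<open>\<theta>\<close> there only for \<open>\<theta> < 1/2\<close>.
  Interpolating \<open>H^(s - \<theta>)\<close> between \<open>H^s\<close> and \<open>H^1\<close>
  gives the power \<open>2 - \<gamma>\<close> with \<open>\<gamma> = \<theta> / (s - 1)\<close>,
  hence growth of order \<open>1 / \<gamma>\<close>; the choice
  \<open>\<theta> = (s - 1) / (2 * s)\<close> makes this \<open>2 * s\<close>. In the form in
  \<open>cnj w\<close> both factors rotate in the same sense, so their phases add; the form pairing
  \<open>w\<close> with \<open>cnj w\<close> has no such phase, but its coefficient is real and a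
  commutator appears. Two points shape the bookkeeping. Linearity in \<open>X\<^sub>0\<close>
  requires the \<open>H^1\<close> norm in two roles, as a constant \<open>K\<close> inside all
  estimates and as a quantity \<open>\<kappa>\<close> proportional to \<open>X\<^sub>0\<close>. And
  the \<open>H^s\<close> bound on a time interval, known only from continuity, may multiply nothing
  but the truncation error, which is sent to zero first.\<close>

abbreviation jb :: "int \<Rightarrow> real" where "jb \<equiv> japanese_bracket"

lemma jb_sq: "(jb n)\<^sup>2 = 1 + (of_int n)\<^sup>2"
  by (simp add: japanese_bracket_def)

lemma jb_ge1 [simp]: "1 \<le> jb n"
  by (simp add: japanese_bracket_def)

lemma jb_pos [simp]: "0 < jb n"
  using jb_ge1[of n] by linarith

lemma jb_nonneg [simp]: "0 \<le> jb n"
  using jb_ge1[of n] by linarith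

lemma jb_minus [simp]: "jb (- n) = jb n"
  by (simp add: japanese_bracket_def)

lemma abs_le_jb: "\<bar>of_int n\<bar> \<le> jb n"
  by (simp add: japanese_bracket_def real_le_rsqrt)

lemma jb_triangle: "jb (m + n) \<le> jb m + \<bar>of_int n\<bar>"
proof -
  have "of_int m * of_int n \<le> \<bar>of_int m\<bar> * \<bar>real_of_int n\<bar>"
    by (metis abs_ge_self abs_mult)
  also have "\<dots> \<le> jb m * \<bar>real_of_int n\<bar>"
    by (intro mult_right_mono abs_le_jb) auto
  finally have "1 + (real_of_int (m + n))\<^sup>2 \<le> (jb m + \<bar>of_int n\<bar>)\<^sup>2"
    by (simp add: power2_sum jb_sq)
  then show ?thesis
    by (subst japanese_bracket_def) (intro real_le_lsqrt, auto)
qed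

lemma jb_add_le: "jb n \<le> jb m + jb (n - m)"
  using jb_triangle[of m "n - m"] abs_le_jb[of "n - m"] by simp

lemma jb_diff_le: "jb n - jb m \<le> jb (n - m)"
  using jb_add_le[of n m] by simp

lemma jb_mono: "\<bar>m\<bar> \<le> \<bar>n\<bar> \<Longrightarrow> jb m \<le> jb n"
  by (simp add: japanese_bracket_def abs_le_square_iff[symmetric] flip: of_int_abs)

lemma jb_powr_ge1: "0 \<le> p \<Longrightarrow> 1 \<le> jb n powr p"
  by (simp add: ge_one_powr_ge_zero)

lemma jb_powr_mono: "p \<le> q \<Longrightarrow> jb n powr p \<le> jb n powr q"
  by (simp add: powr_mono)

lemma powr_add_le:
  fixes x y p :: real
  assumes "0 \<le> x" "0 \<le> y" "0 \<le> p"
  shows "(x + y) powr p \<le> 2 powr p * (x powr p + y powr p)"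
proof -
  have "(x + y) powr p \<le> (2 * max x y) powr p"
    using assms by (intro powr_mono2) auto
  also have "\<dots> = 2 powr p * (max x y) powr p"
    using assms by (simp add: powr_mult)
  also have "\<dots> \<le> 2 powr p * (x powr p + y powr p)"
    by (intro mult_left_mono) (auto simp: max_def)
  finally show ?thesis .
qed

text \<open>The weight of an output frequency is paid by one of the two input frequencies
  \<open>m\<close> and \<open>n - m\<close>; this turns Sobolev weights into product
  estimates.\<close>

lemma jb_powr_add_le:
  assumes "0 \<le> p"
  shows "jb n powr p \<le> 2 powr p * (jb m powr p + jb (n - m) powr p)"
proof -
  have "jb n powr p \<le> (jb m + jb (n - m)) powr p"
    using assms by (intro powr_mono2 jb_add_le) auto
  also have "\<dots> \<le> 2 powr p * (jb m powr p + jb (n - m) powr p)"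
    using assms by (intro powr_add_le) auto
  finally show ?thesis .
qed

text \<open>Comparison with the series of \<open>(1 + |n|)^(-q)\<close>, run separately over
  \<open>n \<ge> 0\<close> and \<open>n < 0\<close>, where the modulus is injective. Convergence is
  phrased as a bound on all finite sums, the form in which Cauchy-Schwarz uses it.\<close>

lemma jb_powr_sum_bounded:
  assumes "1 < q"
  shows "\<exists>C>0. \<forall>S. finite S \<longrightarrow> (\<Sum>n\<in>S. jb n powr (- q)) \<le> C"
proof -
  define g where "g j = (1 + real j) powr (- q)" for j
  have "summable (\<lambda>j. real (Suc j) powr (- q))"
    using assms by (subst summable_Suc_iff) (simp add: summable_real_powr_iff)
  then have g: "summable g"
    by (simp add: g_def[abs_def] add.commute)
  have g0: "0 \<le> g j" for j by (simp add: g_def)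
  have part: "(\<Sum>n\<in>T. g (nat \<bar>n\<bar>)) \<le> suminf g" if "finite T" "inj_on (\<lambda>n. nat \<bar>n\<bar>) T" for T :: "int set"
  proof -
    have "(\<Sum>n\<in>T. g (nat \<bar>n\<bar>)) = sum g ((\<lambda>n. nat \<bar>n\<bar>) ` T)"
      using that by (simp add: sum.reindex)
    also have "\<dots> \<le> suminf g"
      using g g0 that by (intro sum_le_suminf) auto
    finally show ?thesis .
  qed
  have pt: "jb n powr (- q) \<le> 2 powr q * g (nat \<bar>n\<bar>)" for n
  proof -
    have "(1 + \<bar>real_of_int n\<bar>) / 2 \<le> jb n"
      using add_mono[OF jb_ge1[of n] abs_le_jb[of n]] by simp
    then have "jb n powr (- q) \<le> ((1 + \<bar>real_of_int n\<bar>) / 2) powr (- q)"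
      using assms by (intro powr_mono2') auto
    also have "\<dots> = 2 powr q * g (nat \<bar>n\<bar>)"
      by (simp add: g_def powr_divide powr_minus field_simps)
    finally show ?thesis .
  qed
  have "(\<Sum>n\<in>S. jb n powr (- q)) \<le> 2 powr q * (2 * suminf g + 1)" if "finite S" for S
  proof -
    have "(\<Sum>n\<in>S. g (nat \<bar>n\<bar>)) = (\<Sum>n\<in>S \<inter> {0..}. g (nat \<bar>n\<bar>)) + (\<Sum>n\<in>S \<inter> {..<0}. g (nat \<bar>n\<bar>))"
      using that by (subst sum.union_disjoint[symmetric]) (auto intro!: sum.cong)
    also have "\<dots> \<le> suminf g + suminf g"
      using that by (intro add_mono part) (auto simp: inj_on_def)
    finally have *: "(\<Sum>n\<in>S. g (nat \<bar>n\<bar>)) \<le> 2 * suminf g + 1" by simp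
    have "(\<Sum>n\<in>S. jb n powr (- q)) \<le> 2 powr q * (\<Sum>n\<in>S. g (nat \<bar>n\<bar>))"
      unfolding sum_distrib_left by (intro sum_mono pt)
    also have "\<dots> \<le> 2 powr q * (2 * suminf g + 1)"
      by (intro mult_left_mono *) auto
    finally show ?thesis .
  qed
  moreover have "0 < 2 powr q * (2 * suminf g + 1)"
    using suminf_nonneg[OF g g0] by (intro mult_pos_pos) auto
  ultimately show ?thesis by blast
qed

section \<open>Trigonometric polynomials\<close>

text \<open>Unlike \<open>fourier_coeff\<close>, normalised so that \<open>fcoef (tpoly S a) n = a n\<close> for \<open>n \<in> S\<close>.\<close>

definition fcoef :: "(real \<Rightarrow> complex) \<Rightarrow> int \<Rightarrow> complex" where
  "fcoef f n = integral {0..2*pi} (\<lambda>x. f x * cis (- (of_int n * x))) / (2 * pi)"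

definition tpoly :: "int set \<Rightarrow> (int \<Rightarrow> complex) \<Rightarrow> real \<Rightarrow> complex" where
  "tpoly S a x = (\<Sum>n\<in>S. a n * cis (of_int n * x))"

definition trigp :: "(real \<Rightarrow> complex) set" where
  "trigp = {f. \<exists>S a. finite S \<and> f = tpoly S a}"

definition fsupp :: "(real \<Rightarrow> complex) \<Rightarrow> int set" where
  "fsupp f = {n. fcoef f n \<noteq> 0}"

lemma continuous_on_tpoly [continuous_intros]: "continuous_on X (tpoly S a)"
  unfolding tpoly_def by (intro continuous_intros)

lemma trigp_continuous_on: "f \<in> trigp \<Longrightarrow> continuous_on X f"
  by (auto simp: trigp_def intro: continuous_intros)

lemma continuous_cis_mult:
  fixes f :: "real \<Rightarrow> complex"
  shows "continuous_on X f \<Longrightarrow> continuous_on X (\<lambda>x. f x * cis (- (of_int n * x)))"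
  by (intro continuous_intros)

lemma fcoef_integrable:
  fixes f :: "real \<Rightarrow> complex"
  assumes "continuous_on {0..2*pi} f"
  shows "(\<lambda>x. f x * cis (- (of_int n * x))) integrable_on {0..2*pi}"
  using continuous_cis_mult[OF assms] by (rule integrable_continuous_real)

lemma fcoef_add:
  assumes "continuous_on {0..2*pi} f" "continuous_on {0..2*pi} g"
  shows "fcoef (\<lambda>x. f x + g x) n = fcoef f n + fcoef g n"
  using integral_add[OF fcoef_integrable[OF assms(1)] fcoef_integrable[OF assms(2)], of n]
  by (simp add: fcoef_def distrib_right add_divide_distrib)

lemma fcoef_diff:
  assumes "continuous_on {0..2*pi} f" "continuous_on {0..2*pi} g"
  shows "fcoef (\<lambda>x. f x - g x) n = fcoef f n - fcoef g n"
  using integral_diff[OF fcoef_integrable[OF assms(1)] fcoef_integrable[OF assms(2)], of n n]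
  by (simp add: fcoef_def left_diff_distrib diff_divide_distrib)

lemma fcoef_cmult: "fcoef (\<lambda>x. c * f x) n = c * fcoef f n"
  by (simp add: fcoef_def mult.assoc)

lemma fcoef_sum:
  assumes "finite S" "\<And>m. m \<in> S \<Longrightarrow> continuous_on {0..2*pi} (f m)"
  shows "fcoef (\<lambda>x. \<Sum>m\<in>S. f m x) n = (\<Sum>m\<in>S. fcoef (f m) n)"
  using assms
proof (induct S rule: finite_induct)
  case empty show ?case by (simp add: fcoef_def)
next
  case (insert m S)
  have "fcoef (\<lambda>x. f m x + (\<Sum>m\<in>S. f m x)) n = fcoef (f m) n + fcoef (\<lambda>x. \<Sum>m\<in>S. f m x) n"
    using insert.prems by (intro fcoef_add continuous_intros) auto
  with insert show ?case by simp
qed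

lemma integral_cis:
  assumes "j \<noteq> 0"
  shows "integral {0..2*pi} (\<lambda>x. cis (of_int j * x)) = 0"
proof -
  have "((\<lambda>x. cis (of_int j * x)) has_integral
      (cis (of_int j * (2*pi)) / (\<i> * of_int j) - cis (of_int j * 0) / (\<i> * of_int j))) {0..2*pi}"
  proof (rule fundamental_theorem_of_calculus)
    fix x :: real
    have "((\<lambda>x. exp (\<i> * (of_int j * of_real x)) / (\<i> * of_int j)) has_vector_derivative
       (exp (\<i> * (of_int j * of_real x)))) (at x within {0..2*pi})"
      using assms by (auto intro!: derivative_eq_intros has_vector_derivative_real_field simp: field_simps)
    then show "((\<lambda>x. cis (of_int j * x) / (\<i> * of_int j)) has_vector_derivative cis (of_int j * x)) (at x within {0..2*pi})"
      by (simp add: cis_conv_exp)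
  qed auto
  moreover have "cis (of_int j * (2*pi)) = 1"
    using cis_multiple_2pi[of "of_int j"] by (simp add: mult.commute)
  ultimately show ?thesis by (auto dest!: integral_unique)
qed

lemma fcoef_cis_mult:
  "fcoef (\<lambda>x. cis (of_int m * x) * g x) n = fcoef g (n - m)"
proof -
  have "cis (of_int m * x) * g x * cis (- (of_int n * x)) = g x * cis (- (of_int (n - m) * x))" for x
  proof -
    have "cis (of_int m * x) * cis (- (of_int n * x)) = cis (- (of_int (n - m) * x))"
      by (simp add: cis_mult algebra_simps)
    then show ?thesis by (metis mult.assoc mult.commute)
  qed
  then show ?thesis unfolding fcoef_def by presburger
qed

lemma fcoef_const: "fcoef (\<lambda>x. c) n = (if n = 0 then c else 0)"
proof (cases "n = 0")
  case False
  then show ?thesis using integral_cis[of "- n"] by (simp add: fcoef_def)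
qed (simp add: fcoef_def scaleR_conv_of_real)

text \<open>With one factor a trigonometric polynomial the convolution is a finite sum, whatever the
  continuous second factor is.\<close>

lemma fcoef_tpoly_mult:
  assumes "finite S" "continuous_on {0..2*pi} g"
  shows "fcoef (\<lambda>x. tpoly S a x * g x) n = (\<Sum>m\<in>S. a m * fcoef g (n - m))"
proof -
  have "fcoef (\<lambda>x. tpoly S a x * g x) n = fcoef (\<lambda>x. \<Sum>m\<in>S. a m * (cis (of_int m * x) * g x)) n"
    by (simp add: tpoly_def sum_distrib_right mult.assoc)
  also have "\<dots> = (\<Sum>m\<in>S. fcoef (\<lambda>x. a m * (cis (of_int m * x) * g x)) n)"
    using assms by (intro fcoef_sum continuous_intros) auto
  finally show ?thesis by (simp add: fcoef_cmult fcoef_cis_mult)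
qed

lemma fcoef_tpoly:
  assumes "finite S"
  shows "fcoef (tpoly S a) n = (if n \<in> S then a n else 0)"
proof -
  have "fcoef (\<lambda>x. tpoly S a x * 1) n = (\<Sum>m\<in>S. a m * (if n - m = 0 then 1 else 0))"
    using fcoef_tpoly_mult[OF assms, of "\<lambda>_. 1"] by (simp add: fcoef_const)
  also have "\<dots> = (\<Sum>m\<in>S. if n = m then a m else 0)"
    by (intro sum.cong) auto
  finally show ?thesis using assms by simp
qed

lemma fsupp_tpoly: "finite S \<Longrightarrow> fsupp (tpoly S a) \<subseteq> S"
  by (auto simp: fsupp_def fcoef_tpoly split: if_splits)

lemma trigp_finite_fsupp: "f \<in> trigp \<Longrightarrow> finite (fsupp f)"
  by (auto simp: trigp_def intro: finite_subset[OF fsupp_tpoly])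

text \<open>The index set may be any finite superset of the spectrum, so several polynomials can be
  expanded over one common set.\<close>

lemma trigp_eq_tpoly:
  assumes "f \<in> trigp" "finite S" "fsupp f \<subseteq> S"
  shows "f = tpoly S (fcoef f)"
proof -
  obtain T a where T: "finite T" "f = tpoly T a" using assms by (auto simp: trigp_def)
  show ?thesis
  proof
    fix x
    have "f x = (\<Sum>n\<in>T \<union> S. fcoef f n * cis (of_int n * x))"
      unfolding T(2) tpoly_def[of T a x] fcoef_tpoly[OF T(1)]
      using T(1) assms(2) by (intro sum.mono_neutral_cong_left) auto
    also have "\<dots> = (\<Sum>n\<in>S. fcoef f n * cis (of_int n * x))"
      using T(1) assms(2,3) by (intro sum.mono_neutral_right) (auto simp: fsupp_def)
    finally show "f x = tpoly S (fcoef f) x" by (simp add: tpoly_def)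
  qed
qed

lemma trigp_tpoly: "finite S \<Longrightarrow> tpoly S a \<in> trigp"
  by (auto simp: trigp_def)

lemma trigp_cis: "(\<lambda>x. c * cis (of_int m * x)) \<in> trigp"
  using trigp_tpoly[of "{m}" "\<lambda>_. c"] by (simp add: tpoly_def[abs_def])

lemma trigp_const: "(\<lambda>x. c) \<in> trigp"
  using trigp_cis[of c 0] by simp

lemma trigp_add:
  assumes "f \<in> trigp" "g \<in> trigp"
  shows "(\<lambda>x. f x + g x) \<in> trigp"
proof -
  let ?S = "fsupp f \<union> fsupp g"
  have fin: "finite ?S" using assms by (auto dest: trigp_finite_fsupp)
  have "f = tpoly ?S (fcoef f)" "g = tpoly ?S (fcoef g)"
    using assms fin by (auto intro!: trigp_eq_tpoly)
  then have "f x + g x = tpoly ?S (fcoef f) x + tpoly ?S (fcoef g) x" for x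
    by simp
  then have "(\<lambda>x. f x + g x) = tpoly ?S (\<lambda>n. fcoef f n + fcoef g n)"
    by (simp add: tpoly_def distrib_right sum.distrib fun_eq_iff)
  with trigp_tpoly[OF fin] show ?thesis by simp
qed

lemma trigp_sum:
  "(\<And>m. m \<in> S \<Longrightarrow> f m \<in> trigp) \<Longrightarrow> (\<lambda>x. \<Sum>m\<in>S. f m x) \<in> trigp"
  by (induct S rule: infinite_finite_induct) (auto intro: trigp_add trigp_const)

lemma trigp_mult:
  assumes "f \<in> trigp" "g \<in> trigp"
  shows "(\<lambda>x. f x * g x) \<in> trigp"
proof -
  obtain S a T b where f: "f = tpoly S a" and g: "g = tpoly T b"
    using assms by (auto simp: trigp_def)
  have "tpoly S a x * tpoly T b x = (\<Sum>m\<in>S. \<Sum>n\<in>T. (a m * b n) * cis (of_int (m + n) * x))" for x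
    unfolding tpoly_def sum_product
    by (intro sum.cong refl) (simp add: algebra_simps cis_mult)
  then have "(\<lambda>x. f x * g x) = (\<lambda>x. \<Sum>m\<in>S. \<Sum>n\<in>T. (a m * b n) * cis (of_int (m + n) * x))"
    by (simp add: f g)
  moreover have "\<dots> \<in> trigp" by (intro trigp_sum trigp_cis)
  ultimately show ?thesis by simp
qed

lemma trigp_cnj:
  assumes "f \<in> trigp"
  shows "(\<lambda>x. cnj (f x)) \<in> trigp"
proof -
  obtain S a where f: "f = tpoly S a" using assms by (auto simp: trigp_def)
  have "(\<lambda>x. cnj (f x)) = (\<lambda>x. \<Sum>m\<in>S. cnj (a m) * cis (of_int (- m) * x))"
    by (simp add: f tpoly_def cis_cnj)
  moreover have "\<dots> \<in> trigp" by (intro trigp_sum trigp_cis)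
  ultimately show ?thesis by simp
qed

lemma trigp_cmult: "f \<in> trigp \<Longrightarrow> (\<lambda>x. c * f x) \<in> trigp"
  by (rule trigp_mult[OF trigp_const])

lemma trigp_diff: "f \<in> trigp \<Longrightarrow> g \<in> trigp \<Longrightarrow> (\<lambda>x. f x - g x) \<in> trigp"
  using trigp_add[of f "\<lambda>x. - 1 * g x"] trigp_cmult[of g "- 1"] by auto

lemma trigp_power: "f \<in> trigp \<Longrightarrow> (\<lambda>x. f x ^ i) \<in> trigp"
  by (induct i) (auto intro: trigp_mult trigp_const)

lemmas trigp_intros = trigp_add trigp_mult trigp_cnj trigp_diff trigp_power trigp_const

lemma fcoef_cnj:
  assumes "continuous_on {0..2*pi} f"
  shows "fcoef (\<lambda>x. cnj (f x)) n = cnj (fcoef f (- n))"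
proof -
  have "integral {0..2*pi} (\<lambda>x. cnj (f x * cis (- (of_int (- n) * x)))) =
      cnj (integral {0..2*pi} (\<lambda>x. f x * cis (- (of_int (- n) * x))))"
    by (rule integral_cnj[symmetric])
  then show ?thesis by (simp add: fcoef_def cis_cnj)
qed

lemma fcoef_mult:
  assumes "f \<in> trigp" "finite S" "fsupp f \<subseteq> S" "continuous_on {0..2*pi} g"
  shows "fcoef (\<lambda>x. f x * g x) n = (\<Sum>m\<in>S. fcoef f m * fcoef g (n - m))"
  using fcoef_tpoly_mult[OF assms(2,4), of "fcoef f"] trigp_eq_tpoly[OF assms(1-3)] by simp

section \<open>Weighted norms of Fourier coefficients\<close>

text \<open>For \<open>p = 0\<close> the norm of the Wiener algebra, in which the coefficients of
  all multilinear forms are measured; weights \<open>p > 0\<close> record derivatives that fall on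
  such a coefficient.\<close>

definition wl1 :: "real \<Rightarrow> (real \<Rightarrow> complex) \<Rightarrow> real" where
  "wl1 p f = (\<Sum>n\<in>fsupp f. jb n powr p * cmod (fcoef f n))"

text \<open>The \<open>H^p\<close> norm up to the factor \<open>2 * pi\<close> of the Fourier
  normalisation.\<close>

definition wl2 :: "real \<Rightarrow> (real \<Rightarrow> complex) \<Rightarrow> real" where
  "wl2 p f = L2_set (\<lambda>n. jb n powr p * cmod (fcoef f n)) (fsupp f)"

lemma jb_neq0 [simp]: "jb n \<noteq> 0"
  using jb_pos[of n] by linarith

lemma L2_set_subset: "finite B \<Longrightarrow> A \<subseteq> B \<Longrightarrow> L2_set f A \<le> L2_set f B"
  unfolding L2_set_def by (intro real_sqrt_le_mono sum_mono2) auto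

lemma L2_set_sum_le: "L2_set (\<lambda>n. \<Sum>m\<in>T. h m n) S \<le> (\<Sum>m\<in>T. L2_set (h m) S)"
proof (induct T rule: infinite_finite_induct)
  case (insert m T)
  have "L2_set (\<lambda>n. h m n + (\<Sum>m\<in>T. h m n)) S \<le> L2_set (h m) S + L2_set (\<lambda>n. \<Sum>m\<in>T. h m n) S"
    by (rule L2_set_triangle_ineq)
  with insert show ?case by simp
qed (simp_all add: L2_set_def)

lemma L2_set_shift:
  fixes m :: int
  shows "L2_set (\<lambda>n. \<beta> (n - m)) S = L2_set \<beta> ((\<lambda>n. n - m) ` S)"
  unfolding L2_set_def by (subst sum.reindex) (auto simp: inj_on_def)

lemma wl1_eq:
  assumes "finite S" "fsupp f \<subseteq> S"
  shows "wl1 p f = (\<Sum>n\<in>S. jb n powr p * cmod (fcoef f n))"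
  unfolding wl1_def using assms by (intro sum.mono_neutral_left) (auto simp: fsupp_def)

lemma wl2_eq:
  assumes "finite S" "fsupp f \<subseteq> S"
  shows "wl2 p f = L2_set (\<lambda>n. jb n powr p * cmod (fcoef f n)) S"
  unfolding wl2_def L2_set_def using assms
  by (intro arg_cong[where f=sqrt] sum.mono_neutral_left) (auto simp: fsupp_def)

lemma wl1_nonneg [simp]: "0 \<le> wl1 p f"
  unfolding wl1_def by (intro sum_nonneg) auto

lemma wl2_nonneg [simp]: "0 \<le> wl2 p f"
  unfolding wl2_def by simp

lemma sum_le_wl1:
  assumes "f \<in> trigp" "finite S"
  shows "(\<Sum>n\<in>S. jb n powr p * cmod (fcoef f n)) \<le> wl1 p f"
proof -
  have "(\<Sum>n\<in>S. jb n powr p * cmod (fcoef f n)) \<le> (\<Sum>n\<in>S \<union> fsupp f. jb n powr p * cmod (fcoef f n))"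
    using assms trigp_finite_fsupp by (intro sum_mono2) auto
  also have "\<dots> = wl1 p f"
    using assms trigp_finite_fsupp by (intro wl1_eq[symmetric]) auto
  finally show ?thesis .
qed

lemma L2_set_le_wl2:
  assumes "f \<in> trigp" "finite S"
  shows "L2_set (\<lambda>n. jb n powr p * cmod (fcoef f n)) S \<le> wl2 p f"
proof -
  have "L2_set (\<lambda>n. jb n powr p * cmod (fcoef f n)) S \<le> L2_set (\<lambda>n. jb n powr p * cmod (fcoef f n)) (S \<union> fsupp f)"
    using assms trigp_finite_fsupp by (intro L2_set_subset) auto
  also have "\<dots> = wl2 p f"
    using assms trigp_finite_fsupp by (intro wl2_eq[symmetric]) auto
  finally show ?thesis .
qed

lemma wl2_mono_exp: "p \<le> q \<Longrightarrow> wl2 p f \<le> wl2 q f"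
  unfolding wl2_def by (intro L2_set_mono mult_right_mono jb_powr_mono) auto

lemma fsupp_cnj: "f \<in> trigp \<Longrightarrow> fsupp (\<lambda>x. cnj (f x)) = uminus ` fsupp f"
  by (force simp: fsupp_def fcoef_cnj trigp_continuous_on image_iff)

lemma wl1_cnj: "f \<in> trigp \<Longrightarrow> wl1 p (\<lambda>x. cnj (f x)) = wl1 p f"
  unfolding wl1_def fsupp_cnj
  by (subst sum.reindex) (auto simp: inj_on_def fcoef_cnj trigp_continuous_on)

lemma wl2_cnj: "f \<in> trigp \<Longrightarrow> wl2 p (\<lambda>x. cnj (f x)) = wl2 p f"
  unfolding wl2_def fsupp_cnj L2_set_def
  by (subst sum.reindex) (auto simp: inj_on_def fcoef_cnj trigp_continuous_on)

lemma wl2_add: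
  assumes "f \<in> trigp" "g \<in> trigp"
  shows "wl2 p (\<lambda>x. f x + g x) \<le> wl2 p f + wl2 p g"
proof -
  let ?S = "fsupp (\<lambda>x. f x + g x)"
  have fin: "finite ?S" using assms by (intro trigp_finite_fsupp trigp_add)
  have "wl2 p (\<lambda>x. f x + g x) \<le> L2_set (\<lambda>n. jb n powr p * cmod (fcoef f n) + jb n powr p * cmod (fcoef g n)) ?S"
    unfolding wl2_def using assms
    by (intro L2_set_mono) (auto simp: fcoef_add trigp_continuous_on norm_triangle_ineq simp flip: distrib_left)
  also have "\<dots> \<le> L2_set (\<lambda>n. jb n powr p * cmod (fcoef f n)) ?S + L2_set (\<lambda>n. jb n powr p * cmod (fcoef g n)) ?S"
    by (rule L2_set_triangle_ineq)
  also have "\<dots> \<le> wl2 p f + wl2 p g"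
    using assms fin by (intro add_mono L2_set_le_wl2)
  finally show ?thesis .
qed

text \<open>Young's inequality for \<open>l^1\<close> against \<open>l^2\<close>. The bound
  \<open>b\<close> is demanded for every finite set because the shift by \<open>m\<close> moves
  \<open>S\<close>.\<close>

lemma L2_set_conv_le:
  fixes \<alpha> \<beta> :: "int \<Rightarrow> real"
  assumes "\<And>m. m \<in> T \<Longrightarrow> 0 \<le> \<alpha> m" "\<And>S. finite S \<Longrightarrow> L2_set \<beta> S \<le> b" "finite S"
  shows "L2_set (\<lambda>n. \<Sum>m\<in>T. \<alpha> m * \<beta> (n - m)) S \<le> (\<Sum>m\<in>T. \<alpha> m) * b"
proof -
  have "L2_set (\<lambda>n. \<Sum>m\<in>T. \<alpha> m * \<beta> (n - m)) S \<le> (\<Sum>m\<in>T. L2_set (\<lambda>n. \<alpha> m * \<beta> (n - m)) S)"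
    by (rule L2_set_sum_le)
  also have "\<dots> = (\<Sum>m\<in>T. \<alpha> m * L2_set \<beta> ((\<lambda>n. n - m) ` S))"
    by (intro sum.cong refl) (simp add: L2_set_right_distrib[symmetric] assms(1) L2_set_shift)
  also have "\<dots> \<le> (\<Sum>m\<in>T. \<alpha> m * b)"
    using assms by (intro sum_mono mult_left_mono) auto
  finally show ?thesis by (simp add: sum_distrib_right)
qed

lemma sum_conv_le:
  fixes \<alpha> \<beta> :: "int \<Rightarrow> real"
  assumes "\<And>m. m \<in> T \<Longrightarrow> 0 \<le> \<alpha> m" "\<And>S. finite S \<Longrightarrow> sum \<beta> S \<le> b" "finite S"
  shows "(\<Sum>n\<in>S. \<Sum>m\<in>T. \<alpha> m * \<beta> (n - m)) \<le> (\<Sum>m\<in>T. \<alpha> m) * b"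
proof -
  have "(\<Sum>n\<in>S. \<Sum>m\<in>T. \<alpha> m * \<beta> (n - m)) = (\<Sum>m\<in>T. \<alpha> m * sum \<beta> ((\<lambda>n. n - m) ` S))"
    by (subst sum.swap) (auto intro!: sum.cong simp: sum_distrib_left sum.reindex inj_on_def)
  also have "\<dots> \<le> (\<Sum>m\<in>T. \<alpha> m * b)"
    using assms by (intro sum_mono mult_left_mono) auto
  finally show ?thesis by (simp add: sum_distrib_right)
qed

text \<open>Substitution of \<open>n - m\<close> for \<open>m\<close>; the support conditions allow
  both sides to be sums over finite sets that do not depend on \<open>n\<close>.\<close>

lemma conv_commute:
  fixes \<alpha> \<beta> :: "int \<Rightarrow> real"
  assumes "finite T" "finite U" "\<And>m. m \<notin> T \<Longrightarrow> \<alpha> m = 0" "\<And>m. m \<notin> U \<Longrightarrow> \<beta> m = 0"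
  shows "(\<Sum>m\<in>T. \<alpha> m * \<beta> (n - m)) = (\<Sum>m\<in>U. \<beta> m * \<alpha> (n - m))"
proof -
  let ?V = "T \<union> (\<lambda>m. n - m) ` U"
  have "(\<Sum>m\<in>T. \<alpha> m * \<beta> (n - m)) = (\<Sum>m\<in>?V. \<alpha> m * \<beta> (n - m))"
    using assms by (intro sum.mono_neutral_left) auto
  also have "\<dots> = (\<Sum>m\<in>(\<lambda>m. n - m) ` U. \<alpha> m * \<beta> (n - m))"
  proof (intro sum.mono_neutral_right ballI)
    fix i assume "i \<in> ?V - (\<lambda>m. n - m) ` U"
    then have "n - i \<notin> U" by (metis DiffD2 diff_diff_eq2 add_diff_cancel_left' imageI)
    then show "\<alpha> i * \<beta> (n - i) = 0" using assms by simp
  qed (use assms in auto)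
  also have "\<dots> = (\<Sum>m\<in>U. \<beta> m * \<alpha> (n - m))"
    by (subst sum.reindex) (auto simp: inj_on_def mult.commute)
  finally show ?thesis .
qed

text \<open>Both sums have the shape that Young's inequality wants, an unweighted factor at
  \<open>m\<close> times a weighted factor at \<open>n - m\<close>; for this the part in which
  \<open>f\<close> carries the weight is rewritten by commuting the convolution.\<close>

lemma fcoef_mult_weight_le:
  assumes f: "f \<in> trigp" and g: "g \<in> trigp" and "0 \<le> p"
  shows "jb n powr p * cmod (fcoef (\<lambda>x. f x * g x) n) \<le> 2 powr p *
    ((\<Sum>m\<in>fsupp g. cmod (fcoef g m) * (jb (n - m) powr p * cmod (fcoef f (n - m)))) +
     (\<Sum>m\<in>fsupp f. cmod (fcoef f m) * (jb (n - m) powr p * cmod (fcoef g (n - m)))))"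
proof -
  have "jb n powr p * cmod (fcoef (\<lambda>x. f x * g x) n)
      \<le> jb n powr p * (\<Sum>m\<in>fsupp f. cmod (fcoef f m) * cmod (fcoef g (n - m)))"
    using f g trigp_finite_fsupp[OF f]
    by (intro mult_left_mono) (auto simp: fcoef_mult trigp_continuous_on norm_mult intro!: sum_norm_le)
  also have "\<dots> \<le> (\<Sum>m\<in>fsupp f. (2 powr p * (jb m powr p + jb (n - m) powr p)) * (cmod (fcoef f m) * cmod (fcoef g (n - m))))"
    unfolding sum_distrib_left using assms by (intro sum_mono mult_right_mono jb_powr_add_le) auto
  also have "\<dots> = 2 powr p *
    ((\<Sum>m\<in>fsupp f. (jb m powr p * cmod (fcoef f m)) * cmod (fcoef g (n - m))) +
     (\<Sum>m\<in>fsupp f. cmod (fcoef f m) * (jb (n - m) powr p * cmod (fcoef g (n - m)))))"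
    by (simp add: sum_distrib_left sum.distrib algebra_simps)
  also have "(\<Sum>m\<in>fsupp f. (jb m powr p * cmod (fcoef f m)) * cmod (fcoef g (n - m))) =
     (\<Sum>m\<in>fsupp g. cmod (fcoef g m) * (jb (n - m) powr p * cmod (fcoef f (n - m))))"
    using f g trigp_finite_fsupp by (intro conv_commute) (auto simp: fsupp_def)
  finally show ?thesis .
qed

text \<open>Tame estimate: in each term one factor carries the weight, in \<open>l^2\<close>, and
  the other stays in the Wiener algebra. This keeps later bounds linear in the high norm.\<close>

lemma wl2_mult:
  assumes f: "f \<in> trigp" and g: "g \<in> trigp" and p: "0 \<le> p"
  shows "wl2 p (\<lambda>x. f x * g x) \<le> 2 powr p * (wl2 p f * wl1 0 g + wl1 0 f * wl2 p g)"
proof -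
  let ?S = "fsupp (\<lambda>x. f x * g x)"
  have fin: "finite ?S" using f g by (intro trigp_finite_fsupp trigp_mult)
  let ?A = "\<lambda>n. \<Sum>m\<in>fsupp g. cmod (fcoef g m) * (jb (n - m) powr p * cmod (fcoef f (n - m)))"
  let ?B = "\<lambda>n. \<Sum>m\<in>fsupp f. cmod (fcoef f m) * (jb (n - m) powr p * cmod (fcoef g (n - m)))"
  have "wl2 p (\<lambda>x. f x * g x) \<le> L2_set (\<lambda>n. 2 powr p * (?A n + ?B n)) ?S"
    unfolding wl2_def by (intro L2_set_mono fcoef_mult_weight_le f g p) auto
  also have "\<dots> = 2 powr p * L2_set (\<lambda>n. ?A n + ?B n) ?S"
    by (simp add: L2_set_right_distrib)
  also have "\<dots> \<le> 2 powr p * (L2_set ?A ?S + L2_set ?B ?S)"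
    by (intro mult_left_mono L2_set_triangle_ineq) auto
  also have "\<dots> \<le> 2 powr p * ((\<Sum>m\<in>fsupp g. cmod (fcoef g m)) * wl2 p f + (\<Sum>m\<in>fsupp f. cmod (fcoef f m)) * wl2 p g)"
    by (intro mult_left_mono add_mono L2_set_conv_le fin)
       (auto intro: L2_set_le_wl2[OF f] L2_set_le_wl2[OF g])
  also have "\<dots> = 2 powr p * (wl2 p f * wl1 0 g + wl1 0 f * wl2 p g)"
    by (simp add: wl1_def mult.commute)
  finally show ?thesis .
qed

lemma wl1_mult:
  assumes f: "f \<in> trigp" and g: "g \<in> trigp" and p: "0 \<le> p"
  shows "wl1 p (\<lambda>x. f x * g x) \<le> 2 powr p * (wl1 p f * wl1 0 g + wl1 0 f * wl1 p g)"
proof -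
  let ?S = "fsupp (\<lambda>x. f x * g x)"
  have fin: "finite ?S" using f g by (intro trigp_finite_fsupp trigp_mult)
  let ?A = "\<lambda>n. \<Sum>m\<in>fsupp g. cmod (fcoef g m) * (jb (n - m) powr p * cmod (fcoef f (n - m)))"
  let ?B = "\<lambda>n. \<Sum>m\<in>fsupp f. cmod (fcoef f m) * (jb (n - m) powr p * cmod (fcoef g (n - m)))"
  have "wl1 p (\<lambda>x. f x * g x) \<le> (\<Sum>n\<in>?S. 2 powr p * (?A n + ?B n))"
    unfolding wl1_def by (intro sum_mono fcoef_mult_weight_le f g p)
  also have "\<dots> = 2 powr p * (sum ?A ?S + sum ?B ?S)"
    by (simp only: sum_distrib_left[symmetric] sum.distrib)
  also have "\<dots> \<le> 2 powr p * ((\<Sum>m\<in>fsupp g. cmod (fcoef g m)) * wl1 p f + (\<Sum>m\<in>fsupp f. cmod (fcoef f m)) * wl1 p g)"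
    by (intro mult_left_mono add_mono sum_conv_le fin)
       (auto intro: sum_le_wl1[OF f] sum_le_wl1[OF g])
  also have "\<dots> = 2 powr p * (wl1 p f * wl1 0 g + wl1 0 f * wl1 p g)"
    by (simp add: wl1_def mult.commute)
  finally show ?thesis .
qed

text \<open>Cauchy-Schwarz against the weights \<open>jb n powr (q - p)\<close>, which are square
  summable because \<open>2 * (p - q) > 1\<close>.\<close>

lemma wl1_le_wl2:
  assumes "1 / 2 < p - q"
  shows "\<exists>C>0. \<forall>f\<in>trigp. wl1 q f \<le> C * wl2 p f"
proof -
  obtain C where C: "C > 0" "\<And>S. finite S \<Longrightarrow> (\<Sum>n\<in>S. jb n powr (- (2 * (p - q)))) \<le> C"
    using jb_powr_sum_bounded[of "2 * (p - q)"] assms by auto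
  have "wl1 q f \<le> sqrt C * wl2 p f" if f: "f \<in> trigp" for f
  proof -
    have fin: "finite (fsupp f)" using f by (rule trigp_finite_fsupp)
    have e: "jb n powr q = jb n powr (q - p) * jb n powr p" for n
      by (simp flip: powr_add)
    have "wl1 q f = (\<Sum>n\<in>fsupp f. \<bar>jb n powr (q - p)\<bar> * \<bar>jb n powr p * cmod (fcoef f n)\<bar>)"
      unfolding wl1_def e by (simp add: mult.assoc)
    also have "\<dots> \<le> L2_set (\<lambda>n. jb n powr (q - p)) (fsupp f) * wl2 p f"
      unfolding wl2_def by (rule L2_set_mult_ineq)
    also have "L2_set (\<lambda>n. jb n powr (q - p)) (fsupp f) \<le> sqrt C"
    proof -
      have "(jb n powr (q - p))\<^sup>2 = jb n powr (- (2 * (p - q)))" for n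
        by (simp add: power2_eq_square algebra_simps flip: powr_add)
      then show ?thesis unfolding L2_set_def using C(2)[OF fin] by simp
    qed
    finally show ?thesis by (simp add: mult_right_mono)
  qed
  then show ?thesis using C(1) by (intro exI[of _ "sqrt C"]) auto
qed

text \<open>Hoelder's inequality, obtained from Young's inequality for each pair
  \<open>x n / X\<close>, \<open>y n / Y\<close>: after summation the normalised squares add up to
  \<open>(1 - \<gamma>) + \<gamma> = 1\<close>. The empty spectrum is set aside because there
  \<open>X\<close> and \<open>Y\<close> vanish.\<close>

lemma wl2_interpolate:
  assumes "0 \<le> \<gamma>" "\<gamma> \<le> 1" "r = (1 - \<gamma>) * p + \<gamma> * q"
  shows "wl2 r f \<le> wl2 p f powr (1 - \<gamma>) * wl2 q f powr \<gamma>"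
proof (cases "finite (fsupp f) \<and> fsupp f \<noteq> {}")
  case True
  define S where "S = fsupp f"
  define x where "x n = jb n powr p * cmod (fcoef f n)" for n
  define y where "y n = jb n powr q * cmod (fcoef f n)" for n
  have pos: "0 < cmod (fcoef f n)" if "n \<in> S" for n using that by (simp add: S_def fsupp_def)
  have xpos: "0 < x n" and ypos: "0 < y n" if "n \<in> S" for n using pos[OF that] by (auto simp: x_def y_def)
  define X where "X = L2_set x S"
  define Y where "Y = L2_set y S"
  obtain n0 where "n0 \<in> S" using True by (auto simp: S_def)
  have fin: "finite S" using True by (simp add: S_def)
  have "x n0 \<le> X" "y n0 \<le> Y"
    unfolding X_def Y_def using \<open>n0 \<in> S\<close> fin by (auto intro!: member_le_L2_set)
  then have X: "0 < X" and Y: "0 < Y" using xpos ypos \<open>n0 \<in> S\<close> by force+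
  have X2: "(\<Sum>n\<in>S. (x n)\<^sup>2) = X\<^sup>2" and Y2: "(\<Sum>n\<in>S. (y n)\<^sup>2) = Y\<^sup>2"
    unfolding X_def Y_def L2_set_def by (simp_all add: sum_nonneg)
  have z: "jb n powr r * cmod (fcoef f n) = x n powr (1 - \<gamma>) * y n powr \<gamma>" if "n \<in> S" for n
  proof -
    have "x n powr (1 - \<gamma>) * y n powr \<gamma> = (jb n powr ((1 - \<gamma>) * p) * jb n powr (\<gamma> * q)) *
        (cmod (fcoef f n) powr (1 - \<gamma>) * cmod (fcoef f n) powr \<gamma>)"
      by (simp add: x_def y_def powr_mult powr_powr mult_ac)
    also have "\<dots> = jb n powr r * cmod (fcoef f n)"
      using pos[OF that] by (simp add: assms(3) flip: powr_add)
    finally show ?thesis by simp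
  qed
  have "(jb n powr r * cmod (fcoef f n))\<^sup>2 \<le>
      (X powr (1 - \<gamma>) * Y powr \<gamma>)\<^sup>2 * ((1 - \<gamma>) * ((x n)\<^sup>2 / X\<^sup>2) + \<gamma> * ((y n)\<^sup>2 / Y\<^sup>2))" if "n \<in> S" for n
  proof -
    have "((x n / X)\<^sup>2) powr (1 - \<gamma>) * ((y n / Y)\<^sup>2) powr \<gamma> \<le> (1 - \<gamma>) * (x n / X)\<^sup>2 + \<gamma> * (y n / Y)\<^sup>2"
      using assms xpos[OF that] ypos[OF that] X Y by (intro Youngs_inequality_0) auto
    moreover have sq: "(u\<^sup>2) powr c = (u powr c)\<^sup>2" if "0 < u" for u c :: real
      using that by (simp add: power2_eq_square powr_mult)
    have "((x n / X)\<^sup>2) powr (1 - \<gamma>) * ((y n / Y)\<^sup>2) powr \<gamma> = (x n powr (1 - \<gamma>) * y n powr \<gamma>)\<^sup>2 / (X powr (1 - \<gamma>) * Y powr \<gamma>)\<^sup>2"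
      using xpos[OF that] ypos[OF that] X Y
      by (simp add: sq powr_divide power_divide power_mult_distrib)
    ultimately have "(x n powr (1 - \<gamma>) * y n powr \<gamma>)\<^sup>2 / (X powr (1 - \<gamma>) * Y powr \<gamma>)\<^sup>2
        \<le> (1 - \<gamma>) * ((x n)\<^sup>2 / X\<^sup>2) + \<gamma> * ((y n)\<^sup>2 / Y\<^sup>2)"
      by (simp add: power_divide)
    then show ?thesis unfolding z[OF that] using X Y by (simp add: divide_le_eq mult.commute)
  qed
  then have "(\<Sum>n\<in>S. (jb n powr r * cmod (fcoef f n))\<^sup>2) \<le>
     (\<Sum>n\<in>S. (X powr (1 - \<gamma>) * Y powr \<gamma>)\<^sup>2 * ((1 - \<gamma>) * ((x n)\<^sup>2 / X\<^sup>2) + \<gamma> * ((y n)\<^sup>2 / Y\<^sup>2)))"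
    by (rule sum_mono)
  also have "\<dots> = (X powr (1 - \<gamma>) * Y powr \<gamma>)\<^sup>2 * ((1 - \<gamma>) * ((\<Sum>n\<in>S. (x n)\<^sup>2) / X\<^sup>2) + \<gamma> * ((\<Sum>n\<in>S. (y n)\<^sup>2) / Y\<^sup>2))"
    by (simp only: sum_distrib_left[symmetric] sum.distrib sum_divide_distrib[symmetric])
  also have "\<dots> = (X powr (1 - \<gamma>) * Y powr \<gamma>)\<^sup>2"
    using X Y by (simp add: X2 Y2)
  finally have "L2_set (\<lambda>n. jb n powr r * cmod (fcoef f n)) S \<le> X powr (1 - \<gamma>) * Y powr \<gamma>"
    unfolding L2_set_def by (intro real_le_lsqrt sum_nonneg) auto
  then show ?thesis by (simp add: wl2_def X_def Y_def S_def x_def[abs_def] y_def[abs_def])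
qed (auto simp: wl2_def)

section \<open>Monomials\<close>

text \<open>Counting powers of \<open>f\<close> and \<open>cnj f\<close> separately gives a family
  adapted to the product rule; it contains the nonlinearity and every coefficient produced by
  differentiating it.\<close>

definition mono_fun :: "nat \<Rightarrow> nat \<Rightarrow> (real \<Rightarrow> complex) \<Rightarrow> real \<Rightarrow> complex" where
  "mono_fun i j f = (\<lambda>x. f x ^ i * cnj (f x) ^ j)"

lemma mono_fun_Suc1: "mono_fun (Suc i) j f = (\<lambda>x. f x * mono_fun i j f x)"
  by (simp add: mono_fun_def mult.assoc)

lemma mono_fun_Suc2: "mono_fun i (Suc j) f = (\<lambda>x. cnj (f x) * mono_fun i j f x)"
  by (simp add: mono_fun_def mult_ac)

lemma mono_fun_trigp: "f \<in> trigp \<Longrightarrow> mono_fun i j f \<in> trigp"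
  unfolding mono_fun_def by (intro trigp_intros)

lemma nls_nonlinearity_eq_mono: "nls_nonlinearity k f = mono_fun (Suc k) k f"
proof
  fix x
  have "of_real (cmod (f x) ^ (2 * k)) = (f x * cnj (f x)) ^ k"
    unfolding power_mult of_real_power[of "(cmod (f x))\<^sup>2"] complex_norm_square ..
  then show "nls_nonlinearity k f x = mono_fun (Suc k) k f x"
    by (simp add: nls_nonlinearity_def mono_fun_def power_mult_distrib mult_ac)
qed

text \<open>Submultiplicativity of the Wiener norm, one factor at a time. Nothing is said about the
  sign of \<open>L\<close>, whence \<open>\<bar>L\<bar>\<close> and the \<open>+ 1\<close> in the
  constants.\<close>

lemma wl1_mono_fun_bounded:
  "\<exists>C>0. \<forall>f\<in>trigp. wl1 0 f \<le> L \<longrightarrow> wl1 0 (mono_fun i j f) \<le> C"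
proof (induct i)
  case 0
  show ?case
  proof (induct j)
    case 0
    have "wl1 0 (\<lambda>x. 1) \<le> wl1 0 (\<lambda>x. 1) + 1" by simp
    then show ?case
      by (intro exI[of _ "wl1 0 (\<lambda>x. 1) + 1"]) (auto simp: mono_fun_def add_nonneg_pos)
  next
    case (Suc j)
    then obtain C where C: "C > 0" "\<And>f. f \<in> trigp \<Longrightarrow> wl1 0 f \<le> L \<Longrightarrow> wl1 0 (mono_fun 0 j f) \<le> C" by blast
    have "wl1 0 (mono_fun 0 (Suc j) f) \<le> 2 * \<bar>L\<bar> * C + 1" if f: "f \<in> trigp" "wl1 0 f \<le> L" for f
    proof -
      have "wl1 0 (mono_fun 0 (Suc j) f) \<le> 2 * (wl1 0 f * wl1 0 (mono_fun 0 j f))"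
        using wl1_mult[OF trigp_cnj[OF f(1)] mono_fun_trigp[OF f(1)], of 0 0 j] f
        by (simp add: mono_fun_Suc2 wl1_cnj)
      also have "\<dots> \<le> 2 * (\<bar>L\<bar> * C)"
        using f C by (intro mult_left_mono mult_mono) auto
      finally show ?thesis by simp
    qed
    then show ?case using C by (intro exI[of _ "2 * \<bar>L\<bar> * C + 1"]) (auto intro!: add_nonneg_pos)
  qed
next
  case (Suc i)
  then obtain C where C: "C > 0" "\<And>f. f \<in> trigp \<Longrightarrow> wl1 0 f \<le> L \<Longrightarrow> wl1 0 (mono_fun i j f) \<le> C" by blast
  have "wl1 0 (mono_fun (Suc i) j f) \<le> 2 * \<bar>L\<bar> * C + 1" if f: "f \<in> trigp" "wl1 0 f \<le> L" for f
  proof -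
    have "wl1 0 (mono_fun (Suc i) j f) \<le> 2 * (wl1 0 f * wl1 0 (mono_fun i j f))"
      using wl1_mult[OF f(1) mono_fun_trigp[OF f(1)], of 0 i j] f
      by (simp add: mono_fun_Suc1)
    also have "\<dots> \<le> 2 * (\<bar>L\<bar> * C)"
      using f C by (intro mult_left_mono mult_mono) auto
    finally show ?thesis by simp
  qed
  then show ?case using C by (intro exI[of _ "2 * \<bar>L\<bar> * C + 1"]) (auto intro!: add_nonneg_pos)
qed

text \<open>Abstract in the norm \<open>N\<close>, so that one induction on \<open>i + j\<close>
  serves the weighted \<open>l^1\<close> and the weighted \<open>l^2\<close> norms. The bound is
  linear in \<open>N f\<close>, which excludes the constant monomial
  \<open>i + j = 0\<close>.\<close>

lemma norm_mono_fun_le: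
  fixes N :: "(real \<Rightarrow> complex) \<Rightarrow> real"
  assumes mult: "\<And>f g. f \<in> trigp \<Longrightarrow> g \<in> trigp \<Longrightarrow> N (\<lambda>x. f x * g x) \<le> c * (N f * wl1 0 g + wl1 0 f * N g)"
    and cnj: "\<And>f. f \<in> trigp \<Longrightarrow> N (\<lambda>x. cnj (f x)) = N f"
    and nn: "\<And>f. 0 \<le> N f" and c: "0 \<le> c" and ij: "0 < i + j"
  shows "\<exists>C>0. \<forall>f\<in>trigp. wl1 0 f \<le> L \<longrightarrow> N (mono_fun i j f) \<le> C * N f"
proof -
  have step: "\<exists>C>0. \<forall>f\<in>trigp. wl1 0 f \<le> L \<longrightarrow> N (\<lambda>x. h f x * mono_fun i j f x) \<le> C * N f"
    if C: "C > 0" "\<And>f. f \<in> trigp \<Longrightarrow> wl1 0 f \<le> L \<Longrightarrow> N (mono_fun i j f) \<le> C * N f"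
      and h: "\<And>f. f \<in> trigp \<Longrightarrow> h f \<in> trigp" "\<And>f. f \<in> trigp \<Longrightarrow> N (h f) = N f" "\<And>f. f \<in> trigp \<Longrightarrow> wl1 0 (h f) = wl1 0 f"
    for C h i j
  proof -
    obtain C1 where C1: "C1 > 0" "\<And>f. f \<in> trigp \<Longrightarrow> wl1 0 f \<le> L \<Longrightarrow> wl1 0 (mono_fun i j f) \<le> C1"
      using wl1_mono_fun_bounded by blast
    have "N (\<lambda>x. h f x * mono_fun i j f x) \<le> (c * (C1 + \<bar>L\<bar> * C) + 1) * N f" if f: "f \<in> trigp" "wl1 0 f \<le> L" for f
    proof -
      have "N (\<lambda>x. h f x * mono_fun i j f x) \<le> c * (N f * wl1 0 (mono_fun i j f) + wl1 0 f * N (mono_fun i j f))"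
        using mult[OF h(1)[OF f(1)] mono_fun_trigp[OF f(1)], of i j] h f by simp
      also have "\<dots> \<le> c * (N f * C1 + \<bar>L\<bar> * (C * N f))"
        using f C C1 c nn by (intro mult_left_mono add_mono mult_mono) auto
      also have "\<dots> \<le> (c * (C1 + \<bar>L\<bar> * C) + 1) * N f"
        using nn[of f] by (simp add: algebra_simps)
      finally show ?thesis .
    qed
    moreover have "0 < c * (C1 + \<bar>L\<bar> * C) + 1" using c C C1 by (intro add_nonneg_pos) auto
    ultimately show ?thesis by blast
  qed
  have "\<exists>C>0. \<forall>f\<in>trigp. wl1 0 f \<le> L \<longrightarrow> N (mono_fun i j f) \<le> C * N f" if "i + j = Suc d" for d
    using that
  proof (induct d arbitrary: i j)
    case 0
    then consider "i = 1" "j = 0" | "i = 0" "j = 1" by linarith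
    then show ?case
      by cases (auto simp: mono_fun_def cnj intro!: exI[of _ 1])
  next
    case (Suc d)
    show ?case
    proof (cases i)
      case (Suc i')
      then have "i' + j = Suc d" using Suc.prems by simp
      from Suc.hyps[OF this] step[of _ i' j "\<lambda>f. f"] show ?thesis
        unfolding Suc mono_fun_Suc1 by auto
    next
      case 0
      then obtain j' where j': "j = Suc j'" "i + j' = Suc d" using Suc.prems by (cases j) auto
      from Suc.hyps[OF this(2)] step[of _ i j' "\<lambda>f x. cnj (f x)"] show ?thesis
        unfolding j'(1) mono_fun_Suc2 by (auto simp: cnj wl1_cnj trigp_cnj)
    qed
  qed
  from this[of "i + j - 1"] ij show ?thesis by simp
qed

lemma wl1_mono_fun_le:
  assumes "0 \<le> p" "0 < i + j"
  shows "\<exists>C>0. \<forall>f\<in>trigp. wl1 0 f \<le> L \<longrightarrow> wl1 p (mono_fun i j f) \<le> C * wl1 p f"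
  using assms by (intro norm_mono_fun_le[where c = "2 powr p"] wl1_mult wl1_cnj) auto

lemma wl2_mono_fun_le:
  assumes "0 \<le> p" "0 < i + j"
  shows "\<exists>C>0. \<forall>f\<in>trigp. wl1 0 f \<le> L \<longrightarrow> wl2 p (mono_fun i j f) \<le> C * wl2 p f"
  using assms by (intro norm_mono_fun_le[where c = "2 powr p"] wl2_mult wl2_cnj) auto

lemma wl2_algebra:
  assumes "1 \<le> p"
  shows "\<exists>C>0. \<forall>f\<in>trigp. \<forall>g\<in>trigp. wl2 p (\<lambda>x. f x * g x) \<le> C * (wl2 p f * wl2 p g)"
proof -
  obtain C where C: "C > 0" "\<And>f. f \<in> trigp \<Longrightarrow> wl1 0 f \<le> C * wl2 p f"
    using wl1_le_wl2[of p 0] assms by auto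
  have "wl2 p (\<lambda>x. f x * g x) \<le> (2 powr p * (2 * C)) * (wl2 p f * wl2 p g)" if fg: "f \<in> trigp" "g \<in> trigp" for f g
  proof -
    have "wl2 p (\<lambda>x. f x * g x) \<le> 2 powr p * (wl2 p f * wl1 0 g + wl1 0 f * wl2 p g)"
      using assms by (intro wl2_mult fg) auto
    also have "\<dots> \<le> 2 powr p * (wl2 p f * (C * wl2 p g) + (C * wl2 p f) * wl2 p g)"
      using C fg by (intro mult_left_mono add_mono mult_right_mono) auto
    finally show ?thesis by (simp add: algebra_simps)
  qed
  then show ?thesis using C by (intro exI[of _ "2 powr p * (2 * C)"]) auto
qed

text \<open>Local Lipschitz continuity in \<open>H^p\<close>, which later measures the effect of
  truncation on the nonlinearity. Boundedness is part of the same induction because the difference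
  of two products calls for it.\<close>

lemma wl2_mono_fun_lipschitz:
  assumes "1 \<le> p"
  shows "\<exists>C>0. \<forall>f\<in>trigp. \<forall>g\<in>trigp. wl2 p f \<le> R \<longrightarrow> wl2 p g \<le> R \<longrightarrow>
    wl2 p (mono_fun i j f) \<le> C \<and> wl2 p (\<lambda>x. mono_fun i j f x - mono_fun i j g x) \<le> C * wl2 p (\<lambda>x. f x - g x)"
proof -
  obtain A where A: "A > 0" "\<And>f g. f \<in> trigp \<Longrightarrow> g \<in> trigp \<Longrightarrow> wl2 p (\<lambda>x. f x * g x) \<le> A * (wl2 p f * wl2 p g)"
    using wl2_algebra[OF assms] by blast
  have step: "\<exists>C>0. \<forall>f\<in>trigp. \<forall>g\<in>trigp. wl2 p f \<le> R \<longrightarrow> wl2 p g \<le> R \<longrightarrow>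
      wl2 p (\<lambda>x. h f x * mono_fun i j f x) \<le> C \<and>
      wl2 p (\<lambda>x. h f x * mono_fun i j f x - h g x * mono_fun i j g x) \<le> C * wl2 p (\<lambda>x. f x - g x)"
    if ex: "\<exists>C>0. \<forall>f\<in>trigp. \<forall>g\<in>trigp. wl2 p f \<le> R \<longrightarrow> wl2 p g \<le> R \<longrightarrow>
      wl2 p (mono_fun i j f) \<le> C \<and> wl2 p (\<lambda>x. mono_fun i j f x - mono_fun i j g x) \<le> C * wl2 p (\<lambda>x. f x - g x)"
      and h: "\<And>f. f \<in> trigp \<Longrightarrow> h f \<in> trigp" "\<And>f. f \<in> trigp \<Longrightarrow> wl2 p (h f) = wl2 p f"
      "\<And>f g. f \<in> trigp \<Longrightarrow> g \<in> trigp \<Longrightarrow> wl2 p (\<lambda>x. h f x - h g x) = wl2 p (\<lambda>x. f x - g x)" for i j h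
  proof -
    obtain C where C: "C > 0" "\<And>f g. f \<in> trigp \<Longrightarrow> g \<in> trigp \<Longrightarrow> wl2 p f \<le> R \<Longrightarrow> wl2 p g \<le> R \<Longrightarrow>
      wl2 p (mono_fun i j f) \<le> C \<and> wl2 p (\<lambda>x. mono_fun i j f x - mono_fun i j g x) \<le> C * wl2 p (\<lambda>x. f x - g x)"
      using ex by blast
    define D where "D = A * (C * (1 + \<bar>R\<bar>)) + A * (\<bar>R\<bar> * C)"
    have D: "0 < D" "A * (\<bar>R\<bar> * C) \<le> D" using A C by (auto simp: D_def intro!: add_pos_nonneg)
    show ?thesis
    proof (intro exI[of _ D] conjI ballI impI D(1))
      fix f g assume f: "f \<in> trigp" and g: "g \<in> trigp" and R: "wl2 p f \<le> R" "wl2 p g \<le> R"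
      note t = f g h(1)[OF f] h(1)[OF g] mono_fun_trigp[OF f, of i j] mono_fun_trigp[OF g, of i j]
      have R0: "0 \<le> R" using R(1) wl2_nonneg[of p f] by linarith
      have "wl2 p (\<lambda>x. h f x * mono_fun i j f x) \<le> A * (wl2 p (h f) * wl2 p (mono_fun i j f))"
        by (intro A t)
      also have "\<dots> \<le> A * (\<bar>R\<bar> * C)"
        using A C f g R h by (intro mult_left_mono mult_mono) auto
      finally show "wl2 p (\<lambda>x. h f x * mono_fun i j f x) \<le> D" using D by simp
      \<comment> \<open>Telescoping: in each of the two products only one factor is a
        difference.\<close>
      have "(\<lambda>x. h f x * mono_fun i j f x - h g x * mono_fun i j g x) =
         (\<lambda>x. (h f x - h g x) * mono_fun i j f x + h g x * (mono_fun i j f x - mono_fun i j g x))"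
        by (simp add: algebra_simps)
      then have "wl2 p (\<lambda>x. h f x * mono_fun i j f x - h g x * mono_fun i j g x) \<le>
         wl2 p (\<lambda>x. (h f x - h g x) * mono_fun i j f x) + wl2 p (\<lambda>x. h g x * (mono_fun i j f x - mono_fun i j g x))"
        using wl2_add[of "\<lambda>x. (h f x - h g x) * mono_fun i j f x" "\<lambda>x. h g x * (mono_fun i j f x - mono_fun i j g x)" p]
          t by (simp add: trigp_intros)
      also have "\<dots> \<le> A * (wl2 p (\<lambda>x. h f x - h g x) * wl2 p (mono_fun i j f)) +
          A * (wl2 p (h g) * wl2 p (\<lambda>x. mono_fun i j f x - mono_fun i j g x))"
        by (intro add_mono A t trigp_diff)
      also have "\<dots> \<le> A * (wl2 p (\<lambda>x. f x - g x) * C) + A * (R * (C * wl2 p (\<lambda>x. f x - g x)))"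
        using A C f g R R0 h by (intro add_mono mult_left_mono mult_mono) auto
      also have "\<dots> \<le> D * wl2 p (\<lambda>x. f x - g x)"
        using R0 A C by (simp add: D_def algebra_simps)
      finally show "wl2 p (\<lambda>x. h f x * mono_fun i j f x - h g x * mono_fun i j g x) \<le> D * wl2 p (\<lambda>x. f x - g x)" .
    qed
  qed
  have cnjd: "wl2 p (\<lambda>x. cnj (f x) - cnj (g x)) = wl2 p (\<lambda>x. f x - g x)" if "f \<in> trigp" "g \<in> trigp" for f g
    using wl2_cnj[OF trigp_diff[OF that], of p] by simp
  show ?thesis
  proof (induct i)
    case 0
    show ?case
    proof (induct j)
      case 0
      have "wl2 p (\<lambda>x. 0) = 0" by (simp add: wl2_def fsupp_def fcoef_def)
      then show ?case
        by (intro exI[of _ "wl2 p (\<lambda>x. 1) + 1"]) (auto simp: mono_fun_def add_nonneg_pos)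
    next
      case (Suc j)
      from step[OF Suc, of "\<lambda>f x. cnj (f x)"] show ?case
        by (simp add: mono_fun_Suc2 wl2_cnj trigp_cnj cnjd)
    qed
  next
    case (Suc i)
    from step[OF Suc, of "\<lambda>f. f"] show ?case by (simp add: mono_fun_Suc1)
  qed
qed

section \<open>Bilinear estimates\<close>

text \<open>A bilinear form with an \<open>l^1\<close> convolution kernel: Cauchy-Schwarz in
  \<open>n\<close>, then Young's inequality for the convolution.\<close>

lemma schur_minus:
  fixes x y \<beta> :: "int \<Rightarrow> real"
  assumes S: "finite S" and T: "finite T"
    and x: "\<And>n. 0 \<le> x n" and y: "\<And>n. 0 \<le> y n" and \<beta>: "\<And>n. 0 \<le> \<beta> n"
    and b: "\<And>S. finite S \<Longrightarrow> sum \<beta> S \<le> b"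
  shows "(\<Sum>n\<in>S. \<Sum>m\<in>T. x n * y m * \<beta> (n - m)) \<le> L2_set x S * L2_set y T * b"
proof -
  define y' where "y' m = (if m \<in> T then y m else 0)" for m
  \<comment> \<open>All differences \<open>n - m\<close> that occur. The convolution is summed over
    \<open>l = n - m\<close> in this set, which is independent of \<open>n\<close>, at the price of
    cutting \<open>y\<close> off outside \<open>T\<close>.\<close>
  define D where "D = (\<lambda>(n, m). n - m) ` (S \<times> T)"
  have D: "finite D" using S T by (simp add: D_def)
  define c where "c n = (\<Sum>l\<in>D. \<beta> l * y' (n - l))" for n
  have c0: "0 \<le> c n" for n unfolding c_def y'_def using y \<beta> by (intro sum_nonneg) auto
  have "(\<Sum>m\<in>T. y m * \<beta> (n - m)) \<le> c n" if "n \<in> S" for n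
  proof -
    have "(\<Sum>m\<in>T. y m * \<beta> (n - m)) = (\<Sum>l\<in>(\<lambda>m. n - m) ` T. \<beta> l * y' (n - l))"
      by (subst sum.reindex) (auto simp: inj_on_def y'_def intro!: sum.cong)
    also have "\<dots> \<le> c n"
      unfolding c_def using D y \<beta> that by (intro sum_mono2) (auto simp: D_def y'_def)
    finally show ?thesis .
  qed
  then have "(\<Sum>n\<in>S. \<Sum>m\<in>T. x n * y m * \<beta> (n - m)) \<le> (\<Sum>n\<in>S. x n * c n)"
    by (intro sum_mono) (auto simp: mult.assoc x intro!: mult_left_mono simp flip: sum_distrib_left)
  also have "\<dots> \<le> L2_set x S * L2_set c S"
    using L2_set_mult_ineq[of x c S] x c0 by simp
  finally have 1: "(\<Sum>n\<in>S. \<Sum>m\<in>T. x n * y m * \<beta> (n - m)) \<le> L2_set x S * L2_set c S" .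
  have "L2_set c S \<le> sum \<beta> D * L2_set y T"
    unfolding c_def[abs_def]
  proof (intro L2_set_conv_le \<beta> S)
    fix U :: "int set" assume U: "finite U"
    have "L2_set y' U \<le> L2_set y' (U \<union> T)" using U T by (intro L2_set_subset) auto
    also have "\<dots> = L2_set y T"
      unfolding L2_set_def y'_def using U T
      by (intro arg_cong[where f=sqrt] sum.mono_neutral_cong_right) auto
    finally show "L2_set y' U \<le> L2_set y T" .
  qed
  also have "sum \<beta> D * L2_set y T \<le> b * L2_set y T"
    by (intro mult_right_mono b D) auto
  finally have "L2_set x S * L2_set c S \<le> L2_set x S * (b * L2_set y T)"
    by (intro mult_left_mono) auto
  with 1 show ?thesis by (simp add: mult_ac)
qed

text \<open>Reflection of \<open>m\<close>. A kernel in \<open>n + m\<close> belongs to forms in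
  which both factors are conjugated.\<close>

lemma schur_plus:
  fixes x y \<beta> :: "int \<Rightarrow> real"
  assumes S: "finite S" and T: "finite T"
    and x: "\<And>n. 0 \<le> x n" and y: "\<And>n. 0 \<le> y n" and \<beta>: "\<And>n. 0 \<le> \<beta> n"
    and b: "\<And>S. finite S \<Longrightarrow> sum \<beta> S \<le> b"
  shows "(\<Sum>n\<in>S. \<Sum>m\<in>T. x n * y m * \<beta> (n + m)) \<le> L2_set x S * L2_set y T * b"
proof -
  have "(\<Sum>n\<in>S. \<Sum>m\<in>T. x n * y m * \<beta> (n + m)) = (\<Sum>n\<in>S. \<Sum>m\<in>uminus ` T. x n * y (- m) * \<beta> (n - m))"
    by (simp add: sum.reindex inj_on_def)
  also have "\<dots> \<le> L2_set x S * L2_set (\<lambda>m. y (- m)) (uminus ` T) * b"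
    using assms by (intro schur_minus) auto
  also have "L2_set (\<lambda>m. y (- m)) (uminus ` T) = L2_set y T"
    unfolding L2_set_def by (subst sum.reindex) (auto simp: inj_on_def)
  finally show ?thesis .
qed

section \<open>Commutator of a Sobolev weight with multiplication by a real function\<close>

lemma one_minus_powr_le:
  fixes z q :: real
  assumes "0 < z" "z \<le> 1" "0 \<le> q"
  shows "1 - z powr q \<le> real (nat \<lceil>q\<rceil>) * (1 - z)"
proof -
  \<comment> \<open>Bernoulli's inequality wants an integer exponent; rounding \<open>q\<close> up
    is harmless because \<open>z \<le> 1\<close>.\<close>
  define N where "N = nat \<lceil>q\<rceil>"
  have "1 + real N * (z - 1) \<le> (1 + (z - 1)) ^ N"
    using assms by (intro Bernoulli_inequality) auto
  also have "\<dots> = z powr real N"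
    using assms by (simp add: powr_realpow)
  also have "\<dots> \<le> z powr q"
    using assms by (intro powr_mono') (auto simp: real_nat_ceiling_ge N_def)
  finally show ?thesis by (simp add: algebra_simps N_def)
qed

text \<open>For \<open>x \<le> 2 * y\<close> the relative difference is at most a multiple of
  \<open>1 - y / x\<close>, hence of \<open>(d / x) powr \<theta>\<close>, and
  \<open>\<theta>\<close> powers pass to \<open>d\<close>. For \<open>x > 2 * y\<close> one has
  \<open>x \<le> 2 * d\<close>, and \<open>d\<close> takes \<open>\<sigma>\<close> powers.\<close>

lemma powr_diff_le:
  fixes x y d \<sigma> \<theta> :: real
  assumes "0 < y" "y \<le> x" "x - y \<le> d" "0 < d" "0 \<le> \<theta>" "\<theta> \<le> \<sigma>" "\<theta> \<le> 1"
  shows "x powr (2 * \<sigma>) - y powr (2 * \<sigma>) \<le>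
    (2 powr \<sigma> * (real (nat \<lceil>2 * \<sigma>\<rceil>) + 1)) * (d powr \<theta> * (x powr \<sigma> * y powr (\<sigma> - \<theta>)) + d powr \<sigma> * x powr \<sigma>)"
proof -
  define c where "c = real (nat \<lceil>2 * \<sigma>\<rceil>)"
  have c: "0 \<le> c" by (simp add: c_def)
  have x: "0 < x" using assms by simp
  show ?thesis
  proof (cases "x \<le> 2 * y")
    case True
    have "1 - (y / x) powr (2 * \<sigma>) \<le> c * (1 - y / x)"
      unfolding c_def using assms by (intro one_minus_powr_le) auto
    also have "1 - y / x \<le> (1 - y / x) powr \<theta>"
    proof (cases "y = x")
      case False
      then have "(1 - y / x) powr 1 \<le> (1 - y / x) powr \<theta>"
        using assms x by (intro powr_mono') (auto simp: field_simps)
      moreover have "0 \<le> 1 - y / x" using assms x by simp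
      ultimately show ?thesis by simp
    qed (use x in simp)
    also have "(1 - y / x) powr \<theta> \<le> (d / x) powr \<theta>"
    proof (intro powr_mono2)
      have "1 - y / x = (x - y) / x" using x by (simp add: diff_divide_distrib)
      also have "\<dots> \<le> d / x" using assms x by (intro divide_right_mono) auto
      finally show "1 - y / x \<le> d / x" .
    qed (use assms x in auto)
    finally have "1 - (y / x) powr (2 * \<sigma>) \<le> c * (d / x) powr \<theta>"
      using c by (simp add: mult_left_mono)
    then have "x powr (2 * \<sigma>) * (1 - (y / x) powr (2 * \<sigma>)) \<le> x powr (2 * \<sigma>) * (c * (d / x) powr \<theta>)"
      by (intro mult_left_mono) auto
    also have "x powr (2 * \<sigma>) * (1 - (y / x) powr (2 * \<sigma>)) = x powr (2 * \<sigma>) - y powr (2 * \<sigma>)"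
      using x assms by (simp add: powr_divide right_diff_distrib)
    also have "x powr (2 * \<sigma>) * (c * (d / x) powr \<theta>) = c * d powr \<theta> * (x powr \<sigma> * x powr (\<sigma> - \<theta>))"
    proof -
      have "x powr (2 * \<sigma>) = x powr \<sigma> * x powr (\<sigma> - \<theta>) * x powr \<theta>"
        by (simp flip: powr_add)
      then show ?thesis using x assms by (simp add: powr_divide)
    qed
    also have "\<dots> \<le> c * d powr \<theta> * (x powr \<sigma> * (2 powr \<sigma> * y powr (\<sigma> - \<theta>)))"
    proof (intro mult_left_mono)
      have "x powr (\<sigma> - \<theta>) \<le> (2 * y) powr (\<sigma> - \<theta>)"
        using assms x True by (intro powr_mono2) auto
      also have "\<dots> = 2 powr (\<sigma> - \<theta>) * y powr (\<sigma> - \<theta>)"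
        using assms by (simp add: powr_mult)
      also have "\<dots> \<le> 2 powr \<sigma> * y powr (\<sigma> - \<theta>)"
        using assms by (intro mult_right_mono powr_mono) auto
      finally show "x powr (\<sigma> - \<theta>) \<le> 2 powr \<sigma> * y powr (\<sigma> - \<theta>)" .
    qed (use c in auto)
    also have "\<dots> = 2 powr \<sigma> * c * (d powr \<theta> * (x powr \<sigma> * y powr (\<sigma> - \<theta>)))"
      by simp
    also have "\<dots> \<le> (2 powr \<sigma> * (c + 1)) * (d powr \<theta> * (x powr \<sigma> * y powr (\<sigma> - \<theta>)) + d powr \<sigma> * x powr \<sigma>)"
      using c by (intro mult_mono) auto
    finally show ?thesis by (simp add: c_def)
  next
    case False
    then have "x \<le> 2 * d" using assms by linarith
    then have "x powr \<sigma> \<le> (2 * d) powr \<sigma>"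
      using assms x by (intro powr_mono2) auto
    also have "\<dots> = 2 powr \<sigma> * d powr \<sigma>"
      using assms by (simp add: powr_mult)
    finally have *: "x powr \<sigma> * x powr \<sigma> \<le> (2 powr \<sigma> * d powr \<sigma>) * x powr \<sigma>"
      by (intro mult_right_mono) auto
    have "x powr (2 * \<sigma>) = x powr \<sigma> * x powr \<sigma>" by (simp flip: powr_add)
    then have "x powr (2 * \<sigma>) - y powr (2 * \<sigma>) \<le> (2 powr \<sigma> * d powr \<sigma>) * x powr \<sigma>"
      using * powr_ge_zero[of y "2 * \<sigma>"] by linarith
    also have "\<dots> = (2 powr \<sigma> * 1) * (0 + d powr \<sigma> * x powr \<sigma>)" by simp
    also have "\<dots> \<le> (2 powr \<sigma> * (c + 1)) * (d powr \<theta> * (x powr \<sigma> * y powr (\<sigma> - \<theta>)) + d powr \<sigma> * x powr \<sigma>)"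
      using c by (intro mult_mono add_mono) auto
    finally show ?thesis by (simp add: c_def)
  qed
qed

text \<open>The right-hand side is symmetric in \<open>n\<close> and \<open>m\<close>, so only
  \<open>jb m \<le> jb n\<close> has to be treated. Its first group moves \<open>\<theta>\<close>
  powers to the difference of the frequencies, the second moves \<open>\<sigma>\<close>.\<close>

lemma jb_commutator_le:
  assumes "0 \<le> \<theta>" "\<theta> \<le> \<sigma>" "\<theta> \<le> 1"
  shows "\<bar>jb n powr (2 * \<sigma>) - jb m powr (2 * \<sigma>)\<bar> \<le> (2 powr \<sigma> * (real (nat \<lceil>2 * \<sigma>\<rceil>) + 1)) *
    (jb (n - m) powr \<theta> * (jb n powr \<sigma> * jb m powr (\<sigma> - \<theta>) + jb n powr (\<sigma> - \<theta>) * jb m powr \<sigma>) +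
     jb (n - m) powr \<sigma> * (jb n powr \<sigma> + jb m powr \<sigma>))"
    (is "_ \<le> ?c * ?R n m")
proof -
  have one: "\<bar>jb n powr (2 * \<sigma>) - jb m powr (2 * \<sigma>)\<bar> \<le> ?c * ?R n m" if "jb m \<le> jb n" for n m
  proof -
    have "jb m powr (2 * \<sigma>) \<le> jb n powr (2 * \<sigma>)"
      using that assms by (intro powr_mono2) auto
    then have "\<bar>jb n powr (2 * \<sigma>) - jb m powr (2 * \<sigma>)\<bar> = jb n powr (2 * \<sigma>) - jb m powr (2 * \<sigma>)"
      by simp
    also have "\<dots> \<le> ?c * (jb (n - m) powr \<theta> * (jb n powr \<sigma> * jb m powr (\<sigma> - \<theta>)) + jb (n - m) powr \<sigma> * jb n powr \<sigma>)"
      using that assms jb_diff_le by (intro powr_diff_le) auto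
    also have "\<dots> \<le> ?c * ?R n m"
      by (intro mult_left_mono add_mono) auto
    finally show ?thesis .
  qed
  show ?thesis
  proof (cases "jb m \<le> jb n")
    case False
    have "jb (m - n) = jb (n - m)" using jb_minus[of "n - m"] by simp
    then have "?R m n = ?R n m" by (simp add: add.commute mult.commute)
    with one[of n m] False show ?thesis by (simp add: abs_minus_commute)
  qed (rule one)
qed

text \<open>\<open>A\<close> holds the Fourier coefficients of a real function, so conjugating the
  form just moves the weight from \<open>n\<close> to \<open>m\<close>. Hence twice the imaginary
  part is the form with the difference of the two weights, where powers are gained.\<close>

lemma commutator_form_bound:
  fixes w A :: "int \<Rightarrow> complex"
  assumes \<theta>: "0 \<le> \<theta>" "\<theta> \<le> \<sigma>" "\<theta> \<le> 1"
    and S: "finite S" and A: "\<And>l. A (- l) = cnj (A l)"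
    and b\<theta>: "\<And>T. finite T \<Longrightarrow> (\<Sum>l\<in>T. jb l powr \<theta> * cmod (A l)) \<le> b\<theta>"
    and b\<sigma>: "\<And>T. finite T \<Longrightarrow> (\<Sum>l\<in>T. jb l powr \<sigma> * cmod (A l)) \<le> b\<sigma>"
  shows "\<bar>Im (\<Sum>n\<in>S. \<Sum>m\<in>S. of_real (jb n powr (2 * \<sigma>)) * (cnj (w n) * (w m * A (n - m))))\<bar> \<le>
    (2 powr \<sigma> * (real (nat \<lceil>2 * \<sigma>\<rceil>) + 1)) *
    (L2_set (\<lambda>n. jb n powr \<sigma> * cmod (w n)) S * L2_set (\<lambda>n. jb n powr (\<sigma> - \<theta>) * cmod (w n)) S * b\<theta> +
     L2_set (\<lambda>n. jb n powr \<sigma> * cmod (w n)) S * L2_set (\<lambda>n. cmod (w n)) S * b\<sigma>)"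
proof -
  define c where "c = 2 powr \<sigma> * (real (nat \<lceil>2 * \<sigma>\<rceil>) + 1)"
  have c: "0 \<le> c" by (simp add: c_def)
  define I where "I = (\<Sum>n\<in>S. \<Sum>m\<in>S. of_real (jb n powr (2 * \<sigma>)) * (cnj (w n) * (w m * A (n - m))))"
  define X where "X = L2_set (\<lambda>n. jb n powr \<sigma> * cmod (w n)) S"
  define Z where "Z = L2_set (\<lambda>n. jb n powr (\<sigma> - \<theta>) * cmod (w n)) S"
  define W where "W = L2_set (\<lambda>n. cmod (w n)) S"
  have "cnj I = (\<Sum>n\<in>S. \<Sum>m\<in>S. of_real (jb n powr (2 * \<sigma>)) * (w n * (cnj (w m) * A (m - n))))"
    unfolding I_def by (simp add: A[symmetric])
  also have "\<dots> = (\<Sum>n\<in>S. \<Sum>m\<in>S. of_real (jb m powr (2 * \<sigma>)) * (cnj (w n) * (w m * A (n - m))))"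
    by (subst sum.swap) (simp add: mult_ac)
  finally have cI: "I - cnj I = (\<Sum>n\<in>S. \<Sum>m\<in>S. of_real (jb n powr (2 * \<sigma>) - jb m powr (2 * \<sigma>)) * (cnj (w n) * (w m * A (n - m))))"
    by (simp add: I_def left_diff_distrib sum_subtractf)
  have "2 * \<bar>Im I\<bar> = cmod (I - cnj I)" by (simp add: complex_diff_cnj norm_mult)
  also have "\<dots> \<le> (\<Sum>n\<in>S. \<Sum>m\<in>S. \<bar>jb n powr (2 * \<sigma>) - jb m powr (2 * \<sigma>)\<bar> * (cmod (w n) * (cmod (w m) * cmod (A (n - m)))))"
    unfolding cI by (intro sum_norm_le) (simp add: norm_mult flip: of_real_diff)
  also have "\<dots> \<le> (\<Sum>n\<in>S. \<Sum>m\<in>S. (c *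
    (jb (n - m) powr \<theta> * (jb n powr \<sigma> * jb m powr (\<sigma> - \<theta>) + jb n powr (\<sigma> - \<theta>) * jb m powr \<sigma>) +
     jb (n - m) powr \<sigma> * (jb n powr \<sigma> + jb m powr \<sigma>))) * (cmod (w n) * (cmod (w m) * cmod (A (n - m)))))"
    unfolding c_def by (intro sum_mono mult_right_mono jb_commutator_le \<theta>) auto
  also have "\<dots> = c * (
    (\<Sum>n\<in>S. \<Sum>m\<in>S. (jb n powr \<sigma> * cmod (w n)) * (jb m powr (\<sigma> - \<theta>) * cmod (w m)) * (jb (n - m) powr \<theta> * cmod (A (n - m)))) +
    (\<Sum>n\<in>S. \<Sum>m\<in>S. (jb n powr (\<sigma> - \<theta>) * cmod (w n)) * (jb m powr \<sigma> * cmod (w m)) * (jb (n - m) powr \<theta> * cmod (A (n - m)))) +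
    (\<Sum>n\<in>S. \<Sum>m\<in>S. (jb n powr \<sigma> * cmod (w n)) * cmod (w m) * (jb (n - m) powr \<sigma> * cmod (A (n - m)))) +
    (\<Sum>n\<in>S. \<Sum>m\<in>S. cmod (w n) * (jb m powr \<sigma> * cmod (w m)) * (jb (n - m) powr \<sigma> * cmod (A (n - m)))))"
    unfolding sum.distrib[symmetric] sum_distrib_left by (intro sum.cong refl) (simp add: algebra_simps)
  also have "\<dots> \<le> c * (X * Z * b\<theta> + Z * X * b\<theta> + X * W * b\<sigma> + W * X * b\<sigma>)"
    unfolding X_def Z_def W_def using c
    by (intro mult_left_mono add_mono schur_minus S b\<theta> b\<sigma>) auto
  also have "\<dots> = 2 * (c * (X * Z * b\<theta> + X * W * b\<sigma>))" by (simp add: algebra_simps)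
  finally show ?thesis by (simp add: I_def c_def X_def Z_def W_def)
qed

subsection \<open>The resonant region\<close>

text \<open>The region where \<open>m\<close> is close to \<open>- n\<close>; excluding
  \<open>n = 0\<close> keeps the divisor \<open>n^2 + m^2\<close> positive. Outside it the frequency
  \<open>n + m\<close> of the coefficient is comparable with \<open>n\<close> or larger.\<close>

definition near :: "int \<Rightarrow> int \<Rightarrow> bool" where
  "near n m \<longleftrightarrow> n \<noteq> 0 \<and> 2 * \<bar>n + m\<bar> \<le> \<bar>n\<bar>"

lemma far_jb_le: "\<not> near n m \<Longrightarrow> jb n \<le> 2 * jb (n + m)"
proof -
  assume "\<not> near n m"
  then have "\<bar>n\<bar> \<le> 2 * \<bar>n + m\<bar>" by (auto simp: near_def)
  then have "\<bar>n\<bar>\<^sup>2 \<le> (2 * \<bar>n + m\<bar>)\<^sup>2" by (intro power_mono) auto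
  then have "n\<^sup>2 \<le> 4 * (n + m)\<^sup>2" by (simp only: power_mult_distrib power2_abs) simp
  then have "real_of_int (n\<^sup>2) \<le> real_of_int (4 * (n + m)\<^sup>2)"
    by (simp only: of_int_le_iff)
  then have "(real_of_int n)\<^sup>2 \<le> 4 * (real_of_int (n + m))\<^sup>2"
    by simp
  then have "(jb n)\<^sup>2 \<le> (2 * jb (n + m))\<^sup>2" by (simp add: jb_sq power_mult_distrib)
  then show ?thesis by (rule power2_le_imp_le) simp
qed

lemma near_jb:
  assumes "near n m"
  shows "jb n \<le> 2 * jb m" "jb m \<le> 2 * jb n" "jb (n + m) \<le> jb n"
    "(jb n)\<^sup>2 \<le> 2 * ((of_int n)\<^sup>2 + (of_int m)\<^sup>2)"
proof -
  have le: "jb a \<le> 2 * jb b" if "\<bar>a\<bar> \<le> 2 * \<bar>b\<bar>" for a b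
  proof -
    have "\<bar>a\<bar>\<^sup>2 \<le> (2 * \<bar>b\<bar>)\<^sup>2" using that by (intro power_mono) auto
    then have "a\<^sup>2 \<le> 4 * b\<^sup>2" by (simp add: power_mult_distrib)
    then have "real_of_int (a\<^sup>2) \<le> real_of_int (4 * b\<^sup>2)"
      by (simp only: of_int_le_iff)
    then have "(real_of_int a)\<^sup>2 \<le> 4 * (real_of_int b)\<^sup>2"
      by simp
    then have "(jb a)\<^sup>2 \<le> (2 * jb b)\<^sup>2" by (simp add: jb_sq power_mult_distrib)
    then show ?thesis by (rule power2_le_imp_le) simp
  qed
  have R: "n \<noteq> 0" "2 * \<bar>n + m\<bar> \<le> \<bar>n\<bar>" using assms by (auto simp: near_def)
  have "\<bar>n\<bar> \<le> 2 * \<bar>m\<bar>" "\<bar>m\<bar> \<le> 2 * \<bar>n\<bar>" using R(2) by (smt (verit))+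
  then show "jb n \<le> 2 * jb m" and "jb m \<le> 2 * jb n" by (auto intro: le)
  show "jb (n + m) \<le> jb n" using order_trans[OF _ R(2), of "\<bar>n + m\<bar>"] by (intro jb_mono) simp
  have "0 < n\<^sup>2" using R by simp
  then have "1 \<le> n\<^sup>2" by (simp only: int_one_le_iff_zero_less)
  then have "real_of_int 1 \<le> real_of_int (n\<^sup>2)" by (simp only: of_int_le_iff)
  then have "1 \<le> (real_of_int n)\<^sup>2" by simp
  have le': "1 + x \<le> 2 * (x + y)" if "1 \<le> x" "0 \<le> y" for x y :: real
    using that by simp
  show "(jb n)\<^sup>2 \<le> 2 * ((of_int n)\<^sup>2 + (of_int m)\<^sup>2)"
    unfolding jb_sq by (intro le' \<open>1 \<le> (real_of_int n)\<^sup>2\<close> zero_le_power2)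
qed

text \<open>Dividing by \<open>n^2 + m^2\<close> wins two full derivatives in the near
  region.\<close>

lemma near_weight_le:
  assumes "near n m"
  shows "jb n powr (2 * \<sigma>) / ((of_int n)\<^sup>2 + (of_int m)\<^sup>2) \<le> 2 * jb n powr (2 * \<sigma> - 2)"
proof -
  have p: "0 < (real_of_int n)\<^sup>2 + (of_int m)\<^sup>2" using assms by (simp add: near_def sum_power2_gt_zero_iff)
  have "jb n powr (2 * \<sigma>) = jb n powr (2 * \<sigma> - 2) * (jb n)\<^sup>2"
    by (simp flip: powr_numeral powr_add)
  also have "\<dots> \<le> jb n powr (2 * \<sigma> - 2) * (2 * ((of_int n)\<^sup>2 + (of_int m)\<^sup>2))"
    by (intro mult_left_mono near_jb assms) auto
  also have "\<dots> = (2 * jb n powr (2 * \<sigma> - 2)) * ((of_int n)\<^sup>2 + (of_int m)\<^sup>2)" by simp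
  finally show ?thesis by (subst pos_divide_le_eq[OF p])
qed

text \<open>The normal form correction. Its divisor \<open>n^2 + m^2\<close> is the sum of the
  phases of \<open>x n\<close> and \<open>y m\<close> when both are conjugated modes of a
  solution.\<close>

definition nearform :: "real \<Rightarrow> int set \<Rightarrow> (int \<Rightarrow> complex) \<Rightarrow> (int \<Rightarrow> complex) \<Rightarrow> (int \<Rightarrow> complex) \<Rightarrow> complex" where
  "nearform \<sigma> S x y B = (\<Sum>n\<in>S. \<Sum>m\<in>S. if near n m
     then of_real (jb n powr (2 * \<sigma>) / ((of_int n)\<^sup>2 + (of_int m)\<^sup>2)) * (x n * (y m * B (n + m))) else 0)"

text \<open>\<open>x\<close> and \<open>y\<close> may each contain one derivative: the divisor pays
  for both and leaves \<open>\<sigma>\<close> powers on each of \<open>\<xi>\<close> and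
  \<open>\<eta>\<close>. With \<open>\<sigma> = s - 1\<close> such a term is of lower order than the
  squared \<open>H^s\<close> norm.\<close>

lemma nearform_bound:
  assumes S: "finite S" and \<sigma>: "0 \<le> \<sigma>"
    and x: "\<And>n. n \<in> S \<Longrightarrow> cmod (x n) \<le> jb n * \<xi> n" and y: "\<And>n. n \<in> S \<Longrightarrow> cmod (y n) \<le> jb n * \<eta> n"
    and \<xi>: "\<And>n. 0 \<le> \<xi> n" and \<eta>: "\<And>n. 0 \<le> \<eta> n"
    and b: "\<And>T. finite T \<Longrightarrow> (\<Sum>l\<in>T. cmod (B l)) \<le> b"
  shows "cmod (nearform \<sigma> S x y B) \<le> (4 * 2 powr \<sigma>) *
    (L2_set (\<lambda>n. jb n powr \<sigma> * \<xi> n) S * L2_set (\<lambda>n. jb n powr \<sigma> * \<eta> n) S * b)"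
proof -
  have "cmod (nearform \<sigma> S x y B) \<le> (\<Sum>n\<in>S. \<Sum>m\<in>S. (4 * 2 powr \<sigma>) *
     ((jb n powr \<sigma> * \<xi> n) * (jb m powr \<sigma> * \<eta> m) * cmod (B (n + m))))"
    unfolding nearform_def
  proof (intro sum_norm_le)
    fix n m assume nm: "n \<in> S" "m \<in> S"
    show "cmod (if near n m
     then of_real (jb n powr (2 * \<sigma>) / ((of_int n)\<^sup>2 + (of_int m)\<^sup>2)) * (x n * (y m * B (n + m))) else 0)
     \<le> (4 * 2 powr \<sigma>) * ((jb n powr \<sigma> * \<xi> n) * (jb m powr \<sigma> * \<eta> m) * cmod (B (n + m)))"
    proof (cases "near n m")
      case True
      have "jb n powr \<sigma> \<le> (2 * jb m) powr \<sigma>" using near_jb(1)[OF True] \<sigma> by (intro powr_mono2) auto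
      then have n\<sigma>: "jb n powr \<sigma> \<le> 2 powr \<sigma> * jb m powr \<sigma>" by (simp add: powr_mult)
      have "cmod (of_real (jb n powr (2 * \<sigma>) / ((of_int n)\<^sup>2 + (of_int m)\<^sup>2)) * (x n * (y m * B (n + m))))
        = (jb n powr (2 * \<sigma>) / ((of_int n)\<^sup>2 + (of_int m)\<^sup>2)) * (cmod (x n) * (cmod (y m) * cmod (B (n + m))))"
        by (simp add: norm_mult norm_divide flip: of_int_power of_int_add)
      also have "\<dots> \<le> (2 * jb n powr (2 * \<sigma> - 2)) * ((jb n * \<xi> n) * ((2 * jb n * \<eta> m) * cmod (B (n + m))))"
      proof (intro mult_mono near_weight_le True x nm)
        have "cmod (y m) \<le> jb m * \<eta> m" by (intro y nm)
        also have "\<dots> \<le> 2 * jb n * \<eta> m" using near_jb(2)[OF True] \<eta> by (intro mult_right_mono) auto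
        finally show "cmod (y m) \<le> 2 * jb n * \<eta> m" .
      qed (use \<xi> \<eta> in auto)
      also have "\<dots> = 4 * (jb n powr \<sigma> * jb n powr \<sigma>) * \<xi> n * \<eta> m * cmod (B (n + m))"
      proof -
        have "jb n powr \<sigma> * jb n powr \<sigma> = jb n powr (2 * \<sigma> - 2) * (jb n)\<^sup>2"
          by (simp flip: powr_numeral powr_add)
        then show ?thesis by (simp add: power2_eq_square)
      qed
      also have "\<dots> \<le> 4 * (jb n powr \<sigma> * (2 powr \<sigma> * jb m powr \<sigma>)) * \<xi> n * \<eta> m * cmod (B (n + m))"
        by (intro mult_right_mono mult_left_mono n\<sigma> \<xi> \<eta>) auto
      finally show ?thesis using True by (simp add: mult_ac)
    qed (use \<xi> \<eta> in auto)
  qed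
  also have "\<dots> = (4 * 2 powr \<sigma>) * (\<Sum>n\<in>S. \<Sum>m\<in>S. (jb n powr \<sigma> * \<xi> n) * (jb m powr \<sigma> * \<eta> m) * cmod (B (n + m)))"
    by (simp only: sum_distrib_left)
  also have "\<dots> \<le> (4 * 2 powr \<sigma>) *
    (L2_set (\<lambda>n. jb n powr \<sigma> * \<xi> n) S * L2_set (\<lambda>n. jb n powr \<sigma> * \<eta> n) S * b)"
    using \<xi> \<eta> by (intro mult_left_mono schur_plus S b) auto
  finally show ?thesis .
qed

text \<open>For a coefficient \<open>B\<close> of negative regularity. Of the two derivatives won by
  the divisor, \<open>2 - \<theta>\<close> are handed to \<open>B\<close>, by
  \<open>jb (n + m) \<le> jb n\<close>, and \<open>\<theta>\<close> remain as a gain on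
  \<open>y\<close>.\<close>

lemma nearform_bound_rough:
  assumes S: "finite S" and \<theta>: "0 \<le> \<theta>" "\<theta> \<le> \<sigma>" "\<theta> \<le> 2"
    and b: "\<And>T. finite T \<Longrightarrow> (\<Sum>l\<in>T. jb l powr (\<theta> - 2) * cmod (B l)) \<le> b"
  shows "cmod (nearform \<sigma> S x y B) \<le> (2 * 2 powr \<sigma>) *
    (L2_set (\<lambda>n. jb n powr \<sigma> * cmod (x n)) S * L2_set (\<lambda>n. jb n powr (\<sigma> - \<theta>) * cmod (y n)) S * b)"
proof -
  have "cmod (nearform \<sigma> S x y B) \<le> (\<Sum>n\<in>S. \<Sum>m\<in>S. (2 * 2 powr \<sigma>) *
     ((jb n powr \<sigma> * cmod (x n)) * (jb m powr (\<sigma> - \<theta>) * cmod (y m)) * (jb (n + m) powr (\<theta> - 2) * cmod (B (n + m)))))"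
    unfolding nearform_def
  proof (intro sum_norm_le)
    fix n m assume nm: "n \<in> S" "m \<in> S"
    show "cmod (if near n m
     then of_real (jb n powr (2 * \<sigma>) / ((of_int n)\<^sup>2 + (of_int m)\<^sup>2)) * (x n * (y m * B (n + m))) else 0)
     \<le> (2 * 2 powr \<sigma>) *
     ((jb n powr \<sigma> * cmod (x n)) * (jb m powr (\<sigma> - \<theta>) * cmod (y m)) * (jb (n + m) powr (\<theta> - 2) * cmod (B (n + m))))"
    proof (cases "near n m")
      case True
      have "jb n powr (\<sigma> - \<theta>) \<le> (2 * jb m) powr (\<sigma> - \<theta>)" using near_jb(1)[OF True] \<theta> by (intro powr_mono2) auto
      also have "\<dots> = 2 powr (\<sigma> - \<theta>) * jb m powr (\<sigma> - \<theta>)" by (simp add: powr_mult)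
      also have "\<dots> \<le> 2 powr \<sigma> * jb m powr (\<sigma> - \<theta>)" using \<theta> by (intro mult_right_mono powr_mono) auto
      finally have n\<sigma>: "jb n powr (\<sigma> - \<theta>) \<le> 2 powr \<sigma> * jb m powr (\<sigma> - \<theta>)" .
      have n\<theta>: "jb n powr (\<theta> - 2) \<le> jb (n + m) powr (\<theta> - 2)"
        using near_jb(3)[OF True] \<theta> by (intro powr_mono2') auto
      have "cmod (of_real (jb n powr (2 * \<sigma>) / ((of_int n)\<^sup>2 + (of_int m)\<^sup>2)) * (x n * (y m * B (n + m))))
        = (jb n powr (2 * \<sigma>) / ((of_int n)\<^sup>2 + (of_int m)\<^sup>2)) * (cmod (x n) * cmod (y m) * cmod (B (n + m)))"
        by (simp add: norm_mult norm_divide flip: of_int_power of_int_add)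
      also have "\<dots> \<le> (2 * jb n powr (2 * \<sigma> - 2)) * (cmod (x n) * cmod (y m) * cmod (B (n + m)))"
        by (intro mult_right_mono near_weight_le True) auto
      also have "jb n powr (2 * \<sigma> - 2) = jb n powr \<sigma> * (jb n powr (\<sigma> - \<theta>) * jb n powr (\<theta> - 2))"
        by (simp flip: powr_add)
      also have "(2 * (jb n powr \<sigma> * (jb n powr (\<sigma> - \<theta>) * jb n powr (\<theta> - 2)))) * (cmod (x n) * cmod (y m) * cmod (B (n + m)))
         \<le> (2 * (jb n powr \<sigma> * ((2 powr \<sigma> * jb m powr (\<sigma> - \<theta>)) * jb (n + m) powr (\<theta> - 2)))) * (cmod (x n) * cmod (y m) * cmod (B (n + m)))"
        by (intro mult_right_mono mult_left_mono mult_mono n\<sigma> n\<theta>) auto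
      finally show ?thesis using True by (simp add: mult_ac)
    qed auto
  qed
  also have "\<dots> = (2 * 2 powr \<sigma>) * (\<Sum>n\<in>S. \<Sum>m\<in>S. (jb n powr \<sigma> * cmod (x n)) * (jb m powr (\<sigma> - \<theta>) * cmod (y m)) * (jb (n + m) powr (\<theta> - 2) * cmod (B (n + m))))"
    by (simp only: sum_distrib_left)
  also have "\<dots> \<le> (2 * 2 powr \<sigma>) *
    (L2_set (\<lambda>n. jb n powr \<sigma> * cmod (x n)) S * L2_set (\<lambda>n. jb n powr (\<sigma> - \<theta>) * cmod (y n)) S * b)"
    by (intro mult_left_mono schur_plus S b) auto
  finally show ?thesis .
qed

text \<open>Away from the near region \<open>n + m\<close> has at least half the size of
  \<open>n\<close>, so half of the weight moves to the coefficient \<open>B\<close>, and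
  \<open>y\<close> is left without any.\<close>

lemma farform_bound:
  assumes S: "finite S" and \<sigma>: "0 \<le> \<sigma>"
    and b: "\<And>T. finite T \<Longrightarrow> (\<Sum>l\<in>T. jb l powr \<sigma> * cmod (B l)) \<le> b"
  shows "cmod (\<Sum>n\<in>S. \<Sum>m\<in>S. if near n m then 0 else of_real (jb n powr (2 * \<sigma>)) * (x n * (y m * B (n + m)))) \<le> 2 powr \<sigma> *
    (L2_set (\<lambda>n. jb n powr \<sigma> * cmod (x n)) S * L2_set (\<lambda>n. cmod (y n)) S * b)"
proof -
  have "cmod (\<Sum>n\<in>S. \<Sum>m\<in>S. if near n m then 0 else of_real (jb n powr (2 * \<sigma>)) * (x n * (y m * B (n + m))))
    \<le> (\<Sum>n\<in>S. \<Sum>m\<in>S. 2 powr \<sigma> * ((jb n powr \<sigma> * cmod (x n)) * cmod (y m) * (jb (n + m) powr \<sigma> * cmod (B (n + m)))))"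
  proof (intro sum_norm_le)
    fix n m
    show "cmod (if near n m then 0 else of_real (jb n powr (2 * \<sigma>)) * (x n * (y m * B (n + m)))) \<le>
      2 powr \<sigma> * ((jb n powr \<sigma> * cmod (x n)) * cmod (y m) * (jb (n + m) powr \<sigma> * cmod (B (n + m))))"
    proof (cases "near n m")
      case False
      have "jb n powr \<sigma> \<le> (2 * jb (n + m)) powr \<sigma>" using far_jb_le[OF False] \<sigma> by (intro powr_mono2) auto
      then have n\<sigma>: "jb n powr \<sigma> \<le> 2 powr \<sigma> * jb (n + m) powr \<sigma>" by (simp add: powr_mult)
      have "cmod (of_real (jb n powr (2 * \<sigma>)) * (x n * (y m * B (n + m)))) = jb n powr \<sigma> * jb n powr \<sigma> * (cmod (x n) * (cmod (y m) * cmod (B (n + m))))"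
        by (simp add: norm_mult flip: powr_add)
      also have "\<dots> \<le> jb n powr \<sigma> * (2 powr \<sigma> * jb (n + m) powr \<sigma>) * (cmod (x n) * (cmod (y m) * cmod (B (n + m))))"
        by (intro mult_right_mono mult_left_mono n\<sigma>) auto
      finally show ?thesis using False by (simp add: mult_ac)
    qed auto
  qed
  also have "\<dots> = 2 powr \<sigma> * (\<Sum>n\<in>S. \<Sum>m\<in>S. (jb n powr \<sigma> * cmod (x n)) * cmod (y m) * (jb (n + m) powr \<sigma> * cmod (B (n + m))))"
    by (simp only: sum_distrib_left)
  also have "\<dots> \<le> 2 powr \<sigma> *
    (L2_set (\<lambda>n. jb n powr \<sigma> * cmod (x n)) S * L2_set (\<lambda>n. cmod (y n)) S * b)"
    by (intro mult_left_mono schur_plus S b) auto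
  finally show ?thesis .
qed

text \<open>
  A time derivative in \<open>H\<^bsup>-1\<^esup>\<close> multiplied by an \<open>H\<^sup>1\<close> function: the weights are split according
  to \<open>jb m \<le> 2 * jb l\<close> or \<open>jb m \<le> 2 * jb (l - m)\<close>.
\<close>

lemma negative_product_bound:
  assumes \<theta>: "0 \<le> \<theta>" "\<theta> < 1"
  obtains C where "C > 0"
    "\<And>D q v h H T. D \<in> trigp \<Longrightarrow> q \<in> trigp \<Longrightarrow> v \<in> trigp \<Longrightarrow> (\<And>n. 0 \<le> h n) \<Longrightarrow>
      (\<And>T. finite T \<Longrightarrow> sum h T \<le> H) \<Longrightarrow>
      (\<And>n. cmod (fcoef q n) \<le> (jb n)\<^sup>2 * cmod (fcoef v n) + h n) \<Longrightarrow> finite T \<Longrightarrow>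
      (\<Sum>l\<in>T. jb l powr (\<theta> - 2) * cmod (fcoef (\<lambda>x. D x * q x) l)) \<le>
      C * (wl1 0 D * wl1 \<theta> v + wl2 1 D * wl2 1 v + wl1 0 D * H)"
proof -
  \<comment> \<open>In the second case of the split, Cauchy-Schwarz in \<open>m\<close> yields a
    bound uniform in \<open>l\<close>; the remaining factor \<open>jb l powr (\<theta> - 2)\<close>
    is summable because \<open>2 - \<theta> > 1\<close>.\<close>
  obtain C0 where C0: "C0 > 0" "\<And>S. finite S \<Longrightarrow> (\<Sum>n\<in>S. jb n powr (- (2 - \<theta>))) \<le> C0"
    using jb_powr_sum_bounded[of "2 - \<theta>"] \<theta> by auto
  define C where "C = 4 + 2 * C0"
  have sq: "(jb m)\<^sup>2 * jb l powr (\<theta> - 2) \<le> 4 * jb m powr \<theta> + 2 * (jb l powr (\<theta> - 2) * (jb (l - m) * jb m))" for l m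
  proof (cases "jb m \<le> 2 * jb l")
    case True
    have "jb m powr (2 - \<theta>) \<le> (2 * jb l) powr (2 - \<theta>)" using True \<theta> by (intro powr_mono2) auto
    also have "\<dots> = 2 powr (2 - \<theta>) * jb l powr (2 - \<theta>)" by (simp add: powr_mult)
    also have "\<dots> \<le> 2 powr 2 * jb l powr (2 - \<theta>)" using \<theta> by (intro mult_right_mono powr_mono) auto
    finally have "jb m powr \<theta> * jb m powr (2 - \<theta>) * jb l powr (\<theta> - 2) \<le> jb m powr \<theta> * (4 * jb l powr (2 - \<theta>)) * jb l powr (\<theta> - 2)"
      by (intro mult_right_mono mult_left_mono) auto
    also have "\<dots> = 4 * jb m powr \<theta>"
      using powr_add[of "jb l" "2 - \<theta>" "\<theta> - 2"] by simp
    also have "jb m powr \<theta> * jb m powr (2 - \<theta>) = (jb m)\<^sup>2"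
      by (simp flip: powr_numeral powr_add)
    finally show ?thesis by (simp add: add_increasing2)
  next
    case False
    then have "jb m \<le> 2 * jb (l - m)"
      using jb_add_le[of m l] jb_minus[of "m - l"] by simp
    then have "jb m * jb m * jb l powr (\<theta> - 2) \<le> (2 * jb (l - m)) * jb m * jb l powr (\<theta> - 2)"
      by (intro mult_right_mono) auto
    then show ?thesis by (simp add: power2_eq_square mult_ac add_increasing)
  qed
  have main: "(\<Sum>l\<in>T. jb l powr (\<theta> - 2) * cmod (fcoef (\<lambda>x. D x * q x) l)) \<le>
      C * (wl1 0 D * wl1 \<theta> v + wl2 1 D * wl2 1 v + wl1 0 D * H)"
    if D: "D \<in> trigp" and q: "q \<in> trigp" and v: "v \<in> trigp" and h: "\<And>n. 0 \<le> h n" "\<And>T. finite T \<Longrightarrow> sum h T \<le> H"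
      and le: "\<And>n. cmod (fcoef q n) \<le> (jb n)\<^sup>2 * cmod (fcoef v n) + h n" and T: "finite T" for D q v h H T
  proof -
    define U where "U = fsupp q"
    have U: "finite U" using q by (simp add: U_def trigp_finite_fsupp)
    have H: "0 \<le> H" using h(2)[of "{}"] by simp
    have "(\<Sum>l\<in>T. jb l powr (\<theta> - 2) * cmod (fcoef (\<lambda>x. D x * q x) l)) \<le>
       (\<Sum>l\<in>T. (\<Sum>m\<in>U. 4 * ((jb m powr \<theta> * cmod (fcoef v m)) * cmod (fcoef D (l - m)))) +
          jb l powr (\<theta> - 2) * (2 * (\<Sum>m\<in>U. (jb m * cmod (fcoef v m)) * (jb (l - m) * cmod (fcoef D (l - m))))) +
          (\<Sum>m\<in>U. h m * cmod (fcoef D (l - m))))"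
    proof (rule sum_mono)
      fix l assume "l \<in> T"
      have "fcoef (\<lambda>x. D x * q x) l = (\<Sum>m\<in>U. fcoef q m * fcoef D (l - m))"
        using fcoef_mult[OF q U _ trigp_continuous_on[OF D]] by (simp add: U_def mult.commute)
      then have "jb l powr (\<theta> - 2) * cmod (fcoef (\<lambda>x. D x * q x) l) \<le>
         jb l powr (\<theta> - 2) * (\<Sum>m\<in>U. ((jb m)\<^sup>2 * cmod (fcoef v m) + h m) * cmod (fcoef D (l - m)))"
        using le by (intro mult_left_mono) (auto intro!: sum_norm_le mult_right_mono simp: norm_mult)
      also have "\<dots> = (\<Sum>m\<in>U. ((jb m)\<^sup>2 * jb l powr (\<theta> - 2)) * (cmod (fcoef v m) * cmod (fcoef D (l - m))) +
          jb l powr (\<theta> - 2) * (h m * cmod (fcoef D (l - m))))"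
        unfolding sum_distrib_left by (intro sum.cong refl) (simp add: algebra_simps)
      also have "\<dots> \<le> (\<Sum>m\<in>U. (4 * jb m powr \<theta> + 2 * (jb l powr (\<theta> - 2) * (jb (l - m) * jb m))) * (cmod (fcoef v m) * cmod (fcoef D (l - m))) +
          1 * (h m * cmod (fcoef D (l - m))))"
      proof (intro sum_mono add_mono mult_right_mono sq)
        show "jb l powr (\<theta> - 2) \<le> 1" using powr_mono2'[of "\<theta> - 2" 1 "jb l"] \<theta> by simp
      qed (use h in auto)
      also have "\<dots> = (\<Sum>m\<in>U. 4 * ((jb m powr \<theta> * cmod (fcoef v m)) * cmod (fcoef D (l - m)))) +
          jb l powr (\<theta> - 2) * (2 * (\<Sum>m\<in>U. (jb m * cmod (fcoef v m)) * (jb (l - m) * cmod (fcoef D (l - m))))) +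
          (\<Sum>m\<in>U. h m * cmod (fcoef D (l - m)))"
        unfolding sum_distrib_left sum.distrib[symmetric] by (intro sum.cong refl) (simp add: algebra_simps)
      finally show "jb l powr (\<theta> - 2) * cmod (fcoef (\<lambda>x. D x * q x) l) \<le> \<dots>" .
    qed
    also have "\<dots> \<le> (\<Sum>l\<in>T. (\<Sum>m\<in>U. 4 * ((jb m powr \<theta> * cmod (fcoef v m)) * cmod (fcoef D (l - m)))) +
          jb l powr (\<theta> - 2) * (2 * (wl2 1 v * wl2 1 D)) +
          (\<Sum>m\<in>U. h m * cmod (fcoef D (l - m))))"
    proof (intro sum_mono add_mono mult_left_mono order_refl)
      fix l
      have "(\<Sum>m\<in>U. (jb m * cmod (fcoef v m)) * (jb (l - m) * cmod (fcoef D (l - m)))) \<le>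
        L2_set (\<lambda>m. jb m * cmod (fcoef v m)) U * L2_set (\<lambda>m. jb (l - m) * cmod (fcoef D (l - m))) U"
        using L2_set_mult_ineq[of "\<lambda>m. jb m * cmod (fcoef v m)" "\<lambda>m. jb (l - m) * cmod (fcoef D (l - m))" U]
        by (simp add: abs_mult)
      also have "L2_set (\<lambda>m. jb (l - m) * cmod (fcoef D (l - m))) U = L2_set (\<lambda>m. jb m * cmod (fcoef D m)) ((\<lambda>m. l - m) ` U)"
        unfolding L2_set_def by (subst sum.reindex) (auto simp: inj_on_def)
      also have "L2_set (\<lambda>m. jb m * cmod (fcoef v m)) U * \<dots> \<le> wl2 1 v * wl2 1 D"
        using L2_set_le_wl2[OF v U, of 1] L2_set_le_wl2[OF D finite_imageI[OF U, of "\<lambda>m. l - m"], of 1]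
        by (intro mult_mono) auto
      finally show "(\<Sum>m\<in>U. (jb m * cmod (fcoef v m)) * (jb (l - m) * cmod (fcoef D (l - m)))) \<le> wl2 1 v * wl2 1 D" .
    qed (auto simp: h(1))
    also have "\<dots> = 4 * (\<Sum>l\<in>T. \<Sum>m\<in>U. (jb m powr \<theta> * cmod (fcoef v m)) * cmod (fcoef D (l - m))) +
          (\<Sum>l\<in>T. jb l powr (\<theta> - 2)) * (2 * (wl2 1 v * wl2 1 D)) +
          (\<Sum>l\<in>T. \<Sum>m\<in>U. h m * cmod (fcoef D (l - m)))"
      by (simp only: sum.distrib sum_distrib_left[symmetric] sum_distrib_right[symmetric])
    also have "\<dots> \<le> 4 * ((\<Sum>m\<in>U. jb m powr \<theta> * cmod (fcoef v m)) * wl1 0 D) + C0 * (2 * (wl2 1 v * wl2 1 D)) + sum h U * wl1 0 D"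
    proof (intro add_mono mult_left_mono mult_right_mono sum_conv_le T)
      show "(\<Sum>l\<in>T. jb l powr (\<theta> - 2)) \<le> C0" using C0(2)[OF T] by simp
    qed (use sum_le_wl1[OF D, of _ 0] in \<open>auto simp: h(1)\<close>)
    also have "\<dots> \<le> 4 * (wl1 \<theta> v * wl1 0 D) + C0 * (2 * (wl2 1 v * wl2 1 D)) + H * wl1 0 D"
      by (intro add_mono mult_left_mono mult_right_mono sum_le_wl1 v U h) auto
    also have "\<dots> \<le> C * (wl1 \<theta> v * wl1 0 D) + C * (wl2 1 v * wl2 1 D) + C * (H * wl1 0 D)"
    proof (intro add_mono)
      show "4 * (wl1 \<theta> v * wl1 0 D) \<le> C * (wl1 \<theta> v * wl1 0 D)"
        using C0 by (intro mult_right_mono) (auto simp: C_def)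
      have "C0 * (2 * (wl2 1 v * wl2 1 D)) = (2 * C0) * (wl2 1 v * wl2 1 D)" by simp
      also have "\<dots> \<le> C * (wl2 1 v * wl2 1 D)" by (intro mult_right_mono) (auto simp: C_def)
      finally show "C0 * (2 * (wl2 1 v * wl2 1 D)) \<le> C * (wl2 1 v * wl2 1 D)" .
      have "1 * (H * wl1 0 D) \<le> C * (H * wl1 0 D)"
        using H C0 by (intro mult_right_mono) (auto simp: C_def)
      then show "H * wl1 0 D \<le> C * (H * wl1 0 D)" by simp
    qed
    finally show ?thesis by (simp add: algebra_simps)
  qed
  have "0 < C" using C0 by (simp add: C_def)
  from this main show ?thesis by (rule that)
qed

section \<open>Calculus for trigonometric polynomials\<close>

lemma tpoly_has_vector_derivative:
  "(tpoly S a has_vector_derivative tpoly S (\<lambda>n. \<i> * of_int n * a n) x) (at x)"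
proof -
  have "((\<lambda>x. a n * cis (of_int n * x)) has_vector_derivative \<i> * of_int n * a n * cis (of_int n * x)) (at x)" for n
  proof -
    have "((\<lambda>x. a n * exp (\<i> * (of_int n * of_real x))) has_vector_derivative
       (\<i> * of_int n * a n * exp (\<i> * (of_int n * of_real x)))) (at x)"
      by (auto intro!: derivative_eq_intros has_vector_derivative_real_field)
    then show ?thesis by (simp add: cis_conv_exp)
  qed
  then show ?thesis
    unfolding tpoly_def[abs_def] by (intro has_vector_derivative_sum)
qed

lemma fcoef_derivative:
  assumes f: "f \<in> trigp" and d: "\<And>x. (f has_vector_derivative g x) (at x)"
  shows "fcoef g n = \<i> * of_int n * fcoef f n"
proof -
  let ?S = "fsupp f"
  have fin: "finite ?S" using f by (rule trigp_finite_fsupp)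
  have feq: "f = tpoly ?S (fcoef f)" using f fin by (intro trigp_eq_tpoly) auto
  have "g x = tpoly ?S (\<lambda>n. \<i> * of_int n * fcoef f n) x" for x
    using d[of x] tpoly_has_vector_derivative[of ?S "fcoef f" x] unfolding feq[symmetric]
    by (rule vector_derivative_unique_at)
  then have "g = tpoly ?S (\<lambda>n. \<i> * of_int n * fcoef f n)" by blast
  then show ?thesis using fin by (simp add: fcoef_tpoly fsupp_def)
qed

text \<open>For \<open>i = 0\<close> or \<open>j = 0\<close> the truncated exponents
  \<open>i - 1\<close>, \<open>j - 1\<close> are multiplied by zero.\<close>

lemma monomial_has_vector_derivative:
  fixes f :: "real \<Rightarrow> complex"
  assumes f: "(f has_vector_derivative d) (at x within X)"
  shows "((\<lambda>x. f x ^ i * cnj (f x) ^ j) has_vector_derivative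
    of_nat i * (f x ^ (i - 1) * cnj (f x) ^ j * d) + of_nat j * (f x ^ i * cnj (f x) ^ (j - 1) * cnj d)) (at x within X)"
proof -
  have pow: "((\<lambda>x. g x ^ i) has_vector_derivative d' * (of_nat i * g x ^ (i - 1))) (at x within X)"
    if "(g has_vector_derivative d') (at x within X)" for g :: "real \<Rightarrow> complex" and d' and i :: nat
  proof -
    have "((\<lambda>z. z ^ i) has_field_derivative of_nat i * g x ^ (i - 1)) (at (g x) within g ` X)"
      by (auto intro!: derivative_eq_intros)
    from field_vector_diff_chain_within[OF that this] show ?thesis by (simp add: o_def)
  qed
  have "((\<lambda>x. cnj (f x)) has_vector_derivative cnj d) (at x within X)"
    using f by (rule has_vector_derivative_cnj)
  from has_vector_derivative_mult[OF pow[OF f, of i] pow[OF this, of j]]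
  show ?thesis by (simp add: algebra_simps)
qed

text \<open>Conjugation reflects frequencies, so the second factor is taken at \<open>n + m\<close>;
  this sign is the reason why \<open>near\<close> is a condition on \<open>n + m\<close>.\<close>

lemma fcoef_mult_cnj:
  assumes "f \<in> trigp" "finite S" "fsupp f \<subseteq> S" "continuous_on {0..2*pi} g"
  shows "fcoef (\<lambda>x. cnj (f x) * g x) n = (\<Sum>m\<in>S. cnj (fcoef f m) * fcoef g (n + m))"
proof -
  have "fcoef (\<lambda>x. cnj (f x) * g x) n = (\<Sum>m\<in>uminus ` S. fcoef (\<lambda>x. cnj (f x)) m * fcoef g (n - m))"
    using assms by (intro fcoef_mult trigp_cnj) (auto simp: fsupp_cnj)
  also have "\<dots> = (\<Sum>m\<in>S. cnj (fcoef f m) * fcoef g (n + m))"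
    using assms by (simp add: sum.reindex inj_on_def fcoef_cnj trigp_continuous_on)
  finally show ?thesis .
qed

text \<open>The product rule splits the derivative of the nonlinearity in two: a form in
  \<open>w\<close> with the real coefficient \<open>|v|^(2k)\<close>, open to the commutator
  estimate, and a form in \<open>cnj w\<close> whose coefficient has no such symmetry.\<close>

lemma fcoef_nls_derivative:
  assumes v: "v \<in> trigp" and S: "finite S" "fsupp v \<subseteq> S"
  defines "w \<equiv> \<lambda>m. \<i> * of_int m * fcoef v m"
  shows "\<i> * of_int n * fcoef (mono_fun (Suc k) k v) n =
    of_nat (Suc k) * (\<Sum>m\<in>S. w m * fcoef (mono_fun k k v) (n - m)) +
    of_nat k * (\<Sum>m\<in>S. cnj (w m) * fcoef (mono_fun (Suc k) (k - 1) v) (n + m))"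
proof -
  define v' where "v' = tpoly S w"
  have v': "v' \<in> trigp" "fsupp v' \<subseteq> S" using fsupp_tpoly[OF S(1)] trigp_tpoly[OF S(1)] by (simp_all add: v'_def)
  have cw: "fcoef v' m = w m" for m
    using S by (auto simp: v'_def fcoef_tpoly w_def fsupp_def)
  define g where "g x = of_nat (Suc k) * (v' x * mono_fun k k v x) + of_nat k * (cnj (v' x) * mono_fun (Suc k) (k - 1) v x)" for x
  have d: "(mono_fun (Suc k) k v has_vector_derivative g x) (at x)" for x
  proof -
    have "(v has_vector_derivative v' x) (at x)"
      using tpoly_has_vector_derivative[of S "fcoef v" x] trigp_eq_tpoly[OF v S]
      by (simp add: v'_def w_def)
    from monomial_has_vector_derivative[OF this, of "Suc k" k] show ?thesis
      by (simp add: g_def mono_fun_def algebra_simps)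
  qed
  have t: "mono_fun i j v \<in> trigp" for i j by (rule mono_fun_trigp[OF v])
  have "\<i> * of_int n * fcoef (mono_fun (Suc k) k v) n = fcoef g n"
    using fcoef_derivative[OF t d] by simp
  also have "\<dots> = of_nat (Suc k) * fcoef (\<lambda>x. v' x * mono_fun k k v x) n + of_nat k * fcoef (\<lambda>x. cnj (v' x) * mono_fun (Suc k) (k - 1) v x) n"
    unfolding g_def[abs_def] using v' t
    by (subst fcoef_add) (auto simp only: fcoef_cmult intro!: trigp_continuous_on trigp_intros)
  also have "fcoef (\<lambda>x. v' x * mono_fun k k v x) n = (\<Sum>m\<in>S. w m * fcoef (mono_fun k k v) (n - m))"
    using fcoef_mult[OF v'(1) S(1) v'(2) trigp_continuous_on[OF t]] by (simp add: cw)
  also have "fcoef (\<lambda>x. cnj (v' x) * mono_fun (Suc k) (k - 1) v x) n = (\<Sum>m\<in>S. cnj (w m) * fcoef (mono_fun (Suc k) (k - 1) v) (n + m))"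
    using fcoef_mult_cnj[OF v'(1) S(1) v'(2) trigp_continuous_on[OF t]] by (simp add: cw)
  finally show ?thesis .
qed

section \<open>The modified energy inequality\<close>

text \<open>The modes of \<open>v\<close> solve the truncated equation with forcing \<open>e\<close> of size \<open>\<epsilon>\<close>; \<open>vt\<close> stands for \<open>v\<^sub>t\<close>.\<close>

definition galerkin_state ::
  "nat \<Rightarrow> real \<Rightarrow> real \<Rightarrow> int set \<Rightarrow> (real \<Rightarrow> complex) \<Rightarrow> (real \<Rightarrow> complex) \<Rightarrow> (int \<Rightarrow> complex) \<Rightarrow> real \<Rightarrow> bool" where
  "galerkin_state k s K S v vt e \<epsilon> \<longleftrightarrow> finite S \<and> v \<in> trigp \<and> vt \<in> trigp \<and> fsupp v \<subseteq> S \<and> fsupp vt \<subseteq> S \<and>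
    (\<forall>n\<in>S. fcoef vt n = - \<i> * (of_int (n\<^sup>2) * fcoef v n + fcoef (mono_fun (Suc k) k v) n + e n)) \<and>
    L2_set (\<lambda>n. jb n powr s * cmod (e n)) S \<le> \<epsilon> \<and> wl2 1 v \<le> K"

text \<open>Fourier coefficients of the time derivative of \<open>B = mono_fun (Suc k) (k - 1) v\<close>.\<close>

definition Btime :: "nat \<Rightarrow> (real \<Rightarrow> complex) \<Rightarrow> (real \<Rightarrow> complex) \<Rightarrow> int \<Rightarrow> complex" where
  "Btime k v vt n = of_nat (Suc k) * fcoef (\<lambda>x. mono_fun k (k - 1) v x * vt x) n +
     of_nat (k - 1) * fcoef (\<lambda>x. mono_fun (Suc k) (k - 2) v x * cnj (vt x)) n"

text \<open>\<open>vt\<close> is bounded by \<open>(jb n)^2\<close> times the modes of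
  \<open>v\<close> plus nonlinearity and forcing, which lie in the Wiener algebra, and its cofactors
  are bounded in \<open>H^1\<close>; so the weight \<open>\<theta> - 2\<close> restores summability.
  The condition \<open>\<theta> < 1 / 2\<close> lets \<open>H^1\<close> control
  \<open>wl1 \<theta> v\<close>. For small \<open>k\<close> the truncated \<open>k - 2\<close> is
  accompanied by the factor \<open>k - 1 = 0\<close>.\<close>

lemma Btime_bound:
  assumes \<theta>: "0 \<le> \<theta>" "\<theta> < 1 / 2" and s: "1 \<le> s"
  shows "\<exists>C>0. \<forall>S v vt e \<epsilon>. galerkin_state k s K S v vt e \<epsilon> \<longrightarrow>
    (\<forall>T. finite T \<longrightarrow> (\<Sum>l\<in>T. jb l powr (\<theta> - 2) * cmod (Btime k v vt l)) \<le> C * (1 + \<epsilon>))"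
proof -
  obtain C1 where C1: "C1 > 0" "\<And>f. f \<in> trigp \<Longrightarrow> wl1 0 f \<le> C1 * wl2 1 f" using wl1_le_wl2[of 1 0] by auto
  obtain C2 where C2: "C2 > 0" "\<And>f. f \<in> trigp \<Longrightarrow> wl1 \<theta> f \<le> C2 * wl2 1 f" using wl1_le_wl2[of 1 \<theta>] \<theta> by auto
  obtain Cs where Cs: "Cs > 0" "\<And>f. f \<in> trigp \<Longrightarrow> wl1 0 f \<le> Cs * wl2 s f" using wl1_le_wl2[of s 0] s by auto
  obtain CF where CF: "CF > 0" "\<And>f. f \<in> trigp \<Longrightarrow> wl1 0 f \<le> C1 * K \<Longrightarrow> wl1 0 (mono_fun (Suc k) k f) \<le> CF"
    using wl1_mono_fun_bounded[of "C1 * K" "Suc k" k] by blast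
  have "\<exists>D>0. \<forall>f\<in>trigp. wl2 1 f \<le> K \<longrightarrow> wl1 0 (mono_fun i j f) \<le> D \<and> wl2 1 (mono_fun i j f) \<le> D" for i j
  proof -
    obtain D where D: "D > 0" "\<And>f. f \<in> trigp \<Longrightarrow> wl2 1 f \<le> K \<Longrightarrow> wl2 1 (mono_fun i j f) \<le> D"
      using wl2_mono_fun_lipschitz[of 1 K i j] by auto
    have "wl1 0 (mono_fun i j f) \<le> (1 + C1) * D \<and> wl2 1 (mono_fun i j f) \<le> (1 + C1) * D" if f: "f \<in> trigp" "wl2 1 f \<le> K" for f
    proof -
      have "wl1 0 (mono_fun i j f) \<le> C1 * wl2 1 (mono_fun i j f)" by (intro C1 mono_fun_trigp f)
      also have "\<dots> \<le> C1 * D" using D(2)[OF f] C1 by simp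
      finally have "wl1 0 (mono_fun i j f) \<le> C1 * D" .
      moreover have "C1 * D \<le> (1 + C1) * D" "D \<le> (1 + C1) * D" using D C1 by auto
      ultimately show ?thesis using D(2)[OF f] by linarith
    qed
    then show ?thesis using D C1 by (intro exI[of _ "(1 + C1) * D"]) auto
  qed
  note DD = this
  obtain D1 where D1: "D1 > 0" "\<And>f. f \<in> trigp \<Longrightarrow> wl2 1 f \<le> K \<Longrightarrow> wl1 0 (mono_fun k (k - 1) f) \<le> D1 \<and> wl2 1 (mono_fun k (k - 1) f) \<le> D1"
    using DD by blast
  obtain D2 where D2: "D2 > 0" "\<And>f. f \<in> trigp \<Longrightarrow> wl2 1 f \<le> K \<Longrightarrow> wl1 0 (mono_fun (Suc k) (k - 2) f) \<le> D2 \<and> wl2 1 (mono_fun (Suc k) (k - 2) f) \<le> D2"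
    using DD by blast
  have \<theta>1: "\<theta> < 1" using \<theta> by simp
  obtain C where C: "C > 0" "\<And>D q v h H T. D \<in> trigp \<Longrightarrow> q \<in> trigp \<Longrightarrow> v \<in> trigp \<Longrightarrow> (\<And>n. 0 \<le> h n) \<Longrightarrow>
      (\<And>T. finite T \<Longrightarrow> sum h T \<le> H) \<Longrightarrow> (\<And>n. cmod (fcoef q n) \<le> (jb n)\<^sup>2 * cmod (fcoef v n) + h n) \<Longrightarrow> finite T \<Longrightarrow>
      (\<Sum>l\<in>T. jb l powr (\<theta> - 2) * cmod (fcoef (\<lambda>x. D x * q x) l)) \<le>
      C * (wl1 0 D * wl1 \<theta> v + wl2 1 D * wl2 1 v + wl1 0 D * H)"
  proof (rule negative_product_bound[OF \<theta>(1) \<theta>1])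
    fix C :: real
    assume "0 < C" and "\<And>D q v h H T. D \<in> trigp \<Longrightarrow> q \<in> trigp \<Longrightarrow> v \<in> trigp \<Longrightarrow> (\<And>n. 0 \<le> h n) \<Longrightarrow>
      (\<And>T. finite T \<Longrightarrow> sum h T \<le> H) \<Longrightarrow> (\<And>n. cmod (fcoef q n) \<le> (jb n)\<^sup>2 * cmod (fcoef v n) + h n) \<Longrightarrow> finite T \<Longrightarrow>
      (\<Sum>l\<in>T. jb l powr (\<theta> - 2) * cmod (fcoef (\<lambda>x. D x * q x) l)) \<le>
      C * (wl1 0 D * wl1 \<theta> v + wl2 1 D * wl2 1 v + wl1 0 D * H)"
    then show thesis by (rule that)
  qed
  define M where "M = C2 * \<bar>K\<bar> + \<bar>K\<bar> + CF + Cs"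
  have M: "0 < M" using C2 CF Cs by (auto simp: M_def intro!: add_nonneg_pos add_nonneg_nonneg)
  define C' where "C' = real (Suc k) * (C * (D1 * M)) + real (k - 1) * (C * (D2 * M))"
  show ?thesis
  proof (intro exI[of _ C'] conjI allI impI)
    show "0 < C'" using C D1 D2 M by (auto simp: C'_def intro!: add_pos_nonneg mult_pos_pos)
    fix S v vt e \<epsilon> and T :: "int set"
    assume gs: "galerkin_state k s K S v vt e \<epsilon>" and T: "finite T"
    have S: "finite S" and v: "v \<in> trigp" and vt: "vt \<in> trigp" "fsupp vt \<subseteq> S"
      and eq: "(\<forall>n\<in>S. fcoef vt n = - \<i> * (of_int (n\<^sup>2) * fcoef v n + fcoef (mono_fun (Suc k) k v) n + e n))"
      and e: "L2_set (\<lambda>n. jb n powr s * cmod (e n)) S \<le> \<epsilon>" and K: "wl2 1 v \<le> K"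
      using gs by (auto simp: galerkin_state_def)
    have \<epsilon>0: "0 \<le> \<epsilon>" using e L2_set_nonneg order_trans by blast
    have K0: "0 \<le> K" using K wl2_nonneg[of 1 v] by linarith
    define E where "E = tpoly S e"
    have E: "E \<in> trigp" using trigp_tpoly[OF S] by (simp add: E_def)
    have cE: "fcoef E n = e n" if "n \<in> S" for n using that S by (simp add: E_def fcoef_tpoly)
    have "wl2 s E = L2_set (\<lambda>n. jb n powr s * cmod (fcoef E n)) S"
      using S fsupp_tpoly[OF S] by (intro wl2_eq) (auto simp: E_def)
    also have "\<dots> \<le> \<epsilon>" using e cE by (simp cong: L2_set_cong)
    finally have wE: "wl1 0 E \<le> Cs * \<epsilon>" using Cs(2)[OF E] Cs(1) by (smt (verit) mult_left_mono)
    define F where "F = mono_fun (Suc k) k v"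
    have F: "F \<in> trigp" using v by (simp add: F_def mono_fun_trigp)
    have L: "wl1 0 v \<le> C1 * K" using C1(2)[OF v] K C1(1) by (smt (verit) mult_left_mono)
    have wF: "wl1 0 F \<le> CF" unfolding F_def by (intro CF v L)
    define h where "h n = cmod (fcoef F n) + cmod (fcoef E n)" for n
    have h0: "0 \<le> h n" for n by (simp add: h_def)
    have hsum: "sum h U \<le> CF + Cs * \<epsilon>" if "finite U" for U
      using sum_le_wl1[OF F that, of 0] sum_le_wl1[OF E that, of 0] wF wE by (simp add: h_def sum.distrib)
    have vtle: "cmod (fcoef vt n) \<le> (jb n)\<^sup>2 * cmod (fcoef v n) + h n" for n
    proof (cases "n \<in> S")
      case True
      have "cmod (fcoef vt n) = cmod (of_int (n\<^sup>2) * fcoef v n + fcoef F n + e n)"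
        using eq True by (simp add: norm_mult F_def)
      also have "\<dots> \<le> cmod (of_int (n\<^sup>2) * fcoef v n) + cmod (fcoef F n) + cmod (e n)"
        by (intro norm_triangle_mono order_refl)
      also have "cmod (of_int (n\<^sup>2) * fcoef v n) \<le> (jb n)\<^sup>2 * cmod (fcoef v n)"
        by (simp add: norm_mult jb_sq norm_power power2_abs mult_right_mono)
      finally show ?thesis using cE[OF True] by (simp add: h_def)
    next
      case False
      then have "fcoef vt n = 0" using vt by (auto simp: fsupp_def)
      then show ?thesis using h0 by simp
    qed
    have W: "wl1 \<theta> v \<le> C2 * \<bar>K\<bar>" using C2(2)[OF v] K C2(1) by (smt (verit) mult_left_mono)
    have gen: "(\<Sum>l\<in>T. jb l powr (\<theta> - 2) * cmod (fcoef (\<lambda>x. D x * q x) l)) \<le> C * (D0 * M) * (1 + \<epsilon>)"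
      if D: "D \<in> trigp" "wl1 0 D \<le> D0" "wl2 1 D \<le> D0" and q: "q \<in> trigp" and u: "u \<in> trigp" "wl2 1 u \<le> K" "wl1 \<theta> u \<le> C2 * \<bar>K\<bar>"
        and h': "\<And>n. 0 \<le> h' n" "\<And>U. finite U \<Longrightarrow> sum h' U \<le> CF + Cs * \<epsilon>"
          "\<And>n. cmod (fcoef q n) \<le> (jb n)\<^sup>2 * cmod (fcoef u n) + h' n" for D D0 q u h'
    proof -
      have D00: "0 \<le> D0" using D(2) wl1_nonneg order_trans by blast
      have "(\<Sum>l\<in>T. jb l powr (\<theta> - 2) * cmod (fcoef (\<lambda>x. D x * q x) l)) \<le>
        C * (wl1 0 D * wl1 \<theta> u + wl2 1 D * wl2 1 u + wl1 0 D * (CF + Cs * \<epsilon>))"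
        by (rule C(2)[OF D(1) q u(1), of h']) (use h' T in auto)
      also have "\<dots> \<le> C * (D0 * (C2 * \<bar>K\<bar>) + D0 * \<bar>K\<bar> + D0 * (CF + Cs * \<epsilon>))"
        using C(1) D u D00 K0 CF Cs C2 \<epsilon>0 by (intro mult_left_mono add_mono mult_mono) auto
      also have "\<dots> = C * (D0 * (C2 * \<bar>K\<bar> + \<bar>K\<bar> + CF + Cs * \<epsilon>))"
        by (simp add: algebra_simps)
      also have "\<dots> \<le> C * (D0 * (M * (1 + \<epsilon>)))"
        using C(1) D00 C2 CF Cs \<epsilon>0 by (intro mult_left_mono) (auto simp: M_def algebra_simps)
      finally show ?thesis by (simp add: mult_ac)
    qed
    have b1: "(\<Sum>l\<in>T. jb l powr (\<theta> - 2) * cmod (fcoef (\<lambda>x. mono_fun k (k - 1) v x * vt x) l)) \<le> C * (D1 * M) * (1 + \<epsilon>)"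
      by (rule gen[OF _ _ _ vt(1) v K W h0 hsum vtle]) (use D1(2)[OF v K] v in \<open>auto simp: mono_fun_trigp\<close>)
    \<comment> \<open>Conjugation reflects the frequencies of \<open>vt\<close>, hence the majorant
      \<open>h (- n)\<close>.\<close>
    have b2: "(\<Sum>l\<in>T. jb l powr (\<theta> - 2) * cmod (fcoef (\<lambda>x. mono_fun (Suc k) (k - 2) v x * cnj (vt x)) l)) \<le> C * (D2 * M) * (1 + \<epsilon>)"
    proof (rule gen[where h' = "\<lambda>n. h (- n)", OF _ _ _ trigp_cnj[OF vt(1)] trigp_cnj[OF v]])
      fix U :: "int set" assume "finite U"
      then show "(\<Sum>n\<in>U. h (- n)) \<le> CF + Cs * \<epsilon>"
        using hsum[of "uminus ` U"] by (simp add: sum.reindex inj_on_def)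
    next
      fix n show "cmod (fcoef (\<lambda>x. cnj (vt x)) n) \<le> (jb n)\<^sup>2 * cmod (fcoef (\<lambda>x. cnj (v x)) n) + h (- n)"
        using vtle[of "- n"] by (simp add: fcoef_cnj trigp_continuous_on v vt)
    qed (use D2(2)[OF v K] v K W h0 in \<open>auto simp: mono_fun_trigp wl1_cnj wl2_cnj\<close>)
    have "(\<Sum>l\<in>T. jb l powr (\<theta> - 2) * cmod (Btime k v vt l)) \<le>
      (\<Sum>l\<in>T. real (Suc k) * (jb l powr (\<theta> - 2) * cmod (fcoef (\<lambda>x. mono_fun k (k - 1) v x * vt x) l)) +
        real (k - 1) * (jb l powr (\<theta> - 2) * cmod (fcoef (\<lambda>x. mono_fun (Suc k) (k - 2) v x * cnj (vt x)) l)))"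
    proof (rule sum_mono)
      fix l
      have "cmod (Btime k v vt l) \<le> real (Suc k) * cmod (fcoef (\<lambda>x. mono_fun k (k - 1) v x * vt x) l) +
         real (k - 1) * cmod (fcoef (\<lambda>x. mono_fun (Suc k) (k - 2) v x * cnj (vt x)) l)"
        unfolding Btime_def by (rule order_trans[OF norm_triangle_ineq]) (simp only: norm_mult norm_of_nat order_refl)
      from mult_left_mono[OF this, of "jb l powr (\<theta> - 2)"]
      show "jb l powr (\<theta> - 2) * cmod (Btime k v vt l) \<le> real (Suc k) * (jb l powr (\<theta> - 2) * cmod (fcoef (\<lambda>x. mono_fun k (k - 1) v x * vt x) l)) +
        real (k - 1) * (jb l powr (\<theta> - 2) * cmod (fcoef (\<lambda>x. mono_fun (Suc k) (k - 2) v x * cnj (vt x)) l))"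
        by (simp add: algebra_simps)
    qed
    also have "\<dots> \<le> real (Suc k) * (C * (D1 * M) * (1 + \<epsilon>)) + real (k - 1) * (C * (D2 * M) * (1 + \<epsilon>))"
      unfolding sum.distrib sum_distrib_left[symmetric] by (intro add_mono mult_left_mono b1 b2) auto
    also have "\<dots> = C' * (1 + \<epsilon>)" by (simp add: C'_def algebra_simps)
    finally show "(\<Sum>l\<in>T. jb l powr (\<theta> - 2) * cmod (Btime k v vt l)) \<le> C' * (1 + \<epsilon>)" .
  qed
qed

text \<open>The coefficient of the conjugated derivative \<open>cnj v_x\<close> at frequency
  \<open>- n\<close>, stored under the index \<open>n\<close>.\<close>

definition wcnj :: "(int \<Rightarrow> complex) \<Rightarrow> int \<Rightarrow> complex" where
  "wcnj a n = cnj (\<i> * of_int n * a n)"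

text \<open>The time derivative of \<open>mod_energy\<close> below, as an expression in \<open>v\<close> and \<open>vt = v\<^sub>t\<close>.\<close>

definition energy_rate :: "nat \<Rightarrow> real \<Rightarrow> int set \<Rightarrow> (real \<Rightarrow> complex) \<Rightarrow> (real \<Rightarrow> complex) \<Rightarrow> real" where
  "energy_rate k s S v vt =
     2 * Re (\<Sum>n\<in>S. of_real (jb n powr (2 * s)) * (cnj (fcoef v n) * fcoef vt n)) +
     2 * real k * Re (nearform (s - 1) S (wcnj (fcoef vt)) (wcnj (fcoef v)) (fcoef (mono_fun (Suc k) (k - 1) v)) +
       nearform (s - 1) S (wcnj (fcoef v)) (wcnj (fcoef vt)) (fcoef (mono_fun (Suc k) (k - 1) v)) +
       nearform (s - 1) S (wcnj (fcoef v)) (wcnj (fcoef v)) (Btime k v vt))"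

text \<open>
  The time derivative of the factors \<open>wcnj\<close> reproduces, through the weight \<open>1 / (n\<^sup>2 + m\<^sup>2)\<close>,
  exactly the resonant part of the quadratic form.
\<close>

lemma nearform_normal_form:
  assumes "finite S" and a': "\<And>n. n \<in> S \<Longrightarrow> a' n = - \<i> * (of_int (n\<^sup>2) * a n + f n)"
  shows "nearform \<sigma> S (wcnj a') (wcnj a) B + nearform \<sigma> S (wcnj a) (wcnj a') B =
    \<i> * (\<Sum>n\<in>S. \<Sum>m\<in>S. if near n m then of_real (jb n powr (2 * \<sigma>)) * (wcnj a n * (wcnj a m * B (n + m))) else 0) +
    nearform \<sigma> S (\<lambda>n. of_int n * cnj (f n)) (wcnj a) B + nearform \<sigma> S (wcnj a) (\<lambda>n. of_int n * cnj (f n)) B"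
  unfolding nearform_def sum.distrib[symmetric] sum_distrib_left
proof (intro sum.cong refl)
  fix n m assume nm: "n \<in> S" "m \<in> S"
  \<comment> \<open>Conjugation turns the rotation \<open>- \<i> * n^2\<close> into
    \<open>\<i> * n^2\<close>, for both factors alike; so the two phases add and cannot
    cancel.\<close>
  have w: "wcnj a' n = \<i> * of_int (n\<^sup>2) * wcnj a n + of_int n * cnj (f n)" if "n \<in> S" for n
    unfolding wcnj_def a'[OF that] by (simp add: algebra_simps power2_eq_square)
  show "(if near n m then of_real (jb n powr (2 * \<sigma>) / ((of_int n)\<^sup>2 + (of_int m)\<^sup>2)) * (wcnj a' n * (wcnj a m * B (n + m))) else 0) +
      (if near n m then of_real (jb n powr (2 * \<sigma>) / ((of_int n)\<^sup>2 + (of_int m)\<^sup>2)) * (wcnj a n * (wcnj a' m * B (n + m))) else 0) =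
      \<i> * (if near n m then of_real (jb n powr (2 * \<sigma>)) * (wcnj a n * (wcnj a m * B (n + m))) else 0) +
      (if near n m then of_real (jb n powr (2 * \<sigma>) / ((of_int n)\<^sup>2 + (of_int m)\<^sup>2)) * (of_int n * cnj (f n) * (wcnj a m * B (n + m))) else 0) +
      (if near n m then of_real (jb n powr (2 * \<sigma>) / ((of_int n)\<^sup>2 + (of_int m)\<^sup>2)) * (wcnj a n * (of_int m * cnj (f m) * B (n + m))) else 0)"
  proof (cases "near n m")
    case True
    define d :: real where "d = (of_int n)\<^sup>2 + (of_int m)\<^sup>2"
    have "0 < d" using True by (simp add: d_def near_def sum_power2_gt_zero_iff)
    \<comment> \<open>The sum of the two phases is exactly the divisor.\<close>
    then have d: "complex_of_real (jb n powr (2 * \<sigma>)) = of_real (jb n powr (2 * \<sigma>) / d) * (of_int (n\<^sup>2) + of_int (m\<^sup>2))"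
    proof -
      have dd: "complex_of_real d = of_int (n\<^sup>2) + of_int (m\<^sup>2)" by (simp add: d_def)
      show ?thesis unfolding dd[symmetric] using \<open>0 < d\<close> by simp
    qed
    have alg: "\<mu> * ((\<i> * N * X + P) * (Y * b)) + \<mu> * (X * ((\<i> * M * Y + Q) * b)) =
       \<i> * (\<mu> * (N + M) * (X * (Y * b))) + \<mu> * (P * (Y * b)) + \<mu> * (X * (Q * b))" for \<mu> N M X Y P Q b :: complex
      by (simp add: algebra_simps)
    show ?thesis unfolding if_P[OF True] w[OF nm(1)] w[OF nm(2)] d_def[symmetric] d by (rule alg)
  qed simp
qed

text \<open>The linear part drops out because its contribution is purely imaginary. The near part of
  the form in \<open>cnj w\<close> occurs twice, as \<open>2 * k * Im Jn\<close> from the norm and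
  as \<open>2 * k * Re (\<i> * Jn)\<close> from the correction, and these cancel.\<close>

lemma energy_rate_decompose:
  fixes s :: real
  assumes v: "v \<in> trigp" and S: "finite S" "fsupp v \<subseteq> S"
    and eq: "\<And>n. n \<in> S \<Longrightarrow> fcoef vt n = - \<i> * (of_int (n\<^sup>2) * fcoef v n + fcoef (mono_fun (Suc k) k v) n + e n)"
  defines "a \<equiv> fcoef v" and "F \<equiv> fcoef (mono_fun (Suc k) k v)" and "A \<equiv> fcoef (mono_fun k k v)"
    and "B \<equiv> fcoef (mono_fun (Suc k) (k - 1) v)" and "w \<equiv> \<lambda>n. \<i> * of_int n * fcoef v n"
    and "\<phi> \<equiv> \<lambda>n. of_int n * cnj (fcoef (mono_fun (Suc k) k v) n + e n)" and "\<sigma> \<equiv> s - 1"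
  shows "energy_rate k s S v vt =
     2 * Im (\<Sum>n\<in>S. of_real (jb n powr (2 * s)) * (cnj (a n) * e n)) +
     2 * Im (\<Sum>n\<in>S. of_real (jb n powr (2 * \<sigma>)) * (cnj (a n) * F n)) +
     2 * real (Suc k) * Im (\<Sum>n\<in>S. \<Sum>m\<in>S. of_real (jb n powr (2 * \<sigma>)) * (cnj (w n) * (w m * A (n - m)))) +
     2 * real k * Im (\<Sum>n\<in>S. \<Sum>m\<in>S. if near n m then 0 else of_real (jb n powr (2 * \<sigma>)) * (wcnj a n * (wcnj a m * B (n + m)))) +
     2 * real k * Re (nearform \<sigma> S \<phi> (wcnj a) B + nearform \<sigma> S (wcnj a) \<phi> B +
       nearform \<sigma> S (wcnj a) (wcnj a) (Btime k v vt))"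
proof -
  define IA where "IA = (\<Sum>n\<in>S. \<Sum>m\<in>S. of_real (jb n powr (2 * \<sigma>)) * (cnj (w n) * (w m * A (n - m))))"
  define J where "J = (\<Sum>n\<in>S. \<Sum>m\<in>S. of_real (jb n powr (2 * \<sigma>)) * (wcnj a n * (wcnj a m * B (n + m))))"
  define Jn where "Jn = (\<Sum>n\<in>S. \<Sum>m\<in>S. if near n m then of_real (jb n powr (2 * \<sigma>)) * (wcnj a n * (wcnj a m * B (n + m))) else 0)"
  define Jf where "Jf = (\<Sum>n\<in>S. \<Sum>m\<in>S. if near n m then 0 else of_real (jb n powr (2 * \<sigma>)) * (wcnj a n * (wcnj a m * B (n + m))))"
  have J: "J = Jn + Jf"
    unfolding J_def Jn_def Jf_def sum.distrib[symmetric] by (intro sum.cong refl) simp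
  have pt: "Re (of_real (jb n powr (2 * s)) * (cnj (a n) * fcoef vt n)) =
     Im (of_real (jb n powr (2 * s)) * (cnj (a n) * e n)) + Im (of_real (jb n powr (2 * \<sigma>)) * (cnj (a n) * F n)) +
     Im (of_real (jb n powr (2 * \<sigma>)) * (cnj (w n) * (\<i> * of_int n * F n)))" if "n \<in> S" for n
  proof -
    have "jb n powr (2 * s) = jb n powr (2 * \<sigma>) * (jb n)\<^sup>2"
      by (simp add: \<sigma>_def flip: powr_numeral powr_add)
    then have r: "jb n powr (2 * s) = jb n powr (2 * \<sigma>) * (1 + (of_int n)\<^sup>2)" by (simp only: jb_sq)
    \<comment> \<open>The weight of order \<open>2 * s\<close> is that of order
      \<open>2 * \<sigma>\<close> times \<open>1 + n^2\<close>. The 1 leaves a lower order term; the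
      \<open>n^2\<close> is shared as one derivative on \<open>v\<close> and one on the
      nonlinearity.\<close>
    have alg: "Re (of_real (r * (1 + \<nu>\<^sup>2)) * (cnj z * (- \<i> * (of_real (\<nu>\<^sup>2) * z + f + g)))) =
      Im (of_real (r * (1 + \<nu>\<^sup>2)) * (cnj z * g)) + Im (of_real r * (cnj z * f)) +
      Im (of_real r * (cnj (\<i> * of_real \<nu> * z) * (\<i> * of_real \<nu> * f)))" for r \<nu> z f g
      by (simp add: algebra_simps power2_eq_square)
    show ?thesis
      using alg[of "jb n powr (2 * \<sigma>)" "of_int n" "a n" "F n" "e n"] eq[OF that] unfolding r
      by (simp add: a_def F_def w_def)
  qed
  have rw: "(\<Sum>n\<in>S. of_real (jb n powr (2 * \<sigma>)) * (cnj (w n) * (\<i> * of_int n * F n))) = of_nat (Suc k) * IA + of_nat k * J"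
  proof -
    have alg: "r * (u * (c * (\<Sum>m\<in>S. w m * A (n - m)) + d * (\<Sum>m\<in>S. cnj (w m) * B (n + m)))) =
      c * (\<Sum>m\<in>S. r * (u * (w m * A (n - m)))) + d * (\<Sum>m\<in>S. r * (u * (wcnj a m * B (n + m))))" for r u c d n
      by (simp add: sum_distrib_left wcnj_def a_def w_def distrib_left mult_ac)
    have "cnj (w n) = wcnj a n" for n by (simp add: w_def wcnj_def a_def)
    then have "(\<Sum>n\<in>S. of_real (jb n powr (2 * \<sigma>)) * (cnj (w n) * (\<i> * of_int n * F n))) =
      (\<Sum>n\<in>S. of_nat (Suc k) * (\<Sum>m\<in>S. of_real (jb n powr (2 * \<sigma>)) * (cnj (w n) * (w m * A (n - m)))) +
        of_nat k * (\<Sum>m\<in>S. of_real (jb n powr (2 * \<sigma>)) * (wcnj a n * (wcnj a m * B (n + m)))))"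
      using fcoef_nls_derivative[OF v S, of _ k] alg unfolding F_def A_def B_def w_def by simp
    then show ?thesis
      by (simp only: IA_def J_def sum.distrib sum_distrib_left[symmetric])
  qed
  have nf: "nearform \<sigma> S (wcnj (fcoef vt)) (wcnj a) B + nearform \<sigma> S (wcnj a) (wcnj (fcoef vt)) B =
     \<i> * Jn + nearform \<sigma> S \<phi> (wcnj a) B + nearform \<sigma> S (wcnj a) \<phi> B"
    unfolding Jn_def \<phi>_def by (rule nearform_normal_form) (use S eq in \<open>auto simp: a_def add.assoc\<close>)
  have "Re (\<Sum>n\<in>S. of_real (jb n powr (2 * s)) * (cnj (a n) * fcoef vt n)) =
     Im (\<Sum>n\<in>S. of_real (jb n powr (2 * s)) * (cnj (a n) * e n)) +
     Im (\<Sum>n\<in>S. of_real (jb n powr (2 * \<sigma>)) * (cnj (a n) * F n)) +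
     Im (\<Sum>n\<in>S. of_real (jb n powr (2 * \<sigma>)) * (cnj (w n) * (\<i> * of_int n * F n)))"
    unfolding Re_sum Im_sum sum.distrib[symmetric] by (intro sum.cong refl pt)
  then have "2 * Re (\<Sum>n\<in>S. of_real (jb n powr (2 * s)) * (cnj (a n) * fcoef vt n)) =
     2 * Im (\<Sum>n\<in>S. of_real (jb n powr (2 * s)) * (cnj (a n) * e n)) +
     2 * Im (\<Sum>n\<in>S. of_real (jb n powr (2 * \<sigma>)) * (cnj (a n) * F n)) +
     2 * (real (Suc k) * Im IA + real k * (Im Jn + Im Jf))"
    unfolding rw J by (simp del: of_nat_Suc add: algebra_simps)
  then show ?thesis
    unfolding energy_rate_def \<sigma>_def[symmetric] a_def[symmetric] B_def[symmetric] nf IA_def[symmetric] Jf_def[symmetric]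
    by (simp del: of_nat_Suc add: algebra_simps)
qed

text \<open>Apart from the forcing, every term is bounded by the \<open>H^s\<close> norm times the
  \<open>H^(s - \<theta>)\<close> norm. The value of \<open>\<theta>\<close> is below 1/2 and at
  most \<open>s - 1\<close>; among such values it is the one for which interpolation later gives the
  exponent \<open>2 * s\<close>.\<close>

lemma energy_rate_bound:
  assumes s: "1 < s" and \<theta>: "\<theta> = (s - 1) / (2 * s)" and k: "1 \<le> k"
  shows "\<exists>C>0. \<forall>S v vt e \<epsilon>. galerkin_state k s K S v vt e \<epsilon> \<longrightarrow>
    \<bar>energy_rate k s S v vt\<bar> \<le> C * (wl2 s v * wl2 (s - \<theta>) v + \<epsilon> * (wl2 s v + (wl2 s v)\<^sup>2))"
proof -
  define \<sigma> where "\<sigma> = s - 1"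
  have \<sigma>: "0 < \<sigma>" and s\<sigma>: "s = \<sigma> + 1" using s by (auto simp: \<sigma>_def)
  have \<theta>0: "0 \<le> \<theta>" and \<theta>h: "\<theta> < 1 / 2"
    using s by (auto simp: \<theta> field_simps)
  have "(s - 1) / (2 * s) \<le> (s - 1) / 1" using s by (intro divide_left_mono) auto
  then have \<theta>\<sigma>: "\<theta> \<le> \<sigma>" by (simp add: \<theta> \<sigma>_def)
  obtain C1 where C1: "C1 > 0" "\<And>f. f \<in> trigp \<Longrightarrow> wl1 0 f \<le> C1 * wl2 1 f" using wl1_le_wl2[of 1 0] by auto
  obtain C2 where C2: "C2 > 0" "\<And>f. f \<in> trigp \<Longrightarrow> wl1 \<theta> f \<le> C2 * wl2 1 f" using wl1_le_wl2[of 1 \<theta>] \<theta>h by auto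
  \<comment> \<open>A coefficient with \<open>\<sigma> = s - 1\<close> derivatives on it is still
    controlled by \<open>H^(s - \<theta>)\<close>: the gap \<open>1 - \<theta>\<close> exceeds
    1/2.\<close>
  obtain C3 where C3: "C3 > 0" "\<And>f. f \<in> trigp \<Longrightarrow> wl1 \<sigma> f \<le> C3 * wl2 (s - \<theta>) f"
    using wl1_le_wl2[of "s - \<theta>" \<sigma>] \<theta>h by (auto simp: \<sigma>_def)
  define L where "L = C1 * K"
  have kk: "0 < k + k" "0 < Suc k + (k - 1)" "0 < Suc k + k" using k by auto
  obtain CA0 where CA0: "CA0 > 0" "\<And>f. f \<in> trigp \<Longrightarrow> wl1 0 f \<le> L \<Longrightarrow> wl1 \<theta> (mono_fun k k f) \<le> CA0 * wl1 \<theta> f"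
    using wl1_mono_fun_le[OF \<theta>0 kk(1)] by blast
  obtain CA1 where CA1: "CA1 > 0" "\<And>f. f \<in> trigp \<Longrightarrow> wl1 0 f \<le> L \<Longrightarrow> wl1 \<sigma> (mono_fun k k f) \<le> CA1 * wl1 \<sigma> f"
    using wl1_mono_fun_le[OF less_imp_le[OF \<sigma>] kk(1)] by blast
  obtain CB1 where CB1: "CB1 > 0" "\<And>f. f \<in> trigp \<Longrightarrow> wl1 0 f \<le> L \<Longrightarrow> wl1 \<sigma> (mono_fun (Suc k) (k - 1) f) \<le> CB1 * wl1 \<sigma> f"
    using wl1_mono_fun_le[OF less_imp_le[OF \<sigma>] kk(2)] by blast
  obtain CB0 where CB0: "CB0 > 0" "\<And>f. f \<in> trigp \<Longrightarrow> wl1 0 f \<le> L \<Longrightarrow> wl1 0 (mono_fun (Suc k) (k - 1) f) \<le> CB0"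
    using wl1_mono_fun_bounded by blast
  obtain CF where CF: "CF > 0" "\<And>f. f \<in> trigp \<Longrightarrow> wl1 0 f \<le> L \<Longrightarrow> wl2 \<sigma> (mono_fun (Suc k) k f) \<le> CF * wl2 \<sigma> f"
    using wl2_mono_fun_le[OF less_imp_le[OF \<sigma>] kk(3)] by blast
  obtain Cb where Cb: "Cb > 0" "\<forall>S v vt e \<epsilon>. galerkin_state k s K S v vt e \<epsilon> \<longrightarrow>
    (\<forall>T. finite T \<longrightarrow> (\<Sum>l\<in>T. jb l powr (\<theta> - 2) * cmod (Btime k v vt l)) \<le> Cb * (1 + \<epsilon>))"
    using Btime_bound[OF \<theta>0 \<theta>h less_imp_le[OF s], of k K] by (elim exE conjE) (rule that)
  define c where "c = 2 powr \<sigma> * (real (nat \<lceil>2 * \<sigma>\<rceil>) + 1)"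
  have c: "0 \<le> c" by (simp add: c_def)
  define CI where "CI = c * (CA0 * C2 * \<bar>K\<bar> + \<bar>K\<bar> * (CA1 * C3))"
  define CJ where "CJ = 2 powr \<sigma> * (\<bar>K\<bar> * (CB1 * C3))"
  define C\<phi> where "C\<phi> = 4 * 2 powr \<sigma> * ((CF + 1) * CB0)"
  define Ct where "Ct = 2 * 2 powr \<sigma> * Cb"
  define C where "C = 2 + 2 * CF + 2 * real (Suc k) * CI + 2 * real k * CJ + 2 * real k * (C\<phi> + C\<phi> + Ct)"
  have nn: "0 \<le> CI" "0 \<le> CJ" "0 \<le> C\<phi>" "0 \<le> Ct"
    using c C2 CA0 CA1 C3 CB1 CF CB0 Cb by (auto simp: CI_def CJ_def C\<phi>_def Ct_def)
  then have Cpos: "0 < C" using CF by (auto simp: C_def intro!: add_pos_nonneg)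
  have main: "\<bar>energy_rate k s S v vt\<bar> \<le> C * (wl2 s v * wl2 (s - \<theta>) v + \<epsilon> * (wl2 s v + (wl2 s v)\<^sup>2))"
    if gs: "galerkin_state k s K S v vt e \<epsilon>" for S v vt e \<epsilon>
  proof -
    have S: "finite S" and v: "v \<in> trigp" and vt: "vt \<in> trigp" and sv: "fsupp v \<subseteq> S" and svt: "fsupp vt \<subseteq> S"
      and eq: "(\<forall>n\<in>S. fcoef vt n = - \<i> * (of_int (n\<^sup>2) * fcoef v n + fcoef (mono_fun (Suc k) k v) n + e n))"
      and e: "L2_set (\<lambda>n. jb n powr s * cmod (e n)) S \<le> \<epsilon>" and K: "wl2 1 v \<le> K"
      using gs by (auto simp: galerkin_state_def)
    define a where "a = fcoef v"
    define F where "F = fcoef (mono_fun (Suc k) k v)"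
    define A where "A = fcoef (mono_fun k k v)"
    define B where "B = fcoef (mono_fun (Suc k) (k - 1) v)"
    define w where "w n = \<i> * of_int n * a n" for n
    define \<phi> where "\<phi> n = of_int n * cnj (F n + e n)" for n
    define X where "X = wl2 s v"
    define Z where "Z = wl2 (s - \<theta>) v"
    \<comment> \<open>Common majorant of all terms. The \<open>X\<^sup>2\<close> next to
      \<open>\<epsilon>\<close> comes from the factor \<open>1 + \<epsilon>\<close> in the bound for
      \<open>Btime\<close>.\<close>
    define Y where "Y = X * Z + \<epsilon> * (X + X\<^sup>2)"
    have X0: "0 \<le> X" and Z0: "0 \<le> Z" and ZX: "Z \<le> X" by (auto simp: X_def Z_def \<theta>0 wl2_mono_exp)
    have \<epsilon>0: "0 \<le> \<epsilon>" using e L2_set_nonneg order_trans by blast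
    have K0: "0 \<le> K" using K wl2_nonneg[of 1 v] by linarith
    have t: "mono_fun i j v \<in> trigp" for i j by (rule mono_fun_trigp[OF v])
    have Lv: "wl1 0 v \<le> L" unfolding L_def using C1(2)[OF v] K C1(1) by (smt (verit) mult_left_mono)
    have \<sigma>v: "wl2 \<sigma> v \<le> Z" "wl2 \<sigma> v \<le> X" using \<theta>h by (auto simp: X_def Z_def \<sigma>_def intro!: wl2_mono_exp)
    have wl1\<sigma>: "wl1 \<sigma> v \<le> C3 * Z" using C3(2)[OF v] by (simp add: Z_def)
    have wjb: "cmod (w n) \<le> jb n * cmod (a n)" for n
      by (simp add: w_def norm_mult mult_right_mono abs_le_jb)
    have cw: "cmod (wcnj a n) = cmod (w n)" for n by (simp add: wcnj_def w_def norm_mult)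
    have wexp: "jb n powr p * cmod (w n) \<le> jb n powr (p + 1) * cmod (a n)" for n p
      using mult_left_mono[OF wjb[of n], of "jb n powr p"] by (simp add: powr_add mult_ac)
    have aS: "L2_set (\<lambda>n. jb n powr p * cmod (a n)) S \<le> wl2 p v" for p
      unfolding a_def by (rule L2_set_le_wl2[OF v S])
    have wS: "L2_set (\<lambda>n. jb n powr p * cmod (w n)) S \<le> wl2 (p + 1) v" for p
      using aS[of "p + 1"] wexp by (smt (verit, best) L2_set_mono mult_nonneg_nonneg norm_ge_zero powr_ge_zero)
    have wX: "L2_set (\<lambda>n. jb n powr \<sigma> * cmod (w n)) S \<le> X" using wS[of \<sigma>] by (simp add: X_def s\<sigma>)
    have wZ: "L2_set (\<lambda>n. jb n powr (\<sigma> - \<theta>) * cmod (w n)) S \<le> Z" using wS[of "\<sigma> - \<theta>"] by (simp add: Z_def s\<sigma> algebra_simps)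
    have wK: "L2_set (\<lambda>n. cmod (w n)) S \<le> K" using wS[of 0] K by simp
    have FS: "L2_set (\<lambda>n. jb n powr \<sigma> * cmod (F n)) S \<le> CF * wl2 \<sigma> v"
      using L2_set_le_wl2[OF t S, of \<sigma>] CF(2)[OF v Lv] unfolding F_def by (rule order_trans)
    have e\<sigma>: "L2_set (\<lambda>n. jb n powr \<sigma> * cmod (e n)) S \<le> \<epsilon>"
    proof -
      have "L2_set (\<lambda>n. jb n powr \<sigma> * cmod (e n)) S \<le> L2_set (\<lambda>n. jb n powr s * cmod (e n)) S"
        by (intro L2_set_mono mult_right_mono jb_powr_mono) (auto simp: \<sigma>_def)
      with e show ?thesis by linarith
    qed
    have T1: "\<bar>Im (\<Sum>n\<in>S. of_real (jb n powr (2 * s)) * (cnj (a n) * e n))\<bar> \<le> Y"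
    proof -
      have "cmod (\<Sum>n\<in>S. of_real (jb n powr (2 * s)) * (cnj (a n) * e n)) \<le>
          (\<Sum>n\<in>S. \<bar>jb n powr s * cmod (a n)\<bar> * \<bar>jb n powr s * cmod (e n)\<bar>)"
      proof (intro sum_norm_le)
        fix n
        have "jb n powr (2 * s) = jb n powr s * jb n powr s" by (simp flip: powr_add)
        then show "cmod (of_real (jb n powr (2 * s)) * (cnj (a n) * e n)) \<le> \<bar>jb n powr s * cmod (a n)\<bar> * \<bar>jb n powr s * cmod (e n)\<bar>"
          by (simp add: norm_mult)
      qed
      also have "\<dots> \<le> L2_set (\<lambda>n. jb n powr s * cmod (a n)) S * L2_set (\<lambda>n. jb n powr s * cmod (e n)) S"
        by (rule L2_set_mult_ineq)
      also have "\<dots> \<le> X * \<epsilon>" using aS[of s] e X0 by (intro mult_mono) (auto simp: X_def)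
      also have "\<dots> \<le> Y" using X0 Z0 \<epsilon>0 by (simp add: Y_def algebra_simps)
      finally show ?thesis using abs_Im_le_cmod order_trans by blast
    qed
    have T2: "\<bar>Im (\<Sum>n\<in>S. of_real (jb n powr (2 * \<sigma>)) * (cnj (a n) * F n))\<bar> \<le> CF * Y"
    proof -
      have "cmod (\<Sum>n\<in>S. of_real (jb n powr (2 * \<sigma>)) * (cnj (a n) * F n)) \<le>
          (\<Sum>n\<in>S. \<bar>jb n powr \<sigma> * cmod (a n)\<bar> * \<bar>jb n powr \<sigma> * cmod (F n)\<bar>)"
      proof (intro sum_norm_le)
        fix n
        have "jb n powr (2 * \<sigma>) = jb n powr \<sigma> * jb n powr \<sigma>" by (simp flip: powr_add)
        then show "cmod (of_real (jb n powr (2 * \<sigma>)) * (cnj (a n) * F n)) \<le> \<bar>jb n powr \<sigma> * cmod (a n)\<bar> * \<bar>jb n powr \<sigma> * cmod (F n)\<bar>"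
          by (simp add: norm_mult)
      qed
      also have "\<dots> \<le> L2_set (\<lambda>n. jb n powr \<sigma> * cmod (a n)) S * L2_set (\<lambda>n. jb n powr \<sigma> * cmod (F n)) S"
        by (rule L2_set_mult_ineq)
      also have "\<dots> \<le> X * (CF * Z)"
      proof (intro mult_mono)
        show "L2_set (\<lambda>n. jb n powr \<sigma> * cmod (F n)) S \<le> CF * Z"
          using FS mult_left_mono[OF \<sigma>v(1), of CF] CF(1) by linarith
      qed (use aS[of \<sigma>] \<sigma>v X0 in auto)
      also have "\<dots> \<le> CF * Y" using X0 Z0 \<epsilon>0 CF(1) by (simp add: Y_def algebra_simps)
      finally show ?thesis using abs_Im_le_cmod order_trans by blast
    qed
    \<comment> \<open>Two ways to gain: \<open>\<theta>\<close> derivatives fall on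
      \<open>|v|^(2k)\<close>, at a cost seen by \<open>H^1\<close> alone, or
      \<open>\<sigma>\<close> derivatives fall on it, which costs \<open>Z\<close> while one copy of
      \<open>w\<close> costs only \<open>K\<close>.\<close>
    have TA: "\<bar>Im (\<Sum>n\<in>S. \<Sum>m\<in>S. of_real (jb n powr (2 * \<sigma>)) * (cnj (w n) * (w m * A (n - m))))\<bar> \<le> CI * Y"
    proof -
      have Areal: "A (- l) = cnj (A l)" for l
      proof -
        have "fcoef (\<lambda>x. cnj (mono_fun k k v x)) (- l) = cnj (A l)"
          using fcoef_cnj[OF trigp_continuous_on[OF t[of k k]], of "- l"] by (simp add: A_def)
        moreover have "(\<lambda>x. cnj (mono_fun k k v x)) = mono_fun k k v" by (simp add: mono_fun_def mult.commute)
        ultimately show ?thesis by (simp add: A_def)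
      qed
      have A\<theta>: "(\<Sum>l\<in>T. jb l powr \<theta> * cmod (A l)) \<le> CA0 * (C2 * K)" if "finite T" for T
      proof -
        have "(\<Sum>l\<in>T. jb l powr \<theta> * cmod (A l)) \<le> wl1 \<theta> (mono_fun k k v)"
          unfolding A_def by (rule sum_le_wl1[OF t that])
        also have "\<dots> \<le> CA0 * wl1 \<theta> v" by (rule CA0(2)[OF v Lv])
        also have "\<dots> \<le> CA0 * (C2 * K)"
          using order_trans[OF C2(2)[OF v] mult_left_mono[OF K less_imp_le[OF C2(1)]]] CA0(1) by (intro mult_left_mono) auto
        finally show ?thesis .
      qed
      have A\<sigma>: "(\<Sum>l\<in>T. jb l powr \<sigma> * cmod (A l)) \<le> CA1 * (C3 * Z)" if "finite T" for T
      proof -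
        have "(\<Sum>l\<in>T. jb l powr \<sigma> * cmod (A l)) \<le> wl1 \<sigma> (mono_fun k k v)"
          unfolding A_def by (rule sum_le_wl1[OF t that])
        also have "\<dots> \<le> CA1 * wl1 \<sigma> v" by (rule CA1(2)[OF v Lv])
        also have "\<dots> \<le> CA1 * (C3 * Z)" using wl1\<sigma> CA1(1) by (intro mult_left_mono) auto
        finally show ?thesis .
      qed
      have "\<bar>Im (\<Sum>n\<in>S. \<Sum>m\<in>S. of_real (jb n powr (2 * \<sigma>)) * (cnj (w n) * (w m * A (n - m))))\<bar> \<le>
         c * (L2_set (\<lambda>n. jb n powr \<sigma> * cmod (w n)) S * L2_set (\<lambda>n. jb n powr (\<sigma> - \<theta>) * cmod (w n)) S * (CA0 * (C2 * K)) +
          L2_set (\<lambda>n. jb n powr \<sigma> * cmod (w n)) S * L2_set (\<lambda>n. cmod (w n)) S * (CA1 * (C3 * Z)))"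
        unfolding c_def using \<theta>0 \<theta>\<sigma> \<theta>h by (intro commutator_form_bound S Areal A\<theta> A\<sigma>) auto
      also have "\<dots> \<le> c * (X * Z * (CA0 * (C2 * K)) + X * K * (CA1 * (C3 * Z)))"
        using c K0 X0 Z0 C2 C3 CA0 CA1 by (intro mult_left_mono add_mono mult_right_mono mult_mono wX wZ wK) auto
      also have "\<dots> = CI * (X * Z)" using K0 by (simp add: CI_def algebra_simps)
      also have "\<dots> \<le> CI * Y" using X0 \<epsilon>0 nn by (intro mult_left_mono) (auto simp: Y_def)
      finally show ?thesis .
    qed
    have TJ: "\<bar>Im (\<Sum>n\<in>S. \<Sum>m\<in>S. if near n m then 0 else of_real (jb n powr (2 * \<sigma>)) * (wcnj a n * (wcnj a m * B (n + m))))\<bar> \<le> CJ * Y"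
    proof -
      have B\<sigma>: "(\<Sum>l\<in>T. jb l powr \<sigma> * cmod (B l)) \<le> CB1 * (C3 * Z)" if "finite T" for T
      proof -
        have "(\<Sum>l\<in>T. jb l powr \<sigma> * cmod (B l)) \<le> wl1 \<sigma> (mono_fun (Suc k) (k - 1) v)"
          unfolding B_def by (rule sum_le_wl1[OF t that])
        also have "\<dots> \<le> CB1 * wl1 \<sigma> v" by (rule CB1(2)[OF v Lv])
        also have "\<dots> \<le> CB1 * (C3 * Z)" using wl1\<sigma> CB1(1) by (intro mult_left_mono) auto
        finally show ?thesis .
      qed
      have "cmod (\<Sum>n\<in>S. \<Sum>m\<in>S. if near n m then 0 else of_real (jb n powr (2 * \<sigma>)) * (wcnj a n * (wcnj a m * B (n + m)))) \<le>
        2 powr \<sigma> * (L2_set (\<lambda>n. jb n powr \<sigma> * cmod (wcnj a n)) S * L2_set (\<lambda>n. cmod (wcnj a n)) S * (CB1 * (C3 * Z)))"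
        using \<sigma> by (intro farform_bound S B\<sigma>) auto
      also have "\<dots> \<le> 2 powr \<sigma> * (X * K * (CB1 * (C3 * Z)))"
        unfolding cw using K0 X0 Z0 CB1 C3 by (intro mult_left_mono mult_right_mono mult_mono wX wK) auto
      also have "\<dots> = CJ * (X * Z)" using K0 by (simp add: CJ_def algebra_simps)
      also have "\<dots> \<le> CJ * Y" using X0 \<epsilon>0 nn by (intro mult_left_mono) (auto simp: Y_def)
      finally show ?thesis using abs_Im_le_cmod order_trans by blast
    qed
    have B0: "(\<Sum>l\<in>T. cmod (B l)) \<le> CB0" if "finite T" for T
      using sum_le_wl1[OF t that, of 0 "Suc k" "k - 1"] CB0(2)[OF v Lv] by (simp add: B_def)
    define \<eta> where "\<eta> n = cmod (F n) + cmod (e n)" for n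
    have \<eta>0: "0 \<le> \<eta> n" for n by (simp add: \<eta>_def)
    have \<phi>\<eta>: "cmod (\<phi> n) \<le> jb n * \<eta> n" for n
    proof -
      have "cmod (\<phi> n) = \<bar>of_int n\<bar> * cmod (F n + e n)" by (simp only: \<phi>_def norm_mult complex_mod_cnj norm_of_int)
      also have "\<dots> \<le> jb n * \<eta> n"
        unfolding \<eta>_def by (intro mult_mono abs_le_jb norm_triangle_ineq) auto
      finally show ?thesis .
    qed
    have \<eta>S: "L2_set (\<lambda>n. jb n powr \<sigma> * \<eta> n) S \<le> CF * Z + \<epsilon>"
    proof -
      have "L2_set (\<lambda>n. jb n powr \<sigma> * \<eta> n) S \<le> L2_set (\<lambda>n. jb n powr \<sigma> * cmod (F n)) S + L2_set (\<lambda>n. jb n powr \<sigma> * cmod (e n)) S"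
        unfolding \<eta>_def distrib_left by (rule L2_set_triangle_ineq)
      then show ?thesis using FS e\<sigma> mult_left_mono[OF \<sigma>v(1), of CF] CF(1) by linarith
    qed
    have \<phi>Y: "4 * 2 powr \<sigma> * ((CF * Z + \<epsilon>) * X * CB0) \<le> C\<phi> * Y"
    proof -
      have "(CF * Z + \<epsilon>) * X \<le> (CF + 1) * Y"
        using X0 Z0 \<epsilon>0 CF(1) by (simp add: Y_def algebra_simps power2_eq_square)
      then have "4 * 2 powr \<sigma> * ((CF * Z + \<epsilon>) * X * CB0) \<le> 4 * 2 powr \<sigma> * ((CF + 1) * Y * CB0)"
        using CB0(1) by (intro mult_left_mono mult_right_mono) auto
      then show ?thesis by (simp add: C\<phi>_def mult_ac)
    qed
    \<comment> \<open>In this term a time derivative has been replaced by nonlinearity and forcing;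
      the factor \<open>n\<close> in \<open>\<phi>\<close> is absorbed by the divisor.\<close>
    have N1: "cmod (nearform \<sigma> S \<phi> (wcnj a) B) \<le> C\<phi> * Y"
    proof -
      have "cmod (nearform \<sigma> S \<phi> (wcnj a) B) \<le> 4 * 2 powr \<sigma> *
        (L2_set (\<lambda>n. jb n powr \<sigma> * \<eta> n) S * L2_set (\<lambda>n. jb n powr \<sigma> * cmod (a n)) S * CB0)"
        using \<sigma> \<phi>\<eta> \<eta>0 wjb cw by (intro nearform_bound S B0) auto
      also have "\<dots> \<le> 4 * 2 powr \<sigma> * ((CF * Z + \<epsilon>) * X * CB0)"
        using \<eta>S order_trans[OF aS[of \<sigma>] \<sigma>v(2)] CB0(1) X0 CF(1) Z0 \<epsilon>0
        by (intro mult_left_mono mult_right_mono mult_mono) auto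
      finally show ?thesis using \<phi>Y by linarith
    qed
    have N2: "cmod (nearform \<sigma> S (wcnj a) \<phi> B) \<le> C\<phi> * Y"
    proof -
      have "cmod (nearform \<sigma> S (wcnj a) \<phi> B) \<le> 4 * 2 powr \<sigma> *
        (L2_set (\<lambda>n. jb n powr \<sigma> * cmod (a n)) S * L2_set (\<lambda>n. jb n powr \<sigma> * \<eta> n) S * CB0)"
        using \<sigma> \<phi>\<eta> \<eta>0 wjb cw by (intro nearform_bound S B0) auto
      also have "\<dots> \<le> 4 * 2 powr \<sigma> * (X * (CF * Z + \<epsilon>) * CB0)"
        using \<eta>S order_trans[OF aS[of \<sigma>] \<sigma>v(2)] CB0(1) X0 CF(1) Z0 \<epsilon>0
        by (intro mult_left_mono mult_right_mono mult_mono) auto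
      finally show ?thesis using \<phi>Y by (simp add: mult.commute[of X])
    qed
    \<comment> \<open>The time derivative falls on the coefficient, whose negative regularity uses
      up all but \<open>\<theta>\<close> of the two derivatives won by the divisor.\<close>
    have N3: "cmod (nearform \<sigma> S (wcnj a) (wcnj a) (Btime k v vt)) \<le> Ct * Y"
    proof -
      have "cmod (nearform \<sigma> S (wcnj a) (wcnj a) (Btime k v vt)) \<le> 2 * 2 powr \<sigma> *
        (L2_set (\<lambda>n. jb n powr \<sigma> * cmod (wcnj a n)) S * L2_set (\<lambda>n. jb n powr (\<sigma> - \<theta>) * cmod (wcnj a n)) S * (Cb * (1 + \<epsilon>)))"
        using \<theta>0 \<theta>\<sigma> \<theta>h by (intro nearform_bound_rough S Cb(2)[rule_format, OF gs]) auto
      also have "\<dots> \<le> 2 * 2 powr \<sigma> * (X * Z * (Cb * (1 + \<epsilon>)))"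
        unfolding cw using X0 Cb(1) \<epsilon>0 by (intro mult_left_mono mult_right_mono mult_mono wX wZ) auto
      also have "\<dots> = Ct * (X * Z * (1 + \<epsilon>))" by (simp add: Ct_def mult_ac)
      also have "\<dots> \<le> Ct * Y"
      proof (intro mult_left_mono nn)
        have "X * Z * \<epsilon> \<le> X * X * \<epsilon>" using ZX X0 \<epsilon>0 by (intro mult_right_mono mult_left_mono)
        moreover have "0 \<le> \<epsilon> * X" using \<epsilon>0 X0 by simp
        ultimately show "X * Z * (1 + \<epsilon>) \<le> Y" by (simp add: Y_def algebra_simps power2_eq_square)
      qed
      finally show ?thesis .
    qed
    have "energy_rate k s S v vt =
     2 * Im (\<Sum>n\<in>S. of_real (jb n powr (2 * s)) * (cnj (a n) * e n)) +
     2 * Im (\<Sum>n\<in>S. of_real (jb n powr (2 * \<sigma>)) * (cnj (a n) * F n)) +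
     2 * real (Suc k) * Im (\<Sum>n\<in>S. \<Sum>m\<in>S. of_real (jb n powr (2 * \<sigma>)) * (cnj (w n) * (w m * A (n - m)))) +
     2 * real k * Im (\<Sum>n\<in>S. \<Sum>m\<in>S. if near n m then 0 else of_real (jb n powr (2 * \<sigma>)) * (wcnj a n * (wcnj a m * B (n + m)))) +
     2 * real k * Re (nearform \<sigma> S \<phi> (wcnj a) B + nearform \<sigma> S (wcnj a) \<phi> B +
       nearform \<sigma> S (wcnj a) (wcnj a) (Btime k v vt))"
      unfolding a_def F_def A_def B_def w_def[abs_def] \<phi>_def[abs_def] \<sigma>_def
      by (rule energy_rate_decompose[OF v S sv]) (use eq in blast)
    moreover have "\<bar>Re (nearform \<sigma> S \<phi> (wcnj a) B + nearform \<sigma> S (wcnj a) \<phi> B + nearform \<sigma> S (wcnj a) (wcnj a) (Btime k v vt))\<bar>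
       \<le> (C\<phi> + C\<phi> + Ct) * Y"
      using abs_Re_le_cmod norm_triangle_mono[OF norm_triangle_mono[OF N1 N2] N3] by (simp only: distrib_right) (meson order_trans)
    moreover have tri: "\<bar>2 * t1 + 2 * t2 + p * t3 + q * t4 + q * t5\<bar> \<le> (2 + 2 * CF + p * CI + q * CJ + q * D) * Y"
      if "\<bar>t1\<bar> \<le> Y" "\<bar>t2\<bar> \<le> CF * Y" "\<bar>t3\<bar> \<le> CI * Y" "\<bar>t4\<bar> \<le> CJ * Y" "\<bar>t5\<bar> \<le> D * Y" "0 \<le> p" "0 \<le> q"
      for t1 t2 t3 t4 t5 p q D
    proof -
      have "\<bar>2 * t1 + 2 * t2 + p * t3 + q * t4 + q * t5\<bar> \<le> 2 * \<bar>t1\<bar> + 2 * \<bar>t2\<bar> + p * \<bar>t3\<bar> + q * \<bar>t4\<bar> + q * \<bar>t5\<bar>"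
        using that(6,7) by (intro order_trans[OF abs_triangle_ineq] add_mono) (auto simp: abs_mult)
      also have "\<dots> \<le> 2 * Y + 2 * (CF * Y) + p * (CI * Y) + q * (CJ * Y) + q * (D * Y)"
        using that by (intro add_mono mult_left_mono) auto
      finally show ?thesis by (simp add: algebra_simps)
    qed
    ultimately show ?thesis
      using tri[OF T1 T2 TA TJ, of _ "C\<phi> + C\<phi> + Ct" "2 * real (Suc k)" "2 * real k"]
      unfolding C_def X_def[symmetric] Z_def[symmetric] Y_def[symmetric] by simp
  qed
  show ?thesis by (rule exI[of _ C]) (use Cpos main in blast)
qed

section \<open>Time derivatives along a path of trigonometric polynomials\<close>

text \<open>Each Fourier coefficient of the product is a finite sum of products of differentiable
  functions of \<open>t\<close>, so no limit is exchanged with an integral.\<close>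

lemma fcoef_path_mult:
  assumes S: "finite S" and a: "\<And>n. n \<in> S \<Longrightarrow> (a n has_vector_derivative a' n) (at t)"
    and G: "\<And>t. G t \<in> trigp" and G': "G' \<in> trigp"
    and dG: "\<And>l. ((\<lambda>t. fcoef (G t) l) has_vector_derivative fcoef G' l) (at t)"
  shows "((\<lambda>t. fcoef (\<lambda>x. tpoly S (\<lambda>n. a n t) x * G t x) l) has_vector_derivative
    fcoef (\<lambda>x. tpoly S a' x * G t x + tpoly S (\<lambda>n. a n t) x * G' x) l) (at t)"
proof -
  have "((\<lambda>t. \<Sum>m\<in>S. a m t * fcoef (G t) (l - m)) has_vector_derivative
    (\<Sum>m\<in>S. a m t * fcoef G' (l - m) + a' m * fcoef (G t) (l - m))) (at t)"
    by (intro has_vector_derivative_sum has_vector_derivative_mult a dG)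
  moreover have "fcoef (\<lambda>x. tpoly S a' x * G t x + tpoly S (\<lambda>n. a n t) x * G' x) l =
    (\<Sum>m\<in>S. a m t * fcoef G' (l - m) + a' m * fcoef (G t) (l - m))"
    using S G G' by (subst fcoef_add)
      (auto simp: fcoef_tpoly_mult trigp_continuous_on sum.distrib intro!: trigp_continuous_on trigp_mult trigp_tpoly)
  ultimately show ?thesis
    using S G by (simp add: fcoef_tpoly_mult trigp_continuous_on)
qed

lemma fcoef_path_mult_cnj:
  assumes S: "finite S" and a: "\<And>n. n \<in> S \<Longrightarrow> (a n has_vector_derivative a' n) (at t)"
    and G: "\<And>t. G t \<in> trigp" and G': "G' \<in> trigp"
    and dG: "\<And>l. ((\<lambda>t. fcoef (G t) l) has_vector_derivative fcoef G' l) (at t)"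
  shows "((\<lambda>t. fcoef (\<lambda>x. cnj (tpoly S (\<lambda>n. a n t) x) * G t x) l) has_vector_derivative
    fcoef (\<lambda>x. cnj (tpoly S a' x) * G t x + cnj (tpoly S (\<lambda>n. a n t) x) * G' x) l) (at t)"
proof -
  have eq: "fcoef (\<lambda>x. cnj (tpoly S b x) * g x) l = (\<Sum>m\<in>S. cnj (b m) * fcoef g (l + m))" if "g \<in> trigp" for b g
    using fcoef_mult_cnj[OF trigp_tpoly[OF S, of b] S fsupp_tpoly[OF S] trigp_continuous_on[OF that]] S
    by (simp add: fcoef_tpoly)
  have "((\<lambda>t. \<Sum>m\<in>S. cnj (a m t) * fcoef (G t) (l + m)) has_vector_derivative
    (\<Sum>m\<in>S. cnj (a m t) * fcoef G' (l + m) + cnj (a' m) * fcoef (G t) (l + m))) (at t)"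
    by (intro has_vector_derivative_sum has_vector_derivative_mult has_vector_derivative_cnj a dG)
  moreover have "fcoef (\<lambda>x. cnj (tpoly S a' x) * G t x + cnj (tpoly S (\<lambda>n. a n t) x) * G' x) l =
    (\<Sum>m\<in>S. cnj (a m t) * fcoef G' (l + m) + cnj (a' m) * fcoef (G t) (l + m))"
    using S G G' by (subst fcoef_add)
      (auto simp: eq sum.distrib intro!: trigp_continuous_on trigp_mult trigp_cnj trigp_tpoly)
  ultimately show ?thesis
    using eq[OF G] by simp
qed

text \<open>The product rule in time at the level of coefficients, by induction on the exponents:
  one factor \<open>v\<close> or \<open>cnj v\<close> is split off at each step.\<close>

lemma fcoef_path_mono_fun:
  assumes S: "finite S" and a: "\<And>n. n \<in> S \<Longrightarrow> (a n has_vector_derivative a' n) (at t)"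
  defines "v \<equiv> \<lambda>t. tpoly S (\<lambda>n. a n t)" and "v' \<equiv> tpoly S a'"
  shows "((\<lambda>t. fcoef (mono_fun i j (v t)) l) has_vector_derivative
    fcoef (\<lambda>x. of_nat i * (mono_fun (i - 1) j (v t) x * v' x) + of_nat j * (mono_fun i (j - 1) (v t) x * cnj (v' x))) l) (at t)"
proof (induct i arbitrary: l)
  case 0
  show ?case
  proof (induct j arbitrary: l)
    case 0
    show ?case by (simp add: mono_fun_def fcoef_const)
  next
    case (Suc j)
    let ?G' = "\<lambda>x. of_nat 0 * (mono_fun (0 - 1) j (v t) x * v' x) + of_nat j * (mono_fun 0 (j - 1) (v t) x * cnj (v' x))"
    have "v t \<in> trigp" for t unfolding v_def by (rule trigp_tpoly[OF S])
    moreover have "v' \<in> trigp" unfolding v'_def by (rule trigp_tpoly[OF S])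
    ultimately have "((\<lambda>t. fcoef (\<lambda>x. cnj (v t x) * mono_fun 0 j (v t) x) l) has_vector_derivative
      fcoef (\<lambda>x. cnj (v' x) * mono_fun 0 j (v t) x + cnj (v t x) * ?G' x) l) (at t)"
      unfolding v_def v'_def
      by (intro fcoef_path_mult_cnj S a Suc[unfolded v_def v'_def] mono_fun_trigp trigp_intros) auto
    moreover have "(\<lambda>x. cnj (v' x) * mono_fun 0 j (v t) x + cnj (v t x) * ?G' x) =
      (\<lambda>x. of_nat 0 * (mono_fun (0 - 1) (Suc j) (v t) x * v' x) + of_nat (Suc j) * (mono_fun 0 (Suc j - 1) (v t) x * cnj (v' x)))"
      \<comment> \<open>For \<open>j = 0\<close> the truncated exponent \<open>j - 1\<close> breaks
        the pattern, but its term has coefficient zero.\<close>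
      by (cases j) (auto simp: mono_fun_def algebra_simps)
    ultimately show ?case by (simp add: mono_fun_Suc2)
  qed
next
  case (Suc i)
  let ?G' = "\<lambda>x. of_nat i * (mono_fun (i - 1) j (v t) x * v' x) + of_nat j * (mono_fun i (j - 1) (v t) x * cnj (v' x))"
  have "v t \<in> trigp" for t unfolding v_def by (rule trigp_tpoly[OF S])
  moreover have "v' \<in> trigp" unfolding v'_def by (rule trigp_tpoly[OF S])
  ultimately have "((\<lambda>t. fcoef (\<lambda>x. v t x * mono_fun i j (v t) x) l) has_vector_derivative
    fcoef (\<lambda>x. v' x * mono_fun i j (v t) x + v t x * ?G' x) l) (at t)"
    unfolding v_def v'_def
    by (intro fcoef_path_mult S a Suc[unfolded v_def v'_def] mono_fun_trigp trigp_intros) auto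
  moreover have "(\<lambda>x. v' x * mono_fun i j (v t) x + v t x * ?G' x) =
    (\<lambda>x. of_nat (Suc i) * (mono_fun (Suc i - 1) j (v t) x * v' x) + of_nat j * (mono_fun (Suc i) (j - 1) (v t) x * cnj (v' x)))"
    by (cases i) (auto simp: mono_fun_def algebra_simps)
  ultimately show ?case by (simp add: mono_fun_Suc1)
qed

lemma nearform_has_vector_derivative:
  assumes x: "\<And>n. n \<in> S \<Longrightarrow> (x n has_vector_derivative x' n) (at t)"
    and y: "\<And>n. n \<in> S \<Longrightarrow> (y n has_vector_derivative y' n) (at t)"
    and B: "\<And>l. (B l has_vector_derivative B' l) (at t)"
  shows "((\<lambda>t. nearform \<sigma> S (\<lambda>n. x n t) (\<lambda>n. y n t) (\<lambda>l. B l t)) has_vector_derivative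
    nearform \<sigma> S x' (\<lambda>n. y n t) (\<lambda>l. B l t) + nearform \<sigma> S (\<lambda>n. x n t) y' (\<lambda>l. B l t) +
    nearform \<sigma> S (\<lambda>n. x n t) (\<lambda>n. y n t) B') (at t)"
  unfolding nearform_def sum.distrib[symmetric]
proof (intro has_vector_derivative_sum)
  fix n m assume nm: "n \<in> S" "m \<in> S"
  define \<mu> where "\<mu> = complex_of_real (jb n powr (2 * \<sigma>) / ((of_int n)\<^sup>2 + (of_int m)\<^sup>2))"
  have "((\<lambda>t. \<mu> * (x n t * (y m t * B (n + m) t))) has_vector_derivative
     \<mu> * (x n t * (y m t * B' (n + m) + y' m * B (n + m) t) + x' n * (y m t * B (n + m) t))) (at t)"
    by (intro has_vector_derivative_mult_right has_vector_derivative_mult x y B nm)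
  then show "((\<lambda>t. if near n m then \<mu> * (x n t * (y m t * B (n + m) t)) else 0) has_vector_derivative
     (if near n m then \<mu> * (x' n * (y m t * B (n + m) t)) else 0) +
     (if near n m then \<mu> * (x n t * (y' m * B (n + m) t)) else 0) +
     (if near n m then \<mu> * (x n t * (y m t * B' (n + m))) else 0)) (at t)"
    by (cases "near n m") (simp_all add: algebra_simps)
qed

text \<open>The modified energy. The factor \<open>2 * real k\<close> copies the coefficient
  \<open>k\<close> of the form in \<open>cnj w\<close>, doubled by differentiating a square, so that
  the resonant parts cancel.\<close>

definition mod_energy :: "nat \<Rightarrow> real \<Rightarrow> int set \<Rightarrow> (real \<Rightarrow> complex) \<Rightarrow> real" where
  "mod_energy k s S v = (wl2 s v)\<^sup>2 + 2 * real k * Re (nearform (s - 1) S (wcnj (fcoef v)) (wcnj (fcoef v)) (fcoef (mono_fun (Suc k) (k - 1) v)))"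

text \<open>As the real part of a polynomial in the coefficients and their conjugates the squared
  norm can be differentiated mode by mode.\<close>

lemma wl2_sq:
  assumes "finite S" "fsupp v \<subseteq> S"
  shows "(wl2 s v)\<^sup>2 = Re (\<Sum>n\<in>S. of_real (jb n powr (2 * s)) * (cnj (fcoef v n) * fcoef v n))"
proof -
  have "(jb n powr s * cmod z)\<^sup>2 = Re (of_real (jb n powr (2 * s)) * (cnj z * z))" for n z
  proof -
    have "jb n powr (2 * s) = (jb n powr s)\<^sup>2" by (simp add: power2_eq_square flip: powr_add)
    moreover have "cnj z * z = of_real ((cmod z)\<^sup>2)" by (metis complex_norm_square mult.commute)
    ultimately show ?thesis by (simp add: power_mult_distrib)
  qed
  then show ?thesis
    unfolding wl2_eq[OF assms] L2_set_def by (simp add: sum_nonneg)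
qed

lemma weighted_sum_has_derivative:
  assumes S: "finite S" and a: "\<And>n. n \<in> S \<Longrightarrow> (a n has_vector_derivative a' n) (at t)"
  defines "v \<equiv> \<lambda>t. tpoly S (\<lambda>n. a n t)" and "v' \<equiv> tpoly S a'"
  shows "((\<lambda>t. (wl2 s (v t))\<^sup>2) has_real_derivative
    2 * Re (\<Sum>n\<in>S. of_real (jb n powr (2 * s)) * (cnj (fcoef (v t) n) * fcoef v' n))) (at t)"
proof -
  have "((\<lambda>t. \<Sum>n\<in>S. of_real (jb n powr (2 * s)) * (cnj (a n t) * a n t)) has_vector_derivative
     (\<Sum>n\<in>S. of_real (jb n powr (2 * s)) * (cnj (a n t) * a' n + cnj (a' n) * a n t))) (at t)"
    by (intro has_vector_derivative_sum has_vector_derivative_mult_right has_vector_derivative_mult has_vector_derivative_cnj a)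
  from bounded_linear.has_vector_derivative[OF bounded_linear_Re this]
  have "((\<lambda>t. Re (\<Sum>n\<in>S. of_real (jb n powr (2 * s)) * (cnj (a n t) * a n t))) has_real_derivative
     Re (\<Sum>n\<in>S. of_real (jb n powr (2 * s)) * (cnj (a n t) * a' n + cnj (a' n) * a n t))) (at t)"
    by (simp add: has_real_derivative_iff_has_vector_derivative)
  moreover have "Re (\<Sum>n\<in>S. of_real (jb n powr (2 * s)) * (cnj (a n t) * a' n + cnj (a' n) * a n t)) =
     2 * Re (\<Sum>n\<in>S. of_real (jb n powr (2 * s)) * (cnj (fcoef (v t) n) * fcoef v' n))"
    unfolding Re_sum sum_distrib_left
    by (intro sum.cong refl) (simp add: v_def v'_def fcoef_tpoly S algebra_simps)
  moreover have "(wl2 s (v t))\<^sup>2 = Re (\<Sum>n\<in>S. of_real (jb n powr (2 * s)) * (cnj (a n t) * a n t))" for t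
  proof -
    have "(wl2 s (v t))\<^sup>2 = Re (\<Sum>n\<in>S. of_real (jb n powr (2 * s)) * (cnj (fcoef (v t) n) * fcoef (v t) n))"
      unfolding v_def by (rule wl2_sq[OF S fsupp_tpoly[OF S]])
    also have "(\<Sum>n\<in>S. of_real (jb n powr (2 * s)) * (cnj (fcoef (v t) n) * fcoef (v t) n)) =
      (\<Sum>n\<in>S. of_real (jb n powr (2 * s)) * (cnj (a n t) * a n t))"
      by (intro sum.cong refl) (simp add: v_def fcoef_tpoly S)
    finally show ?thesis .
  qed
  ultimately show ?thesis by simp
qed

lemma mod_energy_has_derivative:
  assumes S: "finite S" and a: "\<And>n. n \<in> S \<Longrightarrow> (a n has_vector_derivative a' n) (at t)"
  defines "v \<equiv> \<lambda>t. tpoly S (\<lambda>n. a n t)" and "v' \<equiv> tpoly S a'"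
  shows "((\<lambda>t. mod_energy k s S (v t)) has_real_derivative energy_rate k s S (v t) v') (at t)"
proof -
  have vt: "v t \<in> trigp" for t unfolding v_def by (rule trigp_tpoly[OF S])
  have v't: "v' \<in> trigp" unfolding v'_def by (rule trigp_tpoly[OF S])
  have B: "((\<lambda>t. fcoef (mono_fun (Suc k) (k - 1) (v t)) l) has_vector_derivative Btime k (v t) v' l) (at t)" for l
  proof -
    have "fcoef (\<lambda>x. of_nat (Suc k) * (mono_fun (Suc k - 1) (k - 1) (v t) x * v' x) +
       of_nat (k - 1) * (mono_fun (Suc k) (k - 1 - 1) (v t) x * cnj (v' x))) l = Btime k (v t) v' l"
      unfolding Btime_def using vt v't
      by (subst fcoef_add) (auto simp only: fcoef_cmult diff_Suc_1 diff_diff_left one_add_one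
          intro!: trigp_continuous_on trigp_intros mono_fun_trigp)
    moreover have "((\<lambda>t. fcoef (mono_fun (Suc k) (k - 1) (v t)) l) has_vector_derivative
      fcoef (\<lambda>x. of_nat (Suc k) * (mono_fun (Suc k - 1) (k - 1) (v t) x * v' x) +
       of_nat (k - 1) * (mono_fun (Suc k) (k - 1 - 1) (v t) x * cnj (v' x))) l) (at t)"
      unfolding v_def v'_def by (rule fcoef_path_mono_fun[OF S]) (rule a)
    ultimately show ?thesis by simp
  qed
  have P: "((\<lambda>t. (wl2 s (v t))\<^sup>2) has_real_derivative
    2 * Re (\<Sum>n\<in>S. of_real (jb n powr (2 * s)) * (cnj (fcoef (v t) n) * fcoef v' n))) (at t)"
    unfolding v_def v'_def by (rule weighted_sum_has_derivative[OF S]) (rule a)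
  have w: "((\<lambda>t. wcnj (fcoef (v t)) n) has_vector_derivative wcnj (fcoef v') n) (at t)" if "n \<in> S" for n
    unfolding wcnj_def v_def v'_def fcoef_tpoly[OF S] if_P[OF that]
    by (intro has_vector_derivative_cnj has_vector_derivative_mult_right a that)
  have "((\<lambda>t. nearform (s - 1) S (wcnj (fcoef (v t))) (wcnj (fcoef (v t))) (fcoef (mono_fun (Suc k) (k - 1) (v t)))) has_vector_derivative
     nearform (s - 1) S (wcnj (fcoef v')) (wcnj (fcoef (v t))) (fcoef (mono_fun (Suc k) (k - 1) (v t))) +
     nearform (s - 1) S (wcnj (fcoef (v t))) (wcnj (fcoef v')) (fcoef (mono_fun (Suc k) (k - 1) (v t))) +
     nearform (s - 1) S (wcnj (fcoef (v t))) (wcnj (fcoef (v t))) (Btime k (v t) v')) (at t)" (is "(?N has_vector_derivative ?N') _")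
    by (rule nearform_has_vector_derivative[OF w w B])
  from bounded_linear.has_vector_derivative[OF bounded_linear_Re this]
  have N: "((\<lambda>t. Re (?N t)) has_real_derivative Re ?N') (at t)"
    by (simp add: has_real_derivative_iff_has_vector_derivative)
  show ?thesis
    unfolding mod_energy_def energy_rate_def
    by (rule DERIV_add[OF P DERIV_cmult[OF N]])
qed

text \<open>The divisor in the correction compensates both derivatives, so the modified energy
  differs from the squared \<open>H^s\<close> norm by a term of order \<open>s - 1\<close>
  only.\<close>

lemma mod_energy_near:
  assumes s: "1 \<le> s" and k: "1 \<le> k"
  shows "\<exists>C>0. \<forall>S v. finite S \<longrightarrow> v \<in> trigp \<longrightarrow> fsupp v \<subseteq> S \<longrightarrow> wl2 1 v \<le> K \<longrightarrow>
    \<bar>mod_energy k s S v - (wl2 s v)\<^sup>2\<bar> \<le> C * (wl2 (s - 1) v)\<^sup>2"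
proof -
  obtain C1 where C1: "C1 > 0" "\<And>f. f \<in> trigp \<Longrightarrow> wl1 0 f \<le> C1 * wl2 1 f" using wl1_le_wl2[of 1 0] by auto
  obtain CB where CB: "CB > 0" "\<And>f. f \<in> trigp \<Longrightarrow> wl1 0 f \<le> C1 * K \<Longrightarrow> wl1 0 (mono_fun (Suc k) (k - 1) f) \<le> CB"
    using wl1_mono_fun_bounded by blast
  define C where "C = 2 * real k * (4 * 2 powr (s - 1) * CB)"
  have "\<bar>mod_energy k s S v - (wl2 s v)\<^sup>2\<bar> \<le> C * (wl2 (s - 1) v)\<^sup>2"
    if S: "finite S" and v: "v \<in> trigp" and sv: "fsupp v \<subseteq> S" and K: "wl2 1 v \<le> K" for S v
  proof -
    have L: "wl1 0 v \<le> C1 * K" using C1(2)[OF v] K C1(1) by (smt (verit) mult_left_mono)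
    have B: "(\<Sum>l\<in>T. cmod (fcoef (mono_fun (Suc k) (k - 1) v) l)) \<le> CB" if "finite T" for T
      using sum_le_wl1[OF mono_fun_trigp[OF v] that, of 0 "Suc k" "k - 1"] CB(2)[OF v L] by simp
    have w: "cmod (wcnj (fcoef v) n) \<le> jb n * cmod (fcoef v n)" for n
      by (simp add: wcnj_def norm_mult mult_right_mono abs_le_jb)
    have "cmod (nearform (s - 1) S (wcnj (fcoef v)) (wcnj (fcoef v)) (fcoef (mono_fun (Suc k) (k - 1) v))) \<le>
      4 * 2 powr (s - 1) * (L2_set (\<lambda>n. jb n powr (s - 1) * cmod (fcoef v n)) S * L2_set (\<lambda>n. jb n powr (s - 1) * cmod (fcoef v n)) S * CB)"
      using s by (intro nearform_bound S B w) auto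
    also have "\<dots> = 4 * 2 powr (s - 1) * CB * (wl2 (s - 1) v)\<^sup>2"
      by (simp add: wl2_eq[OF S sv] power2_eq_square)
    finally have N: "\<bar>Re (nearform (s - 1) S (wcnj (fcoef v)) (wcnj (fcoef v)) (fcoef (mono_fun (Suc k) (k - 1) v)))\<bar> \<le>
       4 * 2 powr (s - 1) * CB * (wl2 (s - 1) v)\<^sup>2"
      using abs_Re_le_cmod order_trans by blast
    have "\<bar>mod_energy k s S v - (wl2 s v)\<^sup>2\<bar> =
       2 * real k * \<bar>Re (nearform (s - 1) S (wcnj (fcoef v)) (wcnj (fcoef v)) (fcoef (mono_fun (Suc k) (k - 1) v)))\<bar>"
      by (simp add: mod_energy_def abs_mult)
    also have "\<dots> \<le> 2 * real k * (4 * 2 powr (s - 1) * CB * (wl2 (s - 1) v)\<^sup>2)"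
      by (intro mult_left_mono N) auto
    finally show ?thesis by (simp add: C_def mult_ac)
  qed
  moreover have "C > 0" using k CB by (simp add: C_def)
  ultimately show ?thesis by blast
qed

section \<open>Conservation laws up to the truncation error\<close>

text \<open>This is \<open>energy\<close> divided by \<open>2 * pi\<close>, because of the
  normalisation of \<open>fcoef\<close>; the mean value of \<open>|v|^(2k+2)\<close> is its
  coefficient at frequency 0.\<close>

definition trunc_energy :: "nat \<Rightarrow> int set \<Rightarrow> (real \<Rightarrow> complex) \<Rightarrow> real" where
  "trunc_energy k S v = (\<Sum>n\<in>S. (of_int n)\<^sup>2 * (cmod (fcoef v n))\<^sup>2) / 2 + Re (fcoef (mono_fun (Suc k) (Suc k) v) 0) / (2 * real k + 2)"

text \<open>Since \<open>v\<close> has no modes outside \<open>S\<close>, pairing it with the modes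
  of the nonlinearity in \<open>S\<close> loses nothing. Together with the reality of the result
  this makes the mass insensitive to the projection.\<close>

lemma fcoef_mono_zero:
  assumes v: "v \<in> trigp" and S: "finite S" "fsupp v \<subseteq> S"
  shows "(\<Sum>n\<in>S. cnj (fcoef v n) * fcoef (mono_fun (Suc k) k v) n) = fcoef (mono_fun (Suc k) (Suc k) v) 0"
  using fcoef_mult_cnj[OF v S trigp_continuous_on[OF mono_fun_trigp[OF v]], of "Suc k" k 0]
  by (simp add: mono_fun_Suc2)

lemma fcoef_modulus_real:
  assumes v: "v \<in> trigp"
  shows "Im (fcoef (mono_fun i i v) 0) = 0"
proof -
  have "(\<lambda>x. cnj (mono_fun i i v x)) = mono_fun i i v" by (simp add: mono_fun_def mult.commute)
  then have "fcoef (mono_fun i i v) 0 = cnj (fcoef (mono_fun i i v) 0)"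
    using fcoef_cnj[OF trigp_continuous_on[OF mono_fun_trigp[OF v]], of i i 0] by simp
  then show ?thesis by (metis complex_cnj_cancel_iff cnj.sel(2) neg_equal_zero)
qed

text \<open>The pairings of \<open>v\<close> with its linear part and with the nonlinearity are
  real, so multiplied by \<open>- \<i>\<close> they have no real part; what is left is the pairing
  with the forcing.\<close>

lemma mass_rate_bound:
  assumes gs: "galerkin_state k s K S v vt e \<epsilon>" and s: "0 \<le> s"
  shows "\<bar>2 * Re (\<Sum>n\<in>S. of_real (jb n powr (2 * 0)) * (cnj (fcoef v n) * fcoef vt n))\<bar> \<le> 2 * wl2 0 v * \<epsilon>"
proof -
  have S: "finite S" and v: "v \<in> trigp" and sv: "fsupp v \<subseteq> S"
    and eq: "\<And>n. n \<in> S \<Longrightarrow> fcoef vt n = - \<i> * (of_int (n\<^sup>2) * fcoef v n + fcoef (mono_fun (Suc k) k v) n + e n)"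
    and e: "L2_set (\<lambda>n. jb n powr s * cmod (e n)) S \<le> \<epsilon>"
    using gs by (auto simp: galerkin_state_def)
  have alg: "Re (cnj z * (- \<i> * (of_real r * z + f + g))) = Im (cnj z * f) + Im (cnj z * g)" for r z f g
    by (simp add: algebra_simps)
  have "Re (\<Sum>n\<in>S. of_real (jb n powr (2 * 0)) * (cnj (fcoef v n) * fcoef vt n)) =
    Im (\<Sum>n\<in>S. cnj (fcoef v n) * fcoef (mono_fun (Suc k) k v) n) + Im (\<Sum>n\<in>S. cnj (fcoef v n) * e n)"
    unfolding Re_sum Im_sum sum.distrib[symmetric]
  proof (intro sum.cong refl)
    fix n assume "n \<in> S"
    then show "Re (of_real (jb n powr (2 * 0)) * (cnj (fcoef v n) * fcoef vt n)) =
      Im (cnj (fcoef v n) * fcoef (mono_fun (Suc k) k v) n) + Im (cnj (fcoef v n) * e n)"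
      using alg[of "fcoef v n" "of_int (n\<^sup>2)" "fcoef (mono_fun (Suc k) k v) n" "e n"] eq by simp
  qed
  also have "Im (\<Sum>n\<in>S. cnj (fcoef v n) * fcoef (mono_fun (Suc k) k v) n) = 0"
    unfolding fcoef_mono_zero[OF v S sv] by (rule fcoef_modulus_real[OF v])
  finally have "\<bar>2 * Re (\<Sum>n\<in>S. of_real (jb n powr (2 * 0)) * (cnj (fcoef v n) * fcoef vt n))\<bar> \<le> 2 * cmod (\<Sum>n\<in>S. cnj (fcoef v n) * e n)"
    using abs_Im_le_cmod[of "\<Sum>n\<in>S. cnj (fcoef v n) * e n"] by simp
  also have "cmod (\<Sum>n\<in>S. cnj (fcoef v n) * e n) \<le> (\<Sum>n\<in>S. \<bar>jb n powr 0 * cmod (fcoef v n)\<bar> * \<bar>jb n powr s * cmod (e n)\<bar>)"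
  proof (intro sum_norm_le)
    fix n
    have "1 * cmod (e n) \<le> jb n powr s * cmod (e n)" using jb_powr_ge1[OF s] by (intro mult_right_mono) auto
    then show "cmod (cnj (fcoef v n) * e n) \<le> \<bar>jb n powr 0 * cmod (fcoef v n)\<bar> * \<bar>jb n powr s * cmod (e n)\<bar>"
      by (simp add: norm_mult mult_left_mono)
  qed
  also have "\<dots> \<le> L2_set (\<lambda>n. jb n powr 0 * cmod (fcoef v n)) S * L2_set (\<lambda>n. jb n powr s * cmod (e n)) S"
    by (rule L2_set_mult_ineq)
  also have "\<dots> \<le> wl2 0 v * \<epsilon>"
    using L2_set_le_wl2[OF v S, of 0] e by (intro mult_mono) auto
  finally show ?thesis by simp
qed

definition trunc_energy_rate :: "nat \<Rightarrow> int set \<Rightarrow> (real \<Rightarrow> complex) \<Rightarrow> (real \<Rightarrow> complex) \<Rightarrow> real" where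
  "trunc_energy_rate k S v vt = Re (\<Sum>n\<in>S. cnj (fcoef vt n) * (of_int (n\<^sup>2) * fcoef v n + fcoef (mono_fun (Suc k) k v) n))"

text \<open>The derivatives through \<open>v\<close> and through \<open>cnj v\<close> are conjugate
  to each other and add up to twice a real part; the factor \<open>2 * k + 2\<close> so obtained
  cancels the denominator of the potential term.\<close>

lemma trunc_energy_has_derivative:
  assumes S: "finite S" and a: "\<And>n. n \<in> S \<Longrightarrow> (a n has_vector_derivative a' n) (at t)"
  defines "v \<equiv> \<lambda>t. tpoly S (\<lambda>n. a n t)" and "v' \<equiv> tpoly S a'"
  shows "((\<lambda>t. trunc_energy k S (v t)) has_real_derivative trunc_energy_rate k S (v t) v') (at t)"
proof -
  have vt: "v t \<in> trigp" for t unfolding v_def by (rule trigp_tpoly[OF S])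
  have v't: "v' \<in> trigp" "fsupp v' \<subseteq> S" unfolding v'_def using trigp_tpoly[OF S] fsupp_tpoly[OF S] by auto
  have sq: "(cmod z)\<^sup>2 = Re (cnj z * z)" for z by (metis complex_norm_square mult.commute Re_complex_of_real)
  have cv: "fcoef (v t) n = a n t" if "n \<in> S" for n t using that by (simp add: v_def fcoef_tpoly S)
  have cv': "fcoef v' n = a' n" if "n \<in> S" for n using that by (simp add: v'_def fcoef_tpoly S)
  have "((\<lambda>t. \<Sum>n\<in>S. of_real ((of_int n)\<^sup>2) * (cnj (a n t) * a n t)) has_vector_derivative
     (\<Sum>n\<in>S. of_real ((of_int n)\<^sup>2) * (cnj (a n t) * a' n + cnj (a' n) * a n t))) (at t)"
    by (intro has_vector_derivative_sum has_vector_derivative_mult_right has_vector_derivative_mult has_vector_derivative_cnj a)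
  from bounded_linear.has_vector_derivative[OF bounded_linear_Re this]
  have "((\<lambda>t. Re (\<Sum>n\<in>S. of_real ((of_int n)\<^sup>2) * (cnj (a n t) * a n t))) has_real_derivative
     Re (\<Sum>n\<in>S. of_real ((of_int n)\<^sup>2) * (cnj (a n t) * a' n + cnj (a' n) * a n t))) (at t)"
    by (simp add: has_real_derivative_iff_has_vector_derivative)
  moreover have "Re (\<Sum>n\<in>S. of_real ((of_int n)\<^sup>2) * (cnj (a n t) * a' n + cnj (a' n) * a n t)) =
     2 * Re (\<Sum>n\<in>S. cnj (fcoef v' n) * (of_int (n\<^sup>2) * fcoef (v t) n))"
    unfolding Re_sum sum_distrib_left
    by (intro sum.cong refl) (simp add: cv cv' algebra_simps flip: of_int_power)
  moreover have "(\<Sum>n\<in>S. (of_int n)\<^sup>2 * (cmod (fcoef (v t) n))\<^sup>2) = Re (\<Sum>n\<in>S. of_real ((of_int n)\<^sup>2) * (cnj (a n t) * a n t))" for t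
    unfolding Re_sum by (intro sum.cong refl) (simp add: cv sq del: Re_complex_of_real)
  ultimately have 1: "((\<lambda>t. \<Sum>n\<in>S. (of_int n)\<^sup>2 * (cmod (fcoef (v t) n))\<^sup>2) has_real_derivative
     2 * Re (\<Sum>n\<in>S. cnj (fcoef v' n) * (of_int (n\<^sup>2) * fcoef (v t) n))) (at t)"
    by simp
  define Z where "Z = (\<Sum>n\<in>S. cnj (fcoef v' n) * fcoef (mono_fun (Suc k) k (v t)) n)"
  have Z: "fcoef (\<lambda>x. mono_fun (Suc k) k (v t) x * cnj (v' x)) 0 = Z"
    using fcoef_mult_cnj[OF v't(1) S v't(2) trigp_continuous_on[OF mono_fun_trigp[OF vt]], of "Suc k" k t 0]
    by (simp add: Z_def mult.commute)
  have Zc: "fcoef (\<lambda>x. mono_fun k (Suc k) (v t) x * v' x) 0 = cnj Z"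
  proof -
    have "(\<lambda>x. mono_fun k (Suc k) (v t) x * v' x) = (\<lambda>x. cnj (mono_fun (Suc k) k (v t) x * cnj (v' x)))"
      by (simp add: mono_fun_def mult_ac)
    then show ?thesis
      using fcoef_cnj[OF trigp_continuous_on[OF trigp_mult[OF mono_fun_trigp[OF vt] trigp_cnj[OF v't(1)]]], of "Suc k" k t 0] Z
      by simp
  qed
  have "fcoef (\<lambda>x. of_nat (Suc k) * (mono_fun (Suc k - 1) (Suc k) (v t) x * v' x) + of_nat (Suc k) * (mono_fun (Suc k) (Suc k - 1) (v t) x * cnj (v' x))) 0
     = of_nat (Suc k) * cnj Z + of_nat (Suc k) * Z"
    using vt v't(1)
    by (subst fcoef_add) (auto simp only: fcoef_cmult diff_Suc_1 Z Zc intro!: trigp_continuous_on trigp_intros mono_fun_trigp)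
  moreover have "((\<lambda>t. fcoef (mono_fun (Suc k) (Suc k) (v t)) 0) has_vector_derivative
    fcoef (\<lambda>x. of_nat (Suc k) * (mono_fun (Suc k - 1) (Suc k) (v t) x * v' x) + of_nat (Suc k) * (mono_fun (Suc k) (Suc k - 1) (v t) x * cnj (v' x))) 0) (at t)"
    unfolding v_def v'_def by (rule fcoef_path_mono_fun[OF S]) (rule a)
  ultimately have "((\<lambda>t. fcoef (mono_fun (Suc k) (Suc k) (v t)) 0) has_vector_derivative of_nat (Suc k) * cnj Z + of_nat (Suc k) * Z) (at t)"
    by simp
  from bounded_linear.has_vector_derivative[OF bounded_linear_Re this]
  have 2: "((\<lambda>t. Re (fcoef (mono_fun (Suc k) (Suc k) (v t)) 0)) has_real_derivative (2 * real k + 2) * Re Z) (at t)"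
    by (simp add: has_real_derivative_iff_has_vector_derivative algebra_simps)
  have "((\<lambda>t. trunc_energy k S (v t)) has_real_derivative
     (2 * Re (\<Sum>n\<in>S. cnj (fcoef v' n) * (of_int (n\<^sup>2) * fcoef (v t) n))) / 2 + ((2 * real k + 2) * Re Z) / (2 * real k + 2)) (at t)"
    unfolding trunc_energy_def by (intro DERIV_add DERIV_cdivide 1 2)
  moreover have "(2 * Re (\<Sum>n\<in>S. cnj (fcoef v' n) * (of_int (n\<^sup>2) * fcoef (v t) n))) / 2 + ((2 * real k + 2) * Re Z) / (2 * real k + 2) =
     trunc_energy_rate k S (v t) v'"
  proof -
    have "2 * real k + 2 \<noteq> 0" by (simp add: add_nonneg_eq_0_iff)
    moreover have "trunc_energy_rate k S (v t) v' = Re (\<Sum>n\<in>S. cnj (fcoef v' n) * (of_int (n\<^sup>2) * fcoef (v t) n)) + Re Z"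
      by (simp only: trunc_energy_rate_def Z_def distrib_left sum.distrib plus_complex.sel)
    ultimately show ?thesis by (simp only: nonzero_mult_div_cancel_left) simp
  qed
  ultimately show ?thesis by simp
qed

text \<open>Hamiltonian structure: with \<open>g\<close> the gradient of the energy,
  \<open>vt = - \<i> * (g + e)\<close>, so \<open>Re (cnj vt * g)\<close> reduces to the pairing of
  \<open>e\<close> with \<open>g\<close>. The \<open>n^2\<close> inside \<open>g\<close> is shared
  as \<open>jb n powr s\<close> on both factors, by \<open>s \<ge> 1\<close>.\<close>

lemma trunc_energy_rate_bound:
  assumes gs: "galerkin_state k s K S v vt e \<epsilon>" and s: "1 \<le> s"
  shows "\<bar>trunc_energy_rate k S v vt\<bar> \<le> \<epsilon> * (wl2 s v + wl2 0 (mono_fun (Suc k) k v))"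
proof -
  have S: "finite S" and v: "v \<in> trigp" and sv: "fsupp v \<subseteq> S"
    and eq: "\<And>n. n \<in> S \<Longrightarrow> fcoef vt n = - \<i> * (of_int (n\<^sup>2) * fcoef v n + fcoef (mono_fun (Suc k) k v) n + e n)"
    and e: "L2_set (\<lambda>n. jb n powr s * cmod (e n)) S \<le> \<epsilon>"
    using gs by (auto simp: galerkin_state_def)
  define F where "F = fcoef (mono_fun (Suc k) k v)"
  have alg: "Re (cnj (- \<i> * (g + h)) * g) = - Im (cnj h * g)" for g h
    by (simp add: algebra_simps)
  have rate: "trunc_energy_rate k S v vt = - Im (\<Sum>n\<in>S. cnj (e n) * (of_int (n\<^sup>2) * fcoef v n + F n))"
    unfolding trunc_energy_rate_def Re_sum Im_sum sum_negf[symmetric] F_def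
    by (intro sum.cong refl) (simp only: eq alg)
  have "\<bar>trunc_energy_rate k S v vt\<bar> \<le> cmod (\<Sum>n\<in>S. cnj (e n) * (of_int (n\<^sup>2) * fcoef v n + F n))"
    unfolding rate abs_minus_cancel by (rule abs_Im_le_cmod)
  also have "\<dots> \<le> (\<Sum>n\<in>S. \<bar>jb n powr s * cmod (e n)\<bar> * \<bar>jb n powr s * cmod (fcoef v n) + jb n powr 0 * cmod (F n)\<bar>)"
  proof (intro sum_norm_le)
    fix n
    have e1: "cmod (e n) \<le> jb n powr s * cmod (e n)"
      using mult_right_mono[OF jb_powr_ge1[of s n], of "cmod (e n)"] s by simp
    have p2: "(jb n)\<^sup>2 \<le> jb n powr s * jb n powr s"
    proof -
      have "(jb n)\<^sup>2 = jb n powr 2" by simp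
      also have "\<dots> \<le> jb n powr (s + s)" using s by (intro powr_mono) auto
      finally show ?thesis by (simp only: powr_add)
    qed
    have "cmod (cnj (e n) * (of_int (n\<^sup>2) * fcoef v n + F n)) \<le> cmod (e n) * (cmod (of_int (n\<^sup>2) * fcoef v n) + cmod (F n))"
      unfolding norm_mult[of "cnj (e n)"] complex_mod_cnj by (intro mult_left_mono norm_triangle_ineq) simp
    also have "\<dots> \<le> cmod (e n) * ((jb n)\<^sup>2 * cmod (fcoef v n) + cmod (F n))"
      by (intro mult_left_mono add_mono) (simp_all add: norm_mult norm_power jb_sq power2_abs mult_right_mono)
    also have "\<dots> \<le> cmod (e n) * ((jb n powr s * jb n powr s) * cmod (fcoef v n)) + (jb n powr s * cmod (e n)) * cmod (F n)"
      unfolding distrib_left by (intro add_mono mult_left_mono mult_right_mono p2 e1) auto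
    also have "\<dots> = \<bar>jb n powr s * cmod (e n)\<bar> * \<bar>jb n powr s * cmod (fcoef v n) + jb n powr 0 * cmod (F n)\<bar>"
      by (simp add: algebra_simps abs_mult)
    finally show "cmod (cnj (e n) * (of_int (n\<^sup>2) * fcoef v n + F n)) \<le> \<dots>" .
  qed
  also have "\<dots> \<le> L2_set (\<lambda>n. jb n powr s * cmod (e n)) S * L2_set (\<lambda>n. jb n powr s * cmod (fcoef v n) + jb n powr 0 * cmod (F n)) S"
    by (rule L2_set_mult_ineq)
  also have "\<dots> \<le> \<epsilon> * (wl2 s v + wl2 0 (mono_fun (Suc k) k v))"
  proof (intro mult_mono e)
    have "L2_set (\<lambda>n. jb n powr s * cmod (fcoef v n) + jb n powr 0 * cmod (F n)) S \<le>
      L2_set (\<lambda>n. jb n powr s * cmod (fcoef v n)) S + L2_set (\<lambda>n. jb n powr 0 * cmod (F n)) S"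
      by (rule L2_set_triangle_ineq)
    also have "\<dots> \<le> wl2 s v + wl2 0 (mono_fun (Suc k) k v)"
      unfolding F_def by (intro add_mono L2_set_le_wl2 v S mono_fun_trigp)
    finally show "L2_set (\<lambda>n. jb n powr s * cmod (fcoef v n) + jb n powr 0 * cmod (F n)) S \<le> wl2 s v + wl2 0 (mono_fun (Suc k) k v)" .
  qed (use order_trans[OF L2_set_nonneg e] in auto)
  finally show ?thesis .
qed

section \<open>Galerkin truncations\<close>

text \<open>A finite subcover leaves finitely many local thresholds; their sum majorises each of
  them and makes sense for an empty cover as well.\<close>

lemma compact_local_bound:
  fixes P :: "nat \<Rightarrow> real \<Rightarrow> bool"
  assumes K: "compact K" and loc: "\<And>x. x \<in> K \<Longrightarrow> \<exists>d>0. \<exists>N. \<forall>y. dist y x < d \<longrightarrow> P N y"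
    and mono: "\<And>M N y. M \<le> N \<Longrightarrow> P M y \<Longrightarrow> P N y"
  shows "\<exists>N. \<forall>y\<in>K. P N y"
proof -
  obtain d N where dN: "\<And>x. x \<in> K \<Longrightarrow> 0 < d x" "\<And>x y. x \<in> K \<Longrightarrow> dist y x < d x \<Longrightarrow> P (N x) y"
    using loc by metis
  have "K \<subseteq> (\<Union>x\<in>K. ball x (d x))" using dN(1) by auto
  then obtain C where C: "C \<subseteq> K" "finite C" "K \<subseteq> (\<Union>x\<in>C. ball x (d x))"
    using compactE_image[OF K, of K "\<lambda>x. ball x (d x)"] by auto
  have "P (sum N C) y" if y: "y \<in> K" for y
  proof -
    obtain x where x: "x \<in> C" "dist y x < d x" using C(3) y by (auto simp: dist_commute)
    then have "P (N x) y" using C(1) by (intro dN(2)) auto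
    moreover have "N x \<le> sum N C" using C(2) x(1) by (intro member_le_sum) auto
    ultimately show ?thesis by (intro mono[of "N x" "sum N C" y])
  qed
  then show ?thesis by blast
qed

definition modes :: "nat \<Rightarrow> int set" where
  "modes N = {- int N..int N}"

lemma finite_modes [simp]: "finite (modes N)"
  by (simp add: modes_def)

lemma modes_mono: "M \<le> N \<Longrightarrow> modes M \<subseteq> modes N"
  by (auto simp: modes_def)

lemma finite_subset_modes: "finite S \<Longrightarrow> \<exists>N. S \<subseteq> modes N"
proof (induct S rule: finite_induct)
  case (insert x S)
  then obtain N where "S \<subseteq> modes N" by blast
  moreover have "modes N \<subseteq> modes (max N (nat \<bar>x\<bar>))" by (rule modes_mono) simp
  moreover have "x \<in> modes (max N (nat \<bar>x\<bar>))" by (auto simp: modes_def)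
  ultimately have "insert x S \<subseteq> modes (max N (nat \<bar>x\<bar>))" by blast
  then show ?case by blast
qed simp

text \<open>The Fourier projection of the given path, not the solution of a projected equation; this
  is the origin of the forcing term in \<open>galerkin_state\<close>.\<close>

definition galerkin :: "(int \<Rightarrow> real \<Rightarrow> complex) \<Rightarrow> nat \<Rightarrow> real \<Rightarrow> real \<Rightarrow> complex" where
  "galerkin a N t = tpoly (modes N) (\<lambda>n. a n t)"

lemma galerkin_trigp [simp]: "galerkin a N t \<in> trigp"
  unfolding galerkin_def by (rule trigp_tpoly) simp

lemma fsupp_galerkin: "fsupp (galerkin a N t) \<subseteq> modes N"
  unfolding galerkin_def by (rule fsupp_tpoly) simp

lemma fcoef_galerkin: "n \<in> modes N \<Longrightarrow> fcoef (galerkin a N t) n = a n t"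
  unfolding galerkin_def by (simp add: fcoef_tpoly)

lemma wl2_galerkin: "wl2 p (galerkin a N t) = L2_set (\<lambda>n. jb n powr p * cmod (a n t)) (modes N)"
  unfolding wl2_eq[OF finite_modes fsupp_galerkin] by (intro L2_set_cong refl) (simp add: fcoef_galerkin)

lemma wl2_galerkin_mono: "M \<le> N \<Longrightarrow> wl2 p (galerkin a M t) \<le> wl2 p (galerkin a N t)"
  unfolding wl2_galerkin by (intro L2_set_subset modes_mono) auto

text \<open>A continuous path in \<open>H\<^sup>s\<close>, given by its Fourier coefficients \<open>a n t\<close>.\<close>

locale hs_path =
  fixes s :: real and a :: "int \<Rightarrow> real \<Rightarrow> complex"
  assumes s1: "1 \<le> s"
    and bdd: "\<And>t. \<exists>R. \<forall>S. finite S \<longrightarrow> L2_set (\<lambda>n. jb n powr s * cmod (a n t)) S \<le> R"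
    and cont: "\<And>t\<^sub>0 \<eta>. 0 < \<eta> \<Longrightarrow> \<exists>d>0. \<forall>t. dist t t\<^sub>0 < d \<longrightarrow>
       (\<forall>S. finite S \<longrightarrow> L2_set (\<lambda>n. jb n powr s * cmod (a n t - a n t\<^sub>0)) S \<le> \<eta>)"
begin

lemma L2_set_split:
  "L2_set (\<lambda>n. jb n powr s * cmod (a n t)) S \<le>
    L2_set (\<lambda>n. jb n powr s * cmod (a n t - a n t\<^sub>0)) S + L2_set (\<lambda>n. jb n powr s * cmod (a n t\<^sub>0)) S"
proof -
  have "L2_set (\<lambda>n. jb n powr s * cmod (a n t)) S \<le>
    L2_set (\<lambda>n. jb n powr s * cmod (a n t - a n t\<^sub>0) + jb n powr s * cmod (a n t\<^sub>0)) S"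
  proof (intro L2_set_mono)
    fix n
    have "cmod (a n t) \<le> cmod (a n t - a n t\<^sub>0) + cmod (a n t\<^sub>0)"
      by (metis diff_add_cancel norm_triangle_ineq)
    then show "jb n powr s * cmod (a n t) \<le> jb n powr s * cmod (a n t - a n t\<^sub>0) + jb n powr s * cmod (a n t\<^sub>0)"
      by (simp add: mult_left_mono flip: distrib_left)
  qed auto
  also have "\<dots> \<le> L2_set (\<lambda>n. jb n powr s * cmod (a n t - a n t\<^sub>0)) S + L2_set (\<lambda>n. jb n powr s * cmod (a n t\<^sub>0)) S"
    by (rule L2_set_triangle_ineq)
  finally show ?thesis .
qed

text \<open>A qualitative bound from continuity and compactness. Its dependence on \<open>T\<close>
  is not controlled, but it suffices to let truncation errors tend to zero.\<close>

lemma uniform_bound: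
  "\<exists>R. \<forall>t. \<bar>t\<bar> \<le> T \<longrightarrow> (\<forall>S. finite S \<longrightarrow> L2_set (\<lambda>n. jb n powr s * cmod (a n t)) S \<le> R)"
proof -
  have "\<exists>N. \<forall>t\<in>{-T..T}. \<forall>S. finite S \<longrightarrow> L2_set (\<lambda>n. jb n powr s * cmod (a n t)) S \<le> real N"
  proof (rule compact_local_bound)
    fix t0 assume "t0 \<in> {-T..T}"
    obtain R where R: "\<And>S. finite S \<Longrightarrow> L2_set (\<lambda>n. jb n powr s * cmod (a n t0)) S \<le> R"
      using bdd[of t0] by blast
    obtain d where d: "d > 0" "\<And>t S. dist t t0 < d \<Longrightarrow> finite S \<Longrightarrow> L2_set (\<lambda>n. jb n powr s * cmod (a n t - a n t0)) S \<le> 1"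
      using cont[of 1 t0] by auto
    have "L2_set (\<lambda>n. jb n powr s * cmod (a n t)) S \<le> real (nat \<lceil>1 + R\<rceil>)" if "dist t t0 < d" "finite S" for t S
    proof -
      have "L2_set (\<lambda>n. jb n powr s * cmod (a n t)) S \<le> 1 + R"
        using L2_set_split[of t S t0] d(2)[OF that] R[OF that(2)] by linarith
      also have "\<dots> \<le> real (nat \<lceil>1 + R\<rceil>)" by (rule real_nat_ceiling_ge)
      finally show ?thesis .
    qed
    then show "\<exists>d>0. \<exists>N. \<forall>t. dist t t0 < d \<longrightarrow> (\<forall>S. finite S \<longrightarrow> L2_set (\<lambda>n. jb n powr s * cmod (a n t)) S \<le> real N)"
      using d(1) by blast
  next
    fix M N t assume "M \<le> N" and *: "\<forall>S. finite S \<longrightarrow> L2_set (\<lambda>n. jb n powr s * cmod (a n t)) S \<le> real M"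
    then have "real M \<le> real N" by simp
    with * show "\<forall>S. finite S \<longrightarrow> L2_set (\<lambda>n. jb n powr s * cmod (a n t)) S \<le> real N"
      using order_trans by blast
  qed auto
  then obtain N where N: "\<And>t S. t \<in> {-T..T} \<Longrightarrow> finite S \<Longrightarrow> L2_set (\<lambda>n. jb n powr s * cmod (a n t)) S \<le> real N"
    by blast
  show ?thesis by (intro exI[of _ "real N"] allI impI N) auto
qed

text \<open>\<open>S0\<close> nearly exhausts the supremum of the finite sums of squares, so a set
  disjoint from it can add at most \<open>\<eta>\<^sup>2\<close>.\<close>

lemma tail_at:
  assumes "0 < \<eta>"
  shows "\<exists>N. \<forall>S. finite S \<longrightarrow> S \<inter> modes N = {} \<longrightarrow> L2_set (\<lambda>n. jb n powr s * cmod (a n t)) S \<le> \<eta>"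
proof -
  define g where "g n = (jb n powr s * cmod (a n t))\<^sup>2" for n
  obtain R where R: "\<And>S. finite S \<Longrightarrow> L2_set (\<lambda>n. jb n powr s * cmod (a n t)) S \<le> R"
    using bdd[of t] by blast
  have gR: "sum g S \<le> R\<^sup>2" if "finite S" for S
  proof -
    have "sqrt (sum g S) \<le> R" using R[OF that] by (simp add: L2_set_def g_def)
    then have "(sqrt (sum g S))\<^sup>2 \<le> R\<^sup>2" by (intro power_mono) (auto simp: g_def sum_nonneg)
    then show ?thesis by (simp add: g_def sum_nonneg)
  qed
  define c where "c = (SUP S\<in>{S. finite S}. sum g S)"
  have bddg: "bdd_above (sum g ` {S. finite S})" using gR by (intro bdd_aboveI[of _ "R\<^sup>2"]) auto
  have "c - \<eta>\<^sup>2 < c" using assms by simp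
  then obtain S0 where S0: "finite S0" "c - \<eta>\<^sup>2 < sum g S0"
    unfolding c_def using bddg by (subst (asm) less_cSUP_iff) auto
  obtain N where N: "S0 \<subseteq> modes N" using finite_subset_modes[OF S0(1)] by blast
  have "L2_set (\<lambda>n. jb n powr s * cmod (a n t)) S \<le> \<eta>" if "finite S" "S \<inter> modes N = {}" for S
  proof -
    have "sum g S + sum g S0 = sum g (S \<union> S0)" using that S0 N by (intro sum.union_disjoint[symmetric]) auto
    also have "\<dots> \<le> c" unfolding c_def using that S0 bddg by (intro cSUP_upper) auto
    finally have "sum g S \<le> \<eta>\<^sup>2" using S0 by simp
    then show ?thesis using assms by (auto simp: L2_set_def g_def intro!: real_le_lsqrt sum_nonneg)
  qed
  then show ?thesis by blast
qed

text \<open>The continuous image of a compact interval is precompact in \<open>H^s\<close>, so one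
  cut-off serves all its times.\<close>

lemma uniform_tail:
  assumes "0 < \<eta>"
  shows "\<exists>N. \<forall>t. \<bar>t\<bar> \<le> T \<longrightarrow> (\<forall>S. finite S \<longrightarrow> S \<inter> modes N = {} \<longrightarrow> L2_set (\<lambda>n. jb n powr s * cmod (a n t)) S \<le> \<eta>)"
proof -
  have "\<exists>N. \<forall>t\<in>{-T..T}. \<forall>S. finite S \<longrightarrow> S \<inter> modes N = {} \<longrightarrow> L2_set (\<lambda>n. jb n powr s * cmod (a n t)) S \<le> \<eta>"
  proof (rule compact_local_bound)
    fix t0 assume "t0 \<in> {-T..T}"
    obtain N where N: "\<And>S. finite S \<Longrightarrow> S \<inter> modes N = {} \<Longrightarrow> L2_set (\<lambda>n. jb n powr s * cmod (a n t0)) S \<le> \<eta> / 2"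
      using tail_at[of "\<eta> / 2" t0] assms by auto
    obtain d where d: "d > 0" "\<And>t S. dist t t0 < d \<Longrightarrow> finite S \<Longrightarrow> L2_set (\<lambda>n. jb n powr s * cmod (a n t - a n t0)) S \<le> \<eta> / 2"
      using cont[of "\<eta> / 2" t0] assms by auto
    have "L2_set (\<lambda>n. jb n powr s * cmod (a n t)) S \<le> \<eta>" if "dist t t0 < d" "finite S" "S \<inter> modes N = {}" for t S
      using L2_set_split[of t S t0] d(2)[OF that(1,2)] N[OF that(2,3)] by linarith
    then show "\<exists>d>0. \<exists>N. \<forall>t. dist t t0 < d \<longrightarrow> (\<forall>S. finite S \<longrightarrow> S \<inter> modes N = {} \<longrightarrow> L2_set (\<lambda>n. jb n powr s * cmod (a n t)) S \<le> \<eta>)"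
      using d(1) by blast
  next
    fix M N t assume "M \<le> N" and *: "\<forall>S. finite S \<longrightarrow> S \<inter> modes M = {} \<longrightarrow> L2_set (\<lambda>n. jb n powr s * cmod (a n t)) S \<le> \<eta>"
    then show "\<forall>S. finite S \<longrightarrow> S \<inter> modes N = {} \<longrightarrow> L2_set (\<lambda>n. jb n powr s * cmod (a n t)) S \<le> \<eta>"
      using modes_mono[OF \<open>M \<le> N\<close>] by blast
  qed auto
  then obtain N where N: "\<And>t S. t \<in> {-T..T} \<Longrightarrow> finite S \<Longrightarrow> S \<inter> modes N = {} \<Longrightarrow> L2_set (\<lambda>n. jb n powr s * cmod (a n t)) S \<le> \<eta>"
    by blast
  show ?thesis by (intro exI[of _ N] allI impI N) auto
qed

end

text \<open>The equation mode by mode. The nonlinearity \<open>F\<close> is prescribed as a limit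
  over truncations, so that the growth argument deals with trigonometric polynomials only.\<close>

locale nls_coeffs = hs_path s a for k :: nat and s :: real and a F :: "int \<Rightarrow> real \<Rightarrow> complex" +
  assumes k1: "1 \<le> k"
    and ode: "\<And>n t. (a n has_vector_derivative - \<i> * (of_int (n\<^sup>2) * a n t + F n t)) (at t)"
    and F: "\<And>n t. (\<lambda>N. fcoef (mono_fun (Suc k) k (galerkin a N t)) n) \<longlonglongrightarrow> F n t"
begin

definition gvel :: "nat \<Rightarrow> real \<Rightarrow> real \<Rightarrow> complex" where
  "gvel N t = tpoly (modes N) (\<lambda>n. - \<i> * (of_int (n\<^sup>2) * a n t + F n t))"

text \<open>The forcing: the excess of the full nonlinearity over that of the truncation. The linear
  part commutes with truncation and adds nothing.\<close>

definition gerr :: "nat \<Rightarrow> real \<Rightarrow> int \<Rightarrow> complex" where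
  "gerr N t n = F n t - fcoef (mono_fun (Suc k) k (galerkin a N t)) n"

lemma galerkin_state:
  assumes "L2_set (\<lambda>n. jb n powr s * cmod (gerr N t n)) (modes N) \<le> \<epsilon>" "wl2 1 (galerkin a N t) \<le> K"
  shows "galerkin_state k s K (modes N) (galerkin a N t) (gvel N t) (gerr N t) \<epsilon>"
  unfolding galerkin_state_def using assms fsupp_tpoly[OF finite_modes] trigp_tpoly[OF finite_modes]
  by (auto simp: fsupp_galerkin[THEN subsetD] gvel_def fcoef_tpoly fcoef_galerkin gerr_def)

text \<open>For \<open>N \<le> M\<close> two truncations differ by a tail of the path, uniformly
  small in time, and the nonlinearity is Lipschitz in \<open>H^s\<close>. The bound survives the
  limit in \<open>M\<close>, where the nonlinearity of the \<open>M\<close>-th truncation tends to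
  \<open>F\<close>.\<close>

lemma uniform_error:
  assumes "0 < \<epsilon>"
  shows "\<exists>N\<^sub>0. \<forall>N\<ge>N\<^sub>0. \<forall>t. \<bar>t\<bar> \<le> T \<longrightarrow> L2_set (\<lambda>n. jb n powr s * cmod (gerr N t n)) (modes N) \<le> \<epsilon>"
proof -
  obtain R where R: "\<And>t S. \<bar>t\<bar> \<le> T \<Longrightarrow> finite S \<Longrightarrow> L2_set (\<lambda>n. jb n powr s * cmod (a n t)) S \<le> R"
    using uniform_bound[of T] by blast
  obtain C where C: "C > 0" "\<And>f g. f \<in> trigp \<Longrightarrow> g \<in> trigp \<Longrightarrow> wl2 s f \<le> R \<Longrightarrow> wl2 s g \<le> R \<Longrightarrow>
      wl2 s (\<lambda>x. mono_fun (Suc k) k f x - mono_fun (Suc k) k g x) \<le> C * wl2 s (\<lambda>x. f x - g x)"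
    using wl2_mono_fun_lipschitz[OF s1, of R "Suc k" k] by blast
  have "0 < \<epsilon> / C" using assms C by simp
  then obtain N0 where N0: "\<And>t S. \<bar>t\<bar> \<le> T \<Longrightarrow> finite S \<Longrightarrow> S \<inter> modes N0 = {} \<Longrightarrow> L2_set (\<lambda>n. jb n powr s * cmod (a n t)) S \<le> \<epsilon> / C"
    using uniform_tail[of "\<epsilon> / C" T] by blast
  have "L2_set (\<lambda>n. jb n powr s * cmod (gerr N t n)) (modes N) \<le> \<epsilon>" if N: "N0 \<le> N" and t: "\<bar>t\<bar> \<le> T" for N t
  proof -
    let ?e = "\<lambda>M n. fcoef (mono_fun (Suc k) k (galerkin a M t)) n - fcoef (mono_fun (Suc k) k (galerkin a N t)) n"
    have lim: "(\<lambda>M. L2_set (\<lambda>n. jb n powr s * cmod (?e M n)) (modes N)) \<longlonglongrightarrow> L2_set (\<lambda>n. jb n powr s * cmod (gerr N t n)) (modes N)"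
      unfolding L2_set_def gerr_def by (intro tendsto_intros F)
    have "L2_set (\<lambda>n. jb n powr s * cmod (?e M n)) (modes N) \<le> \<epsilon>" if M: "N \<le> M" for M
    proof -
      have w: "wl2 s (galerkin a L t) \<le> R" for L unfolding wl2_galerkin by (intro R t) simp
      have diff: "(\<lambda>x. galerkin a M t x - galerkin a N t x) = tpoly (modes M - modes N) (\<lambda>n. a n t)"
        unfolding galerkin_def tpoly_def using modes_mono[OF M] by (simp add: sum_diff)
      have "wl2 s (\<lambda>x. galerkin a M t x - galerkin a N t x) = L2_set (\<lambda>n. jb n powr s * cmod (a n t)) (modes M - modes N)"
        unfolding diff by (subst wl2_eq[OF _ fsupp_tpoly]) (auto intro!: L2_set_cong simp: fcoef_tpoly)
      also have "\<dots> \<le> \<epsilon> / C" using modes_mono[OF N] by (intro N0 t) auto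
      finally have d: "wl2 s (\<lambda>x. galerkin a M t x - galerkin a N t x) \<le> \<epsilon> / C" .
      have tp: "mono_fun (Suc k) k (galerkin a L t) \<in> trigp" for L by (simp add: mono_fun_trigp)
      have "L2_set (\<lambda>n. jb n powr s * cmod (?e M n)) (modes N) =
        L2_set (\<lambda>n. jb n powr s * cmod (fcoef (\<lambda>x. mono_fun (Suc k) k (galerkin a M t) x - mono_fun (Suc k) k (galerkin a N t) x) n)) (modes N)"
        by (simp add: fcoef_diff trigp_continuous_on[OF tp])
      also have "\<dots> \<le> wl2 s (\<lambda>x. mono_fun (Suc k) k (galerkin a M t) x - mono_fun (Suc k) k (galerkin a N t) x)"
        by (intro L2_set_le_wl2 trigp_diff tp) simp
      also have "\<dots> \<le> C * wl2 s (\<lambda>x. galerkin a M t x - galerkin a N t x)"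
        by (intro C w) simp_all
      also have "\<dots> \<le> C * (\<epsilon> / C)" using C d by (intro mult_left_mono) auto
      finally show ?thesis using C by simp
    qed
    then show ?thesis by (intro LIMSEQ_le_const2[OF lim]) blast
  qed
  then show ?thesis by blast
qed

section \<open>Drift of mass and energy along the truncations, and the bound in
  \<open>H^1\<close>\<close>

lemma deriv_bound_imp:
  fixes f :: "real \<Rightarrow> real"
  assumes "\<And>\<tau>. \<bar>\<tau>\<bar> \<le> \<bar>t\<bar> \<Longrightarrow> (f has_real_derivative f' \<tau>) (at \<tau>)" "\<And>\<tau>. \<bar>\<tau>\<bar> \<le> \<bar>t\<bar> \<Longrightarrow> \<bar>f' \<tau>\<bar> \<le> B"
  shows "\<bar>f t - f 0\<bar> \<le> B * \<bar>t\<bar>"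
proof -
  have "norm (f t - f 0) \<le> B * norm (t - 0)"
    using assms by (intro field_differentiable_bound[where S = "{-\<bar>t\<bar>..\<bar>t\<bar>}" and f' = f'])
      (auto intro: has_field_derivative_at_within simp: abs_le_iff)
  then show ?thesis by simp
qed

lemma galerkin_path:
  "galerkin a N = (\<lambda>t. tpoly (modes N) (\<lambda>n. a n t))"
  by (simp add: galerkin_def fun_eq_iff)

lemma galerkin_mass_derivative:
  "((\<lambda>t. (wl2 0 (galerkin a N t))\<^sup>2) has_real_derivative
    2 * Re (\<Sum>n\<in>modes N. of_real (jb n powr (2 * 0)) * (cnj (fcoef (galerkin a N t) n) * fcoef (gvel N t) n))) (at t)"
  unfolding galerkin_path gvel_def by (intro weighted_sum_has_derivative ode) simp

lemma galerkin_energy_derivative: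
  "((\<lambda>t. trunc_energy k (modes N) (galerkin a N t)) has_real_derivative trunc_energy_rate k (modes N) (galerkin a N t) (gvel N t)) (at t)"
  unfolding galerkin_path gvel_def by (intro trunc_energy_has_derivative ode) simp

lemma galerkin_mod_energy_derivative:
  "((\<lambda>t. mod_energy k s (modes N) (galerkin a N t)) has_real_derivative energy_rate k s (modes N) (galerkin a N t) (gvel N t)) (at t)"
  unfolding galerkin_path gvel_def by (intro mod_energy_has_derivative ode) simp

text \<open>Mass and energy are almost conserved at a level \<open>M \<ge> N\<close> that is chosen
  large after \<open>\<delta>\<close>; since the norms increase with the level, the estimate
  descends to every \<open>N\<close>.\<close>

lemma h1_bound:
  assumes m0: "\<And>N. (wl2 0 (galerkin a N 0))\<^sup>2 \<le> m\<^sub>0"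
    and E0: "(\<lambda>N. trunc_energy k (modes N) (galerkin a N 0)) \<longlonglongrightarrow> E\<^sub>0"
  shows "(wl2 1 (galerkin a N t))\<^sup>2 \<le> 2 * E\<^sub>0 + m\<^sub>0"
proof -
  obtain R where R: "\<And>\<tau> S. \<bar>\<tau>\<bar> \<le> \<bar>t\<bar> \<Longrightarrow> finite S \<Longrightarrow> L2_set (\<lambda>n. jb n powr s * cmod (a n \<tau>)) S \<le> R"
    using uniform_bound[of "\<bar>t\<bar>"] by blast
  have wR: "wl2 s (galerkin a M \<tau>) \<le> R" if "\<bar>\<tau>\<bar> \<le> \<bar>t\<bar>" for M \<tau>
    unfolding wl2_galerkin by (intro R that) simp
  have R0: "0 \<le> R" by (rule order_trans[OF wl2_nonneg wR[of 0 0]]) simp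
  obtain C where C: "C > 0" "\<And>f. f \<in> trigp \<Longrightarrow> wl2 s f \<le> R \<Longrightarrow> wl2 s (mono_fun (Suc k) k f) \<le> C"
    using wl2_mono_fun_lipschitz[OF s1, of R "Suc k" k] by blast
  \<comment> \<open>The defocusing sign enters here: the potential energy is nonnegative, so mass
    plus twice the energy dominates the squared \<open>H^1\<close> norm.\<close>
  have lower: "(wl2 1 (galerkin a M \<tau>))\<^sup>2 \<le> (wl2 0 (galerkin a M \<tau>))\<^sup>2 + 2 * trunc_energy k (modes M) (galerkin a M \<tau>)" for M \<tau>
  proof -
    have "fcoef (mono_fun (Suc k) (Suc k) (galerkin a M \<tau>)) 0 =
        integral {0..2*pi} (\<lambda>x. complex_of_real ((cmod (galerkin a M \<tau> x)) ^ (2 * k + 2))) / (2 * pi)"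
    proof -
      have "z ^ Suc k * cnj z ^ Suc k = complex_of_real (cmod z ^ (2 * k + 2))" for z
      proof -
        have "z ^ Suc k * cnj z ^ Suc k = (complex_of_real ((cmod z)\<^sup>2)) ^ Suc k"
          by (simp only: complex_norm_square power_mult_distrib)
        also have "\<dots> = complex_of_real (((cmod z)\<^sup>2) ^ Suc k)" by (simp only: of_real_power)
        also have "((cmod z)\<^sup>2) ^ Suc k = cmod z ^ (2 * k + 2)" by (simp only: power_mult[symmetric]) simp
        finally show ?thesis .
      qed
      then show ?thesis by (simp only: fcoef_def mono_fun_def) simp
    qed
    also have "integral {0..2*pi} (\<lambda>x. complex_of_real ((cmod (galerkin a M \<tau> x)) ^ (2 * k + 2))) =
       complex_of_real (integral {0..2*pi} (\<lambda>x. (cmod (galerkin a M \<tau> x)) ^ (2 * k + 2)))"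
      by (rule integral_linear[unfolded o_def, OF _ bounded_linear_of_real])
         (intro integrable_continuous_real continuous_intros trigp_continuous_on, simp)
    finally have "Re (fcoef (mono_fun (Suc k) (Suc k) (galerkin a M \<tau>)) 0) =
       integral {0..2*pi} (\<lambda>x. (cmod (galerkin a M \<tau> x)) ^ (2 * k + 2)) / (2 * pi)"
      by simp
    also have "\<dots> \<ge> 0"
      by (intro divide_nonneg_nonneg integral_nonneg integrable_continuous_real continuous_intros trigp_continuous_on) auto
    finally have pos: "0 \<le> Re (fcoef (mono_fun (Suc k) (Suc k) (galerkin a M \<tau>)) 0) / (2 * real k + 2)" by simp
    have "(wl2 1 (galerkin a M \<tau>))\<^sup>2 = (wl2 0 (galerkin a M \<tau>))\<^sup>2 + (\<Sum>n\<in>modes M. (of_int n)\<^sup>2 * (cmod (fcoef (galerkin a M \<tau>) n))\<^sup>2)"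
      by (simp add: wl2_eq[OF finite_modes fsupp_galerkin] L2_set_def sum_nonneg power_mult_distrib jb_sq distrib_right sum.distrib)
    then show ?thesis using pos by (simp add: trunc_energy_def)
  qed
  have key: "(wl2 1 (galerkin a N t))\<^sup>2 \<le> 2 * E\<^sub>0 + m\<^sub>0 + \<delta>" if \<delta>: "0 < \<delta>" for \<delta>
  proof -
    \<comment> \<open>Total of the error coefficients: \<open>2 * R\<close> for the drift of the
      mass and \<open>2 * (R + C)\<close> for that of twice the energy, each over a time
      \<open>\<bar>t\<bar>\<close>, and 2 for the initial energy.\<close>
    define B where "B = \<bar>t\<bar> * (2 * R + 2 * (R + C)) + 2"
    have B: "0 < B" using R0 C by (auto simp: B_def intro!: add_nonneg_pos)
    define \<epsilon> where "\<epsilon> = \<delta> / B"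
    have \<epsilon>: "0 < \<epsilon>" using \<delta> B by (simp add: \<epsilon>_def)
    obtain N0 where N0: "\<And>M \<tau>. N0 \<le> M \<Longrightarrow> \<bar>\<tau>\<bar> \<le> \<bar>t\<bar> \<Longrightarrow> L2_set (\<lambda>n. jb n powr s * cmod (gerr M \<tau> n)) (modes M) \<le> \<epsilon>"
      using uniform_error[OF \<epsilon>, of "\<bar>t\<bar>"] by blast
    obtain N1 where N1: "\<And>M. N1 \<le> M \<Longrightarrow> \<bar>trunc_energy k (modes M) (galerkin a M 0) - E\<^sub>0\<bar> < \<epsilon>"
      using LIMSEQ_D[OF E0 \<epsilon>] by (auto simp: real_norm_def)
    define M where "M = max N (max N0 N1)"
    have M: "N \<le> M" "N0 \<le> M" "N1 \<le> M" by (auto simp: M_def)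
    have gs: "galerkin_state k s (wl2 1 (galerkin a M \<tau>)) (modes M) (galerkin a M \<tau>) (gvel M \<tau>) (gerr M \<tau>) \<epsilon>" if "\<bar>\<tau>\<bar> \<le> \<bar>t\<bar>" for \<tau>
      by (intro galerkin_state N0 M that) simp
    have "\<bar>(wl2 0 (galerkin a M t))\<^sup>2 - (wl2 0 (galerkin a M 0))\<^sup>2\<bar> \<le> (2 * R * \<epsilon>) * \<bar>t\<bar>"
    proof (rule deriv_bound_imp[OF galerkin_mass_derivative])
      fix \<tau> assume \<tau>: "\<bar>\<tau>\<bar> \<le> \<bar>t\<bar>"
      have "wl2 0 (galerkin a M \<tau>) \<le> R" using wl2_mono_exp[of 0 s "galerkin a M \<tau>"] s1 wR[OF \<tau>, of M] by simp
      then have "2 * wl2 0 (galerkin a M \<tau>) * \<epsilon> \<le> 2 * R * \<epsilon>" using \<epsilon> by simp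
      then show "\<bar>2 * Re (\<Sum>n\<in>modes M. of_real (jb n powr (2 * 0)) * (cnj (fcoef (galerkin a M \<tau>) n) * fcoef (gvel M \<tau>) n))\<bar> \<le> 2 * R * \<epsilon>"
        using mass_rate_bound[OF gs[OF \<tau>]] s1 by linarith
    qed
    moreover have "\<bar>trunc_energy k (modes M) (galerkin a M t) - trunc_energy k (modes M) (galerkin a M 0)\<bar> \<le> (\<epsilon> * (R + C)) * \<bar>t\<bar>"
    proof (rule deriv_bound_imp[OF galerkin_energy_derivative])
      fix \<tau> assume \<tau>: "\<bar>\<tau>\<bar> \<le> \<bar>t\<bar>"
      have "wl2 0 (mono_fun (Suc k) k (galerkin a M \<tau>)) \<le> C"
        using wl2_mono_exp[of 0 s "mono_fun (Suc k) k (galerkin a M \<tau>)"] s1 C(2)[OF galerkin_trigp wR[OF \<tau>], of M] by simp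
      then have "\<epsilon> * (wl2 s (galerkin a M \<tau>) + wl2 0 (mono_fun (Suc k) k (galerkin a M \<tau>))) \<le> \<epsilon> * (R + C)"
        using wR[OF \<tau>, of M] \<epsilon> by (intro mult_left_mono add_mono) auto
      then show "\<bar>trunc_energy_rate k (modes M) (galerkin a M \<tau>) (gvel M \<tau>)\<bar> \<le> \<epsilon> * (R + C)"
        using trunc_energy_rate_bound[OF gs[OF \<tau>] s1] by linarith
    qed
    moreover have combine: "x \<le> m + p + 2 * (E + r + q)"
      if "\<bar>y - y'\<bar> \<le> p" "\<bar>z - z'\<bar> \<le> q" "x \<le> x'" "x' \<le> y + 2 * z" "y' \<le> m" "\<bar>z' - E\<bar> < r"
      for x x' y y' z z' p q m E r :: real
    proof -
      have "y \<le> y' + p" using that(1) by (simp add: abs_le_iff)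
      moreover have "z \<le> z' + q" using that(2) by (simp add: abs_le_iff)
      moreover have "z' \<le> E + r" using that(6) by (simp add: abs_less_iff)
      ultimately show ?thesis unfolding distrib_left using that(3-5) by linarith
    qed
    moreover have "(wl2 1 (galerkin a N t))\<^sup>2 \<le> (wl2 1 (galerkin a M t))\<^sup>2"
      by (intro power_mono wl2_galerkin_mono M) auto
    ultimately have "(wl2 1 (galerkin a N t))\<^sup>2 \<le> m\<^sub>0 + (2 * R * \<epsilon>) * \<bar>t\<bar> + 2 * (E\<^sub>0 + \<epsilon> + (\<epsilon> * (R + C)) * \<bar>t\<bar>)"
      using lower[of M t] m0[of M] N1[OF M(3)] combine by blast
    also have "\<dots> = 2 * E\<^sub>0 + m\<^sub>0 + \<epsilon> * B" by (simp add: B_def algebra_simps)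
    finally show ?thesis using B by (simp add: \<epsilon>_def)
  qed
  show ?thesis by (rule field_le_epsilon) (use key in auto)
qed

end

section \<open>Polynomial growth\<close>

text \<open>At frequencies with \<open>(jb n)\<^sup>2 \<ge> 1 / \<eta>\<close> the weight of order
  \<open>s - 1\<close> is small against that of order \<open>s\<close>; at the others it is bounded,
  and the \<open>H^1\<close> norm takes over.\<close>

lemma wl2_absorb:
  assumes "0 < \<eta>" "1 \<le> s" and f: "f \<in> trigp"
  shows "(wl2 (s - 1) f)\<^sup>2 \<le> \<eta> * (wl2 s f)\<^sup>2 + (1 / \<eta>) powr (s - 1) * (wl2 1 f)\<^sup>2"
proof -
  have w: "(jb n powr (s - 1))\<^sup>2 \<le> \<eta> * (jb n powr s)\<^sup>2 + (1 / \<eta>) powr (s - 1) * (jb n powr 1)\<^sup>2" for n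
  proof (cases "1 / \<eta> \<le> (jb n)\<^sup>2")
    case True
    have "jb n powr s = jb n powr (s - 1) * jb n" using powr_add[of "jb n" "s - 1" 1] by simp
    then have "\<eta> * (jb n powr s)\<^sup>2 = (\<eta> * (jb n)\<^sup>2) * (jb n powr (s - 1))\<^sup>2" by (simp add: power_mult_distrib)
    moreover have "1 \<le> \<eta> * (jb n)\<^sup>2" using True assms(1) by (simp add: field_simps)
    ultimately have "(jb n powr (s - 1))\<^sup>2 \<le> \<eta> * (jb n powr s)\<^sup>2"
      using mult_right_mono[of 1 "\<eta> * (jb n)\<^sup>2" "(jb n powr (s - 1))\<^sup>2"] by (metis mult_1 zero_le_power2)
    then show ?thesis by (simp add: add_increasing2)
  next
    case False
    have "(jb n powr (s - 1))\<^sup>2 = ((jb n)\<^sup>2) powr (s - 1)" by (simp add: power2_eq_square powr_mult)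
    also have "\<dots> \<le> (1 / \<eta>) powr (s - 1)" using False assms by (intro powr_mono2) auto
    also have "\<dots> \<le> (1 / \<eta>) powr (s - 1) * (jb n powr 1)\<^sup>2" by (simp add: mult_le_cancel_left1)
    finally show ?thesis using assms(1) by (simp add: add_increasing)
  qed
  have "(wl2 (s - 1) f)\<^sup>2 = (\<Sum>n\<in>fsupp f. (jb n powr (s - 1))\<^sup>2 * (cmod (fcoef f n))\<^sup>2)"
    by (simp add: wl2_def L2_set_def sum_nonneg power_mult_distrib)
  also have "\<dots> \<le> (\<Sum>n\<in>fsupp f. (\<eta> * (jb n powr s)\<^sup>2 + (1 / \<eta>) powr (s - 1) * (jb n powr 1)\<^sup>2) * (cmod (fcoef f n))\<^sup>2)"
    by (intro sum_mono mult_right_mono w) auto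
  also have "\<dots> = \<eta> * (wl2 s f)\<^sup>2 + (1 / \<eta>) powr (s - 1) * (wl2 1 f)\<^sup>2"
    by (simp add: wl2_def L2_set_def sum_nonneg power_mult_distrib distrib_right sum.distrib sum_distrib_left mult.assoc)
  finally show ?thesis .
qed

lemma powr_sq_half:
  fixes x :: real
  assumes "0 \<le> x"
  shows "(x\<^sup>2) powr (c / 2) = x powr c"
proof (cases "x = 0")
  case False
  then have "x\<^sup>2 = x powr 2" using assms by simp
  then show ?thesis by (simp add: powr_powr)
qed simp

text \<open>Up to truncation errors the energy inequality reads
  \<open>Q' \<le> C * Q^(1 - \<gamma>/2) * \<kappa>^\<gamma>\<close> for a \<open>Q\<close>
  comparable with \<open>X^2 + \<kappa>^2\<close>, so \<open>y = Q^(\<gamma>/2)\<close> grows at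
  most linearly and \<open>X\<close> like the power \<open>1 / \<gamma> = 2 * s\<close>. Of the two
  bounds on the \<open>H^1\<close> norm, \<open>K\<close> enters the constants, while
  \<open>\<kappa>\<close> is tracked explicitly so that the result is homogeneous in
  \<open>X\<^sub>0 + \<kappa>\<close>.\<close>

lemma growth:
  assumes s: "1 < s" and k: "1 \<le> k"
  shows "\<exists>C>0. \<forall>a F \<kappa> X\<^sub>0. nls_coeffs k s a F \<longrightarrow> 0 < \<kappa> \<longrightarrow>
    (\<forall>N t. wl2 1 (galerkin a N t) \<le> K \<and> wl2 1 (galerkin a N t) \<le> \<kappa>) \<longrightarrow> (\<forall>N. wl2 s (galerkin a N 0) \<le> X\<^sub>0) \<longrightarrow>
    (\<forall>N t. wl2 s (galerkin a N t) \<le> C * (1 + \<bar>t\<bar>) powr (2 * s) * (X\<^sub>0 + \<kappa>))"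
proof -
  define \<theta> where "\<theta> = (s - 1) / (2 * s)"
  define \<gamma> where "\<gamma> = 1 / (2 * s)"
  have \<gamma>: "0 < \<gamma>" "\<gamma> < 1" using s by (auto simp: \<gamma>_def)
  \<comment> \<open>Interpolation between \<open>H^s\<close> and \<open>H^1\<close>: this identity
    fixes \<open>\<gamma>\<close> in terms of \<open>\<theta>\<close>.\<close>
  have s\<theta>: "s - \<theta> = (1 - \<gamma>) * s + \<gamma> * 1" using s by (simp add: \<theta>_def \<gamma>_def field_simps)
  obtain C1 where C1: "C1 > 0" "\<forall>S v vt e \<epsilon>. galerkin_state k s K S v vt e \<epsilon> \<longrightarrow>
    \<bar>energy_rate k s S v vt\<bar> \<le> C1 * (wl2 s v * wl2 (s - \<theta>) v + \<epsilon> * (wl2 s v + (wl2 s v)\<^sup>2))"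
    using energy_rate_bound[OF s \<theta>_def k, of K] by (elim exE conjE) (rule that)
  obtain C2 where C2: "C2 > 0" "\<And>S v. finite S \<Longrightarrow> v \<in> trigp \<Longrightarrow> fsupp v \<subseteq> S \<Longrightarrow> wl2 1 v \<le> K \<Longrightarrow>
    \<bar>mod_energy k s S v - (wl2 s v)\<^sup>2\<bar> \<le> C2 * (wl2 (s - 1) v)\<^sup>2"
    using mod_energy_near[OF less_imp_le[OF s] k, of K] by blast
  \<comment> \<open>The constant of \<open>wl2_absorb\<close> for
    \<open>\<eta> = 1 / (2 * C2)\<close>, which after multiplication by \<open>C2\<close> costs just
    half of the squared norm.\<close>
  define C\<eta> where "C\<eta> = (1 / (1 / (2 * C2))) powr (s - 1)"
  \<comment> \<open>The \<open>+ 1\<close> yields \<open>Q \<ge> \<kappa>\<^sup>2 > 0\<close>, so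
    that the fractional power of \<open>Q\<close> can be differentiated.\<close>
  define C3 where "C3 = C2 * C\<eta> + 1"
  have C3: "0 < C3" using C2 by (auto simp: C3_def C\<eta>_def intro!: add_nonneg_pos)
  define C4 where "C4 = 1 + C2 + C3"
  have C4: "0 < C4" using C2 C3 by (auto simp: C4_def)
  define C7 where "C7 = 2 * C4 powr (\<gamma> / 2) + 2 * (C1 * \<gamma>)"
  have C7: "0 < C7" using C4 C1 \<gamma> by (auto simp: C7_def intro!: add_pos_pos)
  have main: "wl2 s (galerkin a N t) \<le> C7 powr (2 * s) * (1 + \<bar>t\<bar>) powr (2 * s) * (X0 + \<kappa>)"
    if nc: "nls_coeffs k s a F" and \<kappa>: "0 < \<kappa>" and K: "\<And>N t. wl2 1 (galerkin a N t) \<le> K"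
      and W: "\<And>N t. wl2 1 (galerkin a N t) \<le> \<kappa>" and X0: "\<And>N. wl2 s (galerkin a N 0) \<le> X0"
    for a F \<kappa> X0 N t
  proof -
    interpret nls_coeffs k s a F by (rule nc)
    have X00: "0 \<le> X0" using X0[of 0] wl2_nonneg order_trans by blast
    define X where "X M \<tau> = wl2 s (galerkin a M \<tau>)" for M \<tau>
    define Q where "Q M \<tau> = mod_energy k s (modes M) (galerkin a M \<tau>) + C3 * \<kappa>\<^sup>2" for M \<tau>
    have X_nn: "0 \<le> X M \<tau>" for M \<tau> by (simp add: X_def)
    have near: "\<bar>mod_energy k s (modes M) (galerkin a M \<tau>) - (X M \<tau>)\<^sup>2\<bar> \<le> C2 * (wl2 (s - 1) (galerkin a M \<tau>))\<^sup>2" for M \<tau>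
      unfolding X_def by (intro C2 K fsupp_galerkin) simp_all
    have Wsq: "(wl2 1 (galerkin a M \<tau>))\<^sup>2 \<le> \<kappa>\<^sup>2" for M \<tau> by (intro power_mono W) simp
    have Qlow: "(X M \<tau>)\<^sup>2 / 2 + \<kappa>\<^sup>2 \<le> Q M \<tau>" for M \<tau>
    proof -
      have "C2 * (wl2 (s - 1) (galerkin a M \<tau>))\<^sup>2 \<le> C2 * ((1 / (2 * C2)) * (X M \<tau>)\<^sup>2 + C\<eta> * (wl2 1 (galerkin a M \<tau>))\<^sup>2)"
        unfolding X_def C\<eta>_def using C2 s by (intro mult_left_mono wl2_absorb) auto
      also have "\<dots> \<le> C2 * ((1 / (2 * C2)) * (X M \<tau>)\<^sup>2 + C\<eta> * \<kappa>\<^sup>2)"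
        using C2 by (intro mult_left_mono add_left_mono Wsq) (auto simp: C\<eta>_def)
      also have "\<dots> = (X M \<tau>)\<^sup>2 / 2 + (C3 - 1) * \<kappa>\<^sup>2" using C2 by (simp add: C3_def field_simps)
      finally have "C2 * (wl2 (s - 1) (galerkin a M \<tau>))\<^sup>2 \<le> (X M \<tau>)\<^sup>2 / 2 + (C3 - 1) * \<kappa>\<^sup>2" .
      then have "C2 * (wl2 (s - 1) (galerkin a M \<tau>))\<^sup>2 \<le> (X M \<tau>)\<^sup>2 / 2 + C3 * \<kappa>\<^sup>2 - \<kappa>\<^sup>2" by (simp add: left_diff_distrib)
      then show ?thesis using near[of M \<tau>] by (simp add: Q_def abs_le_iff)
    qed
    have Qup: "Q M \<tau> \<le> C4 * ((X M \<tau>)\<^sup>2 + \<kappa>\<^sup>2)" for M \<tau>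
    proof -
      have "(wl2 (s - 1) (galerkin a M \<tau>))\<^sup>2 \<le> (X M \<tau>)\<^sup>2"
        unfolding X_def by (intro power_mono wl2_mono_exp) auto
      then have "C2 * (wl2 (s - 1) (galerkin a M \<tau>))\<^sup>2 \<le> C2 * (X M \<tau>)\<^sup>2" using C2 by simp
      then have "Q M \<tau> \<le> (1 + C2) * (X M \<tau>)\<^sup>2 + C3 * \<kappa>\<^sup>2"
        using near[of M \<tau>] by (simp add: Q_def abs_le_iff distrib_right)
      also have "\<dots> \<le> C4 * (X M \<tau>)\<^sup>2 + C4 * \<kappa>\<^sup>2"
        using C2 C3 by (intro add_mono mult_right_mono) (auto simp: C4_def)
      finally show ?thesis by (simp add: distrib_left)
    qed
    have \<kappa>2: "0 < \<kappa>\<^sup>2" using \<kappa> by simp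
    have Q\<kappa>: "\<kappa>\<^sup>2 \<le> Q M \<tau>" for M \<tau> using Qlow[of M \<tau>] zero_le_power2[of "X M \<tau>"] by linarith
    have Qpos: "0 < Q M \<tau>" for M \<tau> using Q\<kappa>[of M \<tau>] \<kappa>2 by linarith
    have XQ: "(X M \<tau>)\<^sup>2 \<le> 2 * Q M \<tau>" for M \<tau> using Qlow[of M \<tau>] \<kappa>2 by linarith
    define y where "y M \<tau> = Q M \<tau> powr (\<gamma> / 2)" for M \<tau>
    have Xy: "X M \<tau> powr \<gamma> \<le> 2 * y M \<tau>" for M \<tau>
    proof -
      have "X M \<tau> powr \<gamma> = ((X M \<tau>)\<^sup>2) powr (\<gamma> / 2)" using powr_sq_half[OF X_nn] by simp
      also have "\<dots> \<le> (2 * Q M \<tau>) powr (\<gamma> / 2)" using \<gamma> XQ by (intro powr_mono2) auto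
      also have "\<dots> = 2 powr (\<gamma> / 2) * y M \<tau>" using Qpos[of M \<tau>] by (simp add: powr_mult y_def)
      also have "\<dots> \<le> 2 powr 1 * y M \<tau>" using \<gamma> by (intro mult_right_mono powr_mono) (auto simp: y_def)
      finally show ?thesis by simp
    qed
    define D where "D = X0 + \<kappa>"
    have D: "0 < D" "\<kappa> \<le> D" using X00 \<kappa> by (auto simp: D_def)
    have y0: "y M 0 \<le> C4 powr (\<gamma> / 2) * D powr \<gamma>" for M
    proof -
      have "(X M 0)\<^sup>2 + \<kappa>\<^sup>2 \<le> D\<^sup>2"
      proof -
        have "(X M 0)\<^sup>2 \<le> X0\<^sup>2" using X0 by (intro power_mono) (auto simp: X_def)
        moreover have "X0\<^sup>2 + \<kappa>\<^sup>2 \<le> D\<^sup>2" using X00 \<kappa> by (simp add: D_def power2_sum)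
        ultimately show ?thesis by linarith
      qed
      then have "C4 * ((X M 0)\<^sup>2 + \<kappa>\<^sup>2) \<le> C4 * D\<^sup>2" using C4 by simp
      then have "y M 0 \<le> (C4 * D\<^sup>2) powr (\<gamma> / 2)"
        unfolding y_def using Qup[of M 0] Qpos[of M 0] \<gamma> by (intro powr_mono2) auto
      also have "\<dots> = C4 powr (\<gamma> / 2) * D powr \<gamma>"
        using C4 D powr_sq_half[of D \<gamma>] by (simp add: powr_mult)
      finally show ?thesis .
    qed
    obtain R where R: "\<And>\<tau> S. \<bar>\<tau>\<bar> \<le> \<bar>t\<bar> \<Longrightarrow> finite S \<Longrightarrow> L2_set (\<lambda>n. jb n powr s * cmod (a n \<tau>)) S \<le> R"
      using uniform_bound[of "\<bar>t\<bar>"] by blast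
    have XR: "X M \<tau> \<le> R" if "\<bar>\<tau>\<bar> \<le> \<bar>t\<bar>" for M \<tau>
      unfolding X_def wl2_galerkin by (intro R that) simp
    have R0: "0 \<le> R" using XR[of 0 0] X_nn[of 0 0] by simp
    \<comment> \<open>Depends on the uncontrolled bound \<open>R\<close> for the path up to time
      \<open>\<bar>t\<bar>\<close>; it may therefore occur only together with
      \<open>\<epsilon>\<close>. Bounding the negative power of \<open>Q\<close> uses
      \<open>Q \<ge> \<kappa>\<^sup>2\<close>.\<close>
    define C6 where "C6 = \<gamma> / 2 * (\<kappa>\<^sup>2) powr (\<gamma> / 2 - 1) * (C1 * (R + R\<^sup>2))"
    have C6: "0 \<le> C6" using \<gamma> C1 R0 by (auto simp: C6_def)
    have key: "X N t powr \<gamma> \<le> D powr \<gamma> * C7 * (1 + \<bar>t\<bar>) + \<delta>" if \<delta>: "0 < \<delta>" for \<delta>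
    proof -
      define \<epsilon> where "\<epsilon> = \<delta> / (2 * (C6 * \<bar>t\<bar>) + 1)"
      have den: "0 < 2 * (C6 * \<bar>t\<bar>) + 1" using C6 by (intro add_nonneg_pos) auto
      have \<epsilon>: "0 < \<epsilon>" using \<delta> den by (simp add: \<epsilon>_def)
      obtain N0 where N0: "\<And>M \<tau>. N0 \<le> M \<Longrightarrow> \<bar>\<tau>\<bar> \<le> \<bar>t\<bar> \<Longrightarrow> L2_set (\<lambda>n. jb n powr s * cmod (gerr M \<tau> n)) (modes M) \<le> \<epsilon>"
        using uniform_error[OF \<epsilon>, of "\<bar>t\<bar>"] by blast
      define M where "M = max N N0"
      have M: "N \<le> M" "N0 \<le> M" by (auto simp: M_def)
      have "\<bar>y M t - y M 0\<bar> \<le> (C1 * \<gamma> * \<kappa> powr \<gamma> + C6 * \<epsilon>) * \<bar>t\<bar>"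
      proof (rule deriv_bound_imp)
        fix \<tau>
        have "((\<lambda>\<tau>. Q M \<tau>) has_real_derivative energy_rate k s (modes M) (galerkin a M \<tau>) (gvel M \<tau>)) (at \<tau>)"
          unfolding Q_def using DERIV_add[OF galerkin_mod_energy_derivative DERIV_const] by simp
        from DERIV_chain2[OF has_real_derivative_powr[where r = "\<gamma> / 2", OF Qpos] this]
        show "((\<lambda>\<tau>. y M \<tau>) has_real_derivative
            (\<gamma> / 2 * Q M \<tau> powr (\<gamma> / 2 - 1)) * energy_rate k s (modes M) (galerkin a M \<tau>) (gvel M \<tau>)) (at \<tau>)"
          unfolding y_def .
        assume \<tau>: "\<bar>\<tau>\<bar> \<le> \<bar>t\<bar>"
        have gs: "galerkin_state k s K (modes M) (galerkin a M \<tau>) (gvel M \<tau>) (gerr M \<tau>) \<epsilon>"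
          by (intro galerkin_state N0 M \<tau> K)
        have "wl2 (s - \<theta>) (galerkin a M \<tau>) \<le> X M \<tau> powr (1 - \<gamma>) * wl2 1 (galerkin a M \<tau>) powr \<gamma>"
          unfolding X_def using \<gamma> s\<theta> by (intro wl2_interpolate) auto
        also have "\<dots> \<le> X M \<tau> powr (1 - \<gamma>) * \<kappa> powr \<gamma>"
          using \<gamma> W by (intro mult_left_mono powr_mono2) auto
        finally have "X M \<tau> * wl2 (s - \<theta>) (galerkin a M \<tau>) \<le> X M \<tau> * (X M \<tau> powr (1 - \<gamma>) * \<kappa> powr \<gamma>)"
          using X_nn by (intro mult_left_mono) auto
        also have "\<dots> = ((X M \<tau>)\<^sup>2) powr (1 - \<gamma> / 2) * \<kappa> powr \<gamma>"
        proof (cases "X M \<tau> = 0")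
          case False
          then have "0 < X M \<tau>" using X_nn[of M \<tau>] by linarith
          then have "X M \<tau> * X M \<tau> powr (1 - \<gamma>) = X M \<tau> powr (2 - \<gamma>)"
            using powr_add[of "X M \<tau>" 1 "1 - \<gamma>"] by simp
          also have "\<dots> = ((X M \<tau>)\<^sup>2) powr ((2 - \<gamma>) / 2)" using powr_sq_half[OF X_nn] by simp
          also have "(2 - \<gamma>) / 2 = 1 - \<gamma> / 2" by simp
          finally show ?thesis by simp
        qed simp
        also have "\<dots> \<le> (2 * Q M \<tau>) powr (1 - \<gamma> / 2) * \<kappa> powr \<gamma>"
          using \<gamma> XQ by (intro mult_right_mono powr_mono2) auto
        also have "\<dots> = 2 powr (1 - \<gamma> / 2) * Q M \<tau> powr (1 - \<gamma> / 2) * \<kappa> powr \<gamma>"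
          using Qpos[of M \<tau>] by (simp add: powr_mult)
        also have "\<dots> \<le> 2 powr 1 * Q M \<tau> powr (1 - \<gamma> / 2) * \<kappa> powr \<gamma>"
          using \<gamma> by (intro mult_right_mono powr_mono) auto
        finally have XZ: "X M \<tau> * wl2 (s - \<theta>) (galerkin a M \<tau>) \<le> 2 * Q M \<tau> powr (1 - \<gamma> / 2) * \<kappa> powr \<gamma>" by simp
        have XX: "X M \<tau> + (X M \<tau>)\<^sup>2 \<le> R + R\<^sup>2" using XR[OF \<tau>, of M] X_nn by (intro add_mono power_mono) auto
        have "\<bar>energy_rate k s (modes M) (galerkin a M \<tau>) (gvel M \<tau>)\<bar> \<le>
            C1 * (X M \<tau> * wl2 (s - \<theta>) (galerkin a M \<tau>) + \<epsilon> * (X M \<tau> + (X M \<tau>)\<^sup>2))"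
          using C1(2)[rule_format, OF gs] by (simp add: X_def)
        also have "\<dots> \<le> C1 * (2 * Q M \<tau> powr (1 - \<gamma> / 2) * \<kappa> powr \<gamma> + \<epsilon> * (R + R\<^sup>2))"
          using C1(1) \<epsilon> by (intro mult_left_mono add_mono[OF XZ mult_left_mono[OF XX]]) auto
        finally have E: "\<bar>energy_rate k s (modes M) (galerkin a M \<tau>) (gvel M \<tau>)\<bar> \<le>
            C1 * (2 * Q M \<tau> powr (1 - \<gamma> / 2) * \<kappa> powr \<gamma> + \<epsilon> * (R + R\<^sup>2))" .
        have "\<bar>(\<gamma> / 2 * Q M \<tau> powr (\<gamma> / 2 - 1)) * energy_rate k s (modes M) (galerkin a M \<tau>) (gvel M \<tau>)\<bar> =
            (\<gamma> / 2 * Q M \<tau> powr (\<gamma> / 2 - 1)) * \<bar>energy_rate k s (modes M) (galerkin a M \<tau>) (gvel M \<tau>)\<bar>"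
          using \<gamma> by (simp add: abs_mult)
        also have "\<dots> \<le> (\<gamma> / 2 * Q M \<tau> powr (\<gamma> / 2 - 1)) * (C1 * (2 * Q M \<tau> powr (1 - \<gamma> / 2) * \<kappa> powr \<gamma> + \<epsilon> * (R + R\<^sup>2)))"
          using \<gamma> by (intro mult_left_mono E) auto
        also have "\<dots> = C1 * \<gamma> * \<kappa> powr \<gamma> * (Q M \<tau> powr (\<gamma> / 2 - 1) * Q M \<tau> powr (1 - \<gamma> / 2)) +
            \<gamma> / 2 * Q M \<tau> powr (\<gamma> / 2 - 1) * (C1 * (R + R\<^sup>2)) * \<epsilon>"
          by (simp add: algebra_simps)
        also have "Q M \<tau> powr (\<gamma> / 2 - 1) * Q M \<tau> powr (1 - \<gamma> / 2) = 1"
          using Qpos[of M \<tau>] by (simp flip: powr_add)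
        also have "C1 * \<gamma> * \<kappa> powr \<gamma> * 1 + \<gamma> / 2 * Q M \<tau> powr (\<gamma> / 2 - 1) * (C1 * (R + R\<^sup>2)) * \<epsilon> \<le>
            C1 * \<gamma> * \<kappa> powr \<gamma> * 1 + C6 * \<epsilon>"
          unfolding C6_def using \<gamma> C1(1) R0 \<epsilon> \<kappa>2 Q\<kappa>[of M \<tau>]
          by (intro add_left_mono mult_right_mono mult_left_mono powr_mono2') auto
        finally show "\<bar>(\<gamma> / 2 * Q M \<tau> powr (\<gamma> / 2 - 1)) * energy_rate k s (modes M) (galerkin a M \<tau>) (gvel M \<tau>)\<bar> \<le>
            C1 * \<gamma> * \<kappa> powr \<gamma> + C6 * \<epsilon>" by simp
      qed
      then have yM: "y M t \<le> C4 powr (\<gamma> / 2) * D powr \<gamma> + (C1 * \<gamma> * \<kappa> powr \<gamma> + C6 * \<epsilon>) * \<bar>t\<bar>"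
        using y0[of M] by linarith
      have "X N t powr \<gamma> \<le> X M t powr \<gamma>"
        unfolding X_def using \<gamma> by (intro powr_mono2 wl2_galerkin_mono M) auto
      also have "\<dots> \<le> 2 * y M t" by (rule Xy)
      also have "\<dots> \<le> 2 * (C4 powr (\<gamma> / 2) * D powr \<gamma> + (C1 * \<gamma> * \<kappa> powr \<gamma> + C6 * \<epsilon>) * \<bar>t\<bar>)"
        using yM by simp
      also have "\<dots> \<le> 2 * (C4 powr (\<gamma> / 2) * D powr \<gamma> * (1 + \<bar>t\<bar>) + (C1 * \<gamma> * D powr \<gamma>) * (1 + \<bar>t\<bar>) + C6 * \<epsilon> * \<bar>t\<bar>)"
      proof -
        have "C4 powr (\<gamma> / 2) * D powr \<gamma> * 1 \<le> C4 powr (\<gamma> / 2) * D powr \<gamma> * (1 + \<bar>t\<bar>)"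
          by (intro mult_left_mono) auto
        moreover have "(C1 * \<gamma> * \<kappa> powr \<gamma>) * \<bar>t\<bar> \<le> (C1 * \<gamma> * D powr \<gamma>) * (1 + \<bar>t\<bar>)"
          using C1 \<gamma> \<kappa> D by (intro mult_mono powr_mono2) auto
        ultimately show ?thesis by (simp add: distrib_right)
      qed
      also have "\<dots> = D powr \<gamma> * C7 * (1 + \<bar>t\<bar>) + 2 * (C6 * \<bar>t\<bar>) * \<epsilon>"
        by (simp add: C7_def algebra_simps)
      also have "2 * (C6 * \<bar>t\<bar>) * \<epsilon> \<le> \<delta>"
      proof -
        have "2 * (C6 * \<bar>t\<bar>) * \<epsilon> \<le> (2 * (C6 * \<bar>t\<bar>) + 1) * \<epsilon>" using \<epsilon> by (intro mult_right_mono) auto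
        also have "\<dots> = \<delta>" using den by (simp add: \<epsilon>_def)
        finally show ?thesis .
      qed
      finally show ?thesis by simp
    qed
    \<comment> \<open>Letting \<open>\<delta>\<close> tend to zero removes the truncation error and
      with it \<open>R\<close>; the power \<open>2 * s = 1 / \<gamma>\<close> then returns to
      \<open>X\<close>.\<close>
    have "X N t powr \<gamma> \<le> D powr \<gamma> * C7 * (1 + \<bar>t\<bar>)"
      by (rule field_le_epsilon) (use key in auto)
    then have "(X N t powr \<gamma>) powr (2 * s) \<le> (D powr \<gamma> * C7 * (1 + \<bar>t\<bar>)) powr (2 * s)"
      using s by (intro powr_mono2) auto
    moreover have "(X N t powr \<gamma>) powr (2 * s) = X N t" using s X_nn by (simp add: powr_powr \<gamma>_def)
    moreover have "(D powr \<gamma> * C7 * (1 + \<bar>t\<bar>)) powr (2 * s) = D * C7 powr (2 * s) * (1 + \<bar>t\<bar>) powr (2 * s)"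
      using s D C7 by (simp add: powr_mult powr_powr \<gamma>_def)
    ultimately show ?thesis by (simp add: X_def D_def mult_ac)
  qed
  show ?thesis
    by (rule exI[of _ "C7 powr (2 * s)"]) (use C7 main in auto)
qed

text \<open>Once \<open>K\<close> bounds the Wiener norm, mass and energy at time 0 are at most
  quadratic in \<open>X\<^sub>0\<close>, so the \<open>H^1\<close> norm stays below
  \<open>c * X\<^sub>0\<close>. With \<open>\<kappa> = c * X\<^sub>0\<close> the growth bound
  becomes linear in the initial norm; for \<open>s = 1\<close> the \<open>H^1\<close> bound is
  already the claim.\<close>

lemma growth_linear:
  assumes s: "1 \<le> s" and k: "1 \<le> k"
  shows "\<exists>C>0. \<forall>a F E\<^sub>0 X\<^sub>0. nls_coeffs k s a F \<longrightarrow>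
    (\<forall>N t. wl2 1 (galerkin a N t) \<le> K) \<longrightarrow> (\<lambda>N. trunc_energy k (modes N) (galerkin a N 0)) \<longlonglongrightarrow> E\<^sub>0 \<longrightarrow>
    0 < X\<^sub>0 \<longrightarrow> (\<forall>N. wl2 s (galerkin a N 0) \<le> X\<^sub>0) \<longrightarrow>
    (\<forall>N t. wl2 s (galerkin a N t) \<le> C * (1 + \<bar>t\<bar>) powr (2 * s) * X\<^sub>0)"
proof -
  obtain C1 where C1: "C1 > 0" "\<And>f. f \<in> trigp \<Longrightarrow> wl1 0 f \<le> C1 * wl2 1 f" using wl1_le_wl2[of 1 0] by auto
  have kk: "0 < Suc k + k" by simp
  obtain CF where CF: "CF > 0" "\<And>f. f \<in> trigp \<Longrightarrow> wl1 0 f \<le> C1 * K \<Longrightarrow> wl2 0 (mono_fun (Suc k) k f) \<le> CF * wl2 0 f"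
    using wl2_mono_fun_le[OF order_refl kk] by blast
  \<comment> \<open>From \<open>2 * E0 + X0\<^sup>2\<close> with
    \<open>E0 \<le> (1 / 2 + CF) * X0\<^sup>2\<close>, the conserved bound on the squared
    \<open>H^1\<close> norm.\<close>
  define c where "c = sqrt (2 + 2 * CF)"
  have c: "0 < c" using CF by (simp add: c_def)
  have H1: "wl2 1 (galerkin a N t) \<le> c * X0"
    if nc: "nls_coeffs k s a F" and K: "\<And>N t. wl2 1 (galerkin a N t) \<le> K"
      and E0: "(\<lambda>N. trunc_energy k (modes N) (galerkin a N 0)) \<longlonglongrightarrow> E0"
      and X0: "0 < X0" "\<And>N. wl2 s (galerkin a N 0) \<le> X0" for a F E0 X0 N t
  proof -
    interpret nls_coeffs k s a F by (rule nc)
    have w1: "wl2 1 (galerkin a M 0) \<le> X0" for M using wl2_mono_exp[OF s] X0(2) order_trans by blast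
    have w0: "wl2 0 (galerkin a M 0) \<le> X0" for M using wl2_mono_exp[of 0 1 "galerkin a M 0"] w1[of M] by simp
    have "trunc_energy k (modes M) (galerkin a M 0) \<le> (1 / 2 + CF) * X0\<^sup>2" for M
    proof -
      define v where "v = galerkin a M 0"
      have v: "v \<in> trigp" by (simp add: v_def)
      have sv: "fsupp v \<subseteq> modes M" by (simp add: v_def fsupp_galerkin)
      have "(\<Sum>n\<in>modes M. (of_int n)\<^sup>2 * (cmod (fcoef v n))\<^sup>2) \<le> (wl2 1 v)\<^sup>2"
        unfolding wl2_eq[OF finite_modes sv] L2_set_def
        by (simp add: sum_nonneg power_mult_distrib jb_sq) (intro sum_mono mult_right_mono, auto)
      also have "\<dots> \<le> X0\<^sup>2" using w1[of M] by (intro power_mono) (auto simp: v_def)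
      finally have 1: "(\<Sum>n\<in>modes M. (of_int n)\<^sup>2 * (cmod (fcoef v n))\<^sup>2) \<le> X0\<^sup>2" .
      have "wl1 0 v \<le> C1 * K" using order_trans[OF C1(2)[OF v]] mult_left_mono[OF K[of M 0] less_imp_le[OF C1(1)]] by (simp add: v_def)
      then have Fv: "wl2 0 (mono_fun (Suc k) k v) \<le> CF * wl2 0 v" by (rule CF(2)[OF v])
      have "Re (fcoef (mono_fun (Suc k) (Suc k) v) 0) \<le> cmod (\<Sum>n\<in>modes M. cnj (fcoef v n) * fcoef (mono_fun (Suc k) k v) n)"
        unfolding fcoef_mono_zero[OF v finite_modes sv] by (rule complex_Re_le_cmod)
      also have "\<dots> \<le> (\<Sum>n\<in>modes M. \<bar>jb n powr 0 * cmod (fcoef v n)\<bar> * \<bar>jb n powr 0 * cmod (fcoef (mono_fun (Suc k) k v) n)\<bar>)"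
        by (intro sum_norm_le) (simp add: norm_mult)
      also have "\<dots> \<le> L2_set (\<lambda>n. jb n powr 0 * cmod (fcoef v n)) (modes M) * L2_set (\<lambda>n. jb n powr 0 * cmod (fcoef (mono_fun (Suc k) k v) n)) (modes M)"
        by (rule L2_set_mult_ineq)
      also have "\<dots> \<le> wl2 0 v * wl2 0 (mono_fun (Suc k) k v)"
        by (intro mult_mono L2_set_le_wl2 v mono_fun_trigp) auto
      also have "\<dots> \<le> X0 * (CF * X0)"
      proof (intro mult_mono)
        show "wl2 0 (mono_fun (Suc k) k v) \<le> CF * X0"
          using order_trans[OF Fv] mult_left_mono[OF w0[of M] less_imp_le[OF CF(1)]] by (simp add: v_def)
      qed (use w0[of M] X0 in \<open>auto simp: v_def\<close>)
      finally have "Re (fcoef (mono_fun (Suc k) (Suc k) v) 0) / (2 * real k + 2) \<le> X0 * (CF * X0) / (2 * real k + 2)"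
        by (intro divide_right_mono) auto
      also have "\<dots> \<le> X0 * (CF * X0) / 1"
        using CF X0 by (intro divide_left_mono) auto
      finally have "Re (fcoef (mono_fun (Suc k) (Suc k) v) 0) / (2 * real k + 2) \<le> CF * X0\<^sup>2"
        by (simp add: power2_eq_square mult_ac)
      with 1 show ?thesis unfolding trunc_energy_def v_def[symmetric] by (simp add: distrib_right)
    qed
    then have E0le: "E0 \<le> (1 / 2 + CF) * X0\<^sup>2" by (intro LIMSEQ_le_const2[OF E0]) blast
    have "(wl2 0 (galerkin a M 0))\<^sup>2 \<le> X0\<^sup>2" for M using w0[of M] by (intro power_mono) auto
    then have "(wl2 1 (galerkin a N t))\<^sup>2 \<le> 2 * E0 + X0\<^sup>2" by (rule h1_bound[OF _ E0])
    also have "\<dots> \<le> 2 * ((1 / 2 + CF) * X0\<^sup>2) + X0\<^sup>2" using E0le by simp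
    also have "\<dots> = (2 + 2 * CF) * X0\<^sup>2" by (simp add: algebra_simps)
    finally have "sqrt ((wl2 1 (galerkin a N t))\<^sup>2) \<le> sqrt ((2 + 2 * CF) * X0\<^sup>2)" by (rule real_sqrt_le_mono)
    then show ?thesis using X0 by (simp add: real_sqrt_mult c_def)
  qed
  show ?thesis
  proof (cases "s = 1")
    case True
    have "wl2 s (galerkin a N t) \<le> c * (1 + \<bar>t\<bar>) powr (2 * s) * X0"
      if "nls_coeffs k s a F" "\<And>N t. wl2 1 (galerkin a N t) \<le> K"
        "(\<lambda>N. trunc_energy k (modes N) (galerkin a N 0)) \<longlonglongrightarrow> E0" "0 < X0" "\<And>N. wl2 s (galerkin a N 0) \<le> X0" for a F E0 X0 N t
    proof -
      have "wl2 s (galerkin a N t) \<le> c * 1 * X0" using H1[OF that] True by simp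
      also have "\<dots> \<le> c * (1 + \<bar>t\<bar>) powr (2 * s) * X0"
        using c that(4) s by (intro mult_right_mono mult_left_mono ge_one_powr_ge_zero) auto
      finally show ?thesis .
    qed
    with c show ?thesis by blast
  next
    case False
    then have s1: "1 < s" using s by simp
    obtain C where C: "C > 0" "\<forall>a F \<kappa> X\<^sub>0. nls_coeffs k s a F \<longrightarrow> 0 < \<kappa> \<longrightarrow>
      (\<forall>N t. wl2 1 (galerkin a N t) \<le> K \<and> wl2 1 (galerkin a N t) \<le> \<kappa>) \<longrightarrow> (\<forall>N. wl2 s (galerkin a N 0) \<le> X\<^sub>0) \<longrightarrow>
      (\<forall>N t. wl2 s (galerkin a N t) \<le> C * (1 + \<bar>t\<bar>) powr (2 * s) * (X\<^sub>0 + \<kappa>))"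
      using growth[OF s1 k, of K] by (elim exE conjE) (rule that)
    have "wl2 s (galerkin a N t) \<le> (C * (1 + c)) * (1 + \<bar>t\<bar>) powr (2 * s) * X0"
      if nc: "nls_coeffs k s a F" and K: "\<And>N t. wl2 1 (galerkin a N t) \<le> K"
        and E0: "(\<lambda>N. trunc_energy k (modes N) (galerkin a N 0)) \<longlonglongrightarrow> E0" and X0: "0 < X0" "\<And>N. wl2 s (galerkin a N 0) \<le> X0" for a F E0 X0 N t
    proof -
      have "0 < c * X0" using c X0 by simp
      moreover have "\<forall>N t. wl2 1 (galerkin a N t) \<le> K \<and> wl2 1 (galerkin a N t) \<le> c * X0"
        using K H1[OF nc K E0 X0] by blast
      ultimately have "wl2 s (galerkin a N t) \<le> C * (1 + \<bar>t\<bar>) powr (2 * s) * (X0 + c * X0)"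
        using C(2) nc X0(2) by blast
      then show ?thesis by (simp add: algebra_simps)
    qed
    moreover have "0 < C * (1 + c)" using C c by simp
    ultimately show ?thesis by blast
  qed
qed

section \<open>Absolutely convergent Fourier series\<close>

definition fser :: "(int \<Rightarrow> complex) \<Rightarrow> real \<Rightarrow> complex" where
  "fser a x = (\<Sum>\<^sub>\<infinity>n. a n * cis (of_int n * x))"

lemma fser_truncation:
  assumes a: "\<And>S. finite S \<Longrightarrow> S \<inter> modes N = {} \<Longrightarrow> (\<Sum>n\<in>S. cmod (a n)) \<le> \<eta>"
  shows "cmod (fser a x - tpoly (modes N) a x) \<le> \<eta>"
proof -
  let ?f = "\<lambda>n. a n * cis (of_int n * x)"
  have tail: "(\<lambda>n. cmod (?f n)) summable_on (- modes N)"
    using a by (intro nonneg_bdd_above_summable_on bdd_aboveI[of _ \<eta>]) (auto simp: norm_mult)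
  then have tail': "?f summable_on (- modes N)" by (rule abs_summable_summable)
  have "fser a x = infsum ?f (modes N \<union> - modes N)" by (simp add: fser_def)
  also have "\<dots> = infsum ?f (modes N) + infsum ?f (- modes N)"
    by (intro infsum_Un_disjoint tail') auto
  also have "infsum ?f (modes N) = tpoly (modes N) a x" by (simp add: tpoly_def)
  finally have "cmod (fser a x - tpoly (modes N) a x) = cmod (infsum ?f (- modes N))" by simp
  also have "\<dots> \<le> (\<Sum>\<^sub>\<infinity>n\<in>- modes N. cmod (?f n))" by (rule norm_infsum_bound[OF tail])
  also have "\<dots> \<le> \<eta>" using tail a by (intro infsum_le_finite_sums) (auto simp: norm_mult)
  finally show ?thesis .
qed

lemma weighted_tail:
  fixes b :: "int \<Rightarrow> real"
  assumes b: "\<And>S. finite S \<Longrightarrow> (\<Sum>n\<in>S. jb n powr (1/4) * b n) \<le> B" "\<And>n. 0 \<le> b n"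
    and S: "finite S" "S \<inter> modes N = {}"
  shows "(\<Sum>n\<in>S. b n) \<le> B * (1 + real N) powr (- (1/4))"
proof -
  have "b n \<le> (1 + real N) powr (- (1/4)) * (jb n powr (1/4) * b n)" if "n \<in> S" for n
  proof -
    have "n \<notin> modes N" using that S by blast
    then have "int N + 1 \<le> \<bar>n\<bar>" by (auto simp: modes_def)
    then have "1 + real N \<le> \<bar>real_of_int n\<bar>" by linarith
    also have "\<dots> \<le> jb n" by (rule abs_le_jb)
    finally have "(1 + real N) powr (1/4) \<le> jb n powr (1/4)" by (intro powr_mono2) auto
    then have "(1 + real N) powr (- (1/4)) * (1 + real N) powr (1/4) \<le> (1 + real N) powr (- (1/4)) * jb n powr (1/4)"
      by (intro mult_left_mono) auto
    moreover have "(1 + real N) powr (- (1/4)) * (1 + real N) powr (1/4) = 1"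
      by (simp flip: powr_add)
    ultimately have "1 \<le> (1 + real N) powr (- (1/4)) * jb n powr (1/4)"
      by linarith
    from mult_right_mono[OF this b(2)[of n]] show ?thesis by (simp only: mult_1 mult.assoc)
  qed
  then have "(\<Sum>n\<in>S. b n) \<le> (1 + real N) powr (- (1/4)) * (\<Sum>n\<in>S. jb n powr (1/4) * b n)"
    unfolding sum_distrib_left by (rule sum_mono)
  also have "\<dots> \<le> (1 + real N) powr (- (1/4)) * B" by (intro mult_left_mono b S) auto
  finally show ?thesis by (simp add: mult.commute)
qed

lemma rate_tendsto: "(\<lambda>N. B * (1 + real N) powr (- (1/4))) \<longlonglongrightarrow> 0"
proof -
  have "filterlim (\<lambda>N. 1 + real N) at_top sequentially"
    by (rule filterlim_tendsto_add_at_top[OF tendsto_const filterlim_real_sequentially])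
  then have "(\<lambda>N. (1 + real N) powr (- (1/4))) \<longlonglongrightarrow> 0" by (intro tendsto_neg_powr) auto
  from tendsto_mult_right_zero[OF this] show ?thesis by (simp add: mult.commute)
qed

text \<open>Absolute convergence with a rate. The exponent could be any number strictly between 0
  and 1/2: positive to give truncations a rate of convergence, below 1/2 to follow from
  \<open>H^1\<close>.\<close>

definition l1_quarter :: "real \<Rightarrow> (int \<Rightarrow> complex) \<Rightarrow> bool" where
  "l1_quarter B a \<longleftrightarrow> (\<forall>S. finite S \<longrightarrow> (\<Sum>n\<in>S. jb n powr (1/4) * cmod (a n)) \<le> B)"

lemma l1_quarter_nonneg: "l1_quarter B a \<Longrightarrow> 0 \<le> B"
  unfolding l1_quarter_def by (metis finite.emptyI sum.empty)

lemma fser_rate: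
  assumes "l1_quarter B a"
  shows "cmod (fser a x - tpoly (modes N) a x) \<le> B * (1 + real N) powr (- (1/4))"
  using assms unfolding l1_quarter_def by (intro fser_truncation weighted_tail) auto

lemma l1_quarter_norm:
  assumes "l1_quarter B a" shows "cmod (fser a x) \<le> B"
proof -
  have s: "(\<Sum>n\<in>S. cmod (a n)) \<le> B" if "finite S" for S
  proof -
    have "(\<Sum>n\<in>S. cmod (a n)) \<le> (\<Sum>n\<in>S. jb n powr (1/4) * cmod (a n))"
      using jb_powr_ge1[of "1/4"] by (intro sum_mono) (simp add: mult_le_cancel_right1)
    then show ?thesis using assms that unfolding l1_quarter_def by fastforce
  qed
  have sm: "(\<lambda>n. cmod (a n * cis (of_int n * x))) summable_on UNIV"
    using s by (intro nonneg_bdd_above_summable_on bdd_aboveI[of _ B]) (auto simp: norm_mult)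
  then have "cmod (fser a x) \<le> (\<Sum>\<^sub>\<infinity>n. cmod (a n * cis (of_int n * x)))"
    unfolding fser_def by (rule norm_infsum_bound)
  also have "\<dots> \<le> B" using sm s by (intro infsum_le_finite_sums) (auto simp: norm_mult)
  finally show ?thesis .
qed

text \<open>The embedding of \<open>H^s\<close> into a weighted Wiener algebra, transferred from
  trigonometric polynomials by testing it on every finite section.\<close>

lemma l1_quarter_of_L2:
  assumes "1 \<le> s"
  shows "\<exists>C>0. \<forall>a R. (\<forall>S. finite S \<longrightarrow> L2_set (\<lambda>n. jb n powr s * cmod (a n)) S \<le> R) \<longrightarrow> l1_quarter (C * R) a"
proof -
  obtain C where C: "C > 0" "\<And>f. f \<in> trigp \<Longrightarrow> wl1 (1/4) f \<le> C * wl2 s f"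
    using wl1_le_wl2[of s "1/4"] assms by auto
  have "(\<Sum>n\<in>S. jb n powr (1/4) * cmod (a n)) \<le> C * R"
    if R: "\<And>S. finite S \<Longrightarrow> L2_set (\<lambda>n. jb n powr s * cmod (a n)) S \<le> R" and S: "finite S" for a R S
  proof -
    have "(\<Sum>n\<in>S. jb n powr (1/4) * cmod (a n)) = wl1 (1/4) (tpoly S a)"
      using S by (simp add: wl1_eq[OF S fsupp_tpoly[OF S]] fcoef_tpoly)
    also have "\<dots> \<le> C * wl2 s (tpoly S a)" by (intro C trigp_tpoly S)
    also have "wl2 s (tpoly S a) = L2_set (\<lambda>n. jb n powr s * cmod (a n)) S"
      unfolding wl2_eq[OF S fsupp_tpoly[OF S]] using S by (intro L2_set_cong) (auto simp: fcoef_tpoly)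
    also have "C * \<dots> \<le> C * R" using C(1) R[OF S] by simp
    finally show ?thesis .
  qed
  then show ?thesis using C(1) unfolding l1_quarter_def by blast
qed

lemma fser_uniform_limit:
  assumes "l1_quarter B a"
  shows "uniform_limit X (\<lambda>N. tpoly (modes N) a) (fser a) sequentially"
proof (rule uniform_limitI)
  fix e :: real assume "0 < e"
  then have "\<forall>\<^sub>F N in sequentially. B * (1 + real N) powr (- (1/4)) < e"
    using order_tendstoD(2)[OF rate_tendsto] by blast
  then show "\<forall>\<^sub>F N in sequentially. \<forall>x\<in>X. dist (tpoly (modes N) a x) (fser a x) < e"
  proof (rule eventually_mono)
    fix N assume "B * (1 + real N) powr (- (1/4)) < e"
    then show "\<forall>x\<in>X. dist (tpoly (modes N) a x) (fser a x) < e"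
      using fser_rate[OF assms, of _ N] by (auto simp: dist_norm norm_minus_commute intro: le_less_trans)
  qed
qed

lemma fser_continuous_on:
  assumes "l1_quarter B a"
  shows "continuous_on X (fser a)"
  by (rule uniform_limit_theorem[OF _ fser_uniform_limit[OF assms]])
     (auto intro: continuous_on_tpoly always_eventually)

text \<open>The filter is arbitrary because the same fact serves limits over the truncation level
  and limits in time.\<close>

lemma fcoef_uniform_limit:
  assumes lim: "uniform_limit {0..2*pi} g f F" and g: "\<forall>\<^sub>F i in F. continuous_on {0..2*pi} (g i)" and F: "F \<noteq> bot"
  shows "((\<lambda>i. fcoef (g i) n) \<longlongrightarrow> fcoef f n) F"
proof -
  have f: "continuous_on {0..2*pi} f" using uniform_limit_theorem[OF g lim F] .
  have "uniform_limit {0..2*pi} (\<lambda>i x. g i x * cis (- (of_int n * x))) (\<lambda>x. f x * cis (- (of_int n * x))) F"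
  proof (rule uniform_limitI)
    fix e :: real assume "0 < e"
    from uniform_limitD[OF lim this]
    show "\<forall>\<^sub>F i in F. \<forall>x\<in>{0..2*pi}. dist (g i x * cis (- (of_int n * x))) (f x * cis (- (of_int n * x))) < e"
      by (rule eventually_mono) (auto simp: dist_norm norm_mult simp flip: left_diff_distrib)
  qed
  then have "((\<lambda>i. integral {0..2*pi} (\<lambda>x. g i x * cis (- (of_int n * x)))) \<longlongrightarrow> integral {0..2*pi} (\<lambda>x. f x * cis (- (of_int n * x)))) F"
  proof -
    assume ul: "uniform_limit {0..2*pi} (\<lambda>i x. g i x * cis (- (of_int n * x))) (\<lambda>x. f x * cis (- (of_int n * x))) F"
    show ?thesis
    proof (rule tendstoI)
      fix e :: real assume e: "0 < e"
      have "0 < e / (4 * pi)" using e by simp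
      from uniform_limitD[OF ul this] g
      show "\<forall>\<^sub>F i in F. dist (integral {0..2*pi} (\<lambda>x. g i x * cis (- (of_int n * x)))) (integral {0..2*pi} (\<lambda>x. f x * cis (- (of_int n * x)))) < e"
      proof eventually_elim
        case (elim i)
        have "integral {0..2*pi} (\<lambda>x. g i x * cis (- (of_int n * x))) - integral {0..2*pi} (\<lambda>x. f x * cis (- (of_int n * x))) =
          integral {0..2*pi} (\<lambda>x. g i x * cis (- (of_int n * x)) - f x * cis (- (of_int n * x)))"
          by (intro integral_diff[symmetric] fcoef_integrable elim f)
        also have "norm \<dots> \<le> e / (4 * pi) * (2 * pi - 0)"
          using elim(1) f elim(2)
          by (intro integral_bound continuous_intros) (auto simp: dist_norm intro: less_imp_le)
        also have "\<dots> < e" using e by simp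
        finally show ?case by (simp add: dist_norm)
      qed
    qed
  qed
  then show ?thesis unfolding fcoef_def by (intro tendsto_intros) simp_all
qed

lemma uniform_limit_mono_fun:
  assumes lim: "uniform_limit X g f F" and f: "bounded (f ` X)"
  shows "uniform_limit X (\<lambda>t. mono_fun i j (g t)) (mono_fun i j f) F"
proof -
  have bdd: "bounded (mono_fun i j f ` X)" for i j
  proof -
    obtain B where B: "\<And>x. x \<in> X \<Longrightarrow> cmod (f x) \<le> B" using f by (auto simp: bounded_iff)
    have "cmod (mono_fun i j f x) \<le> B ^ i * B ^ j" if "x \<in> X" for x
    proof -
      have "0 \<le> B" using order_trans[OF norm_ge_zero B[OF that]] .
      then show ?thesis using B[OF that]
        by (simp add: mono_fun_def norm_mult norm_power mult_mono power_mono)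
    qed
    then show ?thesis by (auto simp: bounded_iff)
  qed
  have cnjl: "uniform_limit X (\<lambda>t x. cnj (g t x)) (\<lambda>x. cnj (f x)) F"
  proof (rule uniform_limitI)
    fix e :: real assume "0 < e"
    from uniform_limitD[OF lim this] show "\<forall>\<^sub>F t in F. \<forall>x\<in>X. dist (cnj (g t x)) (cnj (f x)) < e"
      by (rule eventually_mono) (metis complex_cnj_diff complex_mod_cnj dist_norm)
  qed
  have cnjb: "bounded ((\<lambda>x. cnj (f x)) ` X)" using f by (simp add: bounded_iff)
  show ?thesis
  proof (induct i)
    case 0
    show ?case
    proof (induct j)
      case 0
      show ?case by (simp add: mono_fun_def uniform_limit_const)
    next
      case (Suc j)
      show ?case unfolding mono_fun_Suc2
        by (rule uniform_lim_mult[OF cnjl Suc cnjb bdd])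
    qed
  next
    case (Suc i)
    show ?case unfolding mono_fun_Suc1
      by (rule uniform_lim_mult[OF lim Suc f bdd])
  qed
qed

section \<open>Fourier coefficients of measurable functions\<close>

text \<open>One period as a finite measure space, in which constants are integrable.\<close>

abbreviation circ :: "real measure" where
  "circ \<equiv> restrict_space lborel {0..2*pi}"

lemma space_circ: "space circ = {0..2*pi}"
  by (simp add: space_restrict_space)

lemma finite_measure_circ: "finite_measure circ"
  by (rule finite_measureI) (simp add: emeasure_restrict_space space_restrict_space)

lemma borel_circ: "f \<in> borel_measurable borel \<Longrightarrow> f \<in> borel_measurable circ"
  by (simp add: measurable_restrict_space1)

lemma set_integral_circ: "(LBINT x:{0..2*pi}. f x) = (LINT x|circ. f x)"
  for f :: "real \<Rightarrow> 'a::{banach, second_countable_topology}"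
  by (simp add: set_lebesgue_integral_def integral_restrict_space)

lemma set_integrable_circ: "set_integrable lborel {0..2*pi} f \<longleftrightarrow> integrable circ f"
  for f :: "real \<Rightarrow> 'a::{banach, second_countable_topology}"
  by (simp add: set_integrable_def integrable_restrict_space)

lemma sets_circ_Int: "A \<in> sets borel \<Longrightarrow> A \<inter> {0..2*pi} \<in> sets circ"
  unfolding sets_restrict_space Int_commute[of A] by (rule imageI) simp

lemma sets_circE:
  assumes "A \<in> sets circ" obtains B where "B \<in> sets borel" "A = B \<inter> {0..2*pi}"
proof -
  obtain B where "B \<in> sets lborel" "A = {0..2*pi} \<inter> B"
    using assms unfolding sets_restrict_space by (rule imageE)
  then show thesis using that[of B] by (simp add: Int_commute)
qed

lemma AE_circ: "(AE x in circ. P x) \<longleftrightarrow> (AE x in lborel. x \<in> {0..2*pi} \<longrightarrow> P x)"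
  by (simp add: AE_restrict_space_iff)

lemma integrable_circ_continuous:
  fixes f :: "real \<Rightarrow> 'a::euclidean_space"
  assumes "continuous_on {0..2*pi} f"
  shows "integrable circ f"
  unfolding set_integrable_circ[symmetric] by (rule borel_integrable_atLeastAtMost'[OF assms])

lemma integral_circ_continuous:
  fixes f :: "real \<Rightarrow> 'a::euclidean_space"
  assumes "continuous_on {0..2*pi} f"
  shows "(LINT x|circ. f x) = integral {0..2*pi} f"
  unfolding set_integral_circ[symmetric]
  by (rule set_borel_integral_eq_integral(2)[OF borel_integrable_atLeastAtMost'[OF assms]])

lemma fourier_coeff_circ: "fourier_coeff f n = (LINT x|circ. f x * cis (- (of_int n * x)))"
  by (simp add: fourier_coeff_def set_integral_circ)

lemma fourier_coeff_continuous:
  assumes "continuous_on {0..2*pi} f"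
  shows "fourier_coeff f n = 2 * pi * fcoef f n"
  unfolding fourier_coeff_circ fcoef_def using continuous_cis_mult[OF assms]
  by (subst integral_circ_continuous) auto

lemma circle_L2_measurable: "f \<in> circle_L2 \<Longrightarrow> f \<in> borel_measurable borel"
  by (simp add: circle_L2_def)

lemma circle_L2_sq_integrable: "f \<in> circle_L2 \<Longrightarrow> integrable circ (\<lambda>x. (cmod (f x))\<^sup>2)"
  by (simp add: circle_L2_def set_integrable_circ)

lemma circle_L2_integrable:
  assumes "f \<in> circle_L2"
  shows "integrable circ f"
proof (rule Bochner_Integration.integrable_bound)
  interpret finite_measure circ by (rule finite_measure_circ)
  show "integrable circ (\<lambda>x. 1 + (cmod (f x))\<^sup>2)"
    using circle_L2_sq_integrable[OF assms] by simp
  show "f \<in> borel_measurable circ" using circle_L2_measurable[OF assms] by (rule borel_circ)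
  have "y \<le> 1 + y\<^sup>2" for y :: real
  proof -
    have "2 * y \<le> 1 + y\<^sup>2" using zero_le_power2[of "y - 1"] by (simp add: power2_diff)
    then show ?thesis using zero_le_power2[of y] by linarith
  qed
  then show "AE x in circ. norm (f x) \<le> norm (1 + (cmod (f x))\<^sup>2)" by simp
qed

lemma integrable_circ_mult_bounded:
  fixes f g :: "real \<Rightarrow> complex"
  assumes f: "integrable circ f" and g: "g \<in> borel_measurable circ" and B: "\<And>x. cmod (g x) \<le> B"
  shows "integrable circ (\<lambda>x. f x * g x)"
proof (rule Bochner_Integration.integrable_bound)
  show "integrable circ (\<lambda>x. B * cmod (f x))" using f by simp
  show "(\<lambda>x. f x * g x) \<in> borel_measurable circ" using f g by simp
  have "cmod (f x) * cmod (g x) \<le> \<bar>B\<bar> * cmod (f x)" for x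
  proof -
    have "cmod (g x) \<le> \<bar>B\<bar>" using B[of x] by simp
    from mult_left_mono[OF this norm_ge_zero[of "f x"]] show ?thesis by (simp add: mult.commute)
  qed
  then show "AE x in circ. norm (f x * g x) \<le> norm (B * cmod (f x))"
    by (simp add: norm_mult abs_mult)
qed

lemma tpoly_measurable: "tpoly S a \<in> borel_measurable borel"
  by (intro borel_measurable_continuous_onI continuous_on_tpoly)

lemma tpoly_bound: "cmod (tpoly S a x) \<le> (\<Sum>n\<in>S. cmod (a n))"
  unfolding tpoly_def by (intro sum_norm_le) (simp add: norm_mult)

lemma cis_measurable: "(\<lambda>x. cis (c * x)) \<in> borel_measurable borel"
  by (intro borel_measurable_continuous_onI continuous_intros)

lemma integrable_circ_cis:
  assumes "integrable circ f"
  shows "integrable circ (\<lambda>x. f x * cis (- (of_int n * x)))"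
proof -
  have "(\<lambda>x. cis (- (of_int n * x))) \<in> borel_measurable circ"
    using borel_circ[OF cis_measurable[of "- of_int n"]] by simp
  then show ?thesis by (intro integrable_circ_mult_bounded[where B = 1] assms) auto
qed

lemma fourier_coeff_diff:
  assumes "integrable circ f" "integrable circ g"
  shows "fourier_coeff (\<lambda>x. f x - g x) n = fourier_coeff f n - fourier_coeff g n"
  unfolding fourier_coeff_circ left_diff_distrib
  by (intro Bochner_Integration.integral_diff integrable_circ_cis assms)

lemma fourier_coeff_cong_AE:
  assumes "f \<in> borel_measurable circ" "g \<in> borel_measurable circ" "AE x in circ. f x = g x"
  shows "fourier_coeff f n = fourier_coeff g n"
  unfolding fourier_coeff_circ
proof (rule integral_cong_AE)
  have "(\<lambda>x. cis (- (of_int n * x))) \<in> borel_measurable circ"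
    using borel_circ[OF cis_measurable[of "- of_int n"]] by simp
  then show "(\<lambda>x. f x * cis (- (of_int n * x))) \<in> borel_measurable circ"
    "(\<lambda>x. g x * cis (- (of_int n * x))) \<in> borel_measurable circ" using assms by auto
qed (use assms(3) in auto)

lemma fourier_coeff_norm_le:
  assumes f: "integrable circ f" and B: "AE x in circ. cmod (f x) \<le> B"
  shows "cmod (fourier_coeff f n) \<le> 2 * pi * B"
proof -
  interpret finite_measure circ by (rule finite_measure_circ)
  have "cmod (fourier_coeff f n) \<le> (LINT x|circ. cmod (f x * cis (- (of_int n * x))))"
    unfolding fourier_coeff_circ by (rule integral_norm_bound)
  also have "\<dots> \<le> (LINT x|circ. B)"
    using B f by (intro integral_mono_AE integrable_norm integrable_circ_cis) (auto simp: norm_mult)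
  also have "\<dots> = 2 * pi * B"
    by (simp add: measure_restrict_space space_restrict_space)
  finally show ?thesis .
qed

lemma integral_circ_cnj_tpoly:
  assumes "integrable circ f"
  shows "(LINT x|circ. f x * cnj (tpoly S a x)) = (\<Sum>n\<in>S. cnj (a n) * fourier_coeff f n)"
proof -
  have "f x * cnj (tpoly S a x) = (\<Sum>n\<in>S. cnj (a n) * (f x * cis (- (of_int n * x))))" for x
    by (simp add: tpoly_def cis_cnj sum_distrib_left mult_ac)
  then show ?thesis
    using integrable_circ_cis[OF assms]
    by (simp add: fourier_coeff_circ Bochner_Integration.integral_sum)
qed

text \<open>Expand the integral of \<open>|f - p|^2\<close> for the Fourier projection
  \<open>p\<close>: the pairing of \<open>f\<close> with \<open>p\<close> and that of
  \<open>p\<close> with itself have the same value.\<close>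

lemma bessel:
  assumes f: "f \<in> circle_L2" and S: "finite S"
  shows "(\<Sum>n\<in>S. (cmod (fourier_coeff f n))\<^sup>2) \<le> 2 * pi * (LINT x|circ. (cmod (f x))\<^sup>2)"
proof -
  define c where "c n = fourier_coeff f n / (2 * pi)" for n
  define p where "p = tpoly S c"
  define \<Sigma> where "\<Sigma> = (\<Sum>n\<in>S. (cmod (fourier_coeff f n))\<^sup>2)"
  have fi: "integrable circ f" by (rule circle_L2_integrable[OF f])
  have pi: "integrable circ p" unfolding p_def by (intro integrable_circ_continuous continuous_on_tpoly)
  have pm: "(\<lambda>x. cnj (p x)) \<in> borel_measurable circ"
    unfolding p_def by (intro borel_circ borel_measurable_continuous_onI continuous_intros)
  have pb: "cmod (cnj (p x)) \<le> (\<Sum>n\<in>S. cmod (c n))" for x unfolding p_def complex_mod_cnj by (rule tpoly_bound)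
  note i1 = integrable_circ_mult_bounded[OF fi pm pb] and i2 = integrable_circ_mult_bounded[OF pi pm pb]
  have cc: "cnj z * z = of_real ((cmod z)\<^sup>2)" for z by (metis complex_norm_square mult.commute)
  have A: "(LINT x|circ. f x * cnj (p x)) = of_real (\<Sigma> / (2 * pi))"
    unfolding p_def integral_circ_cnj_tpoly[OF fi] by (simp add: c_def \<Sigma>_def cc sum_divide_distrib[symmetric])
  have cp: "fourier_coeff p n = fourier_coeff f n" if "n \<in> S" for n
    using that S by (simp add: p_def fourier_coeff_continuous[OF continuous_on_tpoly] fcoef_tpoly c_def)
  have B: "(LINT x|circ. p x * cnj (p x)) = of_real (\<Sigma> / (2 * pi))"
    unfolding p_def integral_circ_cnj_tpoly[OF pi[unfolded p_def]]
    by (simp add: cp[unfolded p_def] c_def \<Sigma>_def cc sum_divide_distrib[symmetric] cong: sum.cong)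
  have pt: "(cmod (f x - p x))\<^sup>2 = (cmod (f x))\<^sup>2 - 2 * Re (f x * cnj (p x)) + Re (p x * cnj (p x))" for x
    unfolding cmod_power2 by (simp add: power2_diff power2_eq_square algebra_simps)
  have "0 \<le> (LINT x|circ. (cmod (f x - p x))\<^sup>2)" by (intro Bochner_Integration.integral_nonneg) auto
  also have "\<dots> = (LINT x|circ. (cmod (f x))\<^sup>2) - 2 * (LINT x|circ. Re (f x * cnj (p x))) + (LINT x|circ. Re (p x * cnj (p x)))"
    unfolding pt using integrable_Re[OF i1] integrable_Re[OF i2] circle_L2_sq_integrable[OF f]
    by (simp del: times_complex.sel)
  also have "(LINT x|circ. Re (f x * cnj (p x))) = \<Sigma> / (2 * pi)"
    unfolding integral_Re[OF i1] A by (rule Re_complex_of_real)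
  also have "(LINT x|circ. Re (p x * cnj (p x))) = \<Sigma> / (2 * pi)"
    unfolding integral_Re[OF i2] B by (rule Re_complex_of_real)
  finally have "\<Sigma> / (2 * pi) \<le> (LINT x|circ. (cmod (f x))\<^sup>2)" by simp
  then show ?thesis by (simp add: \<Sigma>_def divide_le_eq mult.commute)
qed

subsection \<open>Uniqueness of Fourier coefficients\<close>

text \<open>A real linear functional of \<open>cis x\<close> is a combination of
  \<open>cos x\<close> and \<open>sin x\<close>, hence of \<open>cis x\<close> and
  \<open>cis (- x)\<close>. This converts polynomial approximation on the unit circle into
  approximation by trigonometric polynomials.\<close>

lemma real_polynomial_cis_trigp:
  assumes "real_polynomial_function g"
  shows "(\<lambda>x. complex_of_real (g (cis x))) \<in> trigp"
  using assms
proof (induct rule: real_polynomial_function.induct)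
  case (linear g)
  have "complex_of_real (g (cis x)) = (of_real (g 1 / 2) - \<i> * of_real (g \<i> / 2)) * cis (of_int 1 * x) +
      (of_real (g 1 / 2) + \<i> * of_real (g \<i> / 2)) * cis (of_int (- 1) * x)" for x
  proof -
    interpret bounded_linear g by (rule linear)
    have "cis x = cos x *\<^sub>R 1 + sin x *\<^sub>R \<i>" by (simp add: complex_eq_iff)
    then have "g (cis x) = cos x * g 1 + sin x * g \<i>" by (simp add: add scaleR)
    then show ?thesis by (simp add: complex_eq_iff)
  qed
  then show ?case by (simp only:) (intro trigp_add trigp_cis)
next
  case (const c)
  show ?case by (rule trigp_const)
next
  case (add f g)
  then show ?case using trigp_add by simp
next
  case (mult f g)
  then show ?case using trigp_mult by simp
qed

lemma cis_eq_imp_eq: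
  assumes "cis x = cis y" "\<bar>x - y\<bar> < 2 * pi"
  shows "x = y"
proof -
  have "sin x = sin y \<and> cos x = cos y" using assms(1) by (simp add: complex_eq_iff)
  then obtain n :: int where n: "x = y + 2 * pi * n" using sin_cos_eq_iff[of x y] by auto
  then have "2 * pi * \<bar>real_of_int n\<bar> < 2 * pi * 1" using assms(2) by (simp add: abs_mult)
  then have "\<bar>real_of_int n\<bar> < 1" by (subst (asm) mult_less_cancel_left_pos) auto
  then have "n = 0" by linarith
  then show ?thesis using n by simp
qed

lemma indicator_cis_measurable:
  assumes "open U"
  shows "(\<lambda>x. complex_of_real (indicator U (cis x))) \<in> borel_measurable circ"
proof -
  have c: "cis \<in> borel_measurable borel" by (intro borel_measurable_continuous_onI continuous_intros)
  have "(indicator U :: complex \<Rightarrow> real) \<in> borel_measurable borel"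
    using borel_open[OF assms] by (rule borel_measurable_indicator)
  note m = measurable_compose[OF c this]
  have r: "complex_of_real \<in> borel_measurable borel"
    by (intro borel_measurable_continuous_onI continuous_intros)
  have "(\<lambda>x. complex_of_real (indicator U (cis x))) \<in> borel_measurable borel"
    by (rule measurable_compose[OF m r])
  then show ?thesis by (rule borel_circ)
qed

text \<open>The class of functions orthogonal to \<open>h\<close> is enlarged from trigonometric
  polynomials to continuous functions of \<open>cis x\<close> (Stone-Weierstrass on the circle), to
  indicators of open sets, to intervals and to Borel sets. Passing through \<open>cis\<close> keeps
  all approximants periodic, so the ends of the period cause no mismatch.\<close>

lemma fourier_coeff_zero_imp:
  assumes h: "integrable circ h" and zero: "\<And>n. fourier_coeff h n = 0"
  shows "AE x in circ. h x = 0"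
proof -
  interpret finite_measure circ by (rule finite_measure_circ)
  have trig: "(LINT x|circ. h x * p x) = 0" if p: "p \<in> trigp" for p
  proof -
    obtain S a where "(\<lambda>x. cnj (p x)) = tpoly S a" using trigp_cnj[OF p] by (auto simp: trigp_def)
    then have "p x = cnj (tpoly S a x)" for x by (metis complex_cnj_cnj)
    then show ?thesis using integral_circ_cnj_tpoly[OF h] by (simp add: zero)
  qed
  have cont: "(LINT x|circ. h x * of_real (\<phi> (cis x))) = 0" if \<phi>: "continuous_on UNIV \<phi>" for \<phi> :: "complex \<Rightarrow> real"
  proof -
    define H where "H = (LINT x|circ. cmod (h x))"
    have H: "0 \<le> H" unfolding H_def by (intro Bochner_Integration.integral_nonneg) auto
    have "cmod (LINT x|circ. h x * of_real (\<phi> (cis x))) \<le> 0 + e" if e: "0 < e" for e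
    proof -
      define \<delta> where "\<delta> = e / (H + 1)"
      have \<delta>: "0 < \<delta>" using e H by (simp add: \<delta>_def add_nonneg_pos)
      obtain g where g: "real_polynomial_function g" "\<And>z. z \<in> sphere 0 1 \<Longrightarrow> \<bar>\<phi> z - g z\<bar> < \<delta>"
        using Stone_Weierstrass_real_polynomial_function[OF compact_sphere continuous_on_subset[OF \<phi>] \<delta>, of 0 1] by auto
      have gc: "continuous_on UNIV g"
        using g(1) by (simp add: continuous_on_polymonial_function real_polynomial_function_eq)
      have ms: "(\<lambda>x. complex_of_real (\<psi> (cis x))) \<in> borel_measurable circ" if "continuous_on UNIV \<psi>" for \<psi>
        by (intro borel_circ borel_measurable_continuous_onI continuous_intros continuous_on_compose2[OF that]) auto
      have b: "\<bar>\<phi> (cis x) - g (cis x)\<bar> \<le> \<delta>" for x using g(2)[of "cis x"] by simp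
      have i1: "integrable circ (\<lambda>x. h x * of_real (\<phi> (cis x) - g (cis x)))"
        using ms[OF continuous_on_diff[OF \<phi> gc]] b
        by (intro integrable_circ_mult_bounded[OF h, where B = \<delta>]) (auto simp del: of_real_diff)
      have i2: "integrable circ (\<lambda>x. h x * of_real (g (cis x)))"
      proof -
        obtain S a where "(\<lambda>x. complex_of_real (g (cis x))) = tpoly S a"
          using real_polynomial_cis_trigp[OF g(1)] by (auto simp: trigp_def)
        then have bb: "cmod (complex_of_real (g (cis x))) \<le> (\<Sum>n\<in>S. cmod (a n))" for x
          using tpoly_bound[of S a x] by metis
        show ?thesis by (rule integrable_circ_mult_bounded[OF h ms[OF gc] bb])
      qed
      have "(LINT x|circ. h x * of_real (\<phi> (cis x))) = (LINT x|circ. h x * of_real (\<phi> (cis x) - g (cis x)) + h x * of_real (g (cis x)))"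
        by (simp add: algebra_simps)
      also have "\<dots> = (LINT x|circ. h x * of_real (\<phi> (cis x) - g (cis x)))"
        using Bochner_Integration.integral_add[OF i1 i2] trig[OF real_polynomial_cis_trigp[OF g(1)]] by simp
      also have "cmod \<dots> \<le> (LINT x|circ. cmod (h x * of_real (\<phi> (cis x) - g (cis x))))"
        by (rule integral_norm_bound)
      also have "\<dots> \<le> (LINT x|circ. \<delta> * cmod (h x))"
      proof (rule integral_mono)
        fix x
        show "cmod (h x * of_real (\<phi> (cis x) - g (cis x))) \<le> \<delta> * cmod (h x)"
          using mult_right_mono[OF b[of x], of "cmod (h x)"] by (simp add: norm_mult mult.commute del: of_real_diff)
      qed (use i1 h in auto)
      also have "\<dots> = \<delta> * H" by (simp add: H_def)
      also have "\<dots> \<le> \<delta> * (H + 1)" using \<delta> by (intro mult_left_mono) auto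
      also have "\<dots> = e" using H by (simp add: \<delta>_def)
      finally show ?thesis by simp
    qed
    then have "cmod (LINT x|circ. h x * of_real (\<phi> (cis x))) \<le> 0" by (rule field_le_epsilon)
    then show ?thesis by simp
  qed
  have op: "(LINT x|circ. h x * of_real (indicator U (cis x))) = 0" if U: "open U" "U \<noteq> UNIV" for U :: "complex set"
  proof -
    \<comment> \<open>The distance to the complement, scaled up and cut at 1, increases to the
      indicator of \<open>U\<close>; for this the complement has to be nonempty.\<close>
    define \<phi> where "\<phi> j z = min 1 (real j * infdist z (- U))" for j z
    have lim: "(\<lambda>j. \<phi> j z) \<longlonglongrightarrow> indicator U z" for z
    proof (cases "z \<in> U")
      case True
      have "closed (- U)" "- U \<noteq> {}" using U by auto
      then have "infdist z (- U) \<noteq> 0" using True in_closed_iff_infdist_zero[of "- U" z] by auto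
      then have d: "0 < infdist z (- U)" using infdist_nonneg[of z "- U"] by linarith
      obtain j0 where "1 / infdist z (- U) < real j0" using reals_Archimedean2 by blast
      then have "\<phi> j z = 1" if "j0 \<le> j" for j
      proof -
        have "1 / infdist z (- U) \<le> real j" using \<open>1 / infdist z (- U) < real j0\<close> that by simp
        then show ?thesis using d by (simp add: \<phi>_def field_simps)
      qed
      then have "\<forall>\<^sub>F j in sequentially. \<phi> j z = 1" by (auto simp: eventually_sequentially)
      then show ?thesis using True by (simp add: tendsto_eventually)
    next
      case False
      then show ?thesis by (simp add: \<phi>_def)
    qed
    have \<phi>c: "continuous_on UNIV (\<phi> j)" for j
      unfolding \<phi>_def by (intro continuous_intros)
    have "(\<lambda>j. LINT x|circ. h x * of_real (\<phi> j (cis x))) \<longlonglongrightarrow> (LINT x|circ. h x * of_real (indicator U (cis x)))"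
    proof (rule integral_dominated_convergence)
      show "(\<lambda>x. h x * of_real (indicator U (cis x))) \<in> borel_measurable circ"
        by (intro borel_measurable_times indicator_cis_measurable U borel_measurable_integrable h)
      have "(\<lambda>x. complex_of_real (\<phi> j (cis x))) \<in> borel_measurable circ" for j
        by (intro borel_circ borel_measurable_continuous_onI continuous_intros continuous_on_compose2[OF \<phi>c]) auto
      then show "(\<lambda>x. h x * of_real (\<phi> j (cis x))) \<in> borel_measurable circ" for j using h by simp
      show "integrable circ (\<lambda>x. cmod (h x))" using h by simp
      show "AE x in circ. (\<lambda>j. h x * of_real (\<phi> j (cis x))) \<longlonglongrightarrow> h x * of_real (indicator U (cis x))"
        by (intro AE_I2 tendsto_intros lim)
      have "\<bar>\<phi> j z\<bar> \<le> 1" for j z by (simp add: \<phi>_def infdist_nonneg)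
      then show "AE x in circ. norm (h x * of_real (\<phi> j (cis x))) \<le> cmod (h x)" for j
        by (intro AE_I2) (simp add: norm_mult mult_left_le)
    qed
    then show ?thesis using cont[OF \<phi>c] by (simp add: LIMSEQ_const_iff)
  qed
  have tot: "(LINT x|circ. h x) = 0" using zero[of 0] by (simp add: fourier_coeff_circ)
  have int: "set_lebesgue_integral circ ({a<..<b} \<inter> {0..2*pi}) h = 0" for a b :: real
  proof -
    \<comment> \<open>The image of the interval need not be open, because the period has ends. The
      complement of the compact image of the remaining points is open, and it detects the interval
      correctly inside the period; the two ends are a null set.\<close>
    define U where "U = - (cis ` ({0..2*pi} - {a<..<b}))"
    have "compact (cis ` ({0..2*pi} - {a<..<b}))"
      by (intro compact_continuous_image continuous_intros compact_diff) auto
    then have U: "open U" unfolding U_def by (intro open_Compl compact_imp_closed)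
    have U_iff: "cis x \<in> U \<longleftrightarrow> x \<in> {a<..<b}" if x: "x \<in> {0<..<2*pi}" for x
    proof
      assume "cis x \<in> U"
      then show "x \<in> {a<..<b}" using x by (force simp: U_def)
    next
      assume "x \<in> {a<..<b}"
      show "cis x \<in> U"
      proof (rule ccontr)
        assume "cis x \<notin> U"
        then obtain y where y: "y \<in> {0..2*pi} - {a<..<b}" "cis x = cis y" unfolding U_def by blast
        have "\<bar>x - y\<bar> < 2 * pi" using x y(1) by (auto simp: abs_if)
        then have "x = y" using y(2) by (intro cis_eq_imp_eq)
        then show False using y \<open>x \<in> {a<..<b}\<close> by auto
      qed
    qed
    have ae: "AE x in circ. x \<in> {0<..<2*pi}"
    proof -
      have "AE x in lborel. x \<noteq> 0 \<and> x \<noteq> 2 * pi"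
        by (intro AE_conjI AE_lborel_singleton)
      then show ?thesis unfolding AE_circ by (rule AE_mp) (auto intro!: AE_I2)
    qed
    have "set_lebesgue_integral circ ({a<..<b} \<inter> {0..2*pi}) h = (LINT x|circ. h x * of_real (indicator U (cis x)))"
      unfolding set_lebesgue_integral_def
    proof (rule integral_cong_AE)
      show "(\<lambda>x. indicator ({a<..<b} \<inter> {0..2*pi}) x *\<^sub>R h x) \<in> borel_measurable circ"
        by (rule borel_measurable_scaleR[OF borel_circ borel_measurable_integrable[OF h]]) simp
      show "(\<lambda>x. h x * of_real (indicator U (cis x))) \<in> borel_measurable circ"
        by (intro borel_measurable_times indicator_cis_measurable U borel_measurable_integrable h)
      show "AE x in circ. indicator ({a<..<b} \<inter> {0..2*pi}) x *\<^sub>R h x = h x * of_real (indicator U (cis x))"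
        using ae by (rule AE_mp) (auto intro!: AE_I2 simp: U_iff indicator_def)
    qed
    also have "\<dots> = 0"
    proof (cases "U = UNIV")
      case True
      then show ?thesis using tot by simp
    next
      case False
      show ?thesis by (rule op[OF U False])
    qed
    finally show ?thesis .
  qed
  have borel_Ioo: "borel = sigma UNIV (range (\<lambda>(a, b). {a<..<b::real}))"
    using borel_eq_box[where 'a = real] by (simp add: box_real)
  have all: "set_lebesgue_integral circ (A \<inter> {0..2*pi}) h = 0" if "A \<in> sets borel" for A
  proof -
    have A: "A \<in> sigma_sets UNIV (range (\<lambda>(a, b). {a<..<b::real}))"
      using that unfolding borel_Ioo by (simp add: sets_measure_of)
    \<comment> \<open>Open intervals generate the Borel sets and are stable under intersection, so
      closure of the vanishing class under complements and disjoint unions suffices.\<close>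
    have stable: "Int_stable (range (\<lambda>(a, b). {a<..<b::real}))"
    proof (rule Int_stableI)
      fix A B :: "real set"
      assume "A \<in> range (\<lambda>(a, b). {a<..<b})" "B \<in> range (\<lambda>(a, b). {a<..<b})"
      then obtain a b c d where "A = {a<..<b}" "B = {c<..<d}" by auto
      then have "A \<inter> B = (\<lambda>(a, b). {a<..<b}) (max a c, min b d)" by auto
      then show "A \<inter> B \<in> range (\<lambda>(a, b). {a<..<b})" by blast
    qed
    have sub: "range (\<lambda>(a, b). {a<..<b::real}) \<subseteq> Pow UNIV" by simp
    from stable sub A show ?thesis
    proof (induct rule: sigma_sets_induct_disjoint)
      case (basic A)
      then show ?case using int by auto
    next
      case empty
      show ?case by (simp add: set_lebesgue_integral_def)
    next
      case (compl A)
      have A: "A \<in> sets borel" using compl(1) unfolding borel_Ioo by (simp add: sets_measure_of)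
      have iA: "set_integrable circ (A \<inter> {0..2*pi}) h"
        unfolding set_integrable_def by (intro integrable_mult_indicator sets_circ_Int A h)
      have cA: "UNIV - A \<in> sets borel" using A by (intro sets.Diff) auto
      have iC: "set_integrable circ ((UNIV - A) \<inter> {0..2*pi}) h"
        unfolding set_integrable_def by (intro integrable_mult_indicator sets_circ_Int cA h)
      have "set_lebesgue_integral circ (((UNIV - A) \<inter> {0..2*pi}) \<union> (A \<inter> {0..2*pi})) h =
         set_lebesgue_integral circ ((UNIV - A) \<inter> {0..2*pi}) h + set_lebesgue_integral circ (A \<inter> {0..2*pi}) h"
        by (intro set_integral_Un iA iC) auto
      moreover have "((UNIV - A) \<inter> {0..2*pi}) \<union> (A \<inter> {0..2*pi}) = {0..2*pi}" by auto
      moreover have "set_lebesgue_integral circ {0..2*pi} h = 0"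
        using tot set_integral_space[OF h] by (simp add: space_circ)
      ultimately show ?case using compl by simp
    next
      case (union A)
      have A: "A i \<in> sets borel" for i using union(2) unfolding borel_Ioo by (auto simp: sets_measure_of)
      have "set_lebesgue_integral circ (\<Union>i. A i \<inter> {0..2*pi}) h = (\<Sum>i. set_lebesgue_integral circ (A i \<inter> {0..2*pi}) h)"
      proof (rule lebesgue_integral_countable_add)
        show "A i \<inter> {0..2*pi} \<in> sets circ" for i by (intro sets_circ_Int A)
        show "A i \<inter> {0..2*pi} \<inter> (A j \<inter> {0..2*pi}) = {}" if "i \<noteq> j" for i j
          using union(1) that by (auto simp: disjoint_family_on_def)
        have "(\<Union>i. A i \<inter> {0..2*pi}) \<in> sets circ" using sets_circ_Int[OF A] by (intro sets.countable_UN) blast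
        then show "set_integrable circ (\<Union>i. A i \<inter> {0..2*pi}) h"
          unfolding set_integrable_def using h by (intro integrable_mult_indicator)
      qed
      then show ?case using union(3) by (simp add: Int_UN_distrib2)
    qed
  qed
  show ?thesis
  proof (rule density_zero[OF h])
    fix A assume "A \<in> sets circ"
    then obtain B where "B \<in> sets borel" "A = B \<inter> {0..2*pi}" by (rule sets_circE)
    then show "set_lebesgue_integral circ A h = 0" using all by simp
  qed
qed

section \<open>Sobolev functions\<close>

lemma weight_sq: "(jb n powr s * c)\<^sup>2 = c\<^sup>2 * jb n powr (2 * s)"
proof -
  have "jb n powr (2 * s) = (jb n powr s)\<^sup>2" by (simp add: power2_eq_square flip: powr_add)
  then show ?thesis by (simp add: power_mult_distrib)
qed

lemma sobolev_circle_L2: "f \<in> sobolev s \<Longrightarrow> f \<in> circle_L2"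
  by (simp add: sobolev_def)

lemma sobolev_L2_set_le:
  assumes f: "f \<in> sobolev s" and S: "finite S"
  shows "L2_set (\<lambda>n. jb n powr s * cmod (fourier_coeff f n)) S \<le> sobolev_norm s f"
  unfolding L2_set_def sobolev_norm_def weight_sq
  using f S by (intro real_sqrt_le_mono finite_sum_le_infsum) (auto simp: sobolev_def)

lemma sobolev_norm_le:
  assumes f: "f \<in> sobolev s"
    and R: "\<And>S. finite S \<Longrightarrow> L2_set (\<lambda>n. jb n powr s * cmod (fourier_coeff f n)) S \<le> R"
  shows "sobolev_norm s f \<le> R"
proof -
  have R0: "0 \<le> R" using R[of "{}"] by simp
  have "(\<Sum>\<^sub>\<infinity>n. (cmod (fourier_coeff f n))\<^sup>2 * jb n powr (2 * s)) \<le> R\<^sup>2"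
  proof (rule infsum_le_finite_sums)
    show "(\<lambda>n. (cmod (fourier_coeff f n))\<^sup>2 * jb n powr (2 * s)) summable_on UNIV"
      using f by (simp add: sobolev_def)
    fix S :: "int set" assume S: "finite S"
    have "(\<Sum>n\<in>S. (cmod (fourier_coeff f n))\<^sup>2 * jb n powr (2 * s)) = (L2_set (\<lambda>n. jb n powr s * cmod (fourier_coeff f n)) S)\<^sup>2"
      unfolding L2_set_def weight_sq by (simp add: sum_nonneg)
    also have "\<dots> \<le> R\<^sup>2" by (intro power_mono R S) simp
    finally show "(\<Sum>n\<in>S. (cmod (fourier_coeff f n))\<^sup>2 * jb n powr (2 * s)) \<le> R\<^sup>2" .
  qed
  then show ?thesis unfolding sobolev_norm_def using R0 by (simp add: real_le_lsqrt)
qed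

text \<open>Agrees with \<open>fcoef\<close> on continuous functions, but rests on the Lebesgue
  integral and so applies to classes modulo null sets.\<close>

definition ncoeff :: "(real \<Rightarrow> complex) \<Rightarrow> int \<Rightarrow> complex" where
  "ncoeff f n = fourier_coeff f n / (2 * pi)"

lemma L2_set_divide: "0 < c \<Longrightarrow> L2_set (\<lambda>n. g n / c) S = L2_set g S / c"
  using L2_set_left_distrib[of "1 / c" g S] by simp

lemma L2_set_ncoeff:
  "L2_set (\<lambda>n. jb n powr s * cmod (ncoeff f n)) S = L2_set (\<lambda>n. jb n powr s * cmod (fourier_coeff f n)) S / (2 * pi)"
  using L2_set_divide[of "2 * pi" "\<lambda>n. jb n powr s * cmod (fourier_coeff f n)" S]
  by (simp add: ncoeff_def norm_divide)

lemma fcoef_fser: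
  assumes "l1_quarter B a"
  shows "fcoef (fser a) n = a n"
proof -
  have "(\<lambda>N. fcoef (tpoly (modes N) a) n) \<longlonglongrightarrow> fcoef (fser a) n"
    by (rule fcoef_uniform_limit[OF fser_uniform_limit[OF assms]]) (auto intro: continuous_on_tpoly always_eventually)
  moreover have "(\<lambda>N. fcoef (tpoly (modes N) a) n) \<longlonglongrightarrow> a n"
  proof (rule tendsto_eventually)
    obtain N0 where "{n} \<subseteq> modes N0" using finite_subset_modes[of "{n}"] by blast
    then have "\<forall>N\<ge>N0. fcoef (tpoly (modes N) a) n = a n" using modes_mono by (auto simp: fcoef_tpoly)
    then show "\<forall>\<^sub>F N in sequentially. fcoef (tpoly (modes N) a) n = a n" by (auto simp: eventually_sequentially)
  qed
  ultimately show ?thesis by (rule LIMSEQ_unique)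
qed

text \<open>The Fourier series of \<open>f\<close> converges absolutely to a continuous function
  with the same coefficients, and uniqueness identifies the two almost everywhere.\<close>

lemma sobolev_fser:
  assumes s: "1 \<le> s"
  shows "\<exists>C>0. \<forall>f\<in>sobolev s. l1_quarter (C * sobolev_norm s f) (ncoeff f) \<and> (AE x in circ. f x = fser (ncoeff f) x)"
proof -
  obtain C where C: "C > 0" "\<And>a R. (\<And>S. finite S \<Longrightarrow> L2_set (\<lambda>n. jb n powr s * cmod (a n)) S \<le> R) \<Longrightarrow> l1_quarter (C * R) a"
    using l1_quarter_of_L2[OF s] by blast
  have "l1_quarter (C / (2 * pi) * sobolev_norm s f) (ncoeff f) \<and> (AE x in circ. f x = fser (ncoeff f) x)" if f: "f \<in> sobolev s" for f
  proof -
    have "l1_quarter (C * (sobolev_norm s f / (2 * pi))) (ncoeff f)"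
      using sobolev_L2_set_le[OF f] by (intro C) (simp add: L2_set_ncoeff divide_right_mono)
    then have l1: "l1_quarter (C / (2 * pi) * sobolev_norm s f) (ncoeff f)" by simp
    have fi: "integrable circ f" by (intro circle_L2_integrable sobolev_circle_L2[OF f])
    have gc: "continuous_on {0..2*pi} (fser (ncoeff f))" by (rule fser_continuous_on[OF l1])
    have gi: "integrable circ (fser (ncoeff f))" by (rule integrable_circ_continuous[OF gc])
    have "AE x in circ. f x - fser (ncoeff f) x = 0"
    proof (rule fourier_coeff_zero_imp)
      show "integrable circ (\<lambda>x. f x - fser (ncoeff f) x)" using fi gi by (rule Bochner_Integration.integrable_diff)
      fix n
      show "fourier_coeff (\<lambda>x. f x - fser (ncoeff f) x) n = 0"
        unfolding fourier_coeff_diff[OF fi gi] fourier_coeff_continuous[OF gc] fcoef_fser[OF l1]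
        by (simp add: ncoeff_def)
    qed
    then show ?thesis using l1 by simp
  qed
  then show ?thesis using C by (intro exI[of _ "C / (2 * pi)"]) auto
qed

subsection \<open>The weak derivative\<close>

lemma tpoly_L2_norm:
  assumes S: "finite S"
  shows "(LINT x|circ. (cmod (tpoly S c x))\<^sup>2) = 2 * pi * (\<Sum>n\<in>S. (cmod (c n))\<^sup>2)"
proof -
  have pi: "integrable circ (tpoly S c)" by (intro integrable_circ_continuous continuous_on_tpoly)
  have cc: "cnj z * z = of_real ((cmod z)\<^sup>2)" for z by (metis complex_norm_square mult.commute)
  have "(LINT x|circ. complex_of_real ((cmod (tpoly S c x))\<^sup>2)) = (LINT x|circ. tpoly S c x * cnj (tpoly S c x))"
    by (simp only: complex_norm_square)
  also have "\<dots> = (\<Sum>n\<in>S. cnj (c n) * (2 * pi * c n))"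
    unfolding integral_circ_cnj_tpoly[OF pi]
    by (intro sum.cong refl) (simp add: fourier_coeff_continuous[OF continuous_on_tpoly] fcoef_tpoly S)
  also have "\<dots> = of_real (2 * pi * (\<Sum>n\<in>S. (cmod (c n))\<^sup>2))"
    by (simp add: sum_distrib_left mult.left_commute[of "cnj _"] cc mult.assoc)
  finally show ?thesis
    unfolding integral_complex_of_real of_real_eq_iff .
qed

lemma bounded_sums_tail:
  fixes g :: "int \<Rightarrow> real"
  assumes g: "\<And>n. 0 \<le> g n" and R: "\<And>S. finite S \<Longrightarrow> sum g S \<le> R" and \<eta>: "0 < \<eta>"
  shows "\<exists>N. \<forall>S. finite S \<longrightarrow> S \<inter> modes N = {} \<longrightarrow> sum g S \<le> \<eta>"
proof -
  define c where "c = (SUP S\<in>{S. finite S}. sum g S)"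
  have bddg: "bdd_above (sum g ` {S. finite S})" using R by (intro bdd_aboveI[of _ R]) auto
  have "c - \<eta> < c" using \<eta> by simp
  then obtain S0 where S0: "finite S0" "c - \<eta> < sum g S0"
    unfolding c_def using bddg by (subst (asm) less_cSUP_iff) auto
  obtain N where N: "S0 \<subseteq> modes N" using finite_subset_modes[OF S0(1)] by blast
  have "sum g S \<le> \<eta>" if "finite S" "S \<inter> modes N = {}" for S
  proof -
    have "sum g S + sum g S0 = sum g (S \<union> S0)" using that S0 N by (intro sum.union_disjoint[symmetric]) auto
    also have "\<dots> \<le> c" unfolding c_def using that S0 bddg by (intro cSUP_upper) auto
    finally show ?thesis using S0 by simp
  qed
  then show ?thesis by blast
qed

lemma tpoly_periodic: "circle_periodic (tpoly S c)"
proof -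
  have "cis (of_int n * (x + 2 * pi)) = cis (of_int n * x)" for n x
  proof -
    have "cis (of_int n * (x + 2 * pi)) = cis (of_int n * x) * cis (2 * pi * of_int n)"
      by (simp add: cis_mult algebra_simps)
    then show ?thesis using cis_multiple_2pi[of "of_int n"] by simp
  qed
  then show ?thesis by (simp add: circle_periodic_def tpoly_def)
qed

text \<open>Along a fast subsequence the norms of the blocks decay geometrically, so the partial
  sums converge absolutely almost everywhere. The conclusion is put in weak form, tested against
  bounded functions, which is what integration by parts consumes.\<close>

lemma riesz_fischer:
  assumes R: "\<And>S. finite S \<Longrightarrow> (\<Sum>n\<in>S. (cmod (c n))\<^sup>2) \<le> R"
  shows "\<exists>g\<in>circle_L2. \<exists>r. strict_mono r \<and> (\<forall>\<phi> B. \<phi> \<in> borel_measurable circ \<longrightarrow> (\<forall>x. cmod (\<phi> x) \<le> B) \<longrightarrow>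
    (\<lambda>j. LINT x|circ. tpoly (modes (r j)) c x * \<phi> x) \<longlonglongrightarrow> (LINT x|circ. g x * \<phi> x))"
proof -
  interpret finite_measure circ by (rule finite_measure_circ)
  have "\<exists>N. \<forall>S. finite S \<longrightarrow> S \<inter> modes N = {} \<longrightarrow> (\<Sum>n\<in>S. (cmod (c n))\<^sup>2) \<le> (1/4) ^ j" for j :: nat
    by (rule bounded_sums_tail) (use R in auto)
  then obtain N where N: "\<And>j S. finite S \<Longrightarrow> S \<inter> modes (N j) = {} \<Longrightarrow> (\<Sum>n\<in>S. (cmod (c n))\<^sup>2) \<le> (1/4) ^ j" by metis
  \<comment> \<open>The sum over \<open>i \<le> j\<close> guarantees \<open>N j \<le> r j\<close>,
    the extra \<open>j\<close> strict monotonicity.\<close>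
  define r where "r j = (\<Sum>i\<le>j. N i) + j" for j
  have r: "strict_mono r" by (rule strict_monoI_Suc) (simp add: r_def)
  have Nr: "N j \<le> r j" for j unfolding r_def by (intro trans_le_add1 member_le_sum) auto
  define p where "p j = tpoly (modes (r j)) c" for j
  define D where "D j = tpoly (modes (r (Suc j)) - modes (r j)) c" for j
  have rS: "modes (r j) \<subseteq> modes (r (Suc j))" for j using r by (intro modes_mono) (simp add: strict_mono_less_eq)
  have pD: "p (Suc j) x = p j x + D j x" for j x
    unfolding p_def D_def tpoly_def using rS by (subst sum.subset_diff[of "modes (r j)" "modes (r (Suc j))"]) auto
  have p_sum: "p j x = p 0 x + (\<Sum>i<j. D i x)" for j x
    by (induct j) (simp_all add: pD)
  have Dc: "continuous_on X (D j)" for X j unfolding D_def by (rule continuous_on_tpoly)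
  have pc: "continuous_on X (p j)" for X j unfolding p_def by (rule continuous_on_tpoly)
  have Di: "integrable circ (D j)" for j by (intro integrable_circ_continuous Dc)
  have Dm: "D j \<in> borel_measurable borel" for j by (intro borel_measurable_continuous_onI Dc)
  have pm: "p j \<in> borel_measurable borel" for j by (intro borel_measurable_continuous_onI pc)
  have D2i: "integrable circ (\<lambda>x. (cmod (D j x))\<^sup>2)" for j
  proof -
    have "integrable circ (\<lambda>x. complex_of_real ((cmod (D j x))\<^sup>2))"
      by (intro integrable_circ_continuous continuous_intros Dc)
    then show ?thesis by (simp only: complex_of_real_integrable_eq)
  qed
  have D2: "(LINT x|circ. (cmod (D j x))\<^sup>2) \<le> 2 * pi * (1/4) ^ j" for j
    unfolding D_def using modes_mono[OF Nr] by (subst tpoly_L2_norm) (auto intro!: mult_left_mono N)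
  have D1: "(LINT x|circ. cmod (D j x)) \<le> 2 * pi * (1/2) ^ j" for j
  proof -
    \<comment> \<open>Arithmetic-geometric mean with weight \<open>(1/2) ^ j\<close>, balanced so
      that the \<open>L^1\<close> norm of the block inherits the decay \<open>(1/2) ^ j\<close> from
      its squared \<open>L^2\<close> norm, which is of size \<open>(1/4) ^ j\<close>.\<close>
    have pt: "cmod (D j x) \<le> (1/2) ^ j / 2 + (cmod (D j x))\<^sup>2 / (2 * (1/2) ^ j)" for x
    proof -
      have "0 \<le> ((1/2) ^ j - cmod (D j x))\<^sup>2" by simp
      then have "2 * (1/2) ^ j * cmod (D j x) \<le> ((1/2) ^ j)\<^sup>2 + (cmod (D j x))\<^sup>2" by (simp add: power2_diff)
      then show ?thesis by (simp add: field_simps power2_eq_square)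
    qed
    have "(LINT x|circ. cmod (D j x)) \<le> (LINT x|circ. (1/2) ^ j / 2 + (cmod (D j x))\<^sup>2 / (2 * (1/2) ^ j))"
      using Di D2i by (intro integral_mono pt) auto
    also have "\<dots> = 2 * pi * ((1/2) ^ j / 2) + (LINT x|circ. (cmod (D j x))\<^sup>2) / (2 * (1/2) ^ j)"
      using D2i by (simp add: measure_restrict_space space_restrict_space)
    also have "\<dots> \<le> 2 * pi * ((1/2) ^ j / 2) + 2 * pi * (1/4) ^ j / (2 * (1/2) ^ j)"
      by (intro add_left_mono divide_right_mono D2) auto
    also have "(1/4 :: real) ^ j = (1/2) ^ j * (1/2) ^ j" by (simp flip: power_mult_distrib)
    finally show ?thesis by simp
  qed
  have sumD1: "summable (\<lambda>j. LINT x|circ. cmod (D j x))"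
  proof (rule summable_comparison_test')
    show "summable (\<lambda>j. 2 * pi * (1/2) ^ j :: real)" by (intro summable_mult summable_geometric) auto
    show "norm (LINT x|circ. cmod (D j x)) \<le> 2 * pi * (1/2) ^ j" if "0 \<le> j" for j
      using D1[of j] Bochner_Integration.integral_nonneg[of circ "\<lambda>x. cmod (D j x)"] by simp
  qed
  have aesum: "AE x in circ. summable (\<lambda>j. cmod (D j x))"
  proof -
    have "(\<integral>\<^sup>+x. (\<Sum>j. ennreal (cmod (D j x))) \<partial>circ) = (\<Sum>j. \<integral>\<^sup>+x. ennreal (cmod (D j x)) \<partial>circ)"
      by (intro nn_integral_suminf) (use borel_circ[OF Dm] in auto)
    also have "\<dots> = (\<Sum>j. ennreal (LINT x|circ. cmod (D j x)))"
      using Di by (intro arg_cong[where f = suminf] ext nn_integral_eq_integral) auto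
    also have "\<dots> \<noteq> \<infinity>" using sumD1 by (simp add: ennreal_suminf_neq_top)
    finally have "AE x in circ. (\<Sum>j. ennreal (cmod (D j x))) \<noteq> \<infinity>"
      using borel_circ[OF Dm] by (intro nn_integral_PInf_AE) auto
    then show ?thesis by (rule AE_mp) (auto intro!: AE_I2 intro: summable_suminf_not_top)
  qed
  define g where "g x = p 0 x + (\<Sum>j. D j x)" for x
  have gm: "g \<in> borel_measurable borel" unfolding g_def using pm Dm by measurable
  have per: "circle_periodic g"
    using tpoly_periodic unfolding circle_periodic_def g_def p_def D_def by simp
  have aelim: "AE x in circ. (\<lambda>j. p j x) \<longlonglongrightarrow> g x"
    using aesum
  proof (rule AE_mp, intro AE_I2 impI)
    fix x assume "summable (\<lambda>j. cmod (D j x))"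
    then have "summable (\<lambda>j. D j x)" by (rule summable_norm_cancel)
    then have "(\<lambda>j. p 0 x + (\<Sum>i<j. D i x)) \<longlonglongrightarrow> g x"
      unfolding g_def by (intro tendsto_add tendsto_const summable_LIMSEQ)
    then show "(\<lambda>j. p j x) \<longlonglongrightarrow> g x" by (simp only: p_sum[symmetric])
  qed
  \<comment> \<open>Fatou's lemma along the subsequence; the squared norms of the partial sums are
    at most \<open>2 * pi * R\<close>.\<close>
  have g2: "integrable circ (\<lambda>x. (cmod (g x))\<^sup>2)"
  proof (rule integrableI_bounded)
    show "(\<lambda>x. (cmod (g x))\<^sup>2) \<in> borel_measurable circ" using borel_circ[OF gm] by simp
    have "(\<integral>\<^sup>+x. ennreal (norm ((cmod (g x))\<^sup>2)) \<partial>circ) = (\<integral>\<^sup>+x. liminf (\<lambda>j. ennreal ((cmod (p j x))\<^sup>2)) \<partial>circ)"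
    proof (rule nn_integral_cong_AE, use aelim in \<open>rule AE_mp\<close>, intro AE_I2 impI)
      fix x assume "(\<lambda>j. p j x) \<longlonglongrightarrow> g x"
      then have "(\<lambda>j. ennreal ((cmod (p j x))\<^sup>2)) \<longlonglongrightarrow> ennreal ((cmod (g x))\<^sup>2)"
        by (intro tendsto_ennrealI tendsto_power tendsto_norm)
      from lim_imp_Liminf[OF trivial_limit_sequentially this] show "ennreal (norm ((cmod (g x))\<^sup>2)) = liminf (\<lambda>j. ennreal ((cmod (p j x))\<^sup>2))"
        by simp
    qed
    also have "\<dots> \<le> liminf (\<lambda>j. \<integral>\<^sup>+x. ennreal ((cmod (p j x))\<^sup>2) \<partial>circ)"
      by (intro nn_integral_liminf) (use borel_circ[OF pm] in auto)
    also have "\<dots> \<le> ennreal (2 * pi * R)"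
    proof -
      have "(\<integral>\<^sup>+x. ennreal ((cmod (p j x))\<^sup>2) \<partial>circ) \<le> ennreal (2 * pi * R)" for j
      proof -
        have "integrable circ (\<lambda>x. complex_of_real ((cmod (p j x))\<^sup>2))"
          by (intro integrable_circ_continuous continuous_intros pc)
        then have "integrable circ (\<lambda>x. (cmod (p j x))\<^sup>2)" by (simp only: complex_of_real_integrable_eq)
        then have "(\<integral>\<^sup>+x. ennreal ((cmod (p j x))\<^sup>2) \<partial>circ) = ennreal (LINT x|circ. (cmod (p j x))\<^sup>2)"
          by (intro nn_integral_eq_integral) auto
        also have "(LINT x|circ. (cmod (p j x))\<^sup>2) \<le> 2 * pi * R"
          unfolding p_def tpoly_L2_norm[OF finite_modes] by (intro mult_left_mono R) auto
        finally show ?thesis by (simp add: ennreal_leI)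
      qed
      then have "liminf (\<lambda>j. \<integral>\<^sup>+x. ennreal ((cmod (p j x))\<^sup>2) \<partial>circ) \<le> liminf (\<lambda>j::nat. ennreal (2 * pi * R))"
        by (intro Liminf_mono always_eventually allI)
      then show ?thesis by (simp add: Liminf_const)
    qed
    finally show "(\<integral>\<^sup>+x. ennreal (norm ((cmod (g x))\<^sup>2)) \<partial>circ) < \<infinity>"
      using le_less_trans ennreal_less_top by (metis infinity_ennreal_def)
  qed
  have gL2: "g \<in> circle_L2" using per gm g2 by (simp add: circle_L2_def set_integrable_circ)
  have lim: "(\<lambda>j. LINT x|circ. p j x * \<phi> x) \<longlonglongrightarrow> (LINT x|circ. g x * \<phi> x)"
    if \<phi>: "\<phi> \<in> borel_measurable circ" "\<And>x. cmod (\<phi> x) \<le> B" for \<phi> B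
  proof -
    have i: "integrable circ (\<lambda>x. D j x * \<phi> x)" for j by (rule integrable_circ_mult_bounded[OF Di \<phi>])
    have ip: "integrable circ (\<lambda>x. p j x * \<phi> x)" for j
      by (rule integrable_circ_mult_bounded[OF integrable_circ_continuous[OF pc] \<phi>])
    have 1: "AE x in circ. summable (\<lambda>j. norm (D j x * \<phi> x))"
      using aesum
    proof (rule AE_mp, intro AE_I2 impI)
      fix x assume "summable (\<lambda>j. cmod (D j x))"
      then have "summable (\<lambda>j. cmod (D j x) * cmod (\<phi> x))" by (rule summable_mult2)
      then show "summable (\<lambda>j. norm (D j x * \<phi> x))" by (simp add: norm_mult)
    qed
    have 2: "summable (\<lambda>j. LINT x|circ. norm (D j x * \<phi> x))"
    proof (rule summable_comparison_test')
      show "summable (\<lambda>j. (LINT x|circ. cmod (D j x)) * B)" using sumD1 by (rule summable_mult2)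
      fix j :: nat assume "0 \<le> j"
      have "(LINT x|circ. norm (D j x * \<phi> x)) \<le> (LINT x|circ. cmod (D j x) * B)"
      proof (rule integral_mono)
        show "integrable circ (\<lambda>x. norm (D j x * \<phi> x))" by (rule integrable_norm[OF i])
        show "integrable circ (\<lambda>x. cmod (D j x) * B)" using Di by simp
        show "norm (D j x * \<phi> x) \<le> cmod (D j x) * B" for x
          by (simp add: norm_mult mult_left_mono \<phi>(2))
      qed
      then show "norm (LINT x|circ. norm (D j x * \<phi> x)) \<le> (LINT x|circ. cmod (D j x)) * B"
        using Bochner_Integration.integral_nonneg[of circ "\<lambda>x. norm (D j x * \<phi> x)"] by simp
    qed
    have "(\<lambda>j. LINT x|circ. D j x * \<phi> x) sums (LINT x|circ. (\<Sum>j. D j x * \<phi> x))"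
      by (rule sums_integral[OF i 1 2])
    then have "(\<lambda>n. (LINT x|circ. p 0 x * \<phi> x) + (\<Sum>j<n. LINT x|circ. D j x * \<phi> x)) \<longlonglongrightarrow>
       (LINT x|circ. p 0 x * \<phi> x) + (LINT x|circ. (\<Sum>j. D j x * \<phi> x))"
      unfolding sums_def by (intro tendsto_add tendsto_const)
    moreover have "(LINT x|circ. p 0 x * \<phi> x) + (\<Sum>j<n. LINT x|circ. D j x * \<phi> x) = (LINT x|circ. p n x * \<phi> x)" for n
      unfolding p_sum[of n] distrib_right sum_distrib_right using ip i
      by (simp add: Bochner_Integration.integral_sum)
    moreover have "(LINT x|circ. p 0 x * \<phi> x) + (LINT x|circ. (\<Sum>j. D j x * \<phi> x)) = (LINT x|circ. g x * \<phi> x)"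
    proof -
      have "(LINT x|circ. g x * \<phi> x) = (LINT x|circ. p 0 x * \<phi> x + (\<Sum>j. D j x * \<phi> x))"
      proof (rule integral_cong_AE)
        show "(\<lambda>x. g x * \<phi> x) \<in> borel_measurable circ" using borel_circ[OF gm] \<phi>(1) by simp
        show "(\<lambda>x. p 0 x * \<phi> x + (\<Sum>j. D j x * \<phi> x)) \<in> borel_measurable circ"
          using borel_circ[OF pm] borel_circ[OF Dm] \<phi>(1) by measurable
        show "AE x in circ. g x * \<phi> x = p 0 x * \<phi> x + (\<Sum>j. D j x * \<phi> x)"
          using aesum
        proof (rule AE_mp, intro AE_I2 impI)
          fix x assume "summable (\<lambda>j. cmod (D j x))"
          then have "summable (\<lambda>j. D j x)" by (rule summable_norm_cancel)
          then show "g x * \<phi> x = p 0 x * \<phi> x + (\<Sum>j. D j x * \<phi> x)"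
            by (simp add: g_def distrib_right suminf_mult2)
        qed
      qed
      then show ?thesis using ip integrable_suminf[OF i 1 2] by simp
    qed
    ultimately show ?thesis by simp
  qed
  show ?thesis
    by (rule bexI[OF _ gL2], rule exI[of _ r]) (use r lim in \<open>auto simp: p_def\<close>)
qed

section \<open>Integration by parts against periodic test functions\<close>

lemma test_function_props:
  assumes "circle_test_function \<phi>"
  shows "\<And>x. (\<phi> has_real_derivative deriv \<phi> x) (at x)" "continuous_on X \<phi>" "continuous_on X (deriv \<phi>)" "\<phi> (2 * pi) = \<phi> 0"
proof -
  have d: "(deriv ^^ m) \<phi> field_differentiable at x" for m x using assms by (simp add: circle_test_function_def)
  show 1: "(\<phi> has_real_derivative deriv \<phi> x) (at x)" for x
    using d[of 0 x] by (simp add: DERIV_deriv_iff_field_differentiable)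
  have 2: "(deriv \<phi> has_real_derivative deriv (deriv \<phi>) x) (at x)" for x
    using d[of 1 x] by (simp add: DERIV_deriv_iff_field_differentiable)
  show "continuous_on X \<phi>"
    by (rule DERIV_continuous_on[OF has_field_derivative_at_within[OF 1]])
  show "continuous_on X (deriv \<phi>)"
    by (rule DERIV_continuous_on[OF has_field_derivative_at_within[OF 2]])
  show "\<phi> (2 * pi) = \<phi> 0" using assms unfolding circle_test_function_def circle_periodic_def by (metis add_0)
qed

lemma tpoly_by_parts:
  assumes \<phi>: "circle_test_function \<phi>"
  shows "(LINT x|circ. tpoly S a x * of_real (deriv \<phi> x)) = - (LINT x|circ. tpoly S (\<lambda>n. \<i> * of_int n * a n) x * of_real (\<phi> x))"
proof -
  note p = test_function_props[OF \<phi>]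
  let ?b = "\<lambda>n. \<i> * of_int n * a n"
  have d: "((\<lambda>x. tpoly S a x * of_real (\<phi> x)) has_vector_derivative
     (tpoly S a x * of_real (deriv \<phi> x) + tpoly S ?b x * of_real (\<phi> x))) (at x within {0..2*pi})" for x
  proof -
    have "(\<phi> has_vector_derivative deriv \<phi> x) (at x within {0..2*pi})"
      using p(1)[of x] by (simp add: has_real_derivative_iff_has_vector_derivative has_vector_derivative_at_within)
    then have "((\<lambda>x. complex_of_real (\<phi> x)) has_vector_derivative of_real (deriv \<phi> x)) (at x within {0..2*pi})"
      by (rule bounded_linear.has_vector_derivative[OF bounded_linear_of_real])
    from has_vector_derivative_mult[OF has_vector_derivative_at_within[OF tpoly_has_vector_derivative] this]
    show ?thesis by simp
  qed
  have "((\<lambda>x. tpoly S a x * of_real (deriv \<phi> x) + tpoly S ?b x * of_real (\<phi> x)) has_integral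
     (tpoly S a (2*pi) * of_real (\<phi> (2*pi)) - tpoly S a 0 * of_real (\<phi> 0))) {0..2*pi}"
    by (rule fundamental_theorem_of_calculus[OF _ d]) simp
  moreover have "tpoly S a (2*pi) = tpoly S a 0"
    using tpoly_periodic[of S a] unfolding circle_periodic_def by (metis add_0)
  ultimately have "integral {0..2*pi} (\<lambda>x. tpoly S a x * of_real (deriv \<phi> x) + tpoly S ?b x * of_real (\<phi> x)) = 0"
    by (simp add: integral_unique p(4))
  moreover have c1: "continuous_on {0..2*pi} (\<lambda>x. tpoly S a x * of_real (deriv \<phi> x))"
    and c2: "continuous_on {0..2*pi} (\<lambda>x. tpoly S ?b x * of_real (\<phi> x))"
    by (intro continuous_intros p)+
  ultimately show ?thesis
    unfolding integral_circ_continuous[OF c1] integral_circ_continuous[OF c2]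
    using integrable_continuous_real[OF c1] integrable_continuous_real[OF c2]
    by (simp add: Henstock_Kurzweil_Integration.integral_add eq_neg_iff_add_eq_0)
qed

text \<open>\<open>weak_deriv\<close> is a choice and carries no information until some weak
  derivative is exhibited. The candidate has the coefficients of the termwise derivative; its
  identity holds for truncations and passes to the limit along the subsequence of
  \<open>riesz_fischer\<close>.\<close>

lemma weak_derivative_exists:
  assumes s: "1 \<le> s" and f: "f \<in> sobolev s"
  shows "has_weak_deriv f (weak_deriv f)"
proof -
  interpret finite_measure circ by (rule finite_measure_circ)
  obtain C where "l1_quarter (C * sobolev_norm s f) (ncoeff f)" and ae: "AE x in circ. f x = fser (ncoeff f) x"
    using sobolev_fser[OF s] f by blast
  then obtain B where B: "l1_quarter B (ncoeff f)" by blast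
  define c where "c n = \<i> * of_int n * ncoeff f n" for n
  have R: "(\<Sum>n\<in>S. (cmod (c n))\<^sup>2) \<le> (sobolev_norm s f / (2 * pi))\<^sup>2" if S: "finite S" for S
  proof -
    have "(\<Sum>n\<in>S. (cmod (c n))\<^sup>2) \<le> (\<Sum>n\<in>S. (jb n powr s * cmod (ncoeff f n))\<^sup>2)"
    proof (intro sum_mono power_mono)
      fix n
      have "jb n powr 1 \<le> jb n powr s" using s by (rule jb_powr_mono)
      then have "\<bar>real_of_int n\<bar> \<le> jb n powr s" using abs_le_jb[of n] by simp
      then show "cmod (c n) \<le> jb n powr s * cmod (ncoeff f n)" by (simp add: c_def norm_mult mult_right_mono)
    qed auto
    also have "\<dots> = (L2_set (\<lambda>n. jb n powr s * cmod (ncoeff f n)) S)\<^sup>2" by (simp add: L2_set_def sum_nonneg)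
    also have "\<dots> \<le> (sobolev_norm s f / (2 * pi))\<^sup>2"
      unfolding L2_set_ncoeff by (intro power_mono divide_right_mono sobolev_L2_set_le f S) auto
    finally show ?thesis .
  qed
  obtain g r where g: "g \<in> circle_L2" "strict_mono r" and lim: "\<And>\<phi> B. \<phi> \<in> borel_measurable circ \<Longrightarrow> (\<And>x. cmod (\<phi> x) \<le> B) \<Longrightarrow>
      (\<lambda>j. LINT x|circ. tpoly (modes (r j)) c x * \<phi> x) \<longlonglongrightarrow> (LINT x|circ. g x * \<phi> x)"
    using riesz_fischer[of c, OF R] by blast
  have "has_weak_deriv f g"
    unfolding has_weak_deriv_def
  proof (intro conjI g(1) allI impI)
    fix \<phi> assume \<phi>: "circle_test_function \<phi>"
    note p = test_function_props[OF \<phi>]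
    \<comment> \<open>\<open>\<phi>\<close> clamped to one period: the weak convergence asks for a
      test function with a global bound.\<close>
    define \<psi> where "\<psi> x = complex_of_real (\<phi> (max 0 (min (2*pi) x)))" for x
    have \<psi>c: "continuous_on UNIV \<psi>"
      unfolding \<psi>_def by (intro continuous_intros continuous_on_compose2[OF p(2)[of UNIV]]) auto
    have \<psi>eq: "\<psi> x = of_real (\<phi> x)" if "x \<in> {0..2*pi}" for x using that by (simp add: \<psi>_def)
    obtain B1 where B1: "\<And>x. x \<in> {0..2*pi} \<Longrightarrow> norm (\<phi> x) \<le> B1"
      using compact_imp_bounded[OF compact_continuous_image[OF p(2) compact_Icc]] unfolding bounded_iff by blast
    have \<psi>b: "cmod (\<psi> x) \<le> B1" for x using B1[of "max 0 (min (2*pi) x)"] by (simp add: \<psi>_def)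
    have congr: "(LINT x|circ. h x * of_real (\<phi> x)) = (LINT x|circ. h x * \<psi> x)" for h
      by (intro Bochner_Integration.integral_cong) (simp_all add: space_circ \<psi>eq)
    have l1: "(\<lambda>j. LINT x|circ. tpoly (modes (r j)) c x * of_real (\<phi> x)) \<longlonglongrightarrow> (LINT x|circ. g x * of_real (\<phi> x))"
      unfolding congr by (rule lim[OF _ \<psi>b]) (intro borel_circ borel_measurable_continuous_onI \<psi>c)
    obtain B2 where B2: "\<And>x. x \<in> {0..2*pi} \<Longrightarrow> norm (deriv \<phi> x) \<le> B2"
      using compact_imp_bounded[OF compact_continuous_image[OF p(3) compact_Icc]] unfolding bounded_iff by blast
    have l2: "(\<lambda>j. LINT x|circ. tpoly (modes (r j)) (ncoeff f) x * of_real (deriv \<phi> x)) \<longlonglongrightarrow> (LINT x|circ. fser (ncoeff f) x * of_real (deriv \<phi> x))"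
    proof (rule integral_dominated_convergence)
      have dm: "(\<lambda>x. complex_of_real (deriv \<phi> x)) \<in> borel_measurable borel"
        by (intro borel_measurable_continuous_onI continuous_intros p)
      have fm: "fser (ncoeff f) \<in> borel_measurable borel"
        by (intro borel_measurable_continuous_onI fser_continuous_on[OF B])
      show "(\<lambda>x. fser (ncoeff f) x * of_real (deriv \<phi> x)) \<in> borel_measurable circ"
        by (intro borel_circ borel_measurable_times dm fm)
      show "(\<lambda>x. tpoly (modes (r j)) (ncoeff f) x * of_real (deriv \<phi> x)) \<in> borel_measurable circ" for j
        by (intro borel_circ borel_measurable_times dm tpoly_measurable)
      show "integrable circ (\<lambda>x. (B + B) * B2)" by simp
      have ul: "(\<lambda>j. tpoly (modes j) (ncoeff f) x) \<longlonglongrightarrow> fser (ncoeff f) x" for x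
        using tendsto_uniform_limitI[OF fser_uniform_limit[OF B, of UNIV]] by simp
      show "AE x in circ. (\<lambda>j. tpoly (modes (r j)) (ncoeff f) x * of_real (deriv \<phi> x)) \<longlonglongrightarrow> fser (ncoeff f) x * of_real (deriv \<phi> x)"
        using LIMSEQ_subseq_LIMSEQ[OF ul g(2)] by (intro AE_I2 tendsto_mult tendsto_const) (simp add: o_def)
      show "AE x in circ. norm (tpoly (modes (r j)) (ncoeff f) x * of_real (deriv \<phi> x)) \<le> (B + B) * B2" for j
      proof (rule AE_I2)
        fix x assume x: "x \<in> space circ"
        have "cmod (tpoly (modes (r j)) (ncoeff f) x) \<le> (\<Sum>n\<in>modes (r j). cmod (ncoeff f n))" by (rule tpoly_bound)
        also have "\<dots> \<le> (\<Sum>n\<in>modes (r j). jb n powr (1/4) * cmod (ncoeff f n))"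
          using jb_powr_ge1[of "1/4"] by (intro sum_mono) (simp add: mult_le_cancel_right1)
        also have "\<dots> \<le> B" using B by (simp add: l1_quarter_def)
        finally have 1: "cmod (tpoly (modes (r j)) (ncoeff f) x) \<le> B + B" using l1_quarter_nonneg[OF B] by simp
        have 2: "\<bar>deriv \<phi> x\<bar> \<le> B2" using B2[of x] x by (simp add: space_circ)
        show "norm (tpoly (modes (r j)) (ncoeff f) x * of_real (deriv \<phi> x)) \<le> (B + B) * B2"
          unfolding norm_mult norm_of_real using 1 2 l1_quarter_nonneg[OF B] by (intro mult_mono) auto
      qed
    qed
    have "(\<lambda>j. LINT x|circ. tpoly (modes (r j)) (ncoeff f) x * of_real (deriv \<phi> x)) \<longlonglongrightarrow> - (LINT x|circ. g x * of_real (\<phi> x))"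
      unfolding tpoly_by_parts[OF \<phi>] c_def[symmetric] by (intro tendsto_minus l1)
    then have "(LINT x|circ. fser (ncoeff f) x * of_real (deriv \<phi> x)) = - (LINT x|circ. g x * of_real (\<phi> x))"
      by (rule LIMSEQ_unique[OF l2])
    moreover have "(LINT x|circ. f x * of_real (deriv \<phi> x)) = (LINT x|circ. fser (ncoeff f) x * of_real (deriv \<phi> x))"
    proof (rule integral_cong_AE)
      have dm: "(\<lambda>x. complex_of_real (deriv \<phi> x)) \<in> borel_measurable borel"
        by (intro borel_measurable_continuous_onI continuous_intros p)
      show "(\<lambda>x. f x * of_real (deriv \<phi> x)) \<in> borel_measurable circ"
        by (intro borel_circ borel_measurable_times dm circle_L2_measurable sobolev_circle_L2[OF f])
      show "(\<lambda>x. fser (ncoeff f) x * of_real (deriv \<phi> x)) \<in> borel_measurable circ"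
        by (intro borel_circ borel_measurable_times dm borel_measurable_continuous_onI fser_continuous_on[OF B])
      show "AE x in circ. f x * of_real (deriv \<phi> x) = fser (ncoeff f) x * of_real (deriv \<phi> x)"
        using ae by (rule AE_mp) (auto intro!: AE_I2)
    qed
    ultimately show "(LBINT x:{0..2*pi}. f x * of_real (deriv \<phi> x)) = - (LBINT x:{0..2*pi}. g x * of_real (\<phi> x))"
      by (simp add: set_integral_circ)
  qed
  then show ?thesis unfolding weak_deriv_def by (rule someI[where P = "has_weak_deriv f"])
qed

lemma trig_has_derivative:
  "((\<lambda>x. \<alpha> * cos (c * x) + \<beta> * sin (c * x)) has_real_derivative (\<beta> * c) * cos (c * x) + (- \<alpha> * c) * sin (c * x)) (at x)"
  by (auto intro!: derivative_eq_intros)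

lemma deriv_trig:
  "deriv (\<lambda>x. \<alpha> * cos (c * x) + \<beta> * sin (c * x)) = (\<lambda>x. (\<beta> * c) * cos (c * x) + (- \<alpha> * c) * sin (c * x))"
  for \<alpha> \<beta> c :: real
  by (intro ext DERIV_imp_deriv trig_has_derivative)

text \<open>The span of the cosine and the sine of frequency \<open>n\<close> is closed under
  differentiation, so all iterated derivatives stay in it.\<close>

lemma trig_test_function:
  "circle_test_function (\<lambda>x. \<alpha> * cos (of_int n * x) + \<beta> * sin (of_int n * x))"
  unfolding circle_test_function_def
proof (intro conjI allI)
  have "cos (of_int n * (x + 2 * pi)) = cos (of_int n * x)" "sin (of_int n * (x + 2 * pi)) = sin (of_int n * x)" for x
  proof -
    have *: "of_int n * (x + 2 * pi) = of_int n * x + 2 * pi * of_int n" for x by (simp add: algebra_simps)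
    show "cos (of_int n * (x + 2 * pi)) = cos (of_int n * x)" "sin (of_int n * (x + 2 * pi)) = sin (of_int n * x)" for x
      unfolding * cos_add sin_add cos_int_2pin sin_int_2pin by simp_all
  qed
  then show "circle_periodic (\<lambda>x. \<alpha> * cos (of_int n * x) + \<beta> * sin (of_int n * x))"
    by (simp add: circle_periodic_def)
  have *: "\<exists>\<alpha>' \<beta>'. (deriv ^^ m) (\<lambda>x. \<alpha> * cos (of_int n * x) + \<beta> * sin (of_int n * x)) =
      (\<lambda>x. \<alpha>' * cos (of_int n * x) + \<beta>' * sin (of_int n * x))" for m
  proof (induct m)
    case (Suc m)
    then obtain \<alpha>' \<beta>' where e: "(deriv ^^ m) (\<lambda>x. \<alpha> * cos (of_int n * x) + \<beta> * sin (of_int n * x)) =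
      (\<lambda>x. \<alpha>' * cos (of_int n * x) + \<beta>' * sin (of_int n * x))" by blast
    have "(deriv ^^ Suc m) (\<lambda>x. \<alpha> * cos (of_int n * x) + \<beta> * sin (of_int n * x)) =
      (\<lambda>x. (\<beta>' * of_int n) * cos (of_int n * x) + (- \<alpha>' * of_int n) * sin (of_int n * x))"
      by (simp only: funpow.simps(2) comp_apply e deriv_trig)
    then show ?case by blast
  qed auto
  fix m x
  show "(deriv ^^ m) (\<lambda>x. \<alpha> * cos (of_int n * x) + \<beta> * sin (of_int n * x)) field_differentiable at x"
  proof -
    obtain \<alpha>' \<beta>' where e: "(deriv ^^ m) (\<lambda>x. \<alpha> * cos (of_int n * x) + \<beta> * sin (of_int n * x)) =
      (\<lambda>x. \<alpha>' * cos (of_int n * x) + \<beta>' * sin (of_int n * x))" using * by blast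
    show ?thesis unfolding e field_differentiable_def by (rule exI, rule trig_has_derivative)
  qed
qed

text \<open>Test functions are real valued, so cosine and sine are tested separately and recombined
  to the exponential.\<close>

lemma weak_deriv_coeff:
  assumes w: "has_weak_deriv f g" and f: "integrable circ f"
  shows "fourier_coeff g n = \<i> * of_int n * fourier_coeff f n"
proof -
  have g: "integrable circ g" using w by (auto simp: has_weak_deriv_def intro: circle_L2_integrable)
  define C where "C h = (LINT x|circ. h x * complex_of_real (cos (of_int n * x)))" for h :: "real \<Rightarrow> complex"
  define S where "S h = (LINT x|circ. h x * complex_of_real (sin (of_int n * x)))" for h :: "real \<Rightarrow> complex"
  have ic: "integrable circ (\<lambda>x. h x * complex_of_real (cos (of_int n * x)))" if "integrable circ h" for h
    by (rule integrable_circ_mult_bounded[OF that, where B = 1])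
       (auto intro!: borel_circ borel_measurable_continuous_onI continuous_intros)
  have isn: "integrable circ (\<lambda>x. h x * complex_of_real (sin (of_int n * x)))" if "integrable circ h" for h
    by (rule integrable_circ_mult_bounded[OF that, where B = 1])
       (auto intro!: borel_circ borel_measurable_continuous_onI continuous_intros)
  have fc: "fourier_coeff h n = C h - \<i> * S h" if h: "integrable circ h" for h
  proof -
    have "h x * cis (- (of_int n * x)) = h x * of_real (cos (of_int n * x)) - \<i> * (h x * of_real (sin (of_int n * x)))" for x
      by (simp add: complex_eq_iff algebra_simps)
    then show ?thesis
      unfolding fourier_coeff_circ C_def S_def using ic[OF h] isn[OF h] by simp
  qed
  have W: "(LINT x|circ. f x * of_real (deriv \<phi> x)) = - (LINT x|circ. g x * of_real (\<phi> x))" if "circle_test_function \<phi>" for \<phi>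
    using w that by (simp add: has_weak_deriv_def set_integral_circ)
  have "(LINT x|circ. f x * of_real (deriv (\<lambda>x. 1 * cos (of_int n * x) + 0 * sin (of_int n * x)) x)) = - of_int n * S f"
  proof -
    have "(LINT x|circ. f x * of_real (deriv (\<lambda>x. 1 * cos (of_int n * x) + 0 * sin (of_int n * x)) x)) =
      (LINT x|circ. - of_int n * (f x * of_real (sin (of_int n * x))))"
      unfolding deriv_trig by (intro Bochner_Integration.integral_cong refl) simp
    then show ?thesis unfolding S_def by (simp only: integral_mult_right_zero)
  qed
  then have 1: "of_int n * S f = C g" using W[OF trig_test_function[of 1 n 0]] by (simp add: C_def)
  have "(LINT x|circ. f x * of_real (deriv (\<lambda>x. 0 * cos (of_int n * x) + 1 * sin (of_int n * x)) x)) = of_int n * C f"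
  proof -
    have "(LINT x|circ. f x * of_real (deriv (\<lambda>x. 0 * cos (of_int n * x) + 1 * sin (of_int n * x)) x)) =
      (LINT x|circ. of_int n * (f x * of_real (cos (of_int n * x))))"
      unfolding deriv_trig by (intro Bochner_Integration.integral_cong refl) simp
    then show ?thesis unfolding C_def by (simp only: integral_mult_right_zero)
  qed
  then have 2: "of_int n * C f = - S g" using W[OF trig_test_function[of 0 n 1]] by (simp add: S_def)
  have "fourier_coeff g n = of_int n * S f + \<i> * (of_int n * C f)"
    unfolding fc[OF g] 1[symmetric] 2 by simp
  then show ?thesis unfolding fc[OF f] by (simp add: algebra_simps)
qed

text \<open>Bessel's inequality for the weak derivative, whose coefficients are
  \<open>\<i> * n\<close> times those of \<open>f\<close>.\<close>

lemma gradient_bound: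
  assumes s: "1 \<le> s" and f: "f \<in> sobolev s" and S: "finite S"
  shows "(\<Sum>n\<in>S. (of_int n)\<^sup>2 * (cmod (fourier_coeff f n))\<^sup>2) \<le> 2 * pi * (LBINT x:{0..2*pi}. (cmod (weak_deriv f x))\<^sup>2)"
proof -
  have w: "has_weak_deriv f (weak_deriv f)" by (rule weak_derivative_exists[OF s f])
  have fi: "integrable circ f" by (intro circle_L2_integrable sobolev_circle_L2[OF f])
  have gL: "weak_deriv f \<in> circle_L2" using w by (simp add: has_weak_deriv_def)
  have "(\<Sum>n\<in>S. (of_int n)\<^sup>2 * (cmod (fourier_coeff f n))\<^sup>2) = (\<Sum>n\<in>S. (cmod (fourier_coeff (weak_deriv f) n))\<^sup>2)"
    by (simp add: weak_deriv_coeff[OF w fi] norm_mult power_mult_distrib)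
  also have "\<dots> \<le> 2 * pi * (LINT x|circ. (cmod (weak_deriv f x))\<^sup>2)" by (rule bessel[OF gL S])
  finally show ?thesis by (simp add: set_integral_circ)
qed

subsection \<open>Mass and energy on the Fourier side\<close>

lemma mono_diag: "mono_fun i i f x = complex_of_real (cmod (f x) ^ (2 * i))"
proof -
  have "mono_fun i i f x = (f x * cnj (f x)) ^ i" by (simp add: mono_fun_def power_mult_distrib)
  also have "\<dots> = (complex_of_real ((cmod (f x))\<^sup>2)) ^ i" by (simp only: complex_norm_square)
  also have "\<dots> = complex_of_real (((cmod (f x))\<^sup>2) ^ i)" by (simp only: of_real_power)
  finally show ?thesis by (simp only: power_mult)
qed

lemma l1_quarter_bounded: "l1_quarter B a \<Longrightarrow> bounded (fser a ` X)"
  using l1_quarter_norm by (auto simp: bounded_iff)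

lemma fcoef_mono_fun_limit:
  assumes "l1_quarter B a"
  shows "(\<lambda>N. fcoef (mono_fun i j (tpoly (modes N) a)) n) \<longlonglongrightarrow> fcoef (mono_fun i j (fser a)) n"
  by (rule fcoef_uniform_limit[OF uniform_limit_mono_fun[OF fser_uniform_limit[OF assms] l1_quarter_bounded[OF assms]]])
     (auto intro!: always_eventually trigp_continuous_on mono_fun_trigp trigp_tpoly)

lemma galerkin_initial_mass:
  assumes f: "f \<in> circle_L2" and a: "\<And>n. a n 0 = ncoeff f n"
  shows "(wl2 0 (galerkin a N 0))\<^sup>2 \<le> mass f / (2 * pi)"
proof -
  have "(wl2 0 (galerkin a N 0))\<^sup>2 = (\<Sum>n\<in>modes N. (cmod (fourier_coeff f n))\<^sup>2) / (2 * pi)\<^sup>2"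
    unfolding wl2_galerkin L2_set_def by (simp add: a ncoeff_def sum_nonneg norm_divide power_divide sum_divide_distrib)
  also have "\<dots> \<le> (2 * pi * mass f) / (2 * pi)\<^sup>2"
    using bessel[OF f finite_modes] unfolding mass_def set_integral_circ by (intro divide_right_mono) auto
  finally show ?thesis by (simp add: power2_eq_square)
qed

text \<open>The kinetic part increases with \<open>N\<close> and is bounded through Bessel's
  inequality, so it has some limit; the potential part converges because the Fourier series
  converges uniformly. The limit is thus compared with the energy of \<open>f\<close>, not
  identified with it.\<close>

lemma galerkin_initial_energy:
  assumes s: "1 \<le> s" and f: "f \<in> sobolev s" and a: "\<And>n. a n 0 = ncoeff f n"
  shows "\<exists>E. (\<lambda>N. trunc_energy k (modes N) (galerkin a N 0)) \<longlonglongrightarrow> E \<and> E \<le> energy k f / (2 * pi)"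
proof -
  obtain C where "l1_quarter (C * sobolev_norm s f) (ncoeff f)" and ae: "AE x in circ. f x = fser (ncoeff f) x"
    using sobolev_fser[OF s] f by blast
  then obtain B where B: "l1_quarter B (ncoeff f)" by blast
  define G where "G = (LBINT x:{0..2*pi}. (cmod (weak_deriv f x))\<^sup>2)"
  define P where "P = (LBINT x:{0..2*pi}. cmod (f x) ^ (2 * k + 2))"
  have gal: "galerkin a N 0 = tpoly (modes N) (ncoeff f)" for N by (simp add: galerkin_def a)
  define K where "K N = (\<Sum>n\<in>modes N. (of_int n)\<^sup>2 * (cmod (ncoeff f n))\<^sup>2)" for N
  have Kle: "K N \<le> G / (2 * pi)" for N
  proof -
    have "K N = (\<Sum>n\<in>modes N. (of_int n)\<^sup>2 * (cmod (fourier_coeff f n))\<^sup>2) / (2 * pi)\<^sup>2"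
      by (simp add: K_def ncoeff_def norm_divide power_divide sum_divide_distrib)
    also have "\<dots> \<le> (2 * pi * G) / (2 * pi)\<^sup>2"
      unfolding G_def by (intro divide_right_mono gradient_bound[OF s f]) auto
    finally show ?thesis by (simp add: power2_eq_square)
  qed
  have "incseq K" unfolding K_def by (intro incseq_SucI sum_mono2 modes_mono) auto
  then obtain L where L: "K \<longlonglongrightarrow> L" using incseq_convergent[of K "G / (2 * pi)"] Kle by blast
  have LG: "L \<le> G / (2 * pi)" using L Kle by (intro LIMSEQ_le_const2) auto
  define Q where "Q = Re (fcoef (mono_fun (Suc k) (Suc k) (fser (ncoeff f))) 0)"
  have Q: "Q = P / (2 * pi)"
  proof -
    have c: "continuous_on {0..2*pi} (\<lambda>x. cmod (fser (ncoeff f) x) ^ (2 * Suc k))"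
      by (intro continuous_intros fser_continuous_on[OF B])
    have "fcoef (mono_fun (Suc k) (Suc k) (fser (ncoeff f))) 0 =
       integral {0..2*pi} (\<lambda>x. complex_of_real (cmod (fser (ncoeff f) x) ^ (2 * Suc k))) / (2 * pi)"
      unfolding fcoef_def mono_diag by simp
    also have "integral {0..2*pi} (\<lambda>x. complex_of_real (cmod (fser (ncoeff f) x) ^ (2 * Suc k))) =
       complex_of_real (integral {0..2*pi} (\<lambda>x. cmod (fser (ncoeff f) x) ^ (2 * Suc k)))"
      by (rule integral_linear[unfolded o_def, OF integrable_continuous_real[OF c] bounded_linear_of_real])
    finally have "Q = integral {0..2*pi} (\<lambda>x. cmod (fser (ncoeff f) x) ^ (2 * Suc k)) / (2 * pi)"
      by (simp add: Q_def)
    also have "integral {0..2*pi} (\<lambda>x. cmod (fser (ncoeff f) x) ^ (2 * Suc k)) = (LINT x|circ. cmod (fser (ncoeff f) x) ^ (2 * Suc k))"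
      by (rule integral_circ_continuous[OF c, symmetric])
    also have "\<dots> = (LINT x|circ. cmod (f x) ^ (2 * Suc k))"
    proof (rule integral_cong_AE)
      show "(\<lambda>x. cmod (fser (ncoeff f) x) ^ (2 * Suc k)) \<in> borel_measurable circ"
        by (intro borel_circ borel_measurable_continuous_onI continuous_intros fser_continuous_on[OF B])
      show "(\<lambda>x. cmod (f x) ^ (2 * Suc k)) \<in> borel_measurable circ"
        by (intro borel_circ borel_measurable_power measurable_compose[OF circle_L2_measurable[OF sobolev_circle_L2[OF f]] borel_measurable_norm])
      show "AE x in circ. cmod (fser (ncoeff f) x) ^ (2 * Suc k) = cmod (f x) ^ (2 * Suc k)"
        using ae by (rule AE_mp) (auto intro!: AE_I2)
    qed
    finally show ?thesis by (simp add: P_def set_integral_circ)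
  qed
  have lim: "(\<lambda>N. trunc_energy k (modes N) (galerkin a N 0)) \<longlonglongrightarrow> L / 2 + Q / (2 * real k + 2)"
  proof -
    have "trunc_energy k (modes N) (galerkin a N 0) = K N / 2 + Re (fcoef (mono_fun (Suc k) (Suc k) (tpoly (modes N) (ncoeff f))) 0) / (2 * real k + 2)" for N
      unfolding trunc_energy_def K_def by (simp add: fcoef_galerkin a flip: gal cong: sum.cong)
    moreover have "(\<lambda>N. K N / 2 + Re (fcoef (mono_fun (Suc k) (Suc k) (tpoly (modes N) (ncoeff f))) 0) / (2 * real k + 2)) \<longlonglongrightarrow> L / 2 + Q / (2 * real k + 2)"
    proof -
      have d: "2 * real k + 2 \<noteq> 0" by (simp add: add_nonneg_eq_0_iff)
      show ?thesis unfolding Q_def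
        by (intro tendsto_add tendsto_divide L tendsto_const tendsto_Re fcoef_mono_fun_limit[OF B] d) simp
    qed
    ultimately show ?thesis by simp
  qed
  have "L / 2 + Q / (2 * real k + 2) \<le> (G / (2 * pi)) / 2 + (P / (2 * pi)) / (2 * real k + 2)"
    using LG by (simp add: Q divide_right_mono)
  also have "\<dots> = energy k f / (2 * pi)"
    by (simp add: energy_def G_def P_def add_divide_distrib)
  finally show ?thesis using lim by blast
qed

section \<open>From Duhamel's formula to the Fourier coefficients\<close>

lemma interval_integral_cases:
  fixes h :: "real \<Rightarrow> complex"
  assumes h: "continuous_on {-T..T} h" and t: "\<bar>t\<bar> \<le> T"
  shows "(LBINT \<tau>=0..t. h \<tau>) = (if 0 \<le> t then integral {0..t} h else - integral {t..0} h)"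
proof (cases "0 \<le> t")
  case True
  have "continuous_on {0..t} h" using t by (intro continuous_on_subset[OF h]) auto
  then have "(LBINT \<tau>=ereal 0..ereal t. h \<tau>) = integral {0..t} h"
    using True by (intro interval_integral_eq_integral borel_integrable_atLeastAtMost')
  then show ?thesis using True by (simp add: zero_ereal_def)
next
  case False
  have "continuous_on {t..0} h" using t by (intro continuous_on_subset[OF h]) auto
  then have "(LBINT \<tau>=ereal t..ereal 0. h \<tau>) = integral {t..0} h"
    using False by (intro interval_integral_eq_integral borel_integrable_atLeastAtMost') auto
  then show ?thesis using False interval_integral_endpoints_reverse[of 0 "ereal t" h]
    by (simp add: zero_ereal_def)
qed

lemma interval_integral_bound:
  fixes h :: "real \<Rightarrow> complex"
  assumes h: "continuous_on {-T..T} h" and t: "\<bar>t\<bar> \<le> T" and B: "\<And>\<tau>. \<bar>\<tau>\<bar> \<le> T \<Longrightarrow> cmod (h \<tau>) \<le> B"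
  shows "cmod (LBINT \<tau>=0..t. h \<tau>) \<le> B * T"
proof -
  have B0: "0 \<le> B" using order_trans[OF norm_ge_zero B[OF t]] .
  show ?thesis
  proof (cases "0 \<le> t")
    case True
    have "norm (integral {0..t} h) \<le> B * (t - 0)"
      using True t by (intro integral_bound continuous_on_subset[OF h] B) auto
    also have "\<dots> \<le> B * T" using B0 t True by (intro mult_left_mono) auto
    finally show ?thesis using True by (simp add: interval_integral_cases[OF h t])
  next
    case False
    have "norm (integral {t..0} h) \<le> B * (0 - t)"
      using False t by (intro integral_bound continuous_on_subset[OF h] B) auto
    also have "\<dots> \<le> B * T" using B0 t False by (intro mult_left_mono) auto
    finally show ?thesis using False by (simp add: interval_integral_cases[OF h t])
  qed
qed

lemma interval_integral_diff_cont:
  fixes h g :: "real \<Rightarrow> complex"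
  assumes h: "continuous_on {-T..T} h" and g: "continuous_on {-T..T} g" and t: "\<bar>t\<bar> \<le> T"
  shows "(LBINT \<tau>=0..t. h \<tau>) - (LBINT \<tau>=0..t. g \<tau>) = (LBINT \<tau>=0..t. h \<tau> - g \<tau>)"
proof -
  have i: "k integrable_on {0..t}" "k integrable_on {t..0}" if "continuous_on {-T..T} k" for k :: "real \<Rightarrow> complex"
    using t by (intro integrable_continuous_real continuous_on_subset[OF that]; auto)+
  show ?thesis
    unfolding interval_integral_cases[OF h t] interval_integral_cases[OF g t] interval_integral_cases[OF continuous_on_diff[OF h g] t]
    using i[OF h] i[OF g] by (simp add: Henstock_Kurzweil_Integration.integral_diff)
qed

lemma interval_integral_tpoly:
  fixes c :: "real \<Rightarrow> int \<Rightarrow> complex" and t T x :: real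
  assumes c: "\<And>n. continuous_on {-T..T} (\<lambda>\<tau>. c \<tau> n)" and t: "\<bar>t\<bar> \<le> T" and S: "finite S"
  shows "(LBINT \<tau>=0..t. tpoly S (c \<tau>) x) = tpoly S (\<lambda>n. LBINT \<tau>=0..t. c \<tau> n) x"
proof -
  have i: "(\<lambda>\<tau>. c \<tau> n * cis (of_int n * x)) integrable_on {0..t}" "(\<lambda>\<tau>. c \<tau> n * cis (of_int n * x)) integrable_on {t..0}" for n
    using t by (intro integrable_continuous_real continuous_intros continuous_on_subset[OF c]; auto)+
  have tc: "continuous_on {-T..T} (\<lambda>\<tau>. tpoly S (c \<tau>) x)"
    unfolding tpoly_def by (intro continuous_intros c)
  show ?thesis
    unfolding interval_integral_cases[OF tc t] interval_integral_cases[OF c t]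
    unfolding tpoly_def using i S by (simp add: integral_sum sum_negf)
qed

text \<open>The Fourier coefficient is exchanged with the time integral by truncation: for finite
  sums the exchange is linearity, and truncating costs an error that is uniform in \<open>x\<close>
  and vanishes with the level.\<close>

lemma duhamel_coeff:
  fixes g :: "real \<Rightarrow> int \<Rightarrow> complex" and t T :: real
  assumes b: "l1_quarter B0 b"
    and g: "\<And>\<tau>. \<bar>\<tau>\<bar> \<le> T \<Longrightarrow> l1_quarter B (g \<tau>)" and gc: "\<And>n. continuous_on {-T..T} (\<lambda>\<tau>. g \<tau> n)"
    and t: "\<bar>t\<bar> \<le> T" and w: "integrable circ w"
    and eq: "AE x in circ. w x = fser b x - \<i> * (LBINT \<tau>=0..t. fser (g \<tau>) x)"
  shows "ncoeff w m = b m - \<i> * (LBINT \<tau>=0..t. g \<tau> m)"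
proof -
  define J where "J n = (LBINT \<tau>=0..t. g \<tau> n)" for n
  define \<rho> where "\<rho> N = (1 + real N) powr (- (1/4))" for N
  \<comment> \<open>Pointwise values are continuous in time as uniform limits of their truncations,
    because the rate is the same for all \<open>\<tau>\<close>.\<close>
  have gfc: "continuous_on {-T..T} (\<lambda>\<tau>. fser (g \<tau>) x)" for x
  proof (rule uniform_limit_theorem)
    show "\<forall>\<^sub>F N in sequentially. continuous_on {-T..T} (\<lambda>\<tau>. tpoly (modes N) (g \<tau>) x)"
      unfolding tpoly_def by (intro always_eventually allI continuous_intros gc)
    show "uniform_limit {-T..T} (\<lambda>N \<tau>. tpoly (modes N) (g \<tau>) x) (\<lambda>\<tau>. fser (g \<tau>) x) sequentially"
    proof (rule uniform_limitI)
      fix e :: real assume "0 < e"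
      then have "\<forall>\<^sub>F N in sequentially. B * \<rho> N < e"
        unfolding \<rho>_def using order_tendstoD(2)[OF rate_tendsto] by blast
      then show "\<forall>\<^sub>F N in sequentially. \<forall>\<tau>\<in>{-T..T}. dist (tpoly (modes N) (g \<tau>) x) (fser (g \<tau>) x) < e"
      proof (rule eventually_mono, intro ballI)
        fix N \<tau> assume "B * \<rho> N < e" "\<tau> \<in> {-T..T}"
        moreover have "l1_quarter B (g \<tau>)" using \<open>\<tau> \<in> _\<close> by (intro g) (auto simp: abs_le_iff)
        ultimately show "dist (tpoly (modes N) (g \<tau>) x) (fser (g \<tau>) x) < e"
          using fser_rate[of B "g \<tau>" x N] by (simp add: \<rho>_def dist_norm norm_minus_commute)
      qed
    qed
  qed simp
  define q where "q N = tpoly (modes N) (\<lambda>n. b n - \<i> * J n)" for N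
  have qeq: "q N x = tpoly (modes N) b x - \<i> * (LBINT \<tau>=0..t. tpoly (modes N) (g \<tau>) x)" for N x
    unfolding interval_integral_tpoly[OF gc t finite_modes] q_def J_def[symmetric]
    by (simp add: tpoly_def sum_subtractf left_diff_distrib right_diff_distrib sum_distrib_left mult_ac)
  have close: "cmod (fser b x - \<i> * (LBINT \<tau>=0..t. fser (g \<tau>) x) - q N x) \<le> (B0 + B * T) * \<rho> N" for N x
  proof -
    have tc: "continuous_on {-T..T} (\<lambda>\<tau>. tpoly (modes N) (g \<tau>) x)"
      unfolding tpoly_def by (intro continuous_intros gc)
    have "fser b x - \<i> * (LBINT \<tau>=0..t. fser (g \<tau>) x) - q N x = (fser b x - tpoly (modes N) b x) -
       \<i> * ((LBINT \<tau>=0..t. fser (g \<tau>) x) - (LBINT \<tau>=0..t. tpoly (modes N) (g \<tau>) x))"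
      by (simp add: qeq algebra_simps)
    also have "\<dots> = (fser b x - tpoly (modes N) b x) - \<i> * (LBINT \<tau>=0..t. fser (g \<tau>) x - tpoly (modes N) (g \<tau>) x)"
      by (simp only: interval_integral_diff_cont[OF gfc tc t])
    also have "cmod \<dots> \<le> cmod (fser b x - tpoly (modes N) b x) + cmod (LBINT \<tau>=0..t. fser (g \<tau>) x - tpoly (modes N) (g \<tau>) x)"
      by (rule order_trans[OF norm_triangle_ineq4]) (simp add: norm_mult)
    also have "\<dots> \<le> B0 * \<rho> N + B * \<rho> N * T"
      unfolding \<rho>_def
      by (intro add_mono fser_rate b interval_integral_bound[OF continuous_on_diff[OF gfc tc] t] g)
    finally show ?thesis by (simp add: algebra_simps)
  qed
  have qi: "integrable circ (q N)" for N unfolding q_def by (intro integrable_circ_continuous continuous_on_tpoly)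
  have est: "cmod (ncoeff w m - fcoef (q N) m) \<le> (B0 + B * T) * \<rho> N" for N
  proof -
    have "cmod (fourier_coeff (\<lambda>x. w x - q N x) m) \<le> 2 * pi * ((B0 + B * T) * \<rho> N)"
    proof (rule fourier_coeff_norm_le)
      show "integrable circ (\<lambda>x. w x - q N x)" using w qi by (rule Bochner_Integration.integrable_diff)
      show "AE x in circ. cmod (w x - q N x) \<le> (B0 + B * T) * \<rho> N"
        using eq by (rule AE_mp) (auto intro!: AE_I2 close)
    qed
    moreover have "fourier_coeff (\<lambda>x. w x - q N x) m = 2 * pi * (ncoeff w m - fcoef (q N) m)"
      unfolding fourier_coeff_diff[OF w qi]
      unfolding q_def fourier_coeff_continuous[OF continuous_on_tpoly] by (simp add: ncoeff_def right_diff_distrib)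
    ultimately have "2 * pi * cmod (ncoeff w m - fcoef (q N) m) \<le> 2 * pi * ((B0 + B * T) * \<rho> N)"
      by (simp add: norm_mult)
    then show ?thesis by (subst (asm) mult_le_cancel_left_pos) auto
  qed
  obtain N0 where "{m} \<subseteq> modes N0" using finite_subset_modes[of "{m}"] by blast
  then have fq: "fcoef (q N) m = b m - \<i> * J m" if "N0 \<le> N" for N
    using modes_mono[OF that] by (auto simp: q_def fcoef_tpoly)
  have "(\<lambda>N. (B0 + B * T) * \<rho> N) \<longlonglongrightarrow> 0" unfolding \<rho>_def by (rule rate_tendsto)
  then have "cmod (ncoeff w m - (b m - \<i> * J m)) \<le> 0"
  proof (rule LIMSEQ_le_const)
    have "cmod (ncoeff w m - (b m - \<i> * J m)) \<le> (B0 + B * T) * \<rho> N" if "N0 \<le> N" for N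
      using est[of N] fq[OF that] by simp
    then show "\<exists>N. \<forall>n\<ge>N. cmod (ncoeff w m - (b m - \<i> * J m)) \<le> (B0 + B * T) * \<rho> n" by blast
  qed
  then show ?thesis by (simp add: J_def)
qed

lemma free_schroedinger_fser:
  "free_schroedinger t f x = fser (\<lambda>n. ncoeff f n * cis (- ((of_int n)\<^sup>2 * t))) x"
proof -
  have "1 / (2 * of_real pi) * (fourier_coeff f n * cis (of_int n * x - (of_int n)\<^sup>2 * t)) =
     ncoeff f n * cis (- ((of_int n)\<^sup>2 * t)) * cis (of_int n * x)" for n
    by (simp add: ncoeff_def cis_mult algebra_simps)
  then show ?thesis
    unfolding free_schroedinger_def fser_def infsum_cmult_right'[symmetric] by presburger
qed

lemma l1_quarter_cis: "l1_quarter B a \<Longrightarrow> l1_quarter B (\<lambda>n. a n * cis (r n))"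
  by (simp add: l1_quarter_def norm_mult)

lemma sobolev_diff:
  assumes f: "f \<in> sobolev s" and g: "g \<in> sobolev s"
  shows "(\<lambda>x. f x - g x) \<in> sobolev s"
proof -
  note fL = sobolev_circle_L2[OF f] and gL = sobolev_circle_L2[OF g]
  have fi: "integrable circ f" and gi: "integrable circ g" by (intro circle_L2_integrable fL gL)+
  have per: "circle_periodic (\<lambda>x. f x - g x)"
    using fL gL by (simp add: circle_L2_def circle_periodic_def)
  have meas: "(\<lambda>x. f x - g x) \<in> borel_measurable borel"
    by (intro borel_measurable_diff circle_L2_measurable fL gL)
  have "integrable circ (\<lambda>x. (cmod (f x - g x))\<^sup>2)"
  proof (rule Bochner_Integration.integrable_bound)
    show "integrable circ (\<lambda>x. 2 * (cmod (f x))\<^sup>2 + 2 * (cmod (g x))\<^sup>2)"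
      using circle_L2_sq_integrable[OF fL] circle_L2_sq_integrable[OF gL] by simp
    show "(\<lambda>x. (cmod (f x - g x))\<^sup>2) \<in> borel_measurable circ"
      by (intro borel_circ borel_measurable_power measurable_compose[OF meas borel_measurable_norm])
    have "(cmod (y - z))\<^sup>2 \<le> 2 * (cmod y)\<^sup>2 + 2 * (cmod z)\<^sup>2" for y z
    proof -
      have "(cmod (y - z))\<^sup>2 \<le> (cmod y + cmod z)\<^sup>2" by (intro power_mono norm_triangle_ineq4) auto
      also have "\<dots> \<le> 2 * (cmod y)\<^sup>2 + 2 * (cmod z)\<^sup>2"
        using zero_le_power2[of "cmod y - cmod z"] by (simp add: power2_sum power2_diff)
      finally show ?thesis .
    qed
    then show "AE x in circ. norm ((cmod (f x - g x))\<^sup>2) \<le> norm (2 * (cmod (f x))\<^sup>2 + 2 * (cmod (g x))\<^sup>2)" by simp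
  qed
  then have L2: "(\<lambda>x. f x - g x) \<in> circle_L2" using per meas by (simp add: circle_L2_def set_integrable_circ)
  have "(\<lambda>n. (cmod (fourier_coeff (\<lambda>x. f x - g x) n))\<^sup>2 * jb n powr (2 * s)) summable_on UNIV"
  proof (rule nonneg_bdd_above_summable_on)
    let ?R = "sobolev_norm s f + sobolev_norm s g"
    have "(\<Sum>n\<in>S. (cmod (fourier_coeff (\<lambda>x. f x - g x) n))\<^sup>2 * jb n powr (2 * s)) \<le> ?R\<^sup>2" if S: "finite S" for S
    proof -
      have "L2_set (\<lambda>n. jb n powr s * cmod (fourier_coeff (\<lambda>x. f x - g x) n)) S \<le>
        L2_set (\<lambda>n. jb n powr s * cmod (fourier_coeff f n) + jb n powr s * cmod (fourier_coeff g n)) S"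
        unfolding fourier_coeff_diff[OF fi gi] distrib_left[symmetric]
        by (intro L2_set_mono mult_left_mono norm_triangle_ineq4) auto
      also have "\<dots> \<le> L2_set (\<lambda>n. jb n powr s * cmod (fourier_coeff f n)) S + L2_set (\<lambda>n. jb n powr s * cmod (fourier_coeff g n)) S"
        by (rule L2_set_triangle_ineq)
      also have "\<dots> \<le> ?R" by (intro add_mono sobolev_L2_set_le f g S)
      finally have "(L2_set (\<lambda>n. jb n powr s * cmod (fourier_coeff (\<lambda>x. f x - g x) n)) S)\<^sup>2 \<le> ?R\<^sup>2" by (intro power_mono) auto
      then show ?thesis unfolding L2_set_def weight_sq by (simp add: sum_nonneg)
    qed
    then show "bdd_above (sum (\<lambda>n. (cmod (fourier_coeff (\<lambda>x. f x - g x) n))\<^sup>2 * jb n powr (2 * s)) ` {F. F \<subseteq> UNIV \<and> finite F})"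
      by (intro bdd_aboveI[of _ "?R\<^sup>2"]) auto
  qed auto
  then show ?thesis using L2 by (simp add: sobolev_def)
qed

lemma fser_diff:
  assumes "l1_quarter B a" "l1_quarter C b"
  shows "fser (\<lambda>n. a n - b n) x = fser a x - fser b x"
proof -
  have "(\<lambda>N. tpoly (modes N) a x - tpoly (modes N) b x) \<longlonglongrightarrow> fser a x - fser b x"
    using tendsto_uniform_limitI[OF fser_uniform_limit[OF assms(1), of UNIV]]
      tendsto_uniform_limitI[OF fser_uniform_limit[OF assms(2), of UNIV]] by (intro tendsto_diff) auto
  moreover have "l1_quarter (B + C) (\<lambda>n. a n - b n)"
    unfolding l1_quarter_def
  proof (intro allI impI)
    fix S :: "int set" assume S: "finite S"
    have "(\<Sum>n\<in>S. jb n powr (1/4) * cmod (a n - b n)) \<le> (\<Sum>n\<in>S. jb n powr (1/4) * (cmod (a n) + cmod (b n)))"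
      by (intro sum_mono mult_left_mono norm_triangle_ineq4) auto
    also have "\<dots> = (\<Sum>n\<in>S. jb n powr (1/4) * cmod (a n)) + (\<Sum>n\<in>S. jb n powr (1/4) * cmod (b n))"
      by (simp add: distrib_left sum.distrib)
    also have "\<dots> \<le> B + C" using assms S by (intro add_mono) (auto simp: l1_quarter_def)
    finally show "(\<Sum>n\<in>S. jb n powr (1/4) * cmod (a n - b n)) \<le> B + C" .
  qed
  from tendsto_uniform_limitI[OF fser_uniform_limit[OF this, of UNIV]]
  have "(\<lambda>N. tpoly (modes N) (\<lambda>n. a n - b n) x) \<longlonglongrightarrow> fser (\<lambda>n. a n - b n) x" by simp
  moreover have "tpoly (modes N) (\<lambda>n. a n - b n) x = tpoly (modes N) a x - tpoly (modes N) b x" for N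
    by (simp add: tpoly_def left_diff_distrib sum_subtractf)
  ultimately show ?thesis using LIMSEQ_unique by auto
qed

section \<open>The Fourier coefficients of the nonlinearity along a path\<close>

context hs_path
begin

text \<open>The nonlinearity is evaluated on the continuous representative of the path, so that
  uniform convergence of Fourier series passes to the coefficient.\<close>

definition nlcoeff :: "nat \<Rightarrow> int \<Rightarrow> real \<Rightarrow> complex" where
  "nlcoeff k n t = fcoef (mono_fun (Suc k) k (fser (\<lambda>n. a n t))) n"

lemma path_l1:
  fixes T :: real
  shows
  "\<exists>B. \<forall>t. \<bar>t\<bar> \<le> T \<longrightarrow> l1_quarter B (\<lambda>n. a n t)"
proof -
  obtain R where R: "\<And>t S. \<bar>t\<bar> \<le> T \<Longrightarrow> finite S \<Longrightarrow> L2_set (\<lambda>n. jb n powr s * cmod (a n t)) S \<le> R"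
    using uniform_bound[of T] by blast
  obtain C where C: "\<And>a R. (\<And>S. finite S \<Longrightarrow> L2_set (\<lambda>n. jb n powr s * cmod (a n)) S \<le> R) \<Longrightarrow> l1_quarter (C * R) a"
    using l1_quarter_of_L2[OF s1] by blast
  show ?thesis by (intro exI[of _ "C * R"] allI impI C R)
qed

lemma nlcoeff_limit:
  "(\<lambda>N. fcoef (mono_fun (Suc k) k (galerkin a N t)) n) \<longlonglongrightarrow> nlcoeff k n t"
proof -
  obtain B where "l1_quarter B (\<lambda>n. a n t)" using path_l1[of "\<bar>t\<bar>"] by auto
  then show ?thesis unfolding nlcoeff_def galerkin_def by (rule fcoef_mono_fun_limit)
qed

lemma nlcoeff_l1:
  fixes T :: real
  shows
  "\<exists>B. \<forall>t. \<bar>t\<bar> \<le> T \<longrightarrow> l1_quarter B (\<lambda>n. nlcoeff k n t)"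
proof -
  obtain R where R: "\<And>t S. \<bar>t\<bar> \<le> T \<Longrightarrow> finite S \<Longrightarrow> L2_set (\<lambda>n. jb n powr s * cmod (a n t)) S \<le> R"
    using uniform_bound[of T] by blast
  obtain C where C: "C > 0" "\<And>f. f \<in> trigp \<Longrightarrow> wl2 s f \<le> R \<Longrightarrow> wl2 s (mono_fun (Suc k) k f) \<le> C"
    using wl2_mono_fun_lipschitz[OF s1, of R "Suc k" k] by blast
  obtain D where D: "D > 0" "\<And>f. f \<in> trigp \<Longrightarrow> wl1 (1/4) f \<le> D * wl2 s f"
    using wl1_le_wl2[of s "1/4"] s1 by auto
  have "(\<Sum>n\<in>S. jb n powr (1/4) * cmod (nlcoeff k n t)) \<le> D * C" if t: "\<bar>t\<bar> \<le> T" and S: "finite S" for t S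
  proof (rule LIMSEQ_le_const2)
    show "(\<lambda>N. \<Sum>n\<in>S. jb n powr (1/4) * cmod (fcoef (mono_fun (Suc k) k (galerkin a N t)) n)) \<longlonglongrightarrow>
      (\<Sum>n\<in>S. jb n powr (1/4) * cmod (nlcoeff k n t))"
      by (intro tendsto_sum tendsto_mult tendsto_const tendsto_norm nlcoeff_limit)
    have "(\<Sum>n\<in>S. jb n powr (1/4) * cmod (fcoef (mono_fun (Suc k) k (galerkin a N t)) n)) \<le> D * C" for N
    proof -
      have w: "wl2 s (galerkin a N t) \<le> R" unfolding wl2_galerkin by (intro R t) simp
      have "(\<Sum>n\<in>S. jb n powr (1/4) * cmod (fcoef (mono_fun (Suc k) k (galerkin a N t)) n)) \<le> wl1 (1/4) (mono_fun (Suc k) k (galerkin a N t))"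
        by (intro sum_le_wl1 mono_fun_trigp S) simp
      also have "\<dots> \<le> D * wl2 s (mono_fun (Suc k) k (galerkin a N t))"
        by (intro D mono_fun_trigp) simp
      also have "\<dots> \<le> D * C" using D(1) C(2)[OF galerkin_trigp w] by (intro mult_left_mono) auto
      finally show ?thesis .
    qed
    then show "\<exists>N. \<forall>n\<ge>N. (\<Sum>na\<in>S. jb na powr (1/4) * cmod (fcoef (mono_fun (Suc k) k (galerkin a n t)) na)) \<le> D * C" by blast
  qed
  then show ?thesis unfolding l1_quarter_def by blast
qed

text \<open>Continuity in \<open>H^s\<close> makes the series converge uniformly in \<open>x\<close>
  as time varies, and the monomial and its coefficients inherit this. It makes the Duhamel integral
  of each mode differentiable at every time.\<close>

lemma nlcoeff_continuous: "isCont (nlcoeff k n) t"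
proof -
  obtain C where C: "C > 0" "\<And>a R. (\<And>S. finite S \<Longrightarrow> L2_set (\<lambda>n. jb n powr s * cmod (a n)) S \<le> R) \<Longrightarrow> l1_quarter (C * R) a"
    using l1_quarter_of_L2[OF s1] by blast
  obtain B where B: "\<And>\<tau>. \<bar>\<tau>\<bar> \<le> \<bar>t\<bar> + 1 \<Longrightarrow> l1_quarter B (\<lambda>n. a n \<tau>)" using path_l1[of "\<bar>t\<bar> + 1"] by blast
  have near: "\<forall>\<^sub>F \<tau> in at t. \<bar>\<tau>\<bar> \<le> \<bar>t\<bar> + 1"
    unfolding eventually_at by (intro exI[of _ 1]) (auto simp: dist_real_def)
  have Bt: "l1_quarter B (\<lambda>n. a n t)" by (rule B) simp
  have "uniform_limit {0..2*pi} (\<lambda>\<tau>. fser (\<lambda>n. a n \<tau>)) (fser (\<lambda>n. a n t)) (at t)"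
  proof (rule uniform_limitI)
    fix e :: real assume e: "0 < e"
    then have "0 < e / (2 * C)" using C by simp
    from cont[OF this, of t] obtain d where d: "d > 0" "\<And>\<tau> S. dist \<tau> t < d \<Longrightarrow> finite S \<Longrightarrow>
       L2_set (\<lambda>n. jb n powr s * cmod (a n \<tau> - a n t)) S \<le> e / (2 * C)" by blast
    have "\<forall>\<^sub>F \<tau> in at t. dist \<tau> t < d" unfolding eventually_at using d(1) by blast
    with near show "\<forall>\<^sub>F \<tau> in at t. \<forall>x\<in>{0..2*pi}. dist (fser (\<lambda>n. a n \<tau>) x) (fser (\<lambda>n. a n t) x) < e"
    proof eventually_elim
      case (elim \<tau>)
      have l: "l1_quarter (C * (e / (2 * C))) (\<lambda>n. a n \<tau> - a n t)" by (intro C d elim)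
      show ?case
      proof
        fix x
        have "dist (fser (\<lambda>n. a n \<tau>) x) (fser (\<lambda>n. a n t) x) = cmod (fser (\<lambda>n. a n \<tau> - a n t) x)"
          using fser_diff[OF B[OF elim(1)] Bt] by (simp add: dist_norm)
        also have "\<dots> \<le> C * (e / (2 * C))" by (rule l1_quarter_norm[OF l])
        also have "\<dots> < e" using C e by simp
        finally show "dist (fser (\<lambda>n. a n \<tau>) x) (fser (\<lambda>n. a n t) x) < e" .
      qed
    qed
  qed
  then have "((\<lambda>\<tau>. fcoef (mono_fun (Suc k) k (fser (\<lambda>n. a n \<tau>))) n) \<longlongrightarrow> fcoef (mono_fun (Suc k) k (fser (\<lambda>n. a n t))) n) (at t)"
  proof (intro fcoef_uniform_limit uniform_limit_mono_fun l1_quarter_bounded[OF Bt])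
    show "\<forall>\<^sub>F \<tau> in at t. continuous_on {0..2*pi} (mono_fun (Suc k) k (fser (\<lambda>n. a n \<tau>)))"
      using near
    proof eventually_elim
      case (elim \<tau>)
      show ?case unfolding mono_fun_def by (intro continuous_intros fser_continuous_on[OF B[OF elim]])
    qed
  qed auto
  moreover have "nlcoeff k n = (\<lambda>\<tau>. fcoef (mono_fun (Suc k) k (fser (\<lambda>n. a n \<tau>))) n)"
    by (simp add: nlcoeff_def fun_eq_iff)
  ultimately show ?thesis by (simp add: isCont_def)
qed

end

section \<open>The differential equations of the modes\<close>

lemma mono_fun_measurable:
  assumes "f \<in> borel_measurable borel"
  shows "mono_fun i j f \<in> borel_measurable borel"
proof -
  have "(\<lambda>z::complex. z ^ i * cnj z ^ j) \<in> borel_measurable borel"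
    by (intro borel_measurable_continuous_onI continuous_intros)
  from measurable_compose[OF assms this] show ?thesis by (simp add: mono_fun_def)
qed

text \<open>Taking one coefficient of Duhamel's formula and factoring out its rotation leaves the
  integral of a continuous function of time, and differentiating it gives the equation of that
  mode.\<close>

lemma solution_coefficients:
  assumes s: "1 \<le> s" and k: "1 \<le> k" and \<Phi>: "\<Phi> \<in> sobolev s" and u: "nls_global_solution s k \<Phi> u"
  shows "\<exists>F. nls_coeffs k s (\<lambda>n t. ncoeff (u t) n) F" "ncoeff (u 0) = ncoeff \<Phi>"
proof -
  define a where "a n t = ncoeff (u t) n" for n t
  have us: "u t \<in> sobolev s" for t using u by (simp add: nls_global_solution_def)
  have ui: "integrable circ (u t)" for t by (intro circle_L2_integrable sobolev_circle_L2[OF us])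
  have um: "u t \<in> borel_measurable borel" for t by (intro circle_L2_measurable sobolev_circle_L2[OF us])
  interpret hs_path s a
  proof
    show "1 \<le> s" by (rule s)
    show "\<exists>R. \<forall>S. finite S \<longrightarrow> L2_set (\<lambda>n. jb n powr s * cmod (a n t)) S \<le> R" for t
      unfolding a_def L2_set_ncoeff
      by (intro exI[of _ "sobolev_norm s (u t) / (2 * pi)"] allI impI divide_right_mono sobolev_L2_set_le us) auto
    fix t0 \<eta> :: real assume \<eta>: "0 < \<eta>"
    have "((\<lambda>t. sobolev_norm s (\<lambda>x. u t x - u t0 x)) \<longlongrightarrow> 0) (at t0)" using u by (simp add: nls_global_solution_def)
    then have "\<forall>\<^sub>F t in at t0. sobolev_norm s (\<lambda>x. u t x - u t0 x) < 2 * pi * \<eta>" using \<eta> by (intro order_tendstoD) auto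
    then obtain d where d: "d > 0" "\<And>t. t \<noteq> t0 \<Longrightarrow> dist t t0 < d \<Longrightarrow> sobolev_norm s (\<lambda>x. u t x - u t0 x) < 2 * pi * \<eta>"
      unfolding eventually_at by auto
    have "L2_set (\<lambda>n. jb n powr s * cmod (a n t - a n t0)) S \<le> \<eta>" if "dist t t0 < d" "finite S" for t S
    \<comment> \<open>The limit in \<open>nls_global_solution\<close> is over punctured
      neighbourhoods, so \<open>t0\<close> itself is treated apart.\<close>
    proof (cases "t = t0")
      case True
      then show ?thesis using \<eta> by (simp add: L2_set_def)
    next
      case False
      have "a n t - a n t0 = ncoeff (\<lambda>x. u t x - u t0 x) n" for n
        by (simp add: a_def ncoeff_def fourier_coeff_diff[OF ui ui] diff_divide_distrib)
      then have "L2_set (\<lambda>n. jb n powr s * cmod (a n t - a n t0)) S =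
         L2_set (\<lambda>n. jb n powr s * cmod (fourier_coeff (\<lambda>x. u t x - u t0 x) n)) S / (2 * pi)"
        by (simp only: L2_set_ncoeff)
      also have "\<dots> \<le> sobolev_norm s (\<lambda>x. u t x - u t0 x) / (2 * pi)"
        by (intro divide_right_mono sobolev_L2_set_le sobolev_diff us that) auto
      also have "\<dots> \<le> 2 * pi * \<eta> / (2 * pi)"
        using d(2)[OF False that(1)] by (intro divide_right_mono) auto
      finally show ?thesis by simp
    qed
    then show "\<exists>d>0. \<forall>t. dist t t0 < d \<longrightarrow> (\<forall>S. finite S \<longrightarrow> L2_set (\<lambda>n. jb n powr s * cmod (a n t - a n t0)) S \<le> \<eta>)"
      using d(1) by blast
  qed
  obtain C where "C > 0" and rep: "\<And>f. f \<in> sobolev s \<Longrightarrow> l1_quarter (C * sobolev_norm s f) (ncoeff f) \<and> (AE x in circ. f x = fser (ncoeff f) x)"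
    using sobolev_fser[OF s] by blast
  have nl: "ncoeff (nls_nonlinearity k (u \<tau>)) n = nlcoeff k n \<tau>" for \<tau> n
  proof -
    have l: "l1_quarter (C * sobolev_norm s (u \<tau>)) (\<lambda>n. a n \<tau>)" and ae: "AE x in circ. u \<tau> x = fser (\<lambda>n. a n \<tau>) x"
      using rep[OF us[of \<tau>]] by (simp_all add: a_def)
    have c: "continuous_on X (mono_fun (Suc k) k (fser (\<lambda>n. a n \<tau>)))" for X
      unfolding mono_fun_def by (intro continuous_intros fser_continuous_on[OF l])
    have "fourier_coeff (nls_nonlinearity k (u \<tau>)) n = fourier_coeff (mono_fun (Suc k) k (fser (\<lambda>n. a n \<tau>))) n"
      unfolding nls_nonlinearity_eq_mono
    proof (rule fourier_coeff_cong_AE)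
      show "mono_fun (Suc k) k (u \<tau>) \<in> borel_measurable circ" by (intro borel_circ mono_fun_measurable um)
      show "mono_fun (Suc k) k (fser (\<lambda>n. a n \<tau>)) \<in> borel_measurable circ"
        by (intro borel_circ borel_measurable_continuous_onI c)
      show "AE x in circ. mono_fun (Suc k) k (u \<tau>) x = mono_fun (Suc k) k (fser (\<lambda>n. a n \<tau>)) x"
        using ae by (rule AE_mp) (auto intro!: AE_I2 simp: mono_fun_def)
    qed
    also have "\<dots> = 2 * pi * nlcoeff k n \<tau>" unfolding fourier_coeff_continuous[OF c] by (simp add: nlcoeff_def)
    finally show ?thesis by (simp add: ncoeff_def)
  qed
  \<comment> \<open>The rotation by \<open>t - \<tau>\<close> splits into one factor in
    \<open>t\<close> and one in \<open>\<tau>\<close>, so that \<open>t\<close> remains inside the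
    integral only as its upper end.\<close>
  have duh: "a m t = cis (- ((of_int m)\<^sup>2 * t)) * (ncoeff \<Phi> m - \<i> * (LBINT \<tau>=0..t. nlcoeff k m \<tau> * cis ((of_int m)\<^sup>2 * \<tau>)))" for m t
  proof -
    define T where "T = \<bar>t\<bar>"
    obtain B where B: "\<And>\<tau>. \<bar>\<tau>\<bar> \<le> T \<Longrightarrow> l1_quarter B (\<lambda>n. nlcoeff k n \<tau>)" using nlcoeff_l1[of T k] by blast
    have nc: "continuous_on X (nlcoeff k n)" for X n
      using nlcoeff_continuous by (intro continuous_at_imp_continuous_on) auto
    have eq: "AE x in circ. u t x = fser (\<lambda>n. ncoeff \<Phi> n * cis (- ((of_int n)\<^sup>2 * t))) x -
      \<i> * (LBINT \<tau>=0..t. fser (\<lambda>n. nlcoeff k n \<tau> * cis (- ((of_int n)\<^sup>2 * (t - \<tau>)))) x)"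
    proof -
      have "AE x in lborel. u t x = free_schroedinger t \<Phi> x - \<i> * (LBINT \<tau>=0..t. free_schroedinger (t - \<tau>) (nls_nonlinearity k (u \<tau>)) x)"
        using u by (simp add: nls_global_solution_def)
      then show ?thesis unfolding AE_circ free_schroedinger_fser nl by (rule AE_mp) (auto intro!: AE_I2)
    qed
    have cc: "continuous_on {-T..T} (\<lambda>\<tau>. nlcoeff k n \<tau> * cis (- ((of_int n)\<^sup>2 * (t - \<tau>))))" for n
      by (intro continuous_intros nc)
    have "ncoeff (u t) m = ncoeff \<Phi> m * cis (- ((of_int m)\<^sup>2 * t)) -
      \<i> * (LBINT \<tau>=0..t. nlcoeff k m \<tau> * cis (- ((of_int m)\<^sup>2 * (t - \<tau>))))"
      by (rule duhamel_coeff[OF l1_quarter_cis[OF conjunct1[OF rep[OF \<Phi>]]] l1_quarter_cis[OF B] cc _ ui eq]) (auto simp: T_def)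
    also have "(\<lambda>\<tau>. nlcoeff k m \<tau> * cis (- ((of_int m)\<^sup>2 * (t - \<tau>)))) =
       (\<lambda>\<tau>. cis (- ((of_int m)\<^sup>2 * t)) * (nlcoeff k m \<tau> * cis ((of_int m)\<^sup>2 * \<tau>)))"
    proof
      fix \<tau>
      have "cis (- ((of_int m)\<^sup>2 * (t - \<tau>))) = cis (- ((of_int m)\<^sup>2 * t)) * cis ((of_int m)\<^sup>2 * \<tau>)"
        by (simp add: cis_mult algebra_simps)
      then show "nlcoeff k m \<tau> * cis (- ((of_int m)\<^sup>2 * (t - \<tau>))) = cis (- ((of_int m)\<^sup>2 * t)) * (nlcoeff k m \<tau> * cis ((of_int m)\<^sup>2 * \<tau>))"
        by (simp only: mult_ac)
    qed
    also have "(LBINT \<tau>=0..t. cis (- ((of_int m)\<^sup>2 * t)) * (nlcoeff k m \<tau> * cis ((of_int m)\<^sup>2 * \<tau>))) =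
       cis (- ((of_int m)\<^sup>2 * t)) * (LBINT \<tau>=0..t. nlcoeff k m \<tau> * cis ((of_int m)\<^sup>2 * \<tau>))"
      by simp
    finally show ?thesis by (simp add: a_def algebra_simps)
  qed
  have "nls_coeffs k s a (nlcoeff k)"
  proof
    show "1 \<le> k" by (rule k)
    show "(\<lambda>N. fcoef (mono_fun (Suc k) k (galerkin a N t)) n) \<longlonglongrightarrow> nlcoeff k n t" for n t by (rule nlcoeff_limit)
    fix n :: int and t :: real
    \<comment> \<open>One unit of room makes \<open>t\<close> an interior point, so the derivative
      is two-sided.\<close>
    define T where "T = \<bar>t\<bar> + 1"
    define h where "h \<tau> = nlcoeff k n \<tau> * cis ((of_int n)\<^sup>2 * \<tau>)" for \<tau>
    have hc: "continuous_on {-T..T} h"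
      unfolding h_def using nlcoeff_continuous by (intro continuous_intros continuous_at_imp_continuous_on) auto
    have "((\<lambda>u. LBINT y=ereal 0..ereal u. h y) has_vector_derivative h t) (at t within {-T..T})"
      by (rule interval_integral_FTC2[OF _ _ hc]) (auto simp: T_def)
    moreover have "t \<in> interior {-T..T}" by (auto simp: T_def)
    ultimately have I: "((\<lambda>u. LBINT y=0..u. h y) has_vector_derivative h t) (at t)"
      unfolding zero_ereal_def by (simp only: at_within_interior)
    have E: "((\<lambda>t. cis (- ((of_int n)\<^sup>2 * t))) has_vector_derivative - \<i> * (of_int n)\<^sup>2 * cis (- ((of_int n)\<^sup>2 * t))) (at t)"
    proof -
      have "((\<lambda>t. exp (\<i> * (- ((of_int n)\<^sup>2 * of_real t)))) has_vector_derivative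
         (- \<i> * (of_int n)\<^sup>2 * exp (\<i> * (- ((of_int n)\<^sup>2 * of_real t))))) (at t)"
        by (auto intro!: derivative_eq_intros has_vector_derivative_real_field)
      then show ?thesis by (simp add: cis_conv_exp)
    qed
    have "((\<lambda>t. cis (- ((of_int n)\<^sup>2 * t)) * (ncoeff \<Phi> n - \<i> * (LBINT y=0..t. h y))) has_vector_derivative
       cis (- ((of_int n)\<^sup>2 * t)) * (0 - \<i> * h t) + (- \<i> * (of_int n)\<^sup>2 * cis (- ((of_int n)\<^sup>2 * t))) * (ncoeff \<Phi> n - \<i> * (LBINT y=0..t. h y))) (at t)"
      by (intro has_vector_derivative_mult E has_vector_derivative_diff has_vector_derivative_const has_vector_derivative_mult_right I)
    moreover have "(\<lambda>t. cis (- ((of_int n)\<^sup>2 * t)) * (ncoeff \<Phi> n - \<i> * (LBINT y=0..t. h y))) = a n"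
      unfolding h_def by (rule ext) (rule duh[symmetric])
    moreover have "cis (- ((of_int n)\<^sup>2 * t)) * (0 - \<i> * h t) + (- \<i> * (of_int n)\<^sup>2 * cis (- ((of_int n)\<^sup>2 * t))) * (ncoeff \<Phi> n - \<i> * (LBINT y=0..t. h y))
       = - \<i> * (of_int (n\<^sup>2) * a n t + nlcoeff k n t)"
    proof -
      have c1: "cis (- ((of_int n)\<^sup>2 * t)) * h t = nlcoeff k n t"
      proof -
        have "cis (- ((of_int n)\<^sup>2 * t)) * cis ((of_int n)\<^sup>2 * t) = 1" by (simp add: cis_mult)
        then show ?thesis by (simp add: h_def mult.left_commute)
      qed
      have c2: "cis (- ((of_int n)\<^sup>2 * t)) * (ncoeff \<Phi> n - \<i> * (LBINT y=0..t. h y)) = a n t"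
        unfolding h_def by (rule duh[symmetric])
      show ?thesis unfolding c1[symmetric] c2[symmetric] by (simp add: algebra_simps)
    qed
    ultimately show "(a n has_vector_derivative - \<i> * (of_int (n\<^sup>2) * a n t + nlcoeff k n t)) (at t)" by simp
  qed
  then show "\<exists>F. nls_coeffs k s (\<lambda>n t. ncoeff (u t) n) F" unfolding a_def by blast
  show "ncoeff (u 0) = ncoeff \<Phi>"
  proof
    fix n
    have "AE x in lborel. u 0 x = \<Phi> x" using u by (simp add: nls_global_solution_def)
    then have "AE x in circ. u 0 x = \<Phi> x" unfolding AE_circ by (rule AE_mp) (auto intro!: AE_I2)
    then have "fourier_coeff (u 0) n = fourier_coeff \<Phi> n"
      by (intro fourier_coeff_cong_AE borel_circ um circle_L2_measurable sobolev_circle_L2[OF \<Phi>])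
    then show "ncoeff (u 0) n = ncoeff \<Phi> n" by (simp add: ncoeff_def)
  qed
qed

section \<open>The growth bound\<close>

text \<open>Where energy plus mass is at most \<open>L\<close>, a single \<open>K\<close> bounds the
  \<open>H^1\<close> norms of all truncations at all times, and \<open>K\<close> fixes every
  constant of the growth estimate.\<close>

lemma bound_on_level_set:
  assumes s: "1 \<le> s" and k: "1 \<le> k"
  shows "\<exists>C>0. \<forall>\<Phi> u. \<Phi> \<in> sobolev s \<longrightarrow> nls_global_solution s k \<Phi> u \<longrightarrow> energy k \<Phi> + mass \<Phi> \<le> L \<longrightarrow>
    (\<forall>t. sobolev_norm s (u t) \<le> C * (1 + \<bar>t\<bar>) powr (2 * s) * sobolev_norm s \<Phi>)"
proof -
  \<comment> \<open>From \<open>2 * E + M \<le> 2 * (E + M)\<close>, divided by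
    \<open>2 * pi\<close> since the coefficients are normalised; \<open>\<bar>L\<bar>\<close> keeps
    the radicand nonnegative.\<close>
  define K where "K = sqrt (2 * \<bar>L\<bar> / (2 * pi))"
  obtain C where C: "C > 0" and growth: "\<forall>a F E\<^sub>0 X\<^sub>0. nls_coeffs k s a F \<longrightarrow>
    (\<forall>N t. wl2 1 (galerkin a N t) \<le> K) \<longrightarrow> (\<lambda>N. trunc_energy k (modes N) (galerkin a N 0)) \<longlonglongrightarrow> E\<^sub>0 \<longrightarrow>
    0 < X\<^sub>0 \<longrightarrow> (\<forall>N. wl2 s (galerkin a N 0) \<le> X\<^sub>0) \<longrightarrow>
    (\<forall>N t. wl2 s (galerkin a N t) \<le> C * (1 + \<bar>t\<bar>) powr (2 * s) * X\<^sub>0)"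
    using growth_linear[OF s k, of K] by (elim exE conjE) (rule that)
  have "sobolev_norm s (u t) \<le> C * (1 + \<bar>t\<bar>) powr (2 * s) * sobolev_norm s \<Phi>"
    if \<Phi>: "\<Phi> \<in> sobolev s" and u: "nls_global_solution s k \<Phi> u" and L: "energy k \<Phi> + mass \<Phi> \<le> L" for \<Phi> u t
  proof -
    define a where "a n t = ncoeff (u t) n" for n t
    obtain F where nc: "nls_coeffs k s a F" using solution_coefficients(1)[OF s k \<Phi> u] unfolding a_def by blast
    interpret nls_coeffs k s a F by (rule nc)
    have a0: "a n 0 = ncoeff \<Phi> n" for n unfolding a_def solution_coefficients(2)[OF s k \<Phi> u] ..
    obtain E0 where E0: "(\<lambda>N. trunc_energy k (modes N) (galerkin a N 0)) \<longlonglongrightarrow> E0" "E0 \<le> energy k \<Phi> / (2 * pi)"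
      using galerkin_initial_energy[where k = k and a = a and f = \<Phi>, OF s \<Phi> a0] by blast
    have m0: "(wl2 0 (galerkin a N 0))\<^sup>2 \<le> mass \<Phi> / (2 * pi)" for N
      by (rule galerkin_initial_mass[where a = a and f = \<Phi>, OF sobolev_circle_L2[OF \<Phi>] a0])
    have mass0: "0 \<le> mass \<Phi>" unfolding mass_def set_integral_circ by (intro Bochner_Integration.integral_nonneg) auto
    have K: "wl2 1 (galerkin a N \<tau>) \<le> K" for N \<tau>
    proof -
      have "(wl2 1 (galerkin a N \<tau>))\<^sup>2 \<le> 2 * E0 + mass \<Phi> / (2 * pi)" by (rule h1_bound[OF m0 E0(1)])
      also have "\<dots> \<le> 2 * (energy k \<Phi> / (2 * pi)) + 2 * (mass \<Phi> / (2 * pi))"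
        using E0(2) mass0 by (intro add_mono mult_left_mono) (auto intro!: divide_left_mono)
      also have "\<dots> = 2 * (energy k \<Phi> + mass \<Phi>) / (2 * pi)" by (simp add: add_divide_distrib)
      also have "\<dots> \<le> 2 * \<bar>L\<bar> / (2 * pi)" using L by (intro divide_right_mono) auto
      finally have "sqrt ((wl2 1 (galerkin a N \<tau>))\<^sup>2) \<le> K" unfolding K_def by (rule real_sqrt_le_mono)
      then show ?thesis by simp
    qed
    define X where "X = sobolev_norm s \<Phi> / (2 * pi)"
    have X0: "wl2 s (galerkin a N 0) \<le> X" for N
      unfolding wl2_galerkin a0 L2_set_ncoeff X_def by (intro divide_right_mono sobolev_L2_set_le \<Phi>) auto
    have X_nn: "0 \<le> X" by (rule order_trans[OF wl2_nonneg X0])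
    define P where "P = C * (1 + \<bar>t\<bar>) powr (2 * s)"
    have P: "0 < P" using C by (simp add: P_def)
    \<comment> \<open>The growth estimate asks for a positive initial bound, while \<open>X\<close>
      vanishes for \<open>\<Phi> = 0\<close>; it is applied to \<open>X + e / P\<close> for every
      positive \<open>e\<close>.\<close>
    have bound: "wl2 s (galerkin a N t) \<le> P * X" for N
    proof (rule field_le_epsilon)
      fix e :: real assume e: "0 < e"
      define Y where "Y = X + e / P"
      have Y: "0 < Y" using X_nn e P by (simp add: Y_def add_nonneg_pos)
      have "wl2 s (galerkin a M 0) \<le> Y" for M using X0[of M] e P by (simp add: Y_def add_increasing2)
      then have "wl2 s (galerkin a N t) \<le> P * Y" unfolding P_def using growth nc K E0(1) Y by blast
      then show "wl2 s (galerkin a N t) \<le> P * X + e" using P by (simp add: Y_def distrib_left)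
    qed
    have "sobolev_norm s (u t) \<le> 2 * pi * (P * X)"
    proof (rule sobolev_norm_le)
      show "u t \<in> sobolev s" using u by (simp add: nls_global_solution_def)
      fix S :: "int set" assume "finite S"
      then obtain N where N: "S \<subseteq> modes N" using finite_subset_modes by blast
      have "L2_set (\<lambda>n. jb n powr s * cmod (fourier_coeff (u t) n)) S / (2 * pi) = L2_set (\<lambda>n. jb n powr s * cmod (a n t)) S"
        unfolding a_def L2_set_ncoeff ..
      also have "\<dots> \<le> wl2 s (galerkin a N t)" unfolding wl2_galerkin by (intro L2_set_subset N) simp
      also have "\<dots> \<le> P * X" by (rule bound)
      finally show "L2_set (\<lambda>n. jb n powr s * cmod (fourier_coeff (u t) n)) S \<le> 2 * pi * (P * X)"
        by (simp add: divide_le_eq mult_ac)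
    qed
    also have "\<dots> = P * sobolev_norm s \<Phi>" by (simp add: X_def)
    finally show ?thesis by (simp add: P_def)
  qed
  then show ?thesis using C by blast
qed

section \<open>Continuous dependence of the constant on energy and mass\<close>

lemma continuous_majorant:
  fixes c :: "nat \<Rightarrow> real"
  shows "\<exists>g :: real \<Rightarrow> real. continuous_on {0..} g \<and> (\<forall>x\<ge>0. 0 < g x) \<and> (\<forall>x\<ge>0. c (nat \<lceil>x\<rceil>) \<le> g x)"
proof -
  \<comment> \<open>The leading 1 provides positivity, the sum of absolute values
    monotonicity.\<close>
  define m where "m x = 1 + (\<Sum>i\<le>nat \<lceil>x\<rceil>. \<bar>c i\<bar>)" for x :: real
  have m1: "1 \<le> m x" for x by (simp add: m_def sum_nonneg)
  have mono: "mono_on A m" for A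
    unfolding m_def by (intro mono_onI add_left_mono sum_mono2 atMost_subset_iff[THEN iffD2] nat_mono ceiling_mono) auto
  have cm: "c (nat \<lceil>x\<rceil>) \<le> m x" for x
    using member_le_sum[of "nat \<lceil>x\<rceil>" "{..nat \<lceil>x\<rceil>}" "\<lambda>i. \<bar>c i\<bar>"] by (simp add: m_def)
  have int: "m integrable_on {a..b}" for a b by (rule integrable_on_mono_on[OF mono])
  \<comment> \<open>As a difference of two indefinite integrals the average is visibly continuous,
    although \<open>m\<close> jumps.\<close>
  define g where "g x = integral {0..x + 1} m - integral {0..x} m" for x
  have g_eq: "g x = integral {x..x + 1} m" if "0 \<le> x" for x
    using Henstock_Kurzweil_Integration.integral_combine[of 0 x "x + 1" m] that int by (simp add: g_def algebra_simps)
  have gm: "m x \<le> g x" if "0 \<le> x" for x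
  proof -
    have "integral {x..x + 1} (\<lambda>_. m x) \<le> integral {x..x + 1} m"
      using mono by (intro integral_le int integrable_const_ivl) (auto simp: mono_on_def)
    then show ?thesis using g_eq[OF that] by simp
  qed
  have "continuous_on {0..} g"
  proof -
    have I: "continuous_on {0..b} (\<lambda>x. integral {0..x} m)" for b
      by (rule indefinite_integral_continuous_1[OF int])
    have pos: "isCont g x" if x: "0 < x" for x
    proof -
      have "continuous_on {0<..<x + 2} (\<lambda>x. integral {0..x} m)" by (rule continuous_on_subset[OF I[of "x + 2"]]) auto
      then have c: "isCont (\<lambda>x. integral {0..x} m) y" if "y \<in> {0<..<x + 2}" for y
        using that by (simp add: continuous_on_eq_continuous_at)
      have "isCont (\<lambda>y. integral {0..y + 1} m) x"
        by (rule isCont_o2[where f = "\<lambda>y. y + 1" and g = "\<lambda>x. integral {0..x} m"]) (use x in \<open>auto intro!: c continuous_intros\<close>)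
      then show ?thesis unfolding g_def using c[of x] x by (intro continuous_intros) auto
    qed
    \<comment> \<open>At the left end of the domain only one-sided continuity is available.\<close>
    have zero: "continuous (at 0 within {0..}) g"
    proof -
      have "continuous_on {0..1} (\<lambda>x. integral {0..x + 1} m)"
        by (rule continuous_on_compose2[OF I[of 2]]) (auto intro!: continuous_intros)
      then have "continuous_on {0..1} g" unfolding g_def by (intro continuous_intros I)
      then have "continuous (at 0 within {0..1}) g" by (simp add: continuous_on_eq_continuous_within)
      moreover have "at (0::real) within {0..1} = at 0 within {0..}"
        by (rule at_within_nhd[of _ "{-1<..<1}"]) auto
      ultimately show ?thesis by simp
    qed
    show ?thesis
      unfolding continuous_on_eq_continuous_within
    proof
      fix x :: real assume "x \<in> {0..}"
      then show "continuous (at x within {0..}) g"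
        using pos[of x] zero by (cases "x = 0") (simp_all add: continuous_at_imp_continuous_at_within)
    qed
  qed
  moreover have "0 < g x" if "0 \<le> x" for x
    using gm[OF that] m1[of x] by linarith
  moreover have "c (nat \<lceil>x\<rceil>) \<le> g x" if "0 \<le> x" for x
    using order_trans[OF cm gm[OF that]] .
  ultimately show ?thesis by auto
qed

theorem theorem1p1:
  fixes k :: nat and s :: real
  assumes "k \<ge> 2" and "s \<ge> 1"
  shows "\<forall>\<^sub>F \<epsilon> in at_right (0::real).
    \<exists>C :: real \<Rightarrow> real \<Rightarrow> real.
      continuous_on ({0..} \<times> {0..}) (\<lambda>(E, M). C E M) \<and>
      (\<forall>E\<ge>0. \<forall>M\<ge>0. C E M > 0) \<and>
      (\<forall>\<Phi> u. \<Phi> \<in> sobolev s \<longrightarrow> nls_global_solution s k \<Phi> u \<longrightarrow>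
        (\<forall>t. sobolev_norm s (u t)
               \<le> C (energy k \<Phi>) (mass \<Phi>) * (1 + \<bar>t\<bar>) powr (2 * s + \<epsilon>) * sobolev_norm s \<Phi>))"
proof -
  have k: "1 \<le> k" using assms(1) by simp
  \<comment> \<open>One constant for each natural bound on energy plus mass. Its sign is left open;
    positivity comes from the majorant.\<close>
  define c where "c L = (SOME C. \<forall>\<Phi> u. \<Phi> \<in> sobolev s \<longrightarrow> nls_global_solution s k \<Phi> u \<longrightarrow> energy k \<Phi> + mass \<Phi> \<le> real L \<longrightarrow>
    (\<forall>t. sobolev_norm s (u t) \<le> C * (1 + \<bar>t\<bar>) powr (2 * s) * sobolev_norm s \<Phi>))" for L
  have c: "sobolev_norm s (u t) \<le> c L * (1 + \<bar>t\<bar>) powr (2 * s) * sobolev_norm s \<Phi>"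
    if "\<Phi> \<in> sobolev s" "nls_global_solution s k \<Phi> u" "energy k \<Phi> + mass \<Phi> \<le> real L" for L \<Phi> u t
  proof -
    have "\<exists>C. \<forall>\<Phi> u. \<Phi> \<in> sobolev s \<longrightarrow> nls_global_solution s k \<Phi> u \<longrightarrow> energy k \<Phi> + mass \<Phi> \<le> real L \<longrightarrow>
      (\<forall>t. sobolev_norm s (u t) \<le> C * (1 + \<bar>t\<bar>) powr (2 * s) * sobolev_norm s \<Phi>)"
      using bound_on_level_set[OF assms(2) k, of "real L"] by (elim exE conjE) (rule exI)
    from someI_ex[OF this, folded c_def, rule_format, OF that] show ?thesis .
  qed
  obtain g :: "real \<Rightarrow> real" where
    g: "continuous_on {0..} g" "\<And>x. 0 \<le> x \<Longrightarrow> 0 < g x" "\<And>x. 0 \<le> x \<Longrightarrow> c (nat \<lceil>x\<rceil>) \<le> g x"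
    using continuous_majorant[of c] by blast
  have cont: "continuous_on ({0..} \<times> {0..}) (\<lambda>(E :: real, M :: real). g (E + M))"
  proof -
    have "continuous_on ({0..} \<times> {0..}) (\<lambda>p :: real \<times> real. fst p + snd p)"
      by (intro continuous_on_add continuous_on_fst continuous_on_snd continuous_on_id)
    then have "continuous_on ({0..} \<times> {0..}) (\<lambda>p :: real \<times> real. g (fst p + snd p))"
      by (rule continuous_on_compose2[OF g(1)]) auto
    then show ?thesis by (simp add: case_prod_beta)
  qed
  have bound: "sobolev_norm s (u t) \<le> g (energy k \<Phi> + mass \<Phi>) * (1 + \<bar>t\<bar>) powr (2 * s + \<epsilon>) * sobolev_norm s \<Phi>"
    if \<epsilon>: "0 < \<epsilon>" and \<Phi>: "\<Phi> \<in> sobolev s" and u: "nls_global_solution s k \<Phi> u" for \<epsilon> \<Phi> u t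
  proof -
    have m: "0 \<le> mass \<Phi>" unfolding mass_def set_integral_circ by (intro Bochner_Integration.integral_nonneg) auto
    have "0 \<le> (LINT x|circ. (cmod (weak_deriv \<Phi> x))\<^sup>2)" "0 \<le> (LINT x|circ. cmod (\<Phi> x) ^ (2 * k + 2))"
      by (intro Bochner_Integration.integral_nonneg; simp)+
    then have e: "0 \<le> energy k \<Phi>" unfolding energy_def set_integral_circ by (intro add_nonneg_nonneg mult_nonneg_nonneg) auto
    have nn: "0 \<le> sobolev_norm s \<Phi>" using sobolev_L2_set_le[OF \<Phi>, of "{}"] by simp
    have "sobolev_norm s (u t) \<le> c (nat \<lceil>energy k \<Phi> + mass \<Phi>\<rceil>) * (1 + \<bar>t\<bar>) powr (2 * s) * sobolev_norm s \<Phi>"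
      by (rule c[OF \<Phi> u real_nat_ceiling_ge])
    also have "\<dots> \<le> g (energy k \<Phi> + mass \<Phi>) * (1 + \<bar>t\<bar>) powr (2 * s) * sobolev_norm s \<Phi>"
      using g(3) e m nn by (intro mult_right_mono) auto
    \<comment> \<open>Here \<open>1 + \<bar>t\<bar> \<ge> 1\<close>, so raising the exponent by
      \<open>\<epsilon>\<close> only increases the right-hand side.\<close>
    also have "\<dots> \<le> g (energy k \<Phi> + mass \<Phi>) * (1 + \<bar>t\<bar>) powr (2 * s + \<epsilon>) * sobolev_norm s \<Phi>"
      using g(2)[of "energy k \<Phi> + mass \<Phi>"] e m nn \<epsilon> by (intro mult_right_mono mult_left_mono powr_mono) auto
    finally show ?thesis .
  qed
  have "\<exists>C :: real \<Rightarrow> real \<Rightarrow> real.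
      continuous_on ({0..} \<times> {0..}) (\<lambda>(E, M). C E M) \<and>
      (\<forall>E\<ge>0. \<forall>M\<ge>0. C E M > 0) \<and>
      (\<forall>\<Phi> u. \<Phi> \<in> sobolev s \<longrightarrow> nls_global_solution s k \<Phi> u \<longrightarrow>
        (\<forall>t. sobolev_norm s (u t)
               \<le> C (energy k \<Phi>) (mass \<Phi>) * (1 + \<bar>t\<bar>) powr (2 * s + \<epsilon>) * sobolev_norm s \<Phi>))" if "0 < \<epsilon>" for \<epsilon>
    by (rule exI[of _ "\<lambda>E M. g (E + M)"]) (use cont g(2) bound[OF that] in auto)
  then show ?thesis by (auto simp: eventually_at_right_less intro: eventually_mono[OF eventually_at_right_less])
qed

end
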